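(* Let $n\ge 1$, $k\geq 1$ and let $\Sigma$ be a complete $n$-dimensional properly immersed self-expander in $\mathbb{R}^{n+k}$. Then the spectrum of the drifted Laplacian $\mathcal{L}=\Delta+\frac12\langle x,\nabla \cdot\rangle$ on $L^2(\Sigma,e^{\frac{|x|^2}{4}}d\sigma)$ is discrete. In particular, the bottom $\lambda_1$ of the spectrum of $\mathcal{L}$ is the first weighted $L^2$ eigenvalue of $\mathcal{L}$.
   Context: An $n$-dimensional self-expander is a smooth $n$-dimensional submanifold $\Sigma$ immersed in Euclidean space $\mathbb{R}^{n+k}$ satisfying ${\bf H}=\frac12 x^{\perp}$, where $x$ is the position vector, $\perp$ is the orthogonal projection onto the normal bundle of $\Sigma$, and ${\bf H}=\sum_{i=1}^n(\bar\nabla_{e_i}e_i)^\perp$ is the mean curvature vector ($\{e_i\}$ a local orthonormal frame of $\Sigma$, $\bar\nabla$ the Euclidean connection). Properly immersed means that the preimage in $\Sigma$ of every compact subset of $\mathbb{R}^{n+k}$ is compact. $\nabla,\Delta,d\sigma$ denote the gradient, Laplacian and volume element of the induced metric on $\Sigma$. $\mathcal{L}u=\Delta u+\frac12\langle x,\nabla u\rangle$ is a densely defined self-adjoint operator in $L^2(\Sigma,e^{\frac{|x|^2}{4}}d\sigma)$. The sign convention for eigenvalues is: $\lambda$ is a weighted $L^2$ eigenvalue of $\mathcal{L}$ if there is a nonzero smooth $u\in L^2(\Sigma,e^{\frac{|x|^2}{4}}d\sigma)$ with $\mathcal{L}u+\lambda u=0$ (so "the spectrum of $\mathcal{L}$"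 is the spectrum of the nonnegative operator $-\mathcal{L}$). The spectrum is discrete if it consists only of isolated eigenvalues of finite multiplicity. The bottom of the spectrum is $$\lambda_1=\inf\left\{\frac{\int_{\Sigma}|\nabla \varphi|^2e^{\frac{|x|^2}{4}}d\sigma}{\int_{\Sigma}\varphi^2e^{\frac{|x|^2}{4}}d\sigma}:\ \varphi\in C_0^{\infty}(\Sigma),\ \int_{\Sigma}\varphi^2e^{\frac{|x|^2}{4}}d\sigma\neq 0\right\}.$$ *)

theory Defs
  imports "HOL-Analysis.Analysis"
begin

section \<open>Smooth manifolds and immersions\<close>

text \<open>\<open>C\<^sup>k\<close> and \<open>C\<^sup>\<infinity>\<close> maps on an open set \<open>S\<close>.\<close>

primrec Ck_on :: "nat \<Rightarrow> ('a::euclidean_space \<Rightarrow> 'b::real_normed_vector) \<Rightarrow> 'a set \<Rightarrow> bool" where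
  "Ck_on 0 f S \<longleftrightarrow> continuous_on S f"
| "Ck_on (Suc k) f S \<longleftrightarrow>
     f differentiable_on S \<and> (\<forall>v. Ck_on k (\<lambda>x. frechet_derivative f (at x) v) S)"

definition smooth_on :: "('a::euclidean_space \<Rightarrow> 'b::real_normed_vector) \<Rightarrow> 'a set \<Rightarrow> bool" where
  "smooth_on f S \<longleftrightarrow> (\<forall>k. Ck_on k f S)"

text \<open>A manifold is the whole of a Hausdorff, second countable type \<open>'m\<close>, with an atlas of local
  parametrizations \<open>(W, \<psi>)\<close>: \<open>W\<close> is open in \<open>\<real>\<^sup>n\<close> and \<open>\<psi>\<close> maps \<open>W\<close> homeomorphically
  onto an open subset of \<open>'m\<close>. Values of \<open>\<psi>\<close> outside \<open>W\<close> are irrelevant. The dimension is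
  \<open>n = CARD('n)\<close>. Connectedness is not required.\<close>

type_synonym ('n, 'm) param = "(real ^ 'n) set \<times> (real ^ 'n \<Rightarrow> 'm)"

definition smooth_atlas ::
  "('n::finite, 'm::{t2_space, second_countable_topology}) param set \<Rightarrow> bool" where
  "smooth_atlas A \<longleftrightarrow>
     (\<forall>(W, \<psi>) \<in> A. open W \<and> open (\<psi> ` W) \<and> (\<exists>\<phi>. homeomorphism W (\<psi> ` W) \<psi> \<phi>)) \<and>
     (\<Union>(W, \<psi>) \<in> A. \<psi> ` W) = UNIV \<and>
     (\<forall>(W, \<psi>) \<in> A. \<forall>(V, \<eta>) \<in> A. smooth_on (inv_into V \<eta> \<circ> \<psi>) {p \<in> W. \<psi> p \<in> \<eta> ` V})"

definition smooth_map :: "('n::finite, 'm) param set \<Rightarrow> ('m \<Rightarrow> 'b::real_normed_vector) \<Rightarrow> bool" where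
  "smooth_map A f \<longleftrightarrow> (\<forall>(W, \<psi>) \<in> A. smooth_on (f \<circ> \<psi>) W)"

definition smooth_immersion ::
  "('n::finite, 'm) param set \<Rightarrow> ('m \<Rightarrow> 'e::euclidean_space) \<Rightarrow> bool" where
  "smooth_immersion A F \<longleftrightarrow> smooth_map A F \<and>
     (\<forall>(W, \<psi>) \<in> A. \<forall>p \<in> W. inj (frechet_derivative (F \<circ> \<psi>) (at p)))"

definition proper_map_into :: "('m::topological_space \<Rightarrow> 'e::euclidean_space) \<Rightarrow> bool" where
  "proper_map_into F \<longleftrightarrow> (\<forall>K. compact K \<longrightarrow> compact (F -` K))"


section \<open>The induced metric\<close>

text \<open>In this section \<open>X = F \<circ> \<psi>\<close> is the immersion read in a parametrization \<open>\<psi>\<close>,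
  \<open>p\<close> is a point of its domain, and \<open>f\<close> is a function of the coordinates.\<close>

definition pd :: "'n::finite \<Rightarrow> (real ^ 'n \<Rightarrow> 'b::real_normed_vector) \<Rightarrow> real ^ 'n \<Rightarrow> 'b" where
  "pd i f p = frechet_derivative f (at p) (axis i 1)"

definition metric :: "(real ^ 'n::finite \<Rightarrow> 'e::euclidean_space) \<Rightarrow> real ^ 'n \<Rightarrow> real ^ 'n ^ 'n" where
  "metric X p = (\<chi> i j. pd i X p \<bullet> pd j X p)"

definition vol_density :: "(real ^ 'n::finite \<Rightarrow> 'e::euclidean_space) \<Rightarrow> real ^ 'n \<Rightarrow> real" where
  "vol_density X p = sqrt (det (metric X p))"

text \<open>The gradient is given as a vector of the ambient space,
  \<open>\<nabla>f = g\<^sup>i\<^sup>j \<partial>\<^sub>jf \<partial>\<^sub>iX\<close>; the Laplacian is that of Laplace and Beltrami.\<close>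

definition grad_coord ::
  "(real ^ 'n::finite \<Rightarrow> 'e::euclidean_space) \<Rightarrow> (real ^ 'n \<Rightarrow> real) \<Rightarrow> real ^ 'n \<Rightarrow> 'e" where
  "grad_coord X f p =
     (\<Sum>i\<in>UNIV. \<Sum>j\<in>UNIV. (matrix_inv (metric X p) $ i $ j * pd j f p) *\<^sub>R pd i X p)"

definition laplace_coord ::
  "(real ^ 'n::finite \<Rightarrow> 'e::euclidean_space) \<Rightarrow> (real ^ 'n \<Rightarrow> real) \<Rightarrow> real ^ 'n \<Rightarrow> real" where
  "laplace_coord X f p = 1 / vol_density X p *
     (\<Sum>i\<in>UNIV. pd i (\<lambda>q. vol_density X q *
        (\<Sum>j\<in>UNIV. matrix_inv (metric X q) $ i $ j * pd j f q)) p)"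

text \<open>The same operators on the manifold, evaluated in some parametrization around the point; the
  result does not depend on which one.\<close>

definition param_at :: "('n::finite, 'm) param set \<Rightarrow> 'm \<Rightarrow> ('n, 'm) param" where
  "param_at A x = (SOME c. c \<in> A \<and> x \<in> snd c ` fst c)"

definition grad ::
  "('n::finite, 'm) param set \<Rightarrow> ('m \<Rightarrow> 'e::euclidean_space) \<Rightarrow> ('m \<Rightarrow> real) \<Rightarrow> 'm \<Rightarrow> 'e" where
  "grad A F u x =
     (let (W, \<psi>) = param_at A x in grad_coord (F \<circ> \<psi>) (u \<circ> \<psi>) (inv_into W \<psi> x))"

definition laplacian ::
  "('n::finite, 'm) param set \<Rightarrow> ('m \<Rightarrow> 'e::euclidean_space) \<Rightarrow> ('m \<Rightarrow> real) \<Rightarrow> 'm \<Rightarrow> real" where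
  "laplacian A F u x =
     (let (W, \<psi>) = param_at A x in laplace_coord (F \<circ> \<psi>) (u \<circ> \<psi>) (inv_into W \<psi> x))"

text \<open>The volume element is \<open>sqrt (det g) dp\<close> in each parametrization. These local measures (extended
  by zero to \<open>'m\<close>) agree on the overlaps of their domains, so their supremum in the complete lattice
  of measures is the Borel measure on \<open>'m\<close> glued from them.\<close>

definition volume ::
  "('n::finite, 'm::topological_space) param set \<Rightarrow> ('m \<Rightarrow> 'e::euclidean_space) \<Rightarrow> 'm measure" where
  "volume A F = (SUP (W, \<psi>) \<in> A.
     distr (density (restrict_space lborel W) (\<lambda>p. ennreal (vol_density (F \<circ> \<psi>) p))) borel \<psi>)"

text \<open>Riemannian distance and completeness. The length of a curve \<open>\<gamma>\<close> in the induced metric is the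
  Euclidean length of \<open>F \<circ> \<gamma>\<close>; since \<open>F\<close> is an immersion, a continuous \<open>\<gamma>\<close> is piecewise
  \<open>C\<^sup>1\<close> iff \<open>F \<circ> \<gamma>\<close> is. Points in different components have distance \<open>\<infinity>\<close>.\<close>

definition curve_length ::
  "('m \<Rightarrow> 'e::euclidean_space) \<Rightarrow> (real \<Rightarrow> 'm) \<Rightarrow> ennreal" where
  "curve_length F \<gamma> =
     (\<integral>\<^sup>+t\<in>{0..1}. ennreal (norm (vector_derivative (F \<circ> \<gamma>) (at t))) \<partial>lborel)"

definition riem_dist ::
  "('m::topological_space \<Rightarrow> 'e::euclidean_space) \<Rightarrow> 'm \<Rightarrow> 'm \<Rightarrow> ennreal" where
  "riem_dist F x y =
     (INF \<gamma> \<in> {\<gamma>. path \<gamma> \<and> valid_path (F \<circ> \<gamma>) \<and> pathstart \<gamma> = x \<and> pathfinish \<gamma> = y}.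
        curve_length F \<gamma>)"

definition complete_induced :: "('m::topological_space \<Rightarrow> 'e::euclidean_space) \<Rightarrow> bool" where
  "complete_induced F \<longleftrightarrow>
     (\<forall>s :: nat \<Rightarrow> 'm. (\<forall>\<epsilon>>0. \<exists>N. \<forall>i\<ge>N. \<forall>j\<ge>N. riem_dist F (s i) (s j) < \<epsilon>) \<longrightarrow>
        (\<exists>x. (\<lambda>i. riem_dist F (s i) x) \<longlonglongrightarrow> 0))"


section \<open>Self-expanders\<close>

definition normal_part ::
  "(real ^ 'n::finite \<Rightarrow> 'e::euclidean_space) \<Rightarrow> real ^ 'n \<Rightarrow> 'e \<Rightarrow> 'e" where
  "normal_part X p = closest_point ((range (frechet_derivative X (at p)))\<^sup>\<bottom>)"

text \<open>A tangent frame over \<open>V\<close> is given by its coordinate vectors \<open>e i q\<close>; the frame vectors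
  themselves are \<open>dX\<^sub>q (e i q)\<close>.\<close>

definition orthonormal_frame ::
  "(real ^ 'n::finite \<Rightarrow> 'e::euclidean_space) \<Rightarrow> (real ^ 'n) set \<Rightarrow>
   ('n \<Rightarrow> real ^ 'n \<Rightarrow> real ^ 'n) \<Rightarrow> bool" where
  "orthonormal_frame X V e \<longleftrightarrow> (\<forall>i. smooth_on (e i) V) \<and>
     (\<forall>q\<in>V. \<forall>i j. frechet_derivative X (at q) (e i q) \<bullet> frechet_derivative X (at q) (e j q) =
        (if i = j then 1 else 0))"

text \<open>\<open>H = \<Sum>\<^sub>i (D\<^bsub>e\<^sub>i\<^esub> e\<^sub>i)\<^sup>\<bottom>\<close> for a local orthonormal frame around \<open>p\<close>. Such frames
  exist and \<open>H\<close> does not depend on the choice, so \<open>H\<close> is uniquely determined.\<close>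

definition is_mean_curvature ::
  "(real ^ 'n::finite \<Rightarrow> 'e::euclidean_space) \<Rightarrow> (real ^ 'n) set \<Rightarrow> real ^ 'n \<Rightarrow> 'e \<Rightarrow> bool" where
  "is_mean_curvature X W p H \<longleftrightarrow>
     (\<exists>V e. open V \<and> p \<in> V \<and> V \<subseteq> W \<and> orthonormal_frame X V e \<and>
        H = (\<Sum>i\<in>UNIV. normal_part X p
               (frechet_derivative (\<lambda>q. frechet_derivative X (at q) (e i q)) (at p) (e i p))))"

definition self_expander ::
  "('n::finite, 'm::{t2_space, second_countable_topology}) param set \<Rightarrow>
   ('m \<Rightarrow> 'e::euclidean_space) \<Rightarrow> bool" where
  "self_expander A F \<longleftrightarrow> smooth_atlas A \<and> smooth_immersion A F \<and>
     (\<forall>(W, \<psi>) \<in> A. \<forall>p \<in> W.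
        is_mean_curvature (F \<circ> \<psi>) W p ((1/2) *\<^sub>R normal_part (F \<circ> \<psi>) p (F (\<psi> p))))"


section \<open>Unbounded operators on \<open>L\<^sup>2\<close>\<close>

text \<open>Elements of real \<open>L\<^sup>2(\<mu>)\<close> are represented by functions; equality is equality almost
  everywhere. An operator is represented by its graph, a relation between such functions.\<close>

definition L2 :: "'a measure \<Rightarrow> ('a \<Rightarrow> real) set" where
  "L2 \<mu> = {u \<in> borel_measurable \<mu>. integrable \<mu> (\<lambda>x. (u x)\<^sup>2)}"

definition L2_norm :: "'a measure \<Rightarrow> ('a \<Rightarrow> real) \<Rightarrow> real" where
  "L2_norm \<mu> u = sqrt (\<integral>x. (u x)\<^sup>2 \<partial>\<mu>)"

text \<open>The graph of the closure of the operator \<open>T\<close> with domain \<open>D \<subseteq> L2 \<mu>\<close>.\<close>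

definition closure_graph ::
  "'a measure \<Rightarrow> ('a \<Rightarrow> real) set \<Rightarrow> (('a \<Rightarrow> real) \<Rightarrow> 'a \<Rightarrow> real) \<Rightarrow>
   (('a \<Rightarrow> real) \<times> ('a \<Rightarrow> real)) set" where
  "closure_graph \<mu> D T = {(u, f). u \<in> L2 \<mu> \<and> f \<in> L2 \<mu> \<and>
     (\<exists>\<phi> :: nat \<Rightarrow> 'a \<Rightarrow> real. (\<forall>j. \<phi> j \<in> D) \<and>
        (\<lambda>j. L2_norm \<mu> (\<lambda>x. \<phi> j x - u x)) \<longlonglongrightarrow> 0 \<and>
        (\<lambda>j. L2_norm \<mu> (\<lambda>x. T (\<phi> j) x - f x)) \<longlonglongrightarrow> 0)}"

text \<open>\<open>\<kappa>\<close> is in the resolvent set if \<open>T - \<kappa>\<close> maps onto \<open>L\<^sup>2\<close> and is injective with bounded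
  inverse; the last two are the estimate \<open>\<parallel>u\<parallel> \<le> C \<parallel>(T - \<kappa>) u\<parallel>\<close>.\<close>

definition resolvent_set :: "'a measure \<Rightarrow> (('a \<Rightarrow> real) \<times> ('a \<Rightarrow> real)) set \<Rightarrow> real set" where
  "resolvent_set \<mu> G = {\<kappa>.
     (\<forall>h \<in> L2 \<mu>. \<exists>u f. (u, f) \<in> G \<and> (AE x in \<mu>. f x - \<kappa> * u x = h x)) \<and>
     (\<exists>C. \<forall>(u, f) \<in> G. L2_norm \<mu> u \<le> C * L2_norm \<mu> (\<lambda>x. f x - \<kappa> * u x))}"

definition spectrum_of :: "'a measure \<Rightarrow> (('a \<Rightarrow> real) \<times> ('a \<Rightarrow> real)) set \<Rightarrow> real set" where
  "spectrum_of \<mu> G = - resolvent_set \<mu> G"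

definition finite_dimensional :: "('a \<Rightarrow> real) set \<Rightarrow> bool" where
  "finite_dimensional E \<longleftrightarrow>
     (\<exists>B. finite B \<and> B \<subseteq> E \<and> (\<forall>u\<in>E. \<exists>a. \<forall>x. u x = (\<Sum>b\<in>B. a b * b x)))"


section \<open>The drifted Laplacian\<close>

definition weighted_measure ::
  "('n::finite, 'm::topological_space) param set \<Rightarrow> ('m \<Rightarrow> 'e::euclidean_space) \<Rightarrow> 'm measure" where
  "weighted_measure A F = density (volume A F) (\<lambda>x. ennreal (exp ((norm (F x))\<^sup>2 / 4)))"

definition drifted_laplacian ::
  "('n::finite, 'm) param set \<Rightarrow> ('m \<Rightarrow> 'e::euclidean_space) \<Rightarrow> ('m \<Rightarrow> real) \<Rightarrow> 'm \<Rightarrow> real" where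
  "drifted_laplacian A F u x = laplacian A F u x + 1/2 * (F x \<bullet> grad A F u x)"

definition test_functions :: "('n::finite, 'm::topological_space) param set \<Rightarrow> ('m \<Rightarrow> real) set" where
  "test_functions A = {\<phi>. smooth_map A \<phi> \<and> compact (closure {x. \<phi> x \<noteq> 0})}"

text \<open>The self-adjoint realization is the closure of the operator on \<open>C\<^sub>0\<^sup>\<infinity>\<close>: on a complete
  manifold this operator is essentially self-adjoint, so the closure is its only self-adjoint
  extension. Being the spectrum of a self-adjoint operator, it is a set of reals and can be computed
  in real \<open>L\<^sup>2\<close>. With the sign convention \<open>\<L>u + \<kappa>u = 0\<close>, it is the spectrum of \<open>-\<L>\<close>.\<close>

definition drifted_spectrum ::
  "('n::finite, 'm::topological_space) param set \<Rightarrow> ('m \<Rightarrow> 'e::euclidean_space) \<Rightarrow> real set" where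
  "drifted_spectrum A F = spectrum_of (weighted_measure A F)
     (closure_graph (weighted_measure A F) (test_functions A)
        (\<lambda>u x. - drifted_laplacian A F u x))"

definition weighted_eigenspace ::
  "('n::finite, 'm::topological_space) param set \<Rightarrow> ('m \<Rightarrow> 'e::euclidean_space) \<Rightarrow> real \<Rightarrow>
   ('m \<Rightarrow> real) set" where
  "weighted_eigenspace A F \<kappa> = {u. smooth_map A u \<and> u \<in> L2 (weighted_measure A F) \<and>
     (\<forall>x. drifted_laplacian A F u x + \<kappa> * u x = 0)}"

definition weighted_eigenvalue ::
  "('n::finite, 'm::topological_space) param set \<Rightarrow> ('m \<Rightarrow> 'e::euclidean_space) \<Rightarrow> real \<Rightarrow> bool" where
  "weighted_eigenvalue A F \<kappa> \<longleftrightarrow> (\<exists>u \<in> weighted_eigenspace A F \<kappa>. \<exists>x. u x \<noteq> 0)"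

definition has_discrete_spectrum ::
  "('n::finite, 'm::topological_space) param set \<Rightarrow> ('m \<Rightarrow> 'e::euclidean_space) \<Rightarrow> bool" where
  "has_discrete_spectrum A F \<longleftrightarrow> (\<forall>\<kappa> \<in> drifted_spectrum A F.
     \<kappa> isolated_in drifted_spectrum A F \<and> weighted_eigenvalue A F \<kappa> \<and>
     finite_dimensional (weighted_eigenspace A F \<kappa>))"

definition spectrum_bottom ::
  "('n::finite, 'm::topological_space) param set \<Rightarrow> ('m \<Rightarrow> 'e::euclidean_space) \<Rightarrow> real" where
  "spectrum_bottom A F = Inf
     {(\<integral>x. (norm (grad A F \<phi> x))\<^sup>2 \<partial>weighted_measure A F) / (\<integral>x. (\<phi> x)\<^sup>2 \<partial>weighted_measure A F)
      | \<phi>. \<phi> \<in> test_functions A \<and> (\<integral>x. (\<phi> x)\<^sup>2 \<partial>weighted_measure A F) \<noteq> 0}"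

end

(* Pairing L|x|^2 = 2n + |x|^2 with phi^2 gives: int |x|^2 phi^2 <= 16 int |grad phi|^2 for test functions phi. On sets of
 bounded energy the mass outside a large ball is therefore uniformly small, and properness reduces the ball to finitely
 many charts, where Rellich's theorem applies: the energy form is compact relative to L^2. The operator on test functions
 is essentially self-adjoint (cutoffs in |x|, and smoothness of weak solutions by Friedrichs mollification), so its closure
 has compact resolvent; the bottom of the form is then an eigenvalue, with a smooth eigenfunction. *)

theory Submission imports Defs "HOL-Analysis.Analysis" begin

text \<open>Compactness is carried by a single inequality: for every e > 0, |u|^2 is at most e *
  (Tu, u) plus a finite sum of squares of inner products of u with fixed L^2 functions. In this
  shape it adds up over charts, tolerates cutoffs, and passes from test functions to the closure, so
  the spectral part can be stated for an abstract symmetric operator. Two obstacles shape the rest.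
  The operators on the manifold are evaluated in an arbitrarily chosen chart, so independence of the
  chart has to be proved; for the drifted Laplacian it is read off the weak formulation, whose right
  side is an integral of gradients. And the spectrum is that of the closure of the operator on test
  functions, so an L^2 function known only by its pairings with test functions must become smooth
  before it can be tested against cutoffs of itself. The constant 16 is Young's inequality 4 |x|
  |phi| |grad phi| <= |x|^2 phi^2 / 2 + 8 |grad phi|^2, after the term 2n, which has the favourable
  sign, is dropped.\<close>

notation scaleR (infixr "*R" 75) and LIMSEQ ("((_)/ ----> (_))" [60, 60] 60)

abbreviation sum_UNIV :: "('i => 'b::comm_monoid_add) => 'b" (binder "SS " 10) where
 "sum_UNIV f == sum f UNIV"

abbreviation nn_lborel :: "('a::euclidean_space => ennreal) => ennreal" (binder "NN " 10) where
 "nn_lborel f == nn_integral lborel f"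

abbreviation FD where "FD f p == frechet_derivative f (at p)"

lemmas LINT_cong = Bochner_Integration.integral_cong and LINT_add = Bochner_Integration.integral_add
 and LINT_diff = Bochner_Integration.integral_diff and LINT_sum = Bochner_Integration.integral_sum
 and LINT_nonneg = Bochner_Integration.integral_nonneg and Lint_add = Bochner_Integration.integrable_add
 and Lint_sum = Bochner_Integration.integrable_sum and Lint_bound = Bochner_Integration.integrable_bound

section \<open>Smooth functions\<close>

text \<open>\<open>frechet_derivative\<close> at a point depends only on the germ of the map there,
  so on an open set equality of two maps passes to all the iterated derivatives in
  \<open>Ck_on\<close>. This is what allows a map to be replaced by a local formula.\<close>

lemma Ck_on_cong:
 assumes "open S" "!!x. x : S ==> f x = g x"
 shows "Ck_on k f S \<longleftrightarrow> Ck_on k g S" using assms(2)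
proof (induction k arbitrary: f g)
 case 0
 thus ?case by (simp cong: continuous_on_cong)
next
 case (Suc k)
 have 0: "(f has_derivative f') (at x) \<longleftrightarrow> (g has_derivative f') (at x)" if "x : S" for x f'
  using has_derivative_transform_within_open[OF _ assms(1) that] Suc.prems by metis
 have 1: "FD f x = FD g x" if "x : S" for x using 0[OF that] unfolding frechet_derivative_def by simp
 have "f differentiable_on S \<longleftrightarrow> g differentiable_on S"
  using 0 by (simp add: differentiable_on_eq_differentiable_at[OF assms(1)] differentiable_def)
 moreover have "Ck_on k (%x. FD f x v) S \<longleftrightarrow> Ck_on k (%x. FD g x v) S" for v using 1 by (intro Suc.IH) auto
 ultimately show ?case by simp
qed

text \<open>Lets a derivative be exhibited through \<open>has_derivative\<close> in any convenient
  form, so that the \<open>frechet_derivative\<close> in the definition of \<open>Ck_on\<close> need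
  not be computed.\<close>

lemma Ck_on_SucI:
 assumes "open S" "!!x. x : S ==> (f has_derivative f' x) (at x)"
  and "!!v. Ck_on k (%x. f' x v) S"
 shows "Ck_on (Suc k) f S"
proof -
 have "f differentiable_on S" using assms(2) by (meson differentiableI differentiable_at_imp_differentiable_on)
 moreover have "Ck_on k (%x. FD f x v) S" for v using assms(3)[of v] frechet_derivative_at[OF assms(2)]
  by (subst Ck_on_cong[OF assms(1), of _ "%x. f' x v"]) (auto simp: fun_eq_iff)
 ultimately show ?thesis by simp
qed

lemma Ck_on_SucD:
 assumes "open S" "Ck_on (Suc k) f S" "x : S"
 shows "(f has_derivative FD f x) (at x)" using assms by (auto simp: frechet_derivative_works[symmetric] differentiable_on_eq_differentiable_at)

lemma Ck_on_Suc_imp: "Ck_on (Suc k) f S ==> Ck_on k f S"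
proof (induction k arbitrary: f)
 case 0
 thus ?case by (simp add: differentiable_imp_continuous_on)
next
 case (Suc k)
 thus ?case by (metis Ck_on.simps(2))
qed

lemma Ck_on_subset:
 assumes "Ck_on k f S" "T <= S"  "open S" "open T"
 shows "Ck_on k f T" using assms(1)
proof (induction k arbitrary: f)
 case 0
 thus ?case using assms continuous_on_subset by auto
next
 case (Suc k)
 thus ?case using assms differentiable_on_subset by auto
qed

lemma Ck_on_local:
 assumes "open S" "!!x. x : S ==> EX N. open N & x : N & Ck_on k f N"
 shows "Ck_on k f S" using assms(2)
proof (induction k arbitrary: f)
 case 0
 thus ?case using assms(1) by (force simp: continuous_on_eq_continuous_at intro!: continuous_at_imp_continuous_on)
next
 case (Suc k)
 have "f differentiable_on S" using Suc.prems assms(1)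
  by (auto simp: differentiable_on_eq_differentiable_at) (metis differentiable_on_eq_differentiable_at)
 moreover have "Ck_on k (%x. FD f x v) S" for v by (rule Suc.IH) (use Suc.prems in fastforce)
 ultimately show ?case by simp
qed

lemma Ck_on_const: "open S ==> Ck_on k (%x. c) S"
proof (induction k arbitrary: c)
 case (Suc k)
 show ?case by (rule Ck_on_SucI[OF Suc.prems, where f'="%_ _. 0"]) (use Suc in auto)
qed simp

lemma Ck_on_ident: "open S ==> Ck_on k (%x. x) S"
proof (cases k)
 case (Suc m)
 assume "open S"
 thus ?thesis unfolding Suc by (intro Ck_on_SucI[where f'="%_ v. v"]) (auto intro: Ck_on_const)
qed (auto intro: continuous_on_id)

lemma Ck_on_bounded_linear:
 assumes "bounded_linear h" "open S" "Ck_on k f S"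
 shows "Ck_on k (%x. h (f x)) S" using assms(3)
proof (induction k arbitrary: f)
 case 0
 thus ?case using assms(1) by (simp add: bounded_linear.continuous_on)
next
 case (Suc k)
 show ?case by (rule Ck_on_SucI[OF assms(2), where f'="%x v. h (FD f x v)"])
   (use Suc in "auto intro!: bounded_linear.has_derivative[OF assms(1)] Ck_on_SucD[OF assms(2)]")
qed

lemma Ck_on_add:
 assumes "open S" "Ck_on k f S" "Ck_on k g S"
 shows "Ck_on k (%x. f x + g x) S" using assms(2,3)
proof (induction k arbitrary: f g)
 case 0
 thus ?case by (simp add: continuous_on_add)
next
 case (Suc k)
 show ?case by (rule Ck_on_SucI[OF assms(1), where f'="%x v. FD f x v + FD g x v"])
   (use Suc in "auto intro!: derivative_intros Ck_on_SucD[OF assms(1)]")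
qed

lemma Ck_on_sum:
 assumes "open S" "!!i. i : I ==> Ck_on k (f i) S"
 shows "Ck_on k (%x. \<Sum>i\<in>I. f i x) S" using assms(2)
 by (induction I rule: infinite_finite_induct) (auto intro: Ck_on_const Ck_on_add assms(1))

lemma Ck_on_bilinear:
 fixes f :: "'a::euclidean_space => _"
 assumes "bounded_bilinear pr" "open S" "Ck_on k f S" "Ck_on k g S"
 shows "Ck_on k (%x. pr (f x) (g x)) S" using assms(3,4)
proof (induction k arbitrary: f g)
 case 0
 thus ?case by (simp add: bounded_bilinear.continuous_on[OF assms(1)])
next
 case (Suc k)
 have 1: "Ck_on k (%x. pr (f x) (FD g x v)) S"
  "Ck_on k (%x. pr (FD f x v) (g x)) S" for v using Suc.prems by (auto intro!: Suc.IH intro: Ck_on_Suc_imp)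
 show ?case by (rule Ck_on_SucI[OF assms(2), where f'="%x v. pr (f x) (FD g x v) + pr (FD f x v) (g x)"])
   (use Suc.prems in "auto intro!: bounded_bilinear.FDERIV[OF assms(1)] Ck_on_add[OF assms(2)] Ck_on_SucD[OF assms(2)] 1")
qed

text \<open>The induction varies \<open>g\<close> and keeps \<open>f\<close>. Expanding the
  increment \<open>?f x v\<close> in the basis writes the derivative of the composition as a sum of
  products in which \<open>%y. FD g y b\<close> has a fixed direction \<open>b\<close> and one order
  of smoothness less than \<open>g\<close>, so that the induction hypothesis applies to it.\<close>

lemma Ck_on_compose:
 fixes f :: "'a::euclidean_space => 'b::euclidean_space"
 assumes "open S" "open T" "Ck_on k f S" "Ck_on k g T" "f ` S <= T"
 shows "Ck_on k (%x. g (f x)) S" using assms(3,4)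
proof (induction k arbitrary: g)
 case 0
 thus ?case using assms(5) continuous_on_compose2 by auto
next
 case (Suc k)
 let ?f = "%x. FD f x" and ?g = "%x. FD g x"
 have D: "(f has_derivative ?f x) (at x)" "(g has_derivative ?g (f x)) (at (f x))" if "x : S" for x
  using Suc.prems that assms(1,2,5) by (auto intro!: Ck_on_SucD)
 have eq: "?g (f x) (?f x v) = (\<Sum>b\<in>Basis. (?f x v \<bullet> b) *R ?g (f x) b)" if "x : S" for x v
 proof -
  have "linear (?g (f x))" using D[OF that] has_derivative_linear by blast
  hence "?g (f x) (\<Sum>b\<in>Basis. (?f x v \<bullet> b) *R b) = (\<Sum>b\<in>Basis. (?f x v \<bullet> b) *R ?g (f x) b)"
   by (simp add: linear_sum linear_cmul)
  thus ?thesis by (simp add: euclidean_representation)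
 qed
 have "Ck_on k (%x. ?g (f x) (?f x v)) S" for v
 proof (subst Ck_on_cong[OF assms(1) eq])
  have "Ck_on k (%x. ?g (f x) b) S" for b by (rule Suc.IH[OF Ck_on_Suc_imp[OF Suc.prems(1)]]) (use Suc.prems(2) in simp)
  moreover have "Ck_on k (%x. ?f x v \<bullet> b) S" for b
   using Suc.prems by (intro Ck_on_bounded_linear[OF bounded_linear_inner_left assms(1)]) auto
  ultimately show "Ck_on k (%x. \<Sum>b\<in>Basis. (?f x v \<bullet> b) *R ?g (f x) b) S"
   by (intro Ck_on_sum Ck_on_bilinear[OF bounded_bilinear_scaleR] assms(1))
 qed auto
 moreover have "((%x. g (f x)) has_derivative (%v. ?g (f x) (?f x v))) (at x)" if "x : S" for x using D[OF that] by (rule has_derivative_compose)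
 ultimately show ?case by (intro Ck_on_SucI[OF assms(1)])
qed

lemma smooth_cong:
 "open S ==> (!!x. x : S ==> f x = g x) ==> smooth_on f S \<longleftrightarrow> smooth_on g S"
 unfolding smooth_on_def using Ck_on_cong[of S f g] by simp

lemma smooth_const[intro]: "open S ==> smooth_on (%x. c) S" unfolding smooth_on_def by (simp add: Ck_on_const)

lemma smooth_ident[intro]: "open S ==> smooth_on (%x. x) S" unfolding smooth_on_def by (simp add: Ck_on_ident)

lemma smooth_add: "open S ==> smooth_on f S ==> smooth_on g S ==> smooth_on (%x. f x + g x) S" unfolding smooth_on_def by (simp add: Ck_on_add)

lemma smooth_sum:
 "open S ==> (!!i. i : I ==> smooth_on (h i) S) ==> smooth_on (%x. \<Sum>i\<in>I. h i x) S"
 unfolding smooth_on_def by (intro allI Ck_on_sum) simp_all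

lemma smooth_bounded_linear:
 "bounded_linear l ==> open S ==> smooth_on f S ==> smooth_on (%x. l (f x)) S" unfolding smooth_on_def by (simp add: Ck_on_bounded_linear[of l])

lemma smooth_bilinear:
 "bounded_bilinear pr ==> open S ==> smooth_on f S ==> smooth_on g S ==> smooth_on (%x. pr (f x) (g x)) S"
 unfolding smooth_on_def by (simp add: Ck_on_bilinear[of pr])

lemmas smooth_scaleR = smooth_bilinear[OF bounded_bilinear_scaleR]
lemmas smooth_inner = smooth_bilinear[OF bounded_bilinear_inner]

lemma smooth_mult:
 fixes f g :: "_ => real"
 shows "open S ==> smooth_on f S ==> smooth_on g S ==> smooth_on (%x. f x*g x) S" by (rule smooth_bilinear[OF bounded_bilinear_mult])

lemma smooth_minus: "open S ==> smooth_on f S ==> smooth_on (%x. - f x) S"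
 by (rule smooth_bounded_linear[OF bounded_linear_minus[OF bounded_linear_ident]])

lemma smooth_diff: "open S ==> smooth_on f S ==> smooth_on g S ==> smooth_on (%x. f x - g x) S"
 using smooth_add[of S f "%x. - g x"] smooth_minus[of S g] by simp

lemma smooth_prod:
 fixes h :: "'i => 'a::euclidean_space => real"
 assumes "open S" "!!i. i : I ==> smooth_on (h i) S"
 shows "smooth_on (%x. \<Prod>i\<in>I. h i x) S" using assms(2) by (induction I rule: infinite_finite_induct) (auto intro: smooth_mult assms(1))

lemma smooth_compose:
 fixes f :: "'a::euclidean_space => 'b::euclidean_space"
 shows "open S ==> open T ==> smooth_on f S ==> smooth_on g T ==> f ` S <= T ==> smooth_on (%x. g (f x)) S"
 unfolding smooth_on_def by (simp add: Ck_on_compose[of S T])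

lemma smooth_subset: "smooth_on f S ==> T <= S ==> open S ==> open T ==> smooth_on f T" unfolding smooth_on_def using Ck_on_subset by metis

lemma smooth_local:
 assumes "open S" "!!x. x : S ==> EX N. open N & x : N & smooth_on f N"
 shows "smooth_on f S" unfolding smooth_on_def
proof
 fix k show "Ck_on k f S" by (rule Ck_on_local[OF assms(1)]) (use assms(2) in "auto simp: smooth_on_def")
qed

lemma smooth_continuous: "smooth_on f S ==> continuous_on S f" unfolding smooth_on_def using Ck_on.simps(1) by blast

lemma smooth_has_derivative:
 "smooth_on f S ==> open S ==> x : S ==> (f has_derivative FD f x) (at x)" unfolding smooth_on_def by (blast intro: Ck_on_SucD)

lemma smooth_frechet_derivative:
 "smooth_on f S ==> smooth_on (%x. FD f x v) S" unfolding smooth_on_def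
proof
 fix k assume "ALL k. Ck_on k f S"
 hence "Ck_on (Suc k) f S" by blast
 thus "Ck_on k (%x. FD f x v) S" by simp
qed

lemma smooth_pd: "smooth_on f S ==> smooth_on (pd i f) S" using smooth_frechet_derivative unfolding pd_def[abs_def] .

lemma smooth_pd': "smooth_on f S ==> smooth_on (%x. pd i f x) S" using smooth_pd[of f S i] by simp

section \<open>Smooth functions of one real variable\<close>

text \<open>Induction on the order, for all members \<open>h m\<close> at once: if the derivatives
  are built from the family by operations that preserve \<open>Ck_on k\<close>, every order is
  inherited. A constant family covers \<open>exp\<close>, \<open>inverse\<close> and
  \<open>sqrt\<close>; the index is there for \<open>flat_fn\<close>.\<close>

lemma smooth_if_real_derivs:
 fixes h :: "nat => real => real"
 assumes "open S" "!!x m. x : S ==> (h m has_field_derivative h' m x) (at x)"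
  and "!!k m. (!!j. Ck_on k (h j) S) ==> Ck_on k (h' m) S"
 shows "smooth_on (h m) S"
proof -
 have "Ck_on k (h m) S" for k
 proof (induction k arbitrary: m)
  case 0
  thus ?case using assms(1,2) by (auto intro!: continuous_at_imp_continuous_on DERIV_isCont)
 next
  case (Suc k)
  have "Ck_on k (h' m) S" using assms(3) Suc by blast
  hence "Ck_on k (%x. h' m x * v) S" for v by (intro Ck_on_bounded_linear[OF bounded_linear_mult_left assms(1)])
  thus ?case by (intro Ck_on_SucI[OF assms(1), where f'="%x v. h' m x * v"]) (use assms(2) in "auto simp: has_field_derivative_def")
 qed
 thus ?thesis by (simp add: smooth_on_def)
qed

lemma smooth_exp: "smooth_on (exp :: real => real) UNIV" by (rule smooth_if_real_derivs[where h="%_. exp" and h'="%_. exp"]) (auto intro: DERIV_exp)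

lemma smooth_inverse: "smooth_on (inverse :: real => real) (- {0})"
proof (rule smooth_if_real_derivs[where h="%_. inverse" and h'="%_ x. - (inverse x*inverse x)"])
 fix x :: real assume "x : -{0}"
 thus "(inverse has_field_derivative - (inverse x*inverse x)) (at x)" by (auto intro!: derivative_eq_intros simp: power2_eq_square)
next
 fix k :: nat
 assume "!!j::nat. Ck_on k (inverse::real=>real) (- {0})"
 thus "Ck_on k (%x::real. - (inverse x*inverse x)) (- {0})" by (intro Ck_on_bounded_linear[OF bounded_linear_minus[OF bounded_linear_ident]]
   Ck_on_bilinear[OF bounded_bilinear_mult]) auto
qed auto

lemma smooth_sqrt: "smooth_on sqrt {0<..}"
proof (rule smooth_if_real_derivs[where h="%_. sqrt" and h'="%_ x. inverse (sqrt x)*(1/2)"])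
 fix x :: real assume "x : {0<..}"
 thus "(sqrt has_field_derivative inverse (sqrt x)*(1/2)) (at x)" by (auto intro!: derivative_eq_intros)
next
 fix k :: nat
 assume "!!j::nat. Ck_on k sqrt {0<..}"
 thus "Ck_on k (%x. inverse (sqrt x)*(1/2)) {0<..}" using smooth_inverse by (intro Ck_on_bounded_linear[OF bounded_linear_mult_left],
    simp, intro Ck_on_compose[where T="-{0}" and g=inverse and f=sqrt]) (auto simp: smooth_on_def)
qed auto

lemma smooth_exp_compose: "open S ==> smooth_on f S ==> smooth_on (%x. exp (f x :: real)) S"
 by (rule smooth_compose[OF _ open_UNIV _ smooth_exp]) auto

lemma smooth_divide:
 fixes f g :: "'a::euclidean_space => real"
 assumes "open S" "smooth_on f S" "smooth_on g S" "!!x. x : S ==> g x ~= 0"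
 shows "smooth_on (%x. f x / g x) S"
proof -
 have "smooth_on (%x. inverse (g x)) S" by (rule smooth_compose[OF assms(1) _ assms(3) smooth_inverse]) (use assms(4) in auto)
 thus ?thesis using smooth_mult[OF assms(1,2)] by (simp add: divide_inverse)
qed

lemma smooth_sqrt_compose:
 "open S ==> smooth_on f S ==> (!!x. x : S ==> f x > 0) ==> smooth_on (%x. sqrt (f x)) S" by (rule smooth_compose[OF _ _ _ smooth_sqrt]) auto

text \<open>The functions \<open>t\<^sup>-\<^sup>m exp (-1/t)\<close>, extended by zero, are closed under differentiation
 up to linear combinations.\<close>

definition flat_fn :: "nat => real => real" where
 "flat_fn m t = (if t > 0 then exp (- (1/t)) / t^m else 0)"

text \<open>The substitution \<open>x = 1/t\<close> turns the limit from the right into that of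
  \<open>x^m / exp x\<close> at infinity.\<close>

lemma flat_fn_tendsto_0: "((%t. flat_fn m t) \<longlongrightarrow> 0) (at 0)"
proof -
 have "((%t. flat_fn m t) \<longlongrightarrow> 0) (at_right 0)"
 proof -
  have "((%x::real. x^m / exp x) \<longlongrightarrow> 0) at_top" by (rule tendsto_power_div_exp_0)
  hence "((%x::real. (inverse x) ^ m / exp (inverse x)) \<longlongrightarrow> 0) (at_right 0)"
   by (rule filterlim_compose[OF _ filterlim_inverse_at_top_right])
  thus ?thesis by (rule Lim_transform_eventually) (auto simp: eventually_at_right_field flat_fn_def field_simps exp_minus intro!: exI[of _ 1])
 qed
 moreover have "((%t. flat_fn m t) \<longlongrightarrow> 0) (at_left 0)" by (rule Lim_transform_eventually[OF tendsto_const])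
   (auto simp: flat_fn_def eventually_at_left_field intro!: exI[of _ "-1"])
 ultimately show ?thesis by (simp add: filterlim_at_split)
qed

text \<open>For positive arguments this is the quotient rule; at 0 the difference quotient of
  \<open>flat_fn m\<close> is \<open>flat_fn (m+1)\<close>, whose limit is 0.\<close>

lemma flat_fn_deriv:
 "(flat_fn m has_field_derivative (flat_fn (m+2) x - real m*flat_fn (m+1) x)) (at x)"
proof -
 consider "x > 0" | "x < 0" | "x = 0" by linarith
 thus ?thesis
 proof cases
  case 1
  have "((%t. exp (- (1/t)) / t^m) has_field_derivative (flat_fn (m+2) x - real m*flat_fn (m+1) x)) (at x)"
  proof -
   have P: "real m * x^(m - Suc 0) = real m * x^m / x" using 1 by (cases m) auto
   have "((%t. exp (- (1/t)) / t^m) has_field_derivative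
     ((exp (- (1/x))*(1 / x^2)) * x^m - exp (- (1/x))*(real m * x^(m - Suc 0))) / (x^m * x^m)) (at x)"
    using 1 by (auto intro!: derivative_eq_intros simp: power2_eq_square)
   thus ?thesis by (rule DERIV_cong) (use 1 in "simp add: P flat_fn_def field_simps power2_eq_square")
  qed
  thus ?thesis by (rule has_field_derivative_transform_within_open[where S="{0<..}"]) (use 1 in "auto simp: flat_fn_def")
 next
  case 2
  have "((%t. 0) has_field_derivative (flat_fn (m+2) x - real m*flat_fn (m+1) x)) (at x)" using 2 by (auto simp: flat_fn_def)
  thus ?thesis by (rule has_field_derivative_transform_within_open[where S="{..<0}"]) (use 2 in "auto simp: flat_fn_def")
 next
  case 3
  have eq: "(%h. (flat_fn m (0 + h) - flat_fn m 0) / h) = flat_fn (m+1)" by (auto simp: flat_fn_def fun_eq_iff)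
  have z: "flat_fn j 0 = 0" for j by (simp add: flat_fn_def)
  show ?thesis using flat_fn_tendsto_0[of "m+1"] unfolding DERIV_def 3 eq by (simp add: z)
 qed
qed

lemma smooth_flat_fn: "smooth_on (flat_fn m) UNIV"
proof (rule smooth_if_real_derivs[where h="flat_fn" and h'="%m x. flat_fn (m+2) x + (- real m)*flat_fn (m+1) x"])
 fix k m
 assume "!!j::nat. Ck_on k (flat_fn j) UNIV"
 thus "Ck_on k (%x. flat_fn (m+2) x + (- real m)*flat_fn (m+1) x) UNIV" by (intro Ck_on_add Ck_on_bounded_linear[OF bounded_linear_mult_right]) auto
qed (use flat_fn_deriv in auto)

lemma flat_fn_nonneg: "flat_fn m t >= 0"
 and flat_fn_pos_iff: "flat_fn m t > 0 \<longleftrightarrow> t > 0"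
 and flat_fn_eq_0_iff: "flat_fn m t = 0 \<longleftrightarrow> t <= 0"
 by (auto simp: flat_fn_def)

text \<open>The profile of the radial cutoffs, both on Euclidean space and on the manifold. At least
  one of \<open>t\<close> and \<open>1 - t\<close> is positive, which keeps the denominator away
  from 0.\<close>

definition smooth_step :: "real => real" where
 "smooth_step t = flat_fn 0 t / (flat_fn 0 t + flat_fn 0 (1 - t))"

lemma smooth_step_denom_pos: "flat_fn 0 t + flat_fn 0 (1 - t) > 0"
proof (cases "t > 0")
 case True
 thus ?thesis using flat_fn_pos_iff[of 0 t] flat_fn_nonneg[of 0 "1-t"] by linarith
next
 case False
 thus ?thesis using flat_fn_pos_iff[of 0 "1-t"] flat_fn_nonneg[of 0 t] by linarith
qed

lemma smooth_step:
 shows smooth_smooth_step: "smooth_on smooth_step UNIV"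
  and smooth_step_nonneg: "smooth_step t >= 0"
  and smooth_step_le_1: "smooth_step t <= 1"
  and smooth_step_0: "t <= 0 ==> smooth_step t = 0"
  and smooth_step_1: "t >= 1 ==> smooth_step t = 1"
proof -
 have "smooth_on (%t::real. flat_fn 0 (1 - t)) UNIV" by (intro smooth_compose[OF _ _ _ smooth_flat_fn] smooth_diff) auto
 thus "smooth_on smooth_step UNIV" unfolding smooth_step_def[abs_def] using smooth_step_denom_pos
  by (intro smooth_divide smooth_add smooth_flat_fn) (auto simp: less_imp_neq[symmetric])
 show "smooth_step t >= 0" "smooth_step t <= 1"
  unfolding smooth_step_def using flat_fn_nonneg[of 0 t] flat_fn_nonneg[of 0 "1-t"] smooth_step_denom_pos[of t] by (auto simp: divide_le_eq_1)
 show "t <= 0 ==> smooth_step t = 0" "t >= 1 ==> smooth_step t = 1" using smooth_step_denom_pos[of t] by (auto simp: smooth_step_def flat_fn_def)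
qed

section \<open>The Hilbert space of square integrable functions\<close>

text \<open>The source of three facts: Cauchy--Schwarz for \<open>L2_inner\<close>, the vanishing of
  the first variation in \<open>L2_riesz\<close> (with \<open>a = 0\<close>), and Cauchy--Schwarz
  for the form of \<open>T - bottom\<close>. These forms may be degenerate, hence the separate case
  \<open>c = 0\<close>.\<close>

lemma quadratic_nonneg_discriminant:
 fixes a b c :: real
 assumes "!!t. 0 <= a + 2*t*b + t^2 * c"
 shows "b^2 <= a * c"
proof (cases "c = 0")
 case True
 have "b = 0"
 proof (rule ccontr)
  assume "b ~= 0"
  thus False using assms[of "- (a + 1) / (2*b)"] True by (simp add: field_simps)
 qed
 thus ?thesis using True by simp
next
 case False
 have "c > 0"
 proof (rule ccontr)
  assume "~ c > 0"
  hence c: "c < 0" using False by simp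
  \<comment> \<open>For negative \<open>c\<close> this \<open>t\<close> is so large that
    \<open>t^2 * c\<close> outweighs both \<open>a\<close> and \<open>2*t*b\<close>; the added 1
    gives \<open>t >= 1\<close>.\<close>
  define t where "t = (abs a + 2*abs b + 1) / (-c) + 1"
  have t: "t >= 1" "t*(-c) >= abs a + 2*abs b + 1" using c by (auto simp: t_def field_simps)
  have "t*(t*(-c)) >= t*(abs a + 2*abs b + 1)" using t by (intro mult_left_mono) auto
  also have "t*(abs a + 2*abs b + 1) = t*abs a + 2*(t*abs b) + t" by (simp add: algebra_simps)
  finally have "t^2 * c <= - (t*abs a + 2*(t*abs b) + t)" by (simp add: power2_eq_square algebra_simps)
  moreover have "abs a <= t*abs a" using t by (intro mult_le_cancel_right1[THEN iffD2]) auto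
  moreover have "t*b <= t*abs b" using t by (intro mult_left_mono) auto
  moreover have "2*t*b = 2*(t*b)" by simp
  ultimately have "a + 2*t*b + t^2 * c < 0" using t abs_ge_self[of a] by linarith
  thus False using assms[of t] by simp
 qed
 thus ?thesis using assms[of "- b / c"] by (simp add: field_simps power2_eq_square)
qed

definition L2_inner :: "'a measure => ('a => real) => ('a => real) => real" where
 "L2_inner mu u v = (LINT x|mu. u x * v x)"

lemma L2_measurable: "u : L2 mu ==> u : borel_measurable mu"
 and L2_integrable_square: "u : L2 mu ==> integrable mu (%x. (u x)^2)"
 by (auto simp: L2_def)

lemma L2_mult_integrable:
 assumes "u : L2 mu" "v : L2 mu"
 shows "integrable mu (%x. u x * v x)"
proof (rule Lint_bound)
 show "integrable mu (%x. (u x)^2 + (v x)^2)" using assms by (auto simp: L2_def)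
 have "abs (a*b) <= a^2 + b^2" for a b :: real
 proof -
  have "0 <= (abs a - abs b)^2" "0 <= abs a*abs b" by auto
  moreover from this have "2*(abs a*abs b) <= a^2 + b^2" by (simp add: power2_eq_square algebra_simps)
  ultimately show ?thesis unfolding abs_mult by linarith
 qed
 thus "AE x in mu. norm (u x * v x) <= norm ((u x)^2 + (v x)^2)" by (auto intro: order_trans[OF _ abs_ge_self])
qed (use assms in "auto simp: L2_def")

lemma L2_lincomb:
 assumes "u : L2 mu" "v : L2 mu"
 shows "(%x. u x + c * v x) : L2 mu"
proof -
 have "integrable mu (%x. (u x)^2 + (2 * c)*(u x * v x) + c^2*(v x)^2)" using assms L2_mult_integrable[OF assms] by (auto simp: L2_def)
 moreover have "(u x)^2 + (2 * c)*(u x * v x) + c^2*(v x)^2 = (u x + c * v x)^2" for x by (simp add: power2_eq_square algebra_simps)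
 ultimately show ?thesis using assms by (auto simp: L2_def)
qed

lemma L2_add: "u : L2 mu ==> v : L2 mu ==> (%x. u x + v x) : L2 mu"
 and L2_diff: "u : L2 mu ==> v : L2 mu ==> (%x. u x - v x) : L2 mu"
 using L2_lincomb[of u mu v 1] L2_lincomb[of u mu v "-1"] by auto

lemma L2_zero: "(%x. 0) : L2 mu" by (auto simp: L2_def)

lemma L2_scale: "u : L2 mu ==> (%x. c*u x) : L2 mu" using L2_lincomb[OF L2_zero, of u mu c] by simp

lemma L2_inner_commute: "L2_inner mu u v = L2_inner mu v u" by (simp add: L2_inner_def mult.commute)

lemma L2_inner_lincomb_right:
 assumes "u : L2 mu" "v : L2 mu" "w : L2 mu"
 shows "L2_inner mu u (%x. v x + c*w x) = L2_inner mu u v + c*L2_inner mu u w"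
proof -
 have "L2_inner mu u (%x. v x + c*w x) = (LINT x|mu. u x * v x + c*(u x*w x))" by (simp add: L2_inner_def algebra_simps)
 thus ?thesis using L2_mult_integrable[OF assms(1,2)] L2_mult_integrable[OF assms(1,3)] by (simp add: L2_inner_def)
qed

lemma L2_inner_lincomb_left:
 assumes "u : L2 mu" "v : L2 mu" "w : L2 mu"
 shows "L2_inner mu (%x. v x + c*w x) u = L2_inner mu v u + c*L2_inner mu w u"
 using L2_inner_lincomb_right[OF assms] by (simp add: L2_inner_commute)

lemma L2_inner_diff_right:
 "u : L2 mu ==> v : L2 mu ==> w : L2 mu ==> L2_inner mu u (%x. v x - w x) = L2_inner mu u v - L2_inner mu u w"
 and L2_inner_diff_left:
 "u : L2 mu ==> v : L2 mu ==> w : L2 mu ==> L2_inner mu (%x. v x - w x) u = L2_inner mu v u - L2_inner mu w u"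
 and L2_inner_add_right:
 "u : L2 mu ==> v : L2 mu ==> w : L2 mu ==> L2_inner mu u (%x. v x + w x) = L2_inner mu u v + L2_inner mu u w"
 and L2_inner_scale_right: "u : L2 mu ==> v : L2 mu ==> L2_inner mu u (%x. c * v x) = c*L2_inner mu u v"
 and L2_inner_scale_left: "u : L2 mu ==> v : L2 mu ==> L2_inner mu (%x. c * v x) u = c*L2_inner mu v u"
 using L2_inner_lincomb_right[of u mu v w "-1"] L2_inner_lincomb_left[of u mu v w "-1"]
  L2_inner_lincomb_right[of u mu v w 1]
  L2_inner_lincomb_right[OF _ L2_zero, of u mu v c] L2_inner_lincomb_left[OF _ L2_zero, of u mu v c] by (auto simp: L2_inner_def)

lemma L2_inner_self_nonneg: "L2_inner mu u u >= 0" by (simp add: L2_inner_def)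

lemma L2_norm_eq: "L2_norm mu u = sqrt (L2_inner mu u u)" by (simp add: L2_norm_def L2_inner_def power2_eq_square)

lemma L2_norm_nonneg: "L2_norm mu u >= 0" by (simp add: L2_norm_def)

lemma L2_norm_sq: "(L2_norm mu u)^2 = L2_inner mu u u" by (simp add: L2_norm_eq L2_inner_self_nonneg)

lemma L2_inner_lincomb_self:
 assumes "u : L2 mu" "v : L2 mu"
 shows "L2_inner mu (%x. u x + c * v x) (%x. u x + c * v x) =
  L2_inner mu u u + 2 * c*L2_inner mu u v + c^2*L2_inner mu v v" using assms L2_lincomb[OF assms, of c]
 by (simp add: L2_inner_lincomb_left L2_inner_lincomb_right L2_inner_commute[of mu v u] algebra_simps power2_eq_square)

lemma L2_Cauchy_Schwarz:
 assumes "u : L2 mu" "v : L2 mu"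
 shows "abs (L2_inner mu u v) <= L2_norm mu u*L2_norm mu v"
proof -
 have "(L2_inner mu u v)^2 <= L2_inner mu u u*L2_inner mu v v"
 proof (rule quadratic_nonneg_discriminant)
  fix t show "0 <= L2_inner mu u u + 2*t*L2_inner mu u v + t^2*L2_inner mu v v"
   unfolding L2_inner_lincomb_self[OF assms, symmetric] by (rule L2_inner_self_nonneg)
 qed
 thus ?thesis using real_le_rsqrt by (fastforce simp: L2_norm_eq real_sqrt_mult[symmetric] intro: real_le_rsqrt)
qed

lemma L2_norm_triangle:
 assumes "u : L2 mu" "v : L2 mu"
 shows "L2_norm mu (%x. u x + v x) <= L2_norm mu u + L2_norm mu v"
proof (rule power2_le_imp_le)
 show "(L2_norm mu (%x. u x + v x))^2 <= (L2_norm mu u + L2_norm mu v)^2"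
  using L2_inner_lincomb_self[OF assms, of 1] L2_Cauchy_Schwarz[OF assms] by (simp add: power2_sum L2_norm_sq)
qed (simp add: L2_norm_nonneg)

lemma L2_norm_scale: "L2_norm mu (%x. c*u x) = abs c*L2_norm mu u" by (simp add: L2_norm_def power_mult_distrib real_sqrt_mult)

lemma L2_norm_minus_commute: "L2_norm mu (%x. u x - v x) = L2_norm mu (%x. v x - u x)" by (simp add: L2_norm_def power2_commute)

lemma L2_norm_triangle_diff:
 assumes "u : L2 mu" "v : L2 mu" "w : L2 mu"
 shows "L2_norm mu (%x. u x - w x) <= L2_norm mu (%x. u x - v x) + L2_norm mu (%x. v x - w x)"
 using L2_norm_triangle[OF L2_diff[OF assms(1,2)] L2_diff[OF assms(2,3)]] by simp

lemma L2_norm_zero_AE: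
 assumes "u : L2 mu" "L2_norm mu u = 0"
 shows "AE x in mu. u x = 0"
proof -
 have "(LINT x|mu. (u x)^2) = 0" using assms(2) by (simp add: L2_norm_def)
 hence "AE x in mu. (u x)^2 = 0" using integral_nonneg_eq_0_iff_AE[OF L2_integrable_square[OF assms(1)]] by simp
 thus ?thesis by simp
qed

lemma L2_norm_cong_AE:
 "AE x in mu. u x = v x ==> u : borel_measurable mu ==> v : borel_measurable mu ==> L2_norm mu u = L2_norm mu v"
 unfolding L2_norm_def by (intro arg_cong[where f=sqrt] integral_cong_AE) auto

lemma L2_inner_cong_AE:
 assumes "AE x in mu. u x = u' x" "AE x in mu. v x = v' x"
  "u : L2 mu" "v : L2 mu" "u' : L2 mu" "v' : L2 mu"
 shows "L2_inner mu u v = L2_inner mu u' v'" unfolding L2_inner_def using assms by (intro integral_cong_AE) (auto simp: L2_def)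

lemma L2_cong_AE:
 assumes "AE x in mu. u x = v x" "u : L2 mu" "v : borel_measurable mu"
 shows "v : L2 mu"
proof -
 have "integrable mu (%x. (v x)^2) \<longleftrightarrow> integrable mu (%x. (u x)^2)" using assms by (intro integrable_cong_AE) (auto simp: L2_def)
 thus ?thesis using assms by (auto simp: L2_def)
qed

abbreviation L2_lim :: "'a measure => (nat => 'a => real) => ('a => real) => bool" where
 "L2_lim mu s u \<equiv> (%j. L2_norm mu (%x. s j x - u x)) ----> 0"

definition L2_Cauchy :: "'a measure => (nat => 'a => real) => bool" where
 "L2_Cauchy mu s \<longleftrightarrow> (ALL e>0. EX N. ALL i>=N. ALL j>=N. L2_norm mu (%x. s i x - s j x) < e)"

lemma tendsto_null_bound:
 fixes a b :: "nat => real"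
 assumes "!!j. abs (a j) <= b j" "b ----> c" "c = 0"
 shows "a ----> 0" by (rule Lim_null_comparison[OF always_eventually]) (use assms in auto)

lemma L2_inner_tendsto:
 assumes "!!j. s j : L2 mu" "!!j. t j : L2 mu" "u : L2 mu" "v : L2 mu" "L2_lim mu s u" "L2_lim mu t v"
 shows "(%j. L2_inner mu (s j) (t j)) ----> L2_inner mu u v"
proof -
 let ?a = "%j. L2_norm mu (%x. s j x - u x)" and ?b = "%j. L2_norm mu (%x. t j x - v x)"
 have "abs (L2_inner mu (s j) (t j) - L2_inner mu u v) <= ?a j*?b j + ?a j*L2_norm mu v + L2_norm mu u*?b j" for j
 proof -
  have d: "(%x. s j x - u x) : L2 mu" "(%x. t j x - v x) : L2 mu" using assms by (auto intro: L2_diff)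
  have "L2_inner mu (s j) (t j) - L2_inner mu u v = L2_inner mu (%x. s j x - u x) (%x. t j x - v x)
   + L2_inner mu (%x. s j x - u x) v + L2_inner mu u (%x. t j x - v x)" using assms d by (simp add: L2_inner_diff_left L2_inner_diff_right)
  thus ?thesis using L2_Cauchy_Schwarz[OF d] L2_Cauchy_Schwarz[OF d(1) assms(4)] L2_Cauchy_Schwarz[OF assms(3) d(2)] by linarith
 qed
 moreover have "(%j. ?a j*?b j + ?a j*L2_norm mu v + L2_norm mu u*?b j) ----> 0*0 + 0*L2_norm mu v + L2_norm mu u*0"
  by (intro tendsto_add tendsto_mult assms(5,6) tendsto_const)
 ultimately have "(%j. L2_inner mu (s j) (t j) - L2_inner mu u v) ----> 0" by (rule tendsto_null_bound) simp
 thus ?thesis by (simp add: LIM_zero_iff)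
qed

lemma L2_lim_const: "u : L2 mu ==> L2_lim mu (%_. u) u" by (simp add: L2_norm_def)

lemma L2_lim_lincomb:
 assumes "!!j. s j : L2 mu" "!!j. t j : L2 mu" "u : L2 mu" "v : L2 mu" "L2_lim mu s u" "L2_lim mu t v"
 shows "L2_lim mu (%j x. s j x + c*t j x) (%x. u x + c * v x)"
proof -
 have "L2_norm mu (%x. (s j x + c*t j x) - (u x + c * v x)) \<le>
  L2_norm mu (%x. s j x - u x) + abs c*L2_norm mu (%x. t j x - v x)" for j
 proof -
  have "(%x. (s j x + c*t j x) - (u x + c * v x)) = (%x. (s j x - u x) + c*(t j x - v x))" by (auto simp: algebra_simps)
  thus ?thesis using L2_norm_triangle[OF L2_diff[OF assms(1)[of j] assms(3)] L2_scale[OF L2_diff[OF assms(2)[of j] assms(4)], of c]]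
   by (simp only: L2_norm_scale)
 qed
 moreover have "(%j. L2_norm mu (%x. s j x - u x) + abs c*L2_norm mu (%x. t j x - v x)) ----> 0 + abs c*0"
  by (intro tendsto_add tendsto_mult assms(5,6) tendsto_const)
 ultimately show ?thesis by (intro tendsto_null_bound[where b="%j. L2_norm mu (%x. s j x - u x) + abs c*L2_norm mu (%x. t j x - v x)"])
   (simp_all add: L2_norm_nonneg)
qed

lemma L2_lim_norm:
 assumes "!!j. s j : L2 mu" "u : L2 mu" "L2_lim mu s u"
 shows "(%j. L2_norm mu (s j)) ----> L2_norm mu u" unfolding L2_norm_eq by (intro tendsto_real_sqrt L2_inner_tendsto assms)

lemma L2_norm_nn: "u : L2 mu ==> (\<integral>\<^sup>+x. ennreal ((u x)^2) \<partial>mu) = ennreal ((L2_norm mu u)^2)"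
 by (subst nn_integral_eq_integral) (auto simp: L2_def L2_norm_def)

lemma L2_if_nn_integral:
 assumes "u : borel_measurable mu" "(\<integral>\<^sup>+x. ennreal ((u x)^2) \<partial>mu) <= ennreal (C^2)" "C >= 0"
 shows "u : L2 mu & L2_norm mu u <= C"
proof -
 have i: "integrable mu (%x. (u x)^2)" using assms by (intro integrableI_bounded) (auto simp: less_top[symmetric] top_unique)
 hence u: "u : L2 mu" using assms by (simp add: L2_def)
 hence "ennreal ((L2_norm mu u)^2) <= ennreal (C^2)" using assms(2) L2_norm_nn[OF u] by simp
 hence "L2_norm mu u <= C" using assms(3) by (auto intro: power2_le_imp_le)
 thus ?thesis using u by simp
qed

text \<open>Riesz--Fischer: a rapidly converging subsequence converges almost everywhere, and Fatou's lemma
 identifies the limit.\<close>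

lemma L2_complete:
 assumes s: "!!j. s j : L2 mu" and C: "L2_Cauchy mu s"
 shows "EX g:L2 mu. L2_lim mu s g"
proof -
 have "EX N. ALL i>=N. ALL j>=N. L2_norm mu (%x. s i x - s j x) < (1/2)^k" for k using C unfolding L2_Cauchy_def by simp
 then obtain N where N: "!!k i j. i >= N k ==> j >= N k ==> L2_norm mu (%x. s i x - s j x) < (1/2)^k" by metis
 \<comment> \<open>Summing the thresholds puts both \<open>r k\<close> and \<open>r (Suc k)\<close>
   beyond \<open>N k\<close>, so consecutive terms along \<open>r\<close> differ by less than
   \<open>(1/2)^k\<close>.\<close>
 define r where "r k = (\<Sum>i\<le>k. N i) + k" for k
 have r: "r k >= N k" "r (Suc k) >= N k" "r k >= k" for k using member_le_sum[of k "{..k}" N] unfolding r_def by (auto simp: sum.atMost_Suc)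
 define a where "a k x = abs (s (r (Suc k)) x - s (r k) x)" for k x
 have a: "a k : L2 mu" "L2_norm mu (a k) <= (1/2)^k" for k
 proof -
  show "a k : L2 mu" using L2_diff[OF s s, of "r (Suc k)" "r k"] unfolding a_def by (auto simp: L2_def)
  have "L2_norm mu (a k) = L2_norm mu (%x. s (r (Suc k)) x - s (r k) x)" by (simp add: L2_norm_def a_def)
  thus "L2_norm mu (a k) <= (1/2)^k" using N[OF r(2) r(1), of k] by simp
 qed
 have S: "(%x. \<Sum>k<n. a k x) : L2 mu & L2_norm mu (%x. \<Sum>k<n. a k x) <= (\<Sum>k<n. (1/2)^k)" for n
 proof (induction n)
  case 0 thus ?case by (simp add: L2_zero L2_norm_def)
 next
  case (Suc n)
  thus ?case using L2_add[of "%x. \<Sum>k<n. a k x" mu "a n"] a[of n] L2_norm_triangle[of "%x. \<Sum>k<n. a k x" mu "a n"] by simp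
 qed
 have S2: "(\<integral>\<^sup>+x. ennreal ((\<Sum>k<n. a k x)^2) \<partial>mu) <= ennreal 4" for n
 proof -
  have "(\<Sum>k<n. (1/2::real)^k) <= 2" by (subst geometric_sum) (auto simp: field_simps)
  hence "L2_norm mu (%x. \<Sum>k<n. a k x) <= 2" using S[of n] by linarith
  hence "(L2_norm mu (%x. \<Sum>k<n. a k x))^2 <= 2^2" by (intro power_mono) (auto simp: L2_norm_nonneg)
  hence "ennreal ((L2_norm mu (%x. \<Sum>k<n. a k x))^2) <= ennreal 4" by (intro ennreal_leI) simp
  thus ?thesis using L2_norm_nn[of "%x. \<Sum>k<n. a k x" mu] S[of n] by simp
 qed
 have sm: "s j : borel_measurable mu" for j using s by (simp add: L2_measurable)
 have am: "a k : borel_measurable mu" for k using a by (simp add: L2_measurable)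
 have "(\<integral>\<^sup>+x. (SUP n. ennreal ((\<Sum>k<n. a k x)^2)) \<partial>mu) = (SUP n. \<integral>\<^sup>+x. ennreal ((\<Sum>k<n. a k x)^2) \<partial>mu)"
 proof (rule nn_integral_monotone_convergence_SUP)
  show "incseq (%n x. ennreal ((\<Sum>k<n. a k x)^2))" by (intro incseq_SucI le_funI ennreal_leI power_mono) (auto simp: a_def sum_nonneg)
 qed (use am in auto)
 also have "... <= ennreal 4" using S2 by (intro SUP_least) auto
 finally have "AE x in mu. (SUP n. ennreal ((\<Sum>k<n. a k x)^2)) ~= \<infinity>" using am by (intro nn_integral_PInf_AE) (auto simp: top_unique)
 hence conv: "AE x in mu. convergent (%k. s (r k) x)"
 proof (rule AE_mp, intro AE_I2 impI)
  fix x assume fin: "(SUP n. ennreal ((\<Sum>k<n. a k x)^2)) ~= \<infinity>"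
  then obtain B where B: "B >= 0" "(SUP n. ennreal ((\<Sum>k<n. a k x)^2)) = ennreal B" by (cases "(SUP n. ennreal ((\<Sum>k<n. a k x)^2))") auto
  have "(\<Sum>k<n. a k x) <= sqrt B" for n
  proof -
   have "ennreal ((\<Sum>k<n. a k x)^2) <= ennreal B" unfolding B(2)[symmetric] by (rule SUP_upper) simp
   thus ?thesis using B(1) by (intro real_le_rsqrt) auto
  qed
  hence "summable (%k. a k x)" by (intro summableI_nonneg_bounded[where x="sqrt B"]) (auto simp: a_def)
  hence "summable (%k. s (r (Suc k)) x - s (r k) x)" unfolding a_def by (rule summable_rabs_cancel)
  hence "convergent (%n. \<Sum>k<n. s (r (Suc k)) x - s (r k) x)" by (simp add: summable_iff_convergent)
  hence "convergent (%n. s (r n) x - s (r 0) x)" by (simp add: sum_lessThan_telescope[of "%k. s (r k) x"])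
  hence "convergent (%n. (s (r n) x - s (r 0) x) + s (r 0) x)" by (intro convergent_add convergent_const)
  thus "convergent (%k. s (r k) x)" by simp
 qed
 define g where "g x = lim (%k. s (r k) x)" for x
 have gm: "g : borel_measurable mu" unfolding g_def using sm by measurable
 have g: "AE x in mu. (%k. s (r k) x) ----> g x" using conv by (auto simp: g_def convergent_LIMSEQ_iff)
 \<comment> \<open>Fatou's lemma with \<open>j\<close> fixed and the index of the subsequence
   tending to infinity. It is used twice, for membership of the limit in L^2 and for the
   convergence.\<close>
 have key: "(%x. s j x - g x) : L2 mu & L2_norm mu (%x. s j x - g x) <= e"
  if e: "e > 0" and j: "!!k. k >= M ==> L2_norm mu (%x. s j x - s k x) < e" for j e M
 proof (rule L2_if_nn_integral)
  have "(\<integral>\<^sup>+x. ennreal ((s j x - g x)^2) \<partial>mu) <= (\<integral>\<^sup>+x. liminf (%k. ennreal ((s j x - s (r k) x)^2)) \<partial>mu)"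
  proof (rule nn_integral_mono_AE, rule AE_mp[OF g], intro AE_I2 impI)
   fix x assume "(%k. s (r k) x) ----> g x"
   hence "(%k. ennreal ((s j x - s (r k) x)^2)) ----> ennreal ((s j x - g x)^2)" by (intro tendsto_ennrealI tendsto_intros)
   hence "liminf (%k. ennreal ((s j x - s (r k) x)^2)) = ennreal ((s j x - g x)^2)" by (intro lim_imp_Liminf) auto
   thus "ennreal ((s j x - g x)^2) <= liminf (%k. ennreal ((s j x - s (r k) x)^2))" by simp
  qed
  also have "... <= liminf (%k. \<integral>\<^sup>+x. ennreal ((s j x - s (r k) x)^2) \<partial>mu)" using sm by (intro nn_integral_liminf) auto
  also have "... <= ennreal (e^2)"
  proof (rule Liminf_le)
   have "(\<integral>\<^sup>+x. ennreal ((s j x - s (r k) x)^2) \<partial>mu) <= ennreal (e^2)" if "k >= M" for k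
   proof -
    have "L2_norm mu (%x. s j x - s (r k) x) < e" using j[of "r k"] r(3)[of k] that by simp
    hence "(L2_norm mu (%x. s j x - s (r k) x))^2 <= e^2" by (intro power_mono) (auto simp: L2_norm_nonneg)
    thus ?thesis by (subst L2_norm_nn[OF L2_diff[OF s s]]) (rule ennreal_leI)
   qed
   thus "\<forall>\<^sub>F k in sequentially. (\<integral>\<^sup>+x. ennreal ((s j x - s (r k) x)^2) \<partial>mu) <= ennreal (e^2)"
    by (auto simp: eventually_sequentially)
  qed simp
  finally show "(\<integral>\<^sup>+x. ennreal ((s j x - g x)^2) \<partial>mu) <= ennreal (e^2)" .
 qed (use e sm gm in auto)
 obtain M where M: "!!i j. i >= M ==> j >= M ==> L2_norm mu (%x. s i x - s j x) < 1" using C unfolding L2_Cauchy_def by (meson zero_less_one)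
 have "(%x. s M x - g x) : L2 mu" using key[of 1 M M] M by auto
 hence "g : L2 mu" using L2_diff[OF s[of M]] by fastforce
 moreover have "L2_lim mu s g"
 proof (rule LIMSEQ_I)
  fix e :: real assume e: "e > 0"
  then obtain M where M: "!!i j. i >= M ==> j >= M ==> L2_norm mu (%x. s i x - s j x) < e/2" using C unfolding L2_Cauchy_def by (meson half_gt_zero)
  have "L2_norm mu (%x. s j x - g x) <= e/2" if "j >= M" for j using key[of "e/2" M j] M that e by auto
  thus "EX M. ALL j>=M. norm (L2_norm mu (%x. s j x - g x) - 0) < e" using e by (intro exI[of _ M]) (force simp: L2_norm_nonneg)
 qed
 ultimately show ?thesis by blast
qed

lemma L2_lim_imp_Cauchy:
 assumes "!!j. s j : L2 mu" "u : L2 mu" "L2_lim mu s u"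
 shows "L2_Cauchy mu s" unfolding L2_Cauchy_def
proof (intro allI impI)
 fix e :: real assume "e > 0"
 then obtain N where N: "!!j. j >= N ==> L2_norm mu (%x. s j x - u x) < e/2" using LIMSEQ_D[OF assms(3), of "e/2"] by (auto simp: L2_norm_nonneg)
 show "EX N. ALL i>=N. ALL j>=N. L2_norm mu (%x. s i x - s j x) < e"
 proof (intro exI allI impI)
  fix i j assume "i >= N" "j >= N"
  thus "L2_norm mu (%x. s i x - s j x) < e" using L2_norm_triangle_diff[OF assms(1)[of i] assms(2) assms(1)[of j]] N[of i] N[of j]
   by (simp add: L2_norm_minus_commute[of mu u])
 qed
qed

text \<open>As \<open>V\<close> may fail to be closed, \<open>g\<close> is found as the limit of a
  sequence in \<open>V\<close> that minimizes \<open>|v|^2 - 2 * l v\<close>. The sequence is part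
  of the conclusion because \<open>D_estimate_solve\<close> needs \<open>g\<close> to be
  approximated from \<open>V\<close>.\<close>

lemma L2_riesz:
 assumes V: "V <= L2 mu" "V ~= {}" "!!u v c. u : V ==> v : V ==> (%x. u x + c * v x) : V"
  and l: "!!u v c. u : V ==> v : V ==> l (%x. u x + c * v x) = l u + c*l v"
  and bd: "!!v. v : V ==> abs (l v) <= C*L2_norm mu v"
 shows "EX g s. g : L2 mu & (ALL j. s j : V) & L2_lim mu s g & (ALL v:V. l v = L2_inner mu g v)"
proof -
 define J where "J v = L2_inner mu v v - 2*l v" for v
 have V': "v : V ==> v : L2 mu" for v using V by auto
 have Jlow: "J v >= - (C^2)" if "v : V" for v
 proof -
  have "(L2_norm mu v - C)^2 >= 0" by simp
  thus ?thesis using bd[OF that] by (simp add: J_def L2_norm_sq[symmetric] power2_eq_square algebra_simps)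
 qed
 hence bb: "bdd_below (J ` V)" by (auto intro!: bdd_belowI2)
 define m where "m = Inf (J ` V)"
 have m: "J v >= m" if "v : V" for v unfolding m_def using bb that by (intro cINF_lower) auto
 have "EX v:V. J v < m + 1 / Suc n" for n
 proof (rule ccontr)
  assume "~ (EX v:V. J v < m + 1 / Suc n)"
  hence "m + 1 / Suc n <= m" unfolding m_def using V(2) by (intro cINF_greatest) (auto simp: not_less)
  thus False by (simp add: field_simps)
 qed
 then obtain s where s: "!!n. s n : V" "!!n. J (s n) < m + 1 / Suc n" by metis
 have cau: "L2_inner mu (%x. s i x - s j x) (%x. s i x - s j x) <= 2*(1 / Suc i) + 2*(1 / Suc j)" for i j
 proof -
  \<comment> \<open>The midpoint of \<open>s i\<close> and \<open>s j\<close>, written with the one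
    closure property of \<open>V\<close>. Both values of \<open>J\<close> are close to the infimum
    and \<open>J h >= m\<close>, so the parallelogram identity bounds the distance of
    \<open>s i\<close> and \<open>s j\<close>.\<close>
  define h where "h = (%x. s i x + (1/2)*((%x. s j x + (-1) * s i x) x))"
  have d: "(%x. s j x + (-1) * s i x) : V" using V(3)[OF s(1) s(1)] .
  have h: "h : V" unfolding h_def by (rule V(3)[OF s(1) d])
  have lh: "l h = l (s i) / 2 + l (s j) / 2" unfolding h_def l[OF s(1) d] l[OF s(1) s(1)] by (simp add: algebra_simps)
  have sL: "s i : L2 mu" "s j : L2 mu" using s V' by auto
  have hh: "h = (%x. 1/2 * s i x + (1/2) * s j x)" unfolding h_def by (auto simp: field_simps)
  have "L2_inner mu h h = L2_inner mu (s i) (s i) / 4 + L2_inner mu (s i) (s j) / 2 + L2_inner mu (s j) (s j) / 4"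
   unfolding hh L2_inner_lincomb_self[OF L2_scale[OF sL(1)] sL(2)]
    L2_inner_scale_left[OF sL(2) sL(1)] L2_inner_scale_left[OF L2_scale[OF sL(1)] sL(1)]
    L2_inner_scale_right[OF sL(1) sL(1)] by (simp add: power2_eq_square)
  hence "J h = (J (s i) + J (s j)) / 2 - L2_inner mu (%x. s i x - s j x) (%x. s i x - s j x) / 4"
   using L2_inner_lincomb_self[OF sL, of "-1"] by (simp add: J_def lh field_simps)
  moreover have "d <= 2*p + 2*q" if "w = (a + b) / 2 - d / 4" "m <= w" "a < m + p" "b < m + q" for a b d w p q :: real
   using that by (simp add: field_simps)
  ultimately show ?thesis using m[OF h] s(2)[of i] s(2)[of j] by blast
 qed
 have "L2_Cauchy mu s" unfolding L2_Cauchy_def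
 proof (intro allI impI)
  fix e :: real assume e: "e > 0"
  then obtain N where N: "1 / Suc N < e^2 / 4" using reals_Archimedean[of "e^2 / 4"] by (auto simp: inverse_eq_divide)
  show "EX N. ALL i>=N. ALL j>=N. L2_norm mu (%x. s i x - s j x) < e"
  proof (intro exI allI impI)
   fix i j assume ij: "N <= i" "N <= j"
   have "1 / Suc i <= 1 / Suc N" "1 / Suc j <= 1 / Suc N" using ij by (auto simp: frac_le)
   hence "(L2_norm mu (%x. s i x - s j x))^2 < e^2" using cau[of i j] N by (simp add: L2_norm_sq)
   thus "L2_norm mu (%x. s i x - s j x) < e" using e by (simp add: power2_less_imp_less)
  qed
 qed
 then obtain g where g: "g : L2 mu" "L2_lim mu s g" using L2_complete[of s mu] s V' by auto
 have "l v = L2_inner mu g v" if v: "v : V" for v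
 proof -
  have "0 <= 0 + 2*t*(L2_inner mu g v - l v) + t^2*L2_inner mu v v" for t
  proof -
   have "m <= m + 1 / Suc n + 2 * t * (L2_inner mu (s n) v - l v) + t^2*L2_inner mu v v" for n
    using m[OF V(3)[OF s(1)[of n] v, of t]] s(2)[of n] L2_inner_lincomb_self[of "s n" mu v t] V'[OF s(1)[of n]] V'[OF v]
    unfolding J_def l[OF s(1) v] by (simp add: algebra_simps)
   moreover have "(%n. m + 1 / Suc n + 2 * t * (L2_inner mu (s n) v - l v) + t^2*L2_inner mu v v) ---->
     m + 0 + 2*t*(L2_inner mu g v - l v) + t^2*L2_inner mu v v" using V'[OF v] V'[OF s(1)] g
    by (intro tendsto_intros L2_inner_tendsto LIMSEQ_Suc[OF lim_1_over_n] L2_lim_const) auto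
   ultimately have "m <= m + 0 + 2*t*(L2_inner mu g v - l v) + t^2*L2_inner mu v v" by (intro Lim_bounded2[where N=0]) auto
   thus ?thesis by simp
  qed
  \<comment> \<open>A quadratic in \<open>t\<close> without constant term that is nowhere negative
    has no linear term.\<close>
  hence "(L2_inner mu g v - l v)^2 <= 0*L2_inner mu v v" by (rule quadratic_nonneg_discriminant)
  thus ?thesis by simp
 qed
 thus ?thesis using g s by blast
qed

section \<open>Symmetric operators with compact resolvent\<close>

text \<open>\<open>range_dense\<close> says that the range of \<open>T + 1\<close> is dense, which
  for a nonnegative symmetric operator means essential self-adjointness. It is phrased by
  orthogonality because an orthogonal \<open>h\<close> is a weak solution of an elliptic equation,
  and that is how the assumption will be verified.\<close>

locale compact_symmetric_operator =
 fixes mu :: "'a measure" and D :: "('a => real) set" and T :: "('a => real) => 'a => real"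
 assumes D_L2: "D <= L2 mu" and D_nonempty: "D ~= {}"
  and D_lincomb: "!!u v c. u : D ==> v : D ==> (%x. u x + c * v x) : D"
  and T_L2: "!!u. u : D ==> T u : L2 mu"
  and T_lincomb: "!!u v c. u : D ==> v : D ==> T (%x. u x + c * v x) = (%x. T u x + c*T v x)"
  and T_sym: "!!u v. u : D ==> v : D ==> L2_inner mu (T u) v = L2_inner mu u (T v)"
  and T_nonneg: "!!u. u : D ==> 0 <= L2_inner mu (T u) u"
  and compactness: "!!e. e > 0 ==> EX (g :: nat => 'a => real) N. (ALL i<N. g i : L2 mu) &
   (ALL u:D. L2_inner mu u u <= e*L2_inner mu (T u) u + (\<Sum>i<N. (L2_inner mu (g i) u)^2))"
  and range_dense: "!!h. h : L2 mu ==> (!!u. u : D ==> L2_inner mu h (%x. T u x + u x) = 0) ==> AE x in mu. h x = 0"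
begin

abbreviation inner_L2 (infix "<.>" 90) where "u <.> v == L2_inner mu u v"

definition G :: "(('a => real) \<times> ('a => real)) set" where
 "G = closure_graph mu D T"

lemma D_imp_L2: "u : D ==> u : L2 mu" using D_L2 by auto

lemma G_L2: "(u, f) : G ==> u : L2 mu" "(u, f) : G ==> f : L2 mu" by (auto simp: G_def closure_graph_def)

lemma G_approx:
 "(u, f) : G ==> EX s. (ALL j. s j : D) & L2_lim mu s u & L2_lim mu (%j. T (s j)) f" by (auto simp: G_def closure_graph_def)

lemma G_I:
 assumes "u : L2 mu" "f : L2 mu" "!!j. s j : D" "L2_lim mu s u" "L2_lim mu (%j. T (s j)) f"
 shows "(u, f) : G" using assms by (auto simp: G_def closure_graph_def intro!: exI[of _ s])

lemma G_D: "u : D ==> (u, T u) : G" by (rule G_I[where s="%_. u"]) (auto simp: D_imp_L2 T_L2 L2_norm_def)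

lemma G_lincomb:
 assumes "(u, f) : G" "(v, g) : G"
 shows "((%x. u x + c * v x), (%x. f x + c*g x)) : G"
proof -
 obtain s where s: "!!j. s j : D" "L2_lim mu s u" "L2_lim mu (%j. T (s j)) f" using G_approx[OF assms(1)] by blast
 obtain t where t: "!!j. t j : D" "L2_lim mu t v" "L2_lim mu (%j. T (t j)) g" using G_approx[OF assms(2)] by blast
 note L = G_L2[OF assms(1)] G_L2[OF assms(2)]
 have 1: "L2_lim mu (%j x. s j x + c*t j x) (%x. u x + c * v x)" by (rule L2_lim_lincomb) (use s t L in "auto simp: D_imp_L2")
 have 2: "L2_lim mu (%j x. T (s j) x + c*T (t j) x) (%x. f x + c*g x)" by (rule L2_lim_lincomb) (use s t L in "auto simp: T_L2")
 show ?thesis by (rule G_I[where s="%j x. s j x + c*t j x"]) (use 1 2 s t L in "auto simp: T_lincomb intro: D_lincomb L2_lincomb")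
qed

lemma G_diff:
 assumes "(u, f) : G" "(v, g) : G"
 shows "((%x. u x - v x), (%x. f x - g x)) : G" using G_lincomb[OF assms, of "-1"] by simp

lemma G_scale:
 assumes "(u, f) : G"
 shows "((%x. c*u x), (%x. c*f x)) : G" using G_lincomb[OF assms assms, of "c - 1"] by (simp add: algebra_simps)

lemma G_sym:
 assumes "(u, f) : G" "(v, g) : G"
 shows "f <.> v = u <.> g"
proof -
 obtain s where s: "!!j. s j : D" "L2_lim mu s u" "L2_lim mu (%j. T (s j)) f" using G_approx[OF assms(1)] by blast
 obtain t where t: "!!j. t j : D" "L2_lim mu t v" "L2_lim mu (%j. T (t j)) g" using G_approx[OF assms(2)] by blast
 note L = G_L2[OF assms(1)] G_L2[OF assms(2)]
 have "(%j. T (s j) <.> t j) ----> f <.> v" by (rule L2_inner_tendsto) (use s t L in "auto simp: D_imp_L2 T_L2")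
 moreover have "(%j. s j <.> T (t j)) ----> u <.> g" by (rule L2_inner_tendsto) (use s t L in "auto simp: D_imp_L2 T_L2")
 ultimately show ?thesis using LIMSEQ_unique by (simp add: T_sym[OF s(1) t(1)])
qed

lemma G_form_tendsto:
 assumes "(u, f) : G" "!!j. s j : D" "L2_lim mu s u" "L2_lim mu (%j. T (s j)) f"
 shows "(%j. T (s j) <.> s j) ----> f <.> u" by (rule L2_inner_tendsto) (use assms G_L2 in "auto simp: D_imp_L2 T_L2")

lemma G_nonneg:
 assumes "(u, f) : G"
 shows "0 <= f <.> u"
proof -
 obtain s where s: "!!j. s j : D" "L2_lim mu s u" "L2_lim mu (%j. T (s j)) f" using G_approx[OF assms] by blast
 show ?thesis by (rule Lim_bounded2[OF G_form_tendsto[OF assms s]]) (use s T_nonneg in auto)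
qed

text \<open>Both sides are continuous along sequences that converge together with their images, so
  the inequality extends from \<open>D\<close> to the closure.\<close>

lemma G_compactness:
 assumes "e > 0"
 shows "EX (g :: nat => 'a => real) N::nat. (ALL i<N. g i : L2 mu) &
  (ALL u f. (u, f) : G --> u <.> u <= e*f <.> u + (\<Sum>i<N. (g i <.> u)^2))"
proof -
 obtain g :: "nat => 'a => real" and N :: nat where g: "!!i. i < N ==> g i : L2 mu"
  "!!u. u : D ==> u <.> u <= e*T u <.> u + (\<Sum>i<N. (g i <.> u)^2)" using compactness[OF assms] by blast
 have "u <.> u <= e*f <.> u + (\<Sum>i<N. (g i <.> u)^2)" if u: "(u, f) : G" for u f
 proof -
  obtain s where s: "!!j. s j : D" "L2_lim mu s u" "L2_lim mu (%j. T (s j)) f" using G_approx[OF u] by blast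
  have "(%j. s j <.> s j) ----> u <.> u" by (rule L2_inner_tendsto) (use s G_L2[OF u] in "auto simp: D_imp_L2")
  moreover have "(%j. e*T (s j) <.> s j + (\<Sum>i<N. (g i <.> s j)^2)) ----> e*f <.> u + (\<Sum>i<N. (g i <.> u)^2)"
  proof (intro tendsto_add tendsto_mult tendsto_const tendsto_sum tendsto_power G_form_tendsto[OF u s])
   fix i assume "i : {..<N}"
   thus "(%j. g i <.> s j) ----> g i <.> u" by (intro L2_inner_tendsto) (use s g G_L2[OF u] in "auto simp: D_imp_L2 L2_norm_def")
  qed
  ultimately show ?thesis by (rule LIMSEQ_le) (use g s in auto)
 qed
 thus ?thesis using g(1) by blast
qed

text \<open>A diagonal choice: an element of \<open>D\<close> is taken within
  \<open>1 / Suc j\<close> of the pair \<open>(s j, t j)\<close> in both components.\<close>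

lemma G_closed:
 assumes "!!j. (s j, t j) : G" "u : L2 mu" "f : L2 mu" "L2_lim mu s u" "L2_lim mu t f"
 shows "(u, f) : G"
proof -
 have "EX p:D. L2_norm mu (%x. p x - s j x) < 1 / Suc j & L2_norm mu (%x. T p x - t j x) < 1 / Suc j" for j
 proof -
  obtain r where r: "!!i. r i : D" "L2_lim mu r (s j)" "L2_lim mu (%i. T (r i)) (t j)" using G_approx[OF assms(1)] by blast
  have "eventually (%i. L2_norm mu (%x. r i x - s j x) < 1 / Suc j) sequentially" by (rule order_tendstoD[OF r(2)]) simp
  moreover have "eventually (%i. L2_norm mu (%x. T (r i) x - t j x) < 1 / Suc j) sequentially" by (rule order_tendstoD[OF r(3)]) simp
  ultimately have "eventually (%i. L2_norm mu (%x. r i x - s j x) < 1 / Suc j &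
   L2_norm mu (%x. T (r i) x - t j x) < 1 / Suc j) sequentially" by (rule eventually_conj)
  thus ?thesis using r(1) eventually_happens'[OF sequentially_bot] by blast
 qed
 then obtain p where p: "!!j. p j : D" "!!j. L2_norm mu (%x. p j x - s j x) < 1 / Suc j"
  "!!j. L2_norm mu (%x. T (p j) x - t j x) < 1 / Suc j" by metis
 have lim: "L2_lim mu q w" if "!!j. L2_norm mu (%x. q j x - a j x) < 1 / Suc j" "L2_lim mu a w"
  "!!j. q j : L2 mu" "!!j. a j : L2 mu" "w : L2 mu" for q a w
 proof (rule tendsto_null_bound)
  show "abs (L2_norm mu (%x. q j x - w x)) <= 1 / Suc j + L2_norm mu (%x. a j x - w x)" for j
   using L2_norm_triangle_diff[of "q j" mu "a j" w] that(1)[of j] that(3-5) by (simp add: L2_norm_nonneg)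
  show "(%j. 1 / Suc j + L2_norm mu (%x. a j x - w x)) ----> 0 + 0" by (rule tendsto_add[OF LIMSEQ_Suc[OF lim_1_over_n] that(2)])
 qed simp
 show ?thesis by (rule G_I[OF assms(2,3) p(1) lim[OF p(2) assms(4)] lim[OF p(3) assms(5)]])
  (use assms p(1) G_L2[OF assms(1)] in "auto simp: D_imp_L2 T_L2")
qed

lemma L2_norm_diff_AE:
 assumes "u : L2 mu" "u' : L2 mu" "AE x in mu. u x = u' x"
 shows "L2_norm mu (%x. u x - u' x) = 0"
proof -
 have "L2_norm mu (%x. u x - u' x) = L2_norm mu (%x. 0)" by (rule L2_norm_cong_AE) (use assms in "auto simp: L2_def")
 thus ?thesis by (simp add: L2_norm_def)
qed

text \<open>Elements of L^2 are functions here, so insensitivity of the graph to null sets has to be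
  proved; it is closedness applied to constant sequences.\<close>

lemma G_cong_AE:
 assumes "(u, f) : G" "AE x in mu. u x = u' x" "AE x in mu. f x = f' x" "u' : L2 mu" "f' : L2 mu"
 shows "(u', f') : G" by (rule G_closed[where s="%_. u" and t="%_. f"]) (use assms G_L2[OF assms(1)] in "auto simp: L2_norm_diff_AE")

text \<open>The values of \<open>T - kappa\<close> on \<open>D\<close> are only dense, so
  \<open>h\<close> is a limit of values \<open>S (p j)\<close>; the estimate turns this into a
  Cauchy sequence of preimages, whose limit solves the equation in the closure.
  \<open>L2_riesz\<close>, applied to the functional of \<open>h\<close> on the range of
  \<open>S\<close>, acts as the orthogonal projection onto the closure of that range.\<close>

lemma D_estimate_solve:
 assumes est: "!!u. u : D ==> L2_norm mu u <= C*L2_norm mu (%x. T u x - kappa*u x)"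
  and dense: "!!h. h : L2 mu ==> (!!u. u : D ==> h <.> (%x. T u x - kappa*u x) = 0) ==> AE x in mu. h x = 0"
  and h: "h : L2 mu"
 shows "EX u f. (u, f) : G & (AE x in mu. f x - kappa*u x = h x)"
proof -
 define S where "S u x = T u x - kappa*u x" for u x
 have S_L2: "S u : L2 mu" if "u : D" for u using L2_lincomb[OF T_L2[OF that] D_imp_L2[OF that], of "- kappa"] by (simp add: S_def[abs_def])
 have S_lin: "S (%x. u x + c * v x) = (%x. S u x + c*S v x)" if "u : D" "v : D" for u v c
  using that by (auto simp: S_def fun_eq_iff T_lincomb algebra_simps)
 have "EX g s. g : L2 mu & (ALL j. s j : S ` D) & L2_lim mu s g & (ALL v:S ` D. h <.> v = g <.> v)"
 proof (rule L2_riesz[where C="L2_norm mu h"])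
  show "(%x. u x + c * v x) : S ` D" if st: "u : S ` D" "v : S ` D" for u v c
  proof -
   obtain a b where ab: "a : D" "b : D" "u = S a" "v = S b" using st by blast
   show ?thesis unfolding ab(3,4) S_lin[OF ab(1,2), symmetric] using D_lincomb[OF ab(1,2)] by (rule imageI)
  qed
  show "h <.> (%x. u x + c * v x) = h <.> u + c*h <.> v" if "u : S ` D" "v : S ` D" for u v c
   using that S_L2 by (intro L2_inner_lincomb_right[OF h]) auto
  show "abs (h <.> v) <= L2_norm mu h*L2_norm mu v" if "v : S ` D" for v using that S_L2 by (intro L2_Cauchy_Schwarz[OF h]) auto
 qed (use S_L2 D_nonempty in auto)
 then obtain g s where g: "g : L2 mu" "!!j. s j : S ` D" "L2_lim mu s g" "!!v. v : S ` D ==> h <.> v = g <.> v" by blast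
 have "AE x in mu. h x - g x = 0"
 proof (rule dense[OF L2_diff[OF h g(1)]])
  fix u assume u: "u : D"
  show "(%x. h x - g x) <.> (%x. T u x - kappa*u x) = 0" using g(4)[of "S u"] u S_L2[OF u] h g(1) by (simp add: L2_inner_diff_left S_def[abs_def])
 qed
 hence hg: "AE x in mu. g x = h x" by auto
 have "ALL j. EX p:D. s j = S p" using g(2) by auto
 then obtain p where p: "!!j. p j : D" "!!j. s j = S (p j)" by metis
 have C: "L2_norm mu (%x. p i x - p j x) <= (abs C + 1)*L2_norm mu (%x. s i x - s j x)" for i j
 proof -
  have d: "(%x. p i x - p j x) : D" "S (%x. p i x - p j x) = (%x. s i x - s j x)"
   using D_lincomb[OF p(1) p(1), of i "-1" j] S_lin[OF p(1) p(1), of i "-1" j] by (auto simp: p(2))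
  have "L2_norm mu (%x. p i x - p j x) <= C*L2_norm mu (%x. s i x - s j x)" using est[OF d(1)] d(2) by (simp add: S_def[abs_def])
  also have "... <= (abs C + 1)*L2_norm mu (%x. s i x - s j x)" by (intro mult_right_mono L2_norm_nonneg) auto
  finally show ?thesis .
 qed
 have sC: "L2_Cauchy mu s" by (rule L2_lim_imp_Cauchy[OF _ g(1,3)]) (use p S_L2 in auto)
 have "L2_Cauchy mu p" unfolding L2_Cauchy_def
 proof (intro allI impI)
  fix e :: real assume "e > 0"
  hence "e / (abs C + 1) > 0" by simp
  then obtain N where "ALL i>=N. ALL j>=N. L2_norm mu (%x. s i x - s j x) < e / (abs C + 1)" using sC unfolding L2_Cauchy_def by meson
  hence "ALL i>=N. ALL j>=N. (abs C + 1)*L2_norm mu (%x. s i x - s j x) < e" by (simp add: field_simps add_nonneg_pos)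
  thus "EX N. ALL i>=N. ALL j>=N. L2_norm mu (%x. p i x - p j x) < e" using C by (meson le_less_trans)
 qed
 then obtain u where u: "u : L2 mu" "L2_lim mu p u" using L2_complete[of p mu] p(1) D_imp_L2 by auto
 have "L2_lim mu (%j x. s j x + kappa*p j x) (%x. g x + kappa*u x)" by (rule L2_lim_lincomb) (use p S_L2 D_imp_L2 g u in auto)
 moreover have "s j x + kappa*p j x = T (p j) x" for j x by (simp add: p(2) S_def)
 ultimately have "L2_lim mu (%j. T (p j)) (%x. g x + kappa*u x)" by simp
 hence "(u, %x. g x + kappa*u x) : G" by (intro G_I[where s=p] u p(1) L2_lincomb g)
 moreover have "AE x in mu. (g x + kappa*u x) - kappa*u x = h x" using hg by auto
 ultimately show ?thesis by blast
qed

text \<open>Nonnegativity gives \<open>|u|^2 <= (u, T u + u)\<close>, hence the estimate with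
  constant 1; density of the range is \<open>range_dense\<close>.\<close>

lemma resolvent_minus_one:
 assumes "h : L2 mu"
 shows "EX u f. (u, f) : G & (AE x in mu. f x + u x = h x)"
proof -
 have "EX u f. (u, f) : G & (AE x in mu. f x - (-1)*u x = h x)"
 proof (rule D_estimate_solve[where C=1])
  fix u assume u: "u : D"
  define w where "w = (%x. T u x + u x)"
  have w: "w : L2 mu" unfolding w_def using u by (intro L2_add T_L2 D_imp_L2)
  have "(L2_norm mu u)^2 <= u <.> w"
   unfolding w_def using u T_nonneg[OF u] by (simp add: L2_inner_add_right D_imp_L2 T_L2 L2_norm_sq L2_inner_commute)
  also have "... <= L2_norm mu u*L2_norm mu w" using L2_Cauchy_Schwarz[OF D_imp_L2[OF u] w] by simp
  finally have "L2_norm mu u <= L2_norm mu w" using L2_norm_nonneg[of mu u] L2_norm_nonneg[of mu w]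
   by (cases "L2_norm mu u = 0") (auto simp: power2_eq_square)
  thus "L2_norm mu u <= 1*L2_norm mu (%x. T u x - (-1)*u x)" by (simp add: w_def)
 qed (use assms range_dense in auto)
 thus ?thesis by simp
qed

text \<open>Essential self-adjointness in use. The closure contains a \<open>w\<close> with
  \<open>(T + 1) w = (kappa + 1) u\<close>; testing both equations shows that \<open>u - w\<close>
  is orthogonal to the range of \<open>T + 1\<close>, hence \<open>u = w\<close> almost
  everywhere.\<close>

lemma weak_in_G:
 assumes u: "u : L2 mu" and w: "!!v. v : D ==> u <.> (%x. T v x - kappa * v x) = 0"
 shows "(u, %x. kappa*u x) : G"
proof -
 obtain w g where g: "(w, g) : G" "AE x in mu. g x + w x = (kappa + 1)*u x" using resolvent_minus_one[OF L2_scale[OF u]] by blast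
 note L = G_L2[OF g(1)]
 have "AE x in mu. u x - w x = 0"
 proof (rule range_dense[OF L2_diff[OF u L(1)]])
  fix v assume v: "v : D"
  have Lv: "v : L2 mu" "T v : L2 mu" using v by (auto simp: D_imp_L2 T_L2)
  have "u <.> T v - kappa*u <.> v = 0" using w[OF v] L2_inner_lincomb_right[OF u Lv(2,1), of "- kappa"] by simp
  moreover have "g <.> v = w <.> T v" by (rule G_sym[OF g(1) G_D[OF v]])
  moreover have "(%x. g x + 1*w x) <.> v = (%x. (kappa + 1)*u x) <.> v" by (rule L2_inner_cong_AE) (use g L Lv u in "auto intro: L2_add L2_scale")
  ultimately show "(%x. u x - w x) <.> (%x. T v x + v x) = 0"
   using L2_inner_lincomb_left[OF Lv(1) L(2) L(1), of 1] L2_inner_scale_left[OF Lv(1) u, of "kappa + 1"] u L Lv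
   by (simp add: L2_inner_diff_left L2_inner_add_right L2_add algebra_simps)
 qed
 hence uw: "AE x in mu. w x = u x" by auto
 with g(2) have "AE x in mu. g x = kappa*u x" by eventually_elim (auto simp: algebra_simps)
 thus ?thesis by (rule G_cong_AE[OF g(1) uw]) (use u in "auto intro: L2_scale")
qed

text \<open>The coefficients of \<open>s j\<close> against all the functions \<open>g k i\<close>
  stay in a countable product of compact intervals, so along one subsequence all of them converge.
  The compactness inequality with \<open>e = 1 / Suc k\<close> then bounds the squared distance of
  two terms by a small multiple of the energy plus finitely many squared differences of
  coefficients.\<close>

lemma G_Cauchy_subseq:
 assumes G: "!!j::nat. (s j, t j) : G" and M: "!!j. s j <.> s j <= M" "!!j. t j <.> s j <= M"
 shows "EX r. strict_mono r & L2_Cauchy mu (s o r)"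
proof -
 have "ALL k. EX (g :: nat => 'a => real) N::nat. (ALL i<N. g i : L2 mu) &
  (ALL u f. (u, f) : G --> u <.> u <= 1 / Suc k * f <.> u + (\<Sum>i<N. (g i <.> u)^2))" by (intro allI G_compactness) simp
 then obtain g :: "nat => nat => 'a => real" and N :: "nat => nat"
  where g0: "ALL k. (ALL i<N k. g k i : L2 mu) &
   (ALL u f. (u, f) : G --> u <.> u <= 1 / Suc k * f <.> u + (\<Sum>i<N k. (g k i <.> u)^2))" unfolding choice_iff by blast
 have g: "!!k i. i < N k ==> g k i : L2 mu"
  "!!k u f. (u, f) : G ==> u <.> u <= 1 / Suc k * f <.> u + (\<Sum>i<N k. (g k i <.> u)^2)" using g0 by blast+
 \<comment> \<open>The value 0 for \<open>i >= N k\<close> turns families of varying length into one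
   point of a product indexed by pairs of naturals.\<close>
 define c where "c j ki = (case ki of (k, i) => if i < N k then g k i <.> s j else 0)" for j and ki :: "nat \<times> nat"
 define K where "K ki = {- abs (L2_norm mu (g (fst ki) (snd ki)) * sqrt M) .. abs (L2_norm mu (g (fst ki) (snd ki)) * sqrt M)}" for ki :: "nat \<times> nat"
 have sL: "s j : L2 mu" for j using G_L2(1)[OF G] .
 have "compact (PiE UNIV K)"
 proof -
  have "compactin (product_topology (%_. euclidean) UNIV) (PiE UNIV K)" by (subst compactin_PiE) (auto simp: K_def)
  thus ?thesis by (simp add: euclidean_product_topology)
 qed
 hence "seq_compact (PiE UNIV K)" by (simp add: compact_eq_seq_compact_metric)
 moreover have "c j : PiE UNIV K" for j
 proof (rule PiE_I)
  fix ki :: "nat \<times> nat"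
  obtain k i where ki: "ki = (k, i)" by fastforce
  have "abs (g k i <.> s j) <= abs (L2_norm mu (g k i) * sqrt M)" if "i < N k"
  proof -
   have "abs (g k i <.> s j) <= L2_norm mu (g k i)*L2_norm mu (s j)" using L2_Cauchy_Schwarz[OF g(1)[OF that] sL] .
   also have "... <= L2_norm mu (g k i) * sqrt M" using M(1)[of j] by (intro mult_left_mono L2_norm_nonneg) (simp add: L2_norm_eq)
   finally show ?thesis by simp
  qed
  thus "c j ki : K ki" by (auto simp: c_def K_def ki abs_le_iff)
 qed auto
 ultimately obtain l r where r: "strict_mono r" "((c o r) \<longlongrightarrow> l) sequentially" unfolding seq_compact_def by metis
 have conv: "(%j. c (r j) ki) ----> l ki" for ki
  using continuous_on_tendsto_compose[OF continuous_on_product_coordinates[of ki] r(2)] by (simp add: o_def)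
 have "L2_Cauchy mu (s o r)" unfolding L2_Cauchy_def
 proof (intro allI impI)
  fix e :: real assume e: "e > 0"
  obtain k where k: "1 / Suc k * (4*abs M) < e^2 / 2"
  proof -
   obtain k where "inverse (real (Suc k)) < e^2 / 2 / (4*abs M + 1)"
    using reals_Archimedean[of "e^2 / 2 / (4*abs M + 1)"] e by (auto simp: add_nonneg_pos)
   hence "1 / Suc k * (4*abs M + 1) < e^2 / 2" by (simp add: field_simps add_nonneg_pos)
   moreover have "1 / Suc k * (4*abs M) <= 1 / Suc k * (4*abs M + 1)" by (intro mult_left_mono) auto
   ultimately have "1 / Suc k * (4*abs M) < e^2 / 2" by (rule le_less_trans[rotated])
   thus ?thesis by (rule that)
  qed
  \<comment> \<open>The threshold makes \<open>N k\<close> squares add up to at most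
    \<open>e^2 / 2\<close>; the summand 2 keeps the denominator positive when
    \<open>N k = 0\<close>.\<close>
  have "EX n0. ALL m>=n0. ALL n>=n0. abs (c (r m) (k, i) - c (r n) (k, i)) < e / sqrt (2*real (N k) + 2)" for i
   using convergent_Cauchy[OF convergentI[OF conv[of "(k, i)"]]] e unfolding Cauchy_def by (auto simp: dist_real_def)
  then obtain n0 where n0: "!!i m n. m >= n0 i ==> n >= n0 i ==> abs (c (r m) (k, i) - c (r n) (k, i)) < e / sqrt (2*real (N k) + 2)" by metis
  have "L2_norm mu (%x. (s o r) m x - (s o r) n x) < e" if mn: "m >= (\<Sum>i<N k. n0 i)" "n >= (\<Sum>i<N k. n0 i)" for m n
  proof -
   define u where "u = (%x. s (r m) x - s (r n) x)"
   define f where "f = (%x. t (r m) x - t (r n) x)"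
   have uf: "(u, f) : G" unfolding u_def f_def by (rule G_diff[OF G G])
   \<comment> \<open>Nonnegativity of the form at the sum of two terms bounds its value at their
     difference by twice the two energies.\<close>
   have "(%x. t (r m) x + 1*t (r n) x) <.> (%x. s (r m) x + 1 * s (r n) x) >= 0" by (rule G_nonneg[OF G_lincomb[OF G G]])
   hence "f <.> u <= 2*t (r m) <.> s (r m) + 2*t (r n) <.> s (r n)" unfolding u_def f_def using G_L2[OF G]
    by (simp add: L2_inner_diff_left L2_inner_diff_right L2_diff L2_add
      L2_inner_lincomb_left[of _ mu _ _ 1, simplified] L2_inner_add_right)
   also have "... <= 4*abs M" using M(2)[of "r m"] M(2)[of "r n"] by linarith
   finally have f: "1 / Suc k * f <.> u <= 1 / Suc k * (4*abs M)" by (intro mult_left_mono) auto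
   have "(\<Sum>i<N k. (g k i <.> u)^2) <= (\<Sum>i<N k. e^2 / (2*real (N k) + 2))"
   proof (rule sum_mono)
    fix i assume i: "i : {..<N k}"
    have "n0 i <= (\<Sum>i<N k. n0 i)" using i by (intro member_le_sum) auto
    hence "abs (c (r m) (k, i) - c (r n) (k, i)) < e / sqrt (2*real (N k) + 2)" using mn by (intro n0) auto
    moreover have "c (r m) (k, i) - c (r n) (k, i) = g k i <.> u" using i g(1) sL by (simp add: c_def u_def L2_inner_diff_right)
    ultimately have "abs (g k i <.> u)^2 <= (e / sqrt (2*real (N k) + 2))^2" by (intro power_mono) auto
    thus "(g k i <.> u)^2 <= e^2 / (2*real (N k) + 2)" by (simp add: power_divide)
   qed
   also have "... = real (N k)*(e^2 / (2*real (N k) + 2))" by simp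
   also have "... <= e^2 / 2" using e by (simp add: field_simps)
   finally have "u <.> u < e^2" using g(2)[OF uf, of k] f k by linarith
   hence "(L2_norm mu u)^2 < e^2" by (simp add: L2_norm_sq)
   thus ?thesis using e by (simp add: power2_less_imp_less u_def)
  qed
  thus "EX n0. ALL i>=n0. ALL j>=n0. L2_norm mu (%x. (s o r) i x - (s o r) j x) < e" by blast
 qed
 thus ?thesis using r(1) by blast
qed

section \<open>Eigenvalues of the closure and its spectrum\<close>

definition eigen :: "real => bool" where
 "eigen kappa \<longleftrightarrow> (EX u. (u, %x. kappa*u x) : G & u <.> u = 1)"

lemma eigenI:
 assumes "(u, %x. kappa*u x) : G" "L2_norm mu u ~= 0"
 shows "eigen kappa"
proof -
 have n: "L2_norm mu u > 0" using assms(2) L2_norm_nonneg[of mu u] by linarith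
 define v where "v = (%x. 1 / L2_norm mu u * u x)"
 have "(v, %x. kappa * v x) : G" unfolding v_def using G_scale[OF assms(1), of "1 / L2_norm mu u"] by (simp add: mult.left_commute)
 moreover have "(L2_norm mu v)^2 = 1" unfolding v_def L2_norm_scale using n by simp
 ultimately show ?thesis unfolding eigen_def by (auto simp: L2_norm_sq)
qed

text \<open>Testing against \<open>D\<close> is enough: bounded energy gives a strongly convergent
  subsequence, whose limit keeps norm 1 and is a weak solution, hence lies in the graph. Both the
  contradiction in \<open>not_eigen_estimate\<close> and the minimizing sequence for
  \<open>bottom\<close> end here.\<close>

lemma eigen_if_approximate:
 assumes uf: "!!j::nat. (u j, f j) : G" and u1: "!!j. u j <.> u j = 1" and M: "!!j. f j <.> u j <= M"
  and lim: "!!v. v : D ==> (%j. u j <.> (%x. T v x - kappa * v x)) ----> 0"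
 shows "eigen kappa"
proof -
 note L = G_L2[OF uf]
 obtain r where r: "strict_mono r" "L2_Cauchy mu (u o r)"
  using G_Cauchy_subseq[where s=u and t=f and M="max 1 M", OF uf] u1 M by (auto simp: le_max_iff_disj)
 obtain w where w: "w : L2 mu" "L2_lim mu (u o r) w" using L2_complete[OF _ r(2)] L by auto
 have "(%j. L2_norm mu ((u o r) j)) ----> L2_norm mu w" by (rule L2_lim_norm[OF _ w]) (use L in auto)
 moreover have "L2_norm mu ((u o r) j) = 1" for j by (simp add: L2_norm_eq u1)
 ultimately have "L2_norm mu w = 1" using LIMSEQ_unique[OF tendsto_const] by force
 moreover have "(w, %x. kappa*w x) : G"
 proof (rule weak_in_G[OF w(1)])
  fix v assume v: "v : D"
  have "(%x. T v x - kappa * v x) : L2 mu" using L2_lincomb[OF T_L2[OF v] D_imp_L2[OF v], of "- kappa"] by simp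
  hence "(%j. (u o r) j <.> (%x. T v x - kappa * v x)) ----> w <.> (%x. T v x - kappa * v x)"
   by (intro L2_inner_tendsto) (use w L in "auto simp: L2_norm_def")
  thus "w <.> (%x. T v x - kappa * v x) = 0" using LIMSEQ_unique[OF _ LIMSEQ_subseq_LIMSEQ[OF lim[OF v] r(1)]] by (simp add: o_def)
 qed
 ultimately show ?thesis using eigenI by force
qed

text \<open>If no constant works, counterexamples normalized to norm 1 have residuals at most
  \<open>1 / Suc j\<close> and energy at most \<open>abs kappa + 1\<close>, so they are approximate
  eigenfunctions.\<close>

lemma not_eigen_estimate:
 assumes "~ eigen kappa"
 shows "EX C. ALL (u, f) : G. L2_norm mu u <= C*L2_norm mu (%x. f x - kappa*u x)"
proof (rule ccontr)
 assume neg: "~ ?thesis"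
 have "EX u f. (u, f) : G & L2_norm mu u > real (Suc j)*L2_norm mu (%x. f x - kappa*u x)" for j
 proof -
  have "~ (ALL (u, f) : G. L2_norm mu u <= real (Suc j)*L2_norm mu (%x. f x - kappa*u x))" using neg by blast
  thus ?thesis by (auto simp: not_le) blast
 qed
 hence "ALL j. EX u f. (u, f) : G & L2_norm mu u > real (Suc j)*L2_norm mu (%x. f x - kappa*u x)" by blast
 then obtain u0 f0 where "ALL j. (u0 j, f0 j) : G & L2_norm mu (u0 j) > real (Suc j)*L2_norm mu (%x. f0 j x - kappa*u0 j x)"
  unfolding choice_iff by blast
 hence 0: "!!j. (u0 j, f0 j) : G" "!!j. L2_norm mu (u0 j) > real (Suc j)*L2_norm mu (%x. f0 j x - kappa*u0 j x)" by blast+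
 have n: "L2_norm mu (u0 j) > 0" for j
  using 0(2)[of j] L2_norm_nonneg[of mu "%x. f0 j x - kappa*u0 j x"] by (smt (verit) mult_nonneg_nonneg of_nat_0_le_iff)
 define a where "a j = 1 / L2_norm mu (u0 j)" for j
 define u f where "u j = (%x. a j*u0 j x)" and "f j = (%x. a j*f0 j x)" for j
 have uf: "(u j, f j) : G" for j unfolding u_def f_def by (rule G_scale[OF 0(1)])
 note L = G_L2[OF uf]
 have u1: "L2_norm mu (u j) = 1" for j unfolding u_def L2_norm_scale a_def using n[of j] by simp
 have d: "L2_norm mu (%x. f j x - kappa*u j x) <= 1 / Suc j" for j
 proof -
  have "(%x. f j x - kappa*u j x) = (%x. a j*(f0 j x - kappa*u0 j x))" by (auto simp: u_def f_def algebra_simps)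
  hence eq: "L2_norm mu (%x. f j x - kappa*u j x) = L2_norm mu (%x. f0 j x - kappa*u0 j x) / L2_norm mu (u0 j)"
   using n[of j] by (simp only: L2_norm_scale) (simp add: a_def)
  show ?thesis using 0(2)[of j] n[of j] unfolding eq by (simp add: field_simps)
 qed
 have dL: "(%x. f j x - kappa*u j x) : L2 mu" for j using L2_lincomb[OF L(2)[of j] L(1)[of j], of "- kappa"] by simp
 have "f j <.> u j <= abs kappa + 1" for j
 proof -
  have "f j <.> u j = (%x. f j x - kappa*u j x) <.> u j + kappa*u j <.> u j"
   using L2_inner_lincomb_left[OF L(1)[of j] dL[of j] L(1)[of j], of kappa] by simp
  also have "... <= L2_norm mu (%x. f j x - kappa*u j x)*L2_norm mu (u j) + kappa*1"
   using L2_Cauchy_Schwarz[OF dL[of j] L(1)[of j]] u1[of j] by (simp add: L2_norm_sq[symmetric])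
  also have "... <= abs kappa + 1"
  proof -
   have "1 / real (Suc j) <= 1" by simp
   hence "L2_norm mu (%x. f j x - kappa*u j x) <= 1" using d[of j] by linarith
   thus ?thesis using u1[of j] by simp
  qed
  finally show ?thesis .
 qed
 moreover have "(%j. u j <.> (%x. T v x - kappa * v x)) ----> 0" if v: "v : D" for v
 proof (rule tendsto_null_bound)
  have "u j <.> (%x. T v x - kappa * v x) = (%x. f j x - kappa*u j x) <.> v" for j
   using L2_inner_lincomb_left[OF D_imp_L2[OF v] L(2,1), of j "- kappa" j] G_sym[OF uf[of j] G_D[OF v]]
    L2_inner_lincomb_right[OF L(1) T_L2[OF v] D_imp_L2[OF v], of j "- kappa"] by simp
  thus "abs (u j <.> (%x. T v x - kappa * v x)) <= 1 / Suc j * L2_norm mu v" for j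
   using L2_Cauchy_Schwarz[OF dL D_imp_L2[OF v], of j] mult_right_mono[OF d[of j] L2_norm_nonneg[of mu v]] by simp
  show "(%j. 1 / Suc j * L2_norm mu v) ----> 0" by (rule tendsto_mult_left_zero[OF LIMSEQ_Suc[OF lim_1_over_n]])
 qed simp
 ultimately have "eigen kappa" by (intro eigen_if_approximate[OF uf]) (simp_all add: L2_norm_sq[symmetric] u1)
 with assms show False ..
qed

text \<open>The Fredholm alternative. Without an eigenfunction both requirements of
  \<open>resolvent_set\<close> hold: the estimate by \<open>not_eigen_estimate\<close>, and
  surjectivity because a nonzero element orthogonal to the range of \<open>T - kappa\<close> would
  itself be an eigenfunction by \<open>weak_in_G\<close>.\<close>

lemma spectrum_imp_eigen:
 assumes "kappa : spectrum_of mu G"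
 shows "eigen kappa"
proof (rule ccontr)
 assume ne: "~ eigen kappa"
 then obtain C where C: "!!u f. (u, f) : G ==> L2_norm mu u <= C*L2_norm mu (%x. f x - kappa*u x)" using not_eigen_estimate by blast
 have "EX u f. (u, f) : G & (AE x in mu. f x - kappa*u x = h x)" if "h : L2 mu" for h
 proof (rule D_estimate_solve[OF C[OF G_D] _ that])
  fix u assume u: "u : L2 mu" "!!v. v : D ==> u <.> (%x. T v x - kappa * v x) = 0"
  have "L2_norm mu u = 0" using weak_in_G[OF u] eigenI ne by blast
  thus "AE x in mu. u x = 0" by (rule L2_norm_zero_AE[OF u(1)])
 qed
 hence "kappa : resolvent_set mu G" using C unfolding resolvent_set_def by blast
 thus False using assms by (simp add: spectrum_of_def)
qed

text \<open>Normalized eigenfunctions for distinct eigenvalues are orthogonal, hence at mutual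
  distance \<open>sqrt 2\<close>, while their bounded energies would force a Cauchy
  subsequence.\<close>

lemma eigen_finite: "finite {kappa. eigen kappa & kappa <= \<Lambda>}"
proof (rule ccontr)
 assume "infinite {kappa. eigen kappa & kappa <= \<Lambda>}"
 then obtain k :: "nat => real" where k: "inj k" "range k <= {kappa. eigen kappa & kappa <= \<Lambda>}" using infinite_countable_subset by metis
 hence "ALL j. EX u. (u, %x. k j*u x) : G & u <.> u = 1" unfolding eigen_def by auto
 then obtain u where u: "!!j. (u j, %x. k j*u j x) : G" "!!j. u j <.> u j = 1" by metis
 note L = G_L2(1)[OF u(1)]
 have orth: "u i <.> u j = 0" if "i ~= j" for i j
 proof -
  have "k i*u i <.> u j = k j*u i <.> u j" using G_sym[OF u(1)[of i] u(1)[of j]] L by (simp add: L2_inner_scale_left L2_inner_scale_right)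
  thus ?thesis using injD[OF k(1)] that by auto
 qed
 have "u j <.> u j <= abs \<Lambda> + 1" "(%x. k j*u j x) <.> u j <= abs \<Lambda> + 1" for j
  using k(2) u(2) L by (auto simp: L2_inner_scale_left image_subset_iff intro: order_trans[of _ \<Lambda>])
 then obtain r where r: "strict_mono r" "L2_Cauchy mu (u o r)"
  using G_Cauchy_subseq[where s=u and t="%j x. k j*u j x" and M="abs \<Lambda> + 1", OF u(1)] by blast
 then obtain N where N: "!!i j. i >= N ==> j >= N ==> L2_norm mu (%x. (u o r) i x - (u o r) j x) < 1"
  unfolding L2_Cauchy_def by (meson zero_less_one)
 have "r N ~= r (Suc N)" using strict_monoD[OF r(1), of N "Suc N"] by simp
 hence "(L2_norm mu (%x. u (r N) x - u (r (Suc N)) x))^2 = 2"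
  using L2_inner_lincomb_self[OF L L, of "r N" "-1" "r (Suc N)"] u(2) orth by (simp add: L2_norm_sq)
 moreover have "(L2_norm mu (%x. u (r N) x - u (r (Suc N)) x))^2 <= 1^2"
  using N[of N "Suc N"] by (intro power_mono) (auto simp: L2_norm_nonneg less_imp_le)
 ultimately show False by simp
qed

text \<open>Up to \<open>kappa + 1\<close> the spectrum is finite, so removing its points other than
  \<open>kappa\<close> from a half-line leaves an open set.\<close>

lemma spectrum_isolated:
 assumes "kappa : spectrum_of mu G"
 shows "kappa isolated_in spectrum_of mu G"
proof -
 define S where "S = {l : spectrum_of mu G. l <= kappa + 1} - {kappa}"
 have "finite S" by (rule finite_subset[OF _ eigen_finite[of "kappa + 1"]]) (auto simp: S_def dest: spectrum_imp_eigen)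
 hence "open ({..<kappa + 1} - S)" by (intro open_Diff open_lessThan finite_imp_closed)
 moreover have "({..<kappa + 1} - S) \<inter> spectrum_of mu G = {kappa}" using assms by (auto simp: S_def)
 ultimately show ?thesis using assms unfolding isolated_in_def by blast
qed

end

section \<open>Multiplicity and the bottom of the form\<close>

text \<open>The kernel of the last functional is spanned by induction, and one further vector
  \<open>e\<close> outside it spans the rest. The separation assumption is pointwise because
  \<open>finite_dimensional\<close> speaks of functions and not of classes modulo null sets.\<close>

lemma finite_dimensional_if_functionals:
 fixes l :: "nat => ('a => real) => real"
 assumes "!!u v c. u : E ==> v : E ==> (%x. u x + c * v x) : E"
  and "!!i u v c. i < N ==> u : E ==> v : E ==> l i (%x. u x + c * v x) = l i u + c*l i v"
  and "!!u x. u : E ==> (!!i. i < N ==> l i u = 0) ==> u x = 0"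
 shows "finite_dimensional E" using assms
proof (induction N arbitrary: E)
 case 0
 thus ?case unfolding finite_dimensional_def by (intro exI[of _ "{}"]) auto
next
 case (Suc N)
 define E' where "E' = {u\<in>E. l N u = 0}"
 have "finite_dimensional E'"
 proof (rule Suc.IH)
  show "(%x. u x + c * v x) : E'" if "u : E'" "v : E'" for u v c using that Suc.prems(1)[of u v c] Suc.prems(2)[of N u v c] by (auto simp: E'_def)
  show "u x = 0" if "u : E'" "!!i. i < N ==> l i u = 0" for u x using that Suc.prems(3)[of u x] by (auto simp: E'_def less_Suc_eq)
 qed (use Suc.prems(2) in "auto simp: E'_def")
 then obtain B where B: "finite B" "B <= E'" "!!u. u : E' ==> EX a. ALL x. u x = (\<Sum>b\<in>B. a b*b x)" unfolding finite_dimensional_def by auto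
 show ?case
 proof (cases "E' = E")
  case True
  thus ?thesis using \<open>finite_dimensional E'\<close> by simp
 next
  case False
  then obtain e where e: "e : E" "l N e ~= 0" by (auto simp: E'_def)
  hence eB: "e ~: B" using B(2) by (auto simp: E'_def)
  have "EX a. ALL x. u x = (\<Sum>b\<in>insert e B. a b*b x)" if u: "u : E" for u
  proof -
   define c where "c = l N u / l N e"
   have m: "(%x. u x + (- c)*e x) : E'"
    using Suc.prems(1)[OF u e(1), of "-c"] Suc.prems(2)[of N, OF _ u e(1), of "-c"] e(2) by (auto simp: E'_def c_def)
   obtain a where a: "!!x. u x + (- c)*e x = (\<Sum>b\<in>B. a b*b x)" using B(3)[OF m] by auto
   have "(\<Sum>b\<in>insert e B. (a(e := c)) b*b x) = c*e x + (\<Sum>b\<in>B. a b*b x)" for x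
    using eB B(1) by (subst sum.insert) (auto intro!: sum.cong)
   hence "u x = (\<Sum>b\<in>insert e B. (a(e := c)) b*b x)" for x using a[of x] by simp
   thus ?thesis by blast
  qed
  thus ?thesis unfolding finite_dimensional_def using B e by (intro exI[of _ "insert e B"]) (auto simp: E'_def)
 qed
qed

context compact_symmetric_operator
begin

text \<open>An eigenfunction orthogonal to all \<open>g i\<close> satisfies
  \<open>|u|^2 <= e * kappa * |u|^2\<close>, and \<open>e\<close> is chosen with
  \<open>e * kappa <= 1/2\<close>; so finitely many coefficients determine it. The last assumption
  leads from almost everywhere to everywhere.\<close>

lemma eigenspace_finite_dimensional:
 assumes E: "!!u v c. u : E ==> v : E ==> (%x. u x + c * v x) : E"
  and G: "!!u. u : E ==> (u, %x. kappa*u x) : G"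
  and 0: "!!u x. u : E ==> AE x in mu. u x = 0 ==> u x = 0"
 shows "finite_dimensional E"
proof -
 define e where "e = 1 / (2*(abs kappa + 1))"
 have e: "e > 0" "e * kappa <= 1/2" by (auto simp: e_def field_simps)
 obtain g :: "nat => 'a => real" and N :: nat where g: "!!i. i < N ==> g i : L2 mu"
  "!!u f. (u, f) : G ==> u <.> u <= e*f <.> u + (\<Sum>i<N. (g i <.> u)^2)" using G_compactness[OF e(1)] by blast
 show ?thesis
 proof (rule finite_dimensional_if_functionals[where N=N and l="%i u. g i <.> u"])
  show "g i <.> (%x. u x + c * v x) = g i <.> u + c*g i <.> v" if "i < N" "u : E" "v : E" for i u v c
   using that g(1) G_L2(1)[OF G] by (intro L2_inner_lincomb_right) auto
  show "u x = 0" if u: "u : E" "!!i. i < N ==> g i <.> u = 0" for u x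
  proof (rule 0[OF u(1)])
   have L: "u : L2 mu" using G_L2(1)[OF G[OF u(1)]] .
   have "u <.> u <= (e * kappa)*u <.> u" using g(2)[OF G[OF u(1)]] u(2) L by (simp add: L2_inner_scale_left)
   also have "... <= 1/2*u <.> u" by (intro mult_right_mono e L2_inner_self_nonneg)
   finally have "L2_norm mu u = 0" using L2_inner_self_nonneg[of mu u] by (simp add: L2_norm_eq)
   thus "AE x in mu. u x = 0" by (rule L2_norm_zero_AE[OF L])
  qed
 qed (use E in auto)
qed

definition bottom :: real where
 "bottom = Inf {(T u <.> u) / u <.> u | u. u : D & u <.> u ~= 0}"

text \<open>On \<open>D\<close> this is the definition of the infimum, or nonnegativity of the form
  when the norm is 0; both sides are continuous along the approximating sequence.\<close>

lemma bottom_le: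
 assumes "(u, f) : G"
 shows "bottom*u <.> u <= f <.> u"
proof -
 have D: "bottom * v <.> v <= T v <.> v" if "v : D" for v
 proof (cases "v <.> v = 0")
  case False
  hence "v <.> v > 0" using L2_inner_self_nonneg[of mu v] by simp
  moreover have "bottom <= T v <.> v / v <.> v" unfolding bottom_def
  proof (rule cInf_lower)
   show "bdd_below {(T u <.> u) / u <.> u | u. u : D & u <.> u ~= 0}" by (rule bdd_belowI[where m=0]) (auto simp: T_nonneg L2_inner_self_nonneg)
  qed (use that False in auto)
  ultimately show ?thesis by (simp add: field_simps)
 qed (use that T_nonneg in auto)
 obtain s where s: "!!j. s j : D" "L2_lim mu s u" "L2_lim mu (%j. T (s j)) f" using G_approx[OF assms] by blast
 have "(%j. bottom * s j <.> s j) ----> bottom*u <.> u"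
  by (intro tendsto_mult tendsto_const L2_inner_tendsto) (use s G_L2[OF assms] in "auto simp: D_imp_L2")
 thus ?thesis using G_form_tendsto[OF assms s] by (rule LIMSEQ_le) (use D s in auto)
qed

text \<open>The Cauchy--Schwarz inequality for the form of \<open>T - bottom\<close> turns a minimizing sequence into
 approximate eigenfunctions.\<close>

lemma eigen_bottom:
 assumes "u0 : D" "u0 <.> u0 ~= 0"
 shows "eigen bottom"
proof -
 define Q where "Q u v = u <.> (%x. T v x - bottom * v x)" for u v
 have Q: "Q u v = T u <.> v - bottom*u <.> v" if "u : D" "v : D" for u v
  using L2_inner_lincomb_right[of u mu "T v" v "- bottom"] that by (simp add: Q_def D_imp_L2 T_L2 T_sym)
 have "EX u:D. u <.> u = 1 & T u <.> u < bottom + 1 / Suc j" for j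
 proof -
  obtain u where u: "u : D" "u <.> u ~= 0" "T u <.> u / u <.> u < bottom + 1 / Suc j"
   using cInf_lessD[of "{(T u <.> u) / u <.> u | u. u : D & u <.> u ~= 0}" "bottom + 1 / Suc j"] assms by (auto simp: bottom_def)
  define c where "c = 1 / L2_norm mu u"
  have c: "(%x. c*u x) : D" "T (%x. c*u x) = (%x. c*T u x)" "c^2 = 1 / u <.> u"
   using D_lincomb[OF u(1) u(1), of "c - 1"] T_lincomb[OF u(1) u(1), of "c - 1"] by (simp_all add: c_def power_divide L2_norm_sq algebra_simps)
  have "c*(c*z) = z / u <.> u" for z using c(3) by (simp add: power2_eq_square mult.assoc[symmetric])
  with c u show ?thesis by (intro bexI[OF _ c(1)]) (simp add: L2_inner_scale_left L2_inner_scale_right D_imp_L2 T_L2 L2_scale)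
 qed
 then obtain u where u: "!!j. u j : D" "!!j. u j <.> u j = 1" "!!j. T (u j) <.> u j < bottom + 1 / Suc j" by metis
 show ?thesis
 proof (rule eigen_if_approximate[OF G_D[OF u(1)] u(2)])
  show "T (u j) <.> u j <= bottom + 1" for j using u(3)[of j] by (rule less_imp_le[OF less_le_trans]) simp
  fix v assume v: "v : D"
  have 1: "(Q (u j) v)^2 <= Q (u j) (u j)*Q v v" for j
  proof (rule quadratic_nonneg_discriminant)
   fix t
   have "(%x. u j x + t * v x) : D" by (rule D_lincomb[OF u(1) v])
   note q = bottom_le[OF G_D[OF this], unfolded T_lincomb[OF u(1) v] L2_inner_lincomb_self[OF D_imp_L2[OF u(1)] D_imp_L2[OF v]]]
   have "(%x. T (u j) x + t*T v x) <.> (%x. u j x + t * v x) = T (u j) <.> u j + 2*t*T (u j) <.> v + t^2*T v <.> v"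
    using u(1)[of j] v T_sym[OF v u(1)[of j]] L2_inner_commute[of mu v "T (u j)"]
    by (simp add: L2_inner_lincomb_left L2_inner_lincomb_right L2_lincomb D_imp_L2 T_L2 algebra_simps power2_eq_square)
   with q show "0 <= Q (u j) (u j) + 2*t*Q (u j) v + t^2*Q v v" by (simp add: Q u(1) v algebra_simps)
  qed
  \<comment> \<open>For a normalized \<open>u\<close> the form is \<open>(T u, u) - bottom\<close>,
    which the minimizing sequence keeps below \<open>1 / Suc j\<close>.\<close>
  have 2: "Q (u j) (u j)*Q v v <= 1 / Suc j * Q v v" for j using u(3)[of j] bottom_le[OF G_D[OF v]] by (intro mult_right_mono) (simp_all add: Q u v)
  have "(%j. (Q (u j) v)^2) ----> 0"
   by (rule tendsto_null_bound[OF _ tendsto_mult_left_zero[OF LIMSEQ_Suc[OF lim_1_over_n]]]) (use order_trans[OF 1 2] in auto)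
  thus "(%j. u j <.> (%x. T v x - bottom * v x)) ----> 0" by (simp add: Q_def)
 qed
qed

end

section \<open>Calculus on Euclidean space\<close>

lemma pd_eq: "(f has_derivative f') (at x) ==> pd i f x = f' (axis i 1)" unfolding pd_def by (drule frechet_derivative_at) simp

lemma vec_basis_expansion: "(SS i. (h$i) *R axis i 1) = (h :: real^'n)" using basis_expansion[of h] by (simp add: scalar_mult_eq_scaleR)

lemma linear_vec_expansion:
 fixes f :: "real^'n => 'b::real_vector"
 assumes "linear f"
 shows "f h = (SS i. (h$i) *R f (axis i 1))"
proof -
 have "f (SS i. (h$i) *R axis i 1) = (SS i. (h$i) *R f (axis i 1))" using assms by (simp add: linear_sum linear_cmul)
 thus ?thesis by (simp add: vec_basis_expansion)
qed

lemma frechet_derivative_pd: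
 assumes "f differentiable (at x)"
 shows "FD f x h = (SS i. (h$i) *R pd i f x)" unfolding pd_def using assms by (intro linear_vec_expansion linear_frechet_derivative)

lemma has_derivative_pd:
 assumes "f differentiable (at x)"
 shows "(f has_derivative (%h. SS i. (h$i) *R pd i f x)) (at x)" using assms unfolding frechet_derivative_works frechet_derivative_pd[OF assms] .

lemma smooth_differentiable: "smooth_on f S ==> open S ==> x : S ==> f differentiable (at x)" using smooth_has_derivative differentiableI by blast

lemma Ck_on_SucI_pd:
 assumes "open S" "!!x. x : S ==> (f has_derivative (%h. SS i. (h$i) *R g i x)) (at x)" "!!i. Ck_on k (g i) S"
 shows "Ck_on (Suc k) f S" by (rule Ck_on_SucI[OF assms(1,2)])
  (auto intro!: Ck_on_sum[OF assms(1)] Ck_on_bounded_linear[OF bounded_linear_scaleR_right assms(1)] assms(3))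

lemma pd_cong_open:
 assumes "open S" "x : S" "!!y. y : S ==> f y = g y"
 shows "pd i f x = pd i g x"
proof -
 have "(f has_derivative f') (at x) \<longleftrightarrow> (g has_derivative f') (at x)" for f'
  using has_derivative_transform_within_open[OF _ assms(1,2)] assms(3) by metis
 thus ?thesis unfolding pd_def frechet_derivative_def by simp
qed

lemma pd_const: "pd i (%x. c) x = 0" by (rule pd_eq[where f'="%_. 0", simplified]) simp

lemma pd_add:
 assumes "f differentiable (at x)" "g differentiable (at x)"
 shows "pd i (%x. f x + g x) x = pd i f x + pd i g x"
 using has_derivative_add[OF assms[unfolded frechet_derivative_works]] by (simp add: pd_eq pd_def[symmetric])

lemma pd_bounded_linear:
 assumes "f differentiable (at x)" "bounded_linear l"
 shows "pd i (%x. l (f x)) x = l (pd i f x)"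
 using bounded_linear.has_derivative[OF assms(2) assms(1)[unfolded frechet_derivative_works]] by (simp add: pd_eq pd_def[symmetric])

lemma pd_bilinear:
 assumes "bounded_bilinear pr" "f differentiable (at x)" "g differentiable (at x)"
 shows "pd i (%x. pr (f x) (g x)) x = pr (f x) (pd i g x) + pr (pd i f x) (g x)"
 using bounded_bilinear.FDERIV[OF assms(1) assms(2,3)[unfolded frechet_derivative_works]] by (simp add: pd_eq pd_def[symmetric])

lemmas pd_mult = pd_bilinear[OF bounded_bilinear_mult]
lemmas pd_inner = pd_bilinear[OF bounded_bilinear_inner]

lemma pd_cmult: "f differentiable (at x) ==> pd i (%x. (c::real)*f x) x = c*pd i f x" by (rule pd_bounded_linear[OF _ bounded_linear_mult_right])

lemma pd_sum:
 assumes "!!j. j : J ==> f j differentiable (at x)"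
 shows "pd i (%x. \<Sum>j\<in>J. f j x) x = (\<Sum>j\<in>J. pd i (f j) x)"
proof -
 have "((%x. \<Sum>j\<in>J. f j x) has_derivative (%h. \<Sum>j\<in>J. FD (f j) x h)) (at x)"
  using assms by (intro has_derivative_sum) (auto simp: frechet_derivative_works)
 thus ?thesis by (simp add: pd_eq pd_def[symmetric])
qed

lemma pd_reflect:
 assumes "f differentiable (at (c - x))"
 shows "pd i (%x. f (c - x)) x = - pd i f (c - x)"
proof -
 have "((%x. f (c - x)) has_derivative (%h. FD f (c - x) (- h))) (at x)"
 proof -
  have "((%x. c - x) has_derivative (%h. - h)) (at x)" by (auto intro!: derivative_eq_intros)
  from has_derivative_compose[OF this assms[unfolded frechet_derivative_works]] show ?thesis .
 qed
 hence "pd i (%x. f (c - x)) x = FD f (c - x) (- axis i 1)" by (rule pd_eq)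
 thus ?thesis using linear_neg[OF linear_frechet_derivative[OF assms]] by (simp add: pd_def)
qed

lemma pd_line:
 fixes f :: "real^'n => real"
 assumes "f differentiable (at (x + t *R axis i 1))"
 shows "((%t. f (x + t *R axis i 1)) has_field_derivative pd i f (x + t *R axis i 1)) (at t)"
proof -
 let ?F = "FD f (x + t *R axis i 1)"
 have "((%t. f (x + t *R axis i 1)) has_derivative (%h. ?F (h *R axis i 1))) (at t)"
 proof -
  have "((%t. x + t *R axis i 1) has_derivative (%h. h *R axis i 1)) (at t)" by (auto intro!: derivative_eq_intros)
  from has_derivative_compose[OF this assms[unfolded frechet_derivative_works]] show ?thesis .
 qed
 thus ?thesis unfolding has_field_derivative_def
  by (rule has_derivative_eq_rhs) (use linear_cmul[OF linear_frechet_derivative[OF assms]] in "simp add: fun_eq_iff pd_def")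
qed

text \<open>Mean value theorem for second differences; its left hand side is symmetric in \<open>i\<close> and \<open>j\<close>.\<close>

lemma second_difference_mean_value:
 fixes f :: "real^'n => real"
 assumes f: "smooth_on f S" "open S" "cball x (2*h) <= S" "h > 0"
 shows "EX z:cball x (2*h). f (x + h *R axis i 1 + h *R axis j 1) - f (x + h *R axis i 1) - f (x + h *R axis j 1) + f x
  = h*h*pd j (pd i f) z"
proof -
 have mem: "x + s *R axis i 1 + t *R axis j 1 : cball x (2*h)" if "0 <= s" "s <= h" "0 <= t" "t <= h" for s t
 proof -
  have "norm (s *R axis i 1 + t *R axis j (1::real)) <= s + t" by (rule order_trans[OF norm_triangle_ineq]) (use that in simp)
  moreover have "dist x (x + s *R axis i 1 + t *R axis j 1) = norm (s *R axis i 1 + t *R axis j (1::real))"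
   by (metis add.assoc add_diff_cancel_left' dist_commute dist_norm)
  ultimately show ?thesis using that by simp
 qed
 have d: "g differentiable (at (x + s *R axis i 1 + t *R axis j 1))"
  if "0 <= s" "s <= h" "0 <= t" "t <= h" "smooth_on g S" for s t and g :: "real^'n => real"
  using smooth_differentiable[OF that(5) f(2)] mem[OF that(1-4)] f(3) by auto
 define P where "P s = f (x + s *R axis i 1 + h *R axis j 1) - f (x + s *R axis i 1)" for s
 have dP: "(P has_field_derivative (pd i f (x + s *R axis i 1 + h *R axis j 1) - pd i f (x + s *R axis i 1))) (at s)"
  if "0 <= s" "s <= h" for s
 proof -
  have "((%s. f ((x + h *R axis j 1) + s *R axis i 1)) has_field_derivative
    pd i f ((x + h *R axis j 1) + s *R axis i 1)) (at s)" by (rule pd_line) (use d[of s h f] that f in "simp add: add_ac")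
  moreover have "((%s. f (x + s *R axis i 1)) has_field_derivative pd i f (x + s *R axis i 1)) (at s)"
   by (rule pd_line) (use d[of s 0 f] that f in simp)
  ultimately show ?thesis unfolding P_def by (auto intro!: derivative_eq_intros simp: add_ac)
 qed
 obtain s where s: "0 < s" "s < h" "P h - P 0 = (h - 0)*(pd i f (x + s *R axis i 1 + h *R axis j 1) - pd i f (x + s *R axis i 1))"
  using MVT2[OF f(4) dP] by blast
 have dQ: "((%t. pd i f (x + s *R axis i 1 + t *R axis j 1)) has_field_derivative
  pd j (pd i f) (x + s *R axis i 1 + t *R axis j 1)) (at t)" if "0 <= t" "t <= h" for t
  by (rule pd_line) (use d[of s t "pd i f"] that s smooth_pd[OF f(1)] in simp)
 obtain t where t: "0 < t" "t < h" "pd i f (x + s *R axis i 1 + h *R axis j 1) - pd i f (x + s *R axis i 1 + 0 *R axis j 1)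
  = (h - 0)*pd j (pd i f) (x + s *R axis i 1 + t *R axis j 1)" using MVT2[OF f(4) dQ] by blast
 show ?thesis by (rule bexI[of _ "x + s *R axis i 1 + t *R axis j 1"]) (use s t mem[of s t] in "auto simp: P_def algebra_simps")
qed

text \<open>One and the same second difference equals \<open>h^2\<close> times either mixed
  derivative, each at some point of a shrinking ball; after cancelling \<open>h^2\<close>,
  continuity of both derivatives gives equality at the centre.\<close>

lemma pd_commute:
 fixes f :: "real^'n => real"
 assumes f: "smooth_on f S" "open S" "x : S"
 shows "pd i (pd j f) x = pd j (pd i f) x"
proof -
 obtain r where r: "r > 0" "cball x r <= S" using f open_contains_cball by metis
 have c: "isCont (pd k (pd l f)) x" for k l using smooth_continuous[OF smooth_pd[OF smooth_pd[OF f(1)]]] f(2,3)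
  by (simp add: continuous_on_eq_continuous_at)
 define h where "h n = r / (2*real (Suc n))" for n
 have h: "h n > 0" "cball x (2*h n) <= S" for n
 proof -
  show "h n > 0" using r by (simp add: h_def)
  have "2*h n <= r" using r by (simp add: h_def field_simps)
  thus "cball x (2*h n) <= S" using r(2) subset_cball by blast
 qed
 have h0: "(%n. 2*h n) ----> 0"
 proof -
  have "(%n. r*(1 / real (Suc n))) ----> r*0" by (intro tendsto_mult tendsto_const LIMSEQ_Suc[OF lim_1_over_n])
  moreover have "r*(1 / real (Suc n)) = 2*h n" for n by (simp add: h_def field_simps)
  ultimately show ?thesis by simp
 qed
 define D where "D n = f (x + h n *R axis i 1 + h n *R axis j 1) - f (x + h n *R axis i 1) - f (x + h n *R axis j 1) + f x" for n
 have "ALL n. EX z. z : cball x (2*h n) & D n = h n*h n*pd j (pd i f) z"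
  unfolding D_def using second_difference_mean_value[OF f(1,2) h(2,1)] by blast
 then obtain z where "ALL n. z n : cball x (2*h n) & D n = h n*h n*pd j (pd i f) (z n)" unfolding choice_iff by blast
 hence z: "z n : cball x (2*h n)" "D n = h n*h n*pd j (pd i f) (z n)" for n by blast+
 have D': "D n = f (x + h n *R axis j 1 + h n *R axis i 1) - f (x + h n *R axis j 1) - f (x + h n *R axis i 1) + f x" for n
  by (simp add: D_def add_ac)
 have "ALL n. EX z. z : cball x (2*h n) & D n = h n*h n*pd i (pd j f) z" unfolding D' using second_difference_mean_value[OF f(1,2) h(2,1)] by blast
 then obtain w where "ALL n. w n : cball x (2*h n) & D n = h n*h n*pd i (pd j f) (w n)" unfolding choice_iff by blast
 hence w: "w n : cball x (2*h n)" "D n = h n*h n*pd i (pd j f) (w n)" for n by blast+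
 have lim: "v ----> x" if "!!n. v n : cball x (2*h n)" for v
  by (rule tendsto_dist_iff[THEN iffD2], rule Lim_null_comparison[OF always_eventually h0]) (use that in "auto simp: dist_commute")
 have "(%n. pd j (pd i f) (z n)) ----> pd j (pd i f) x" by (rule isCont_tendsto_compose[OF c lim[OF z(1)]])
 moreover have "(%n. pd i (pd j f) (w n)) ----> pd i (pd j f) x" by (rule isCont_tendsto_compose[OF c lim[OF w(1)]])
 moreover have "pd j (pd i f) (z n) = pd i (pd j f) (w n)" for n using z(2)[of n] w(2)[of n] h(1)[of n] by simp
 ultimately show ?thesis using LIMSEQ_unique by simp
qed

lemma sum_components_le:
 fixes h :: "real^'n"
 assumes "!!i. abs (c i) <= C"
 shows "abs (SS i. (h$i) *R c i) <= real CARD('n)*C*norm h"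
proof -
 have "abs (SS i. (h$i) *R c i) <= (SS i. abs (h$i)*abs (c i))" by (rule order_trans[OF sum_abs]) (simp add: abs_mult)
 also have "... <= (\<Sum>i\<in>(UNIV::'n set). norm h*C)" using assms by (intro sum_mono mult_mono component_le_norm_cart) auto
 finally show ?thesis by (simp add: mult.assoc mult.left_commute mult.commute)
qed

lemma lipschitz_pd_bound:
 fixes f :: "real^'n => real"
 assumes "!!x. x : S ==> f differentiable (at x)" "!!x i. x : S ==> abs (pd i f x) <= C" "convex S" "x : S" "y : S"
 shows "abs (f x - f y) <= real CARD('n)*C*norm (x - y)"
proof -
 have "norm (f x - f y) <= (real CARD('n)*C)*norm (x - y)"
 proof (rule differentiable_bound[where S=S and f'="%x h. SS i. (h$i) *R pd i f x"])
  show "(f has_derivative (%h. SS i. (h$i) *R pd i f x)) (at x within S)" if "x : S" for x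
   using has_derivative_at_withinI[OF has_derivative_pd[OF assms(1)[OF that]]] .
  show "onorm (%h. SS i. (h$i) *R pd i f x) <= real CARD('n)*C" if "x : S" for x
   by (rule onorm_le) (use sum_components_le[of "%i. pd i f x" C] assms(2)[OF that] in simp)
 qed (use assms in auto)
 thus ?thesis by simp
qed

text \<open>The remainder, as a function of the increment, has a gradient that vanishes at 0 and is
  Lipschitz. The mean value inequality is applied twice: to \<open>pd i f\<close>, and to the
  remainder on the ball of radius \<open>norm h\<close>. The constant does not depend on
  \<open>x\<close>, since the remainder will be integrated.\<close>

lemma taylor_second_order_bound:
 fixes f :: "real^'n => real"
 assumes f: "smooth_on f UNIV" and C: "!!x i j. abs (pd i (pd j f) x) <= C"
 shows "abs (f (x + h) - f x - (SS i. (h$i) *R pd i f x)) <= real CARD('n)*(real CARD('n)*C)*(norm h)^2"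
proof -
 define g where "g k = f (x + k) - (SS i. (k$i) *R pd i f x)" for k
 let ?B = "real CARD('n)*C*norm h"
 have df: "f differentiable (at y)" for y using smooth_differentiable[OF f] by auto
 have gd: "(g has_derivative (%k. SS i. (k$i) *R (pd i f (x + y) - pd i f x))) (at y)" for y
 proof -
  have 1: "((%k. f (x + k)) has_derivative (%k. SS i. (k$i) *R pd i f (x + y))) (at y)"
  proof -
   have "((%k. x + k) has_derivative (%k. k)) (at y)" by (auto intro!: derivative_eq_intros)
   from has_derivative_compose[OF this has_derivative_pd[OF df]] show ?thesis .
  qed
  have 2: "((%k. SS i. (k$i) *R pd i f x) has_derivative (%k. SS i. (k$i) *R pd i f x)) (at y)"
   by (intro bounded_linear_imp_has_derivative bounded_linear_sum bounded_linear_scaleR_left bounded_linear_compose[OF bounded_linear_scaleR_left bounded_linear_vec_nth])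
  show ?thesis unfolding g_def using has_derivative_diff[OF 1 2] by (simp add: sum_subtractf[symmetric] right_diff_distrib[symmetric])
 qed
 have "norm (g h - g 0) <= (real CARD('n)*?B)*norm (h - 0)"
 proof (rule differentiable_bound[where S="cball 0 (norm h)"])
  show "(g has_derivative (%k. SS i. (k$i) *R (pd i f (x + y) - pd i f x))) (at y within cball 0 (norm h))" for y
   using has_derivative_at_withinI[OF gd] .
  show "onorm (%k. SS i. (k$i) *R (pd i f (x + y) - pd i f x)) <= real CARD('n)*?B" if "y : cball 0 (norm h)" for y
  proof (rule onorm_le)
   fix k :: "real^'n"
   have "abs (pd i f (x + y) - pd i f x) <= ?B" for i
   proof -
    have "abs (pd i f (x + y) - pd i f x) <= real CARD('n)*C*norm ((x + y) - x)"
     by (rule lipschitz_pd_bound[where S=UNIV]) (use C smooth_differentiable[OF smooth_pd[OF f]] in auto)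
    also have "... <= ?B" using that C[of undefined undefined undefined] by (intro mult_left_mono) (auto intro: order_trans[OF abs_ge_zero])
    finally show ?thesis .
   qed
   thus "norm (SS i. (k$i) *R (pd i f (x + y) - pd i f x)) <= real CARD('n)*?B*norm k"
    using sum_components_le[of "%i. pd i f (x + y) - pd i f x" ?B k] by simp
  qed
 qed auto
 thus ?thesis by (simp add: g_def power2_eq_square mult_ac)
qed

text \<open>Differentiability in a form that survives integration against a kernel and pointwise
  limits: a bound of the remainder is all that has to be carried along.\<close>

lemma has_derivative_quadratic_remainder:
 assumes "bounded_linear f'" "!!h. norm (f (x + h) - f x - f' h) <= C*(norm h)^2"
 shows "(f has_derivative f') (at x)" unfolding has_derivative_at
proof (intro conjI assms(1))
 show "(%h. norm (f (x + h) - f x - f' h) / norm h) \<midarrow>0\<rightarrow> 0"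
 proof (rule Lim_null_comparison[OF always_eventually])
  show "ALL h. norm (norm (f (x + h) - f x - f' h) / norm h) <= C*norm h"
  proof
   fix h
   show "norm (norm (f (x + h) - f x - f' h) / norm h) <= C*norm h"
    using assms(2)[of h] by (cases "h = 0") (auto simp: field_simps power2_eq_square)
  qed
  show "(%h. C*norm h) \<midarrow>0\<rightarrow> 0" by (auto intro!: tendsto_eq_intros)
 qed
qed

section \<open>Test functions and mollification\<close>

text \<open>Elements live on the whole space and vanish outside a compact subset of
  \<open>U\<close>, so all integrals run over \<open>lborel\<close>, and a smaller open set gives a
  subset of the test functions.\<close>

definition test_fun :: "(real^'n) set => (real^'n => real) set" where
 "test_fun U = {phi. smooth_on phi UNIV & (EX K. compact K & K <= U & (ALL x. x ~: K --> phi x = 0))}"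

lemma tf_smooth: "phi : test_fun U ==> smooth_on phi UNIV" by (simp add: test_fun_def)

lemma tf_diff: "phi : test_fun U ==> phi differentiable (at x)" using smooth_differentiable[OF tf_smooth] by auto

lemma tf_mono: "phi : test_fun U ==> U <= V ==> phi : test_fun V" by (auto simp: test_fun_def)

lemma tf_UNIV: "phi : test_fun U ==> phi : test_fun UNIV" by (rule tf_mono) auto

lemma tf_zero: "(%x. 0) : test_fun U" unfolding test_fun_def by (auto intro: smooth_const intro!: exI[of _ "{}"])

lemma tf_lincomb:
 assumes "phi : test_fun U" "psi : test_fun U"
 shows "(%x. phi x + c*psi x) : test_fun U"
proof -
 obtain K L where K: "compact K" "K <= U" "!!x. x ~: K ==> phi x = 0" and L: "compact L" "L <= U" "!!x. x ~: L ==> psi x = 0"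
  using assms unfolding test_fun_def by blast
 have "ALL x. x ~: K \<union> L --> phi x + c*psi x = 0" using K(3) L(3) by simp
 moreover have "smooth_on (%x. phi x + c*psi x) UNIV" using assms by (intro smooth_add smooth_mult smooth_const) (auto simp: test_fun_def)
 moreover have "compact (K \<union> L)" "K \<union> L <= U" using K L by auto
 ultimately show ?thesis unfolding test_fun_def by blast
qed

lemma tf_add: "phi : test_fun U ==> psi : test_fun U ==> (%x. phi x + psi x) : test_fun U" using tf_lincomb[of phi U psi 1] by simp

lemma tf_sum: "(!!i. i : I ==> f i : test_fun U) ==> (%x. \<Sum>i\<in>I. f i x) : test_fun U"
 by (induction I rule: infinite_finite_induct) (auto intro: tf_zero tf_add)

text \<open>The values of \<open>s\<close> outside \<open>U\<close> are irrelevant: \<open>U\<close>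
  and the complement of the compact support are open and cover the space, and the product is smooth
  on each of them.\<close>

lemma tf_mult:
 assumes "phi : test_fun U" "smooth_on s U" "open U"
 shows "(%x. phi x * s x) : test_fun U"
proof -
 obtain K where K: "compact K" "K <= U" "!!x. x ~: K ==> phi x = 0" using assms(1) unfolding test_fun_def by blast
 have o: "open (- K)" using K(1) by (simp add: compact_imp_closed open_Compl)
 have "smooth_on (%x. phi x * s x) UNIV"
 proof (rule smooth_local)
  fix x
  show "EX N. open N & x : N & smooth_on (%x. phi x * s x) N"
  proof (cases "x : K")
   case True
   thus ?thesis using K(2) assms(3) by (intro exI[of _ U]) (auto intro!: smooth_mult assms smooth_subset[OF tf_smooth[OF assms(1)]])
  next
   case False
   have "smooth_on (%x. phi x * s x) (- K)" by (subst smooth_cong[OF o, of _ "%_. 0"]) (auto simp: K(3) intro: smooth_const[OF o])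
   thus ?thesis using False o by (intro exI[of _ "- K"]) auto
  qed
 qed auto
 thus ?thesis unfolding test_fun_def using K by auto
qed

lemma tf_mult': "phi : test_fun U ==> smooth_on s U ==> open U ==> (%x. s x*phi x) : test_fun U" using tf_mult by (simp add: mult.commute)

lemma tf_cmult: "phi : test_fun U ==> (%x. c*phi x) : test_fun U" using tf_lincomb[OF tf_zero, of phi U c] by simp

lemma tf_pd:
 assumes "phi : test_fun U"
 shows "pd i phi : test_fun U"
proof -
 obtain K where K: "compact K" "K <= U" "!!x. x ~: K ==> phi x = 0" using assms(1) unfolding test_fun_def by blast
 have o: "open (- K)" using K(1) by (simp add: compact_imp_closed open_Compl)
 have "pd i phi x = 0" if "x ~: K" for x using pd_cong_open[OF o, of x phi "%_. 0"] K(3) that by (simp add: pd_const)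
 thus ?thesis using K smooth_pd[OF tf_smooth[OF assms]] unfolding test_fun_def by auto
qed

lemma tf_bounded:
 assumes "phi : test_fun U"
 obtains B where "B > 0" "!!x. abs (phi x) <= B"
proof -
 obtain K where K: "compact K" "!!x. x ~: K ==> phi x = 0" using assms(1) unfolding test_fun_def by blast
 have "bounded (phi ` K)" using smooth_continuous[OF tf_smooth[OF assms]] K(1)
  by (intro compact_imp_bounded compact_continuous_image) (auto intro: continuous_on_subset)
 then obtain B where B: "!!x. x : K ==> abs (phi x) <= B" by (auto simp: bounded_iff)
 have "abs (phi x) <= abs B + 1" for x using B[of x] K(2)[of x] by (cases "x : K") auto
 thus ?thesis by (intro that[of "abs B + 1"]) auto
qed

lemma tf_measurable[measurable]: "phi : test_fun U ==> phi : borel_measurable borel"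
 using smooth_continuous[OF tf_smooth] by (rule borel_measurable_continuous_onI)

lemma tf_integrable:
 assumes "phi : test_fun U"
 shows "integrable lborel phi"
proof -
 obtain K where K: "compact K" "!!x. x ~: K ==> phi x = 0" using assms(1) unfolding test_fun_def by blast
 have "integrable lborel (%x. indicator K x *R phi x)" using smooth_continuous[OF tf_smooth[OF assms]]
  by (intro borel_integrable_compact K(1)) (auto intro: continuous_on_subset)
 moreover have "(%x. indicator K x *R phi x) = phi" using K(2) by (auto simp: indicator_def fun_eq_iff)
 ultimately show ?thesis by simp
qed

lemma tf_L2: "phi : test_fun U ==> phi : L2 lborel"
 unfolding L2_def using tf_integrable[OF tf_mult[OF tf_UNIV, of phi U phi]] tf_smooth by (auto simp: power2_eq_square)

lemma tf_translate:
 assumes "phi : test_fun UNIV"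
 shows "(%y. phi (x - y)) : test_fun UNIV"
proof -
 obtain K where K: "compact K" "!!x. x ~: K ==> phi x = 0" using assms(1) unfolding test_fun_def by blast
 have "smooth_on (%y. phi (x - y)) UNIV" by (rule smooth_compose[OF _ open_UNIV _ tf_smooth[OF assms]])
   (auto intro!: smooth_diff smooth_const smooth_ident)
 moreover have "compact ((%y. x - y) ` K)" by (intro compact_continuous_image K continuous_intros)
 moreover have "y : (%y. x - y) ` K" if "x - y : K" for y using that by (intro image_eqI[of _ _ "x - y"]) auto
 ultimately show ?thesis unfolding test_fun_def using K(2) by blast
qed

lemma lborel_integral_translate:
 fixes f :: "real^'n => real"
 assumes "f : borel_measurable borel"
 shows "(LBINT x. f (c + x)) = (LBINT x. f x)"
proof -
 have "(LBINT x. f x) = (\<integral>x. f x \<partial>(distr lborel borel ((+) c)))" by (simp add: lborel_distr_plus)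
 also have "... = (LBINT x. f (c + x))" using assms by (subst integral_distr) auto
 finally show ?thesis by simp
qed

lemma lborel_nn_integral_affine:
 fixes f :: "real^'n => ennreal"
 assumes "f : borel_measurable borel" "c ~= 0"
 shows "(NN x. f x) = ennreal (abs c^CARD('n))*(NN x. f (t + c *R x))"
proof -
 have "(NN x. f x) = (\<integral>\<^sup>+x. f x \<partial>density (distr lborel borel (%x. t + c *R x)) (%_. ennreal (abs c^DIM(real^'n))))"
  using lborel_affine[OF assms(2), of t] by simp
 also have "... = ennreal (abs c^CARD('n))*(NN x. f (t + c *R x))"
  using assms(1) by (simp add: nn_integral_density nn_integral_distr nn_integral_cmult)
 finally show ?thesis .
qed

lemma lborel_nn_integral_reflect:
 fixes f :: "real^'n => ennreal"
 assumes "f : borel_measurable borel"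
 shows "(NN x. f (t - x)) = (NN x. f x)" using lborel_nn_integral_affine[OF assms, of "-1" t] by simp

text \<open>The integral of a difference quotient vanishes by translation invariance.\<close>

lemma integral_pd_tf:
 fixes f :: "real^'n => real"
 assumes f: "f : test_fun UNIV"
 shows "(LBINT x. pd i f x) = 0"
proof -
 obtain K where K: "compact K" "!!x. x ~: K ==> f x = 0" using f unfolding test_fun_def by blast
 obtain R where R: "!!x. x : K ==> norm x <= R" using compact_imp_bounded[OF K(1)] by (auto simp: bounded_iff)
 obtain B where B: "B > 0" "!!x. abs (pd i f x) <= B" using tf_bounded[OF tf_pd[OF f]] by metis
 define q where "q k x = (f (inverse (real (Suc k)) *R axis i 1 + x) - f x)*real (Suc k)" for k x
 have fm[measurable]: "f : borel_measurable borel" using f by (rule tf_measurable)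
 have fi: "integrable lborel f" using f by (rule tf_integrable)
 have fti: "integrable lborel (%x. f (c + x))" for c
 proof -
  have "integrable (distr lborel borel ((+) c)) f" using fi by (simp add: lborel_distr_plus)
  thus ?thesis by (subst (asm) integrable_distr_eq) auto
 qed
 have "(LBINT x. q k x) = 0" for k unfolding q_def using fi fti lborel_integral_translate[OF fm] by simp
 moreover have "(%k. LBINT x. q k x) ----> (LBINT x. pd i f x)"
 proof (rule integral_dominated_convergence[where w="%x. indicator (cball 0 (R + 1)) x*B"])
  show "integrable lborel (%x. indicator (cball 0 (R + 1)) x*B :: real)" using emeasure_bounded_finite[OF bounded_cball]
   by (intro integrable_mult_left integrable_real_indicator) auto
  have "pd i f : test_fun UNIV" by (rule tf_pd[OF f])
  thus "pd i f : borel_measurable lborel" by simp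
  show "AE x in lborel. (%k. q k x) ----> pd i f x"
  proof (rule AE_I2)
   fix x :: "real^'n"
   have "((%t. f (x + t *R axis i 1)) has_field_derivative pd i f (x + 0 *R axis i 1)) (at 0)" by (rule pd_line[OF tf_diff[OF f]])
   hence "(%t. (f (x + t *R axis i 1) - f x) / t) \<midarrow>0\<rightarrow> pd i f x" by (simp add: DERIV_def)
   moreover have "filterlim (%k. inverse (real (Suc k))) (at 0) sequentially"
    using LIMSEQ_inverse_real_of_nat unfolding filterlim_at by (simp del: of_nat_Suc)
   ultimately have "(%k. (f (x + inverse (real (Suc k)) *R axis i 1) - f x) / inverse (real (Suc k))) ----> pd i f x" by (rule filterlim_compose)
   thus "(%k. q k x) ----> pd i f x" by (simp add: q_def add.commute field_simps)
  qed
  show "AE x in lborel. norm (q k x) <= indicator (cball 0 (R + 1)) x*B" for k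
  proof (rule AE_I2)
   fix x :: "real^'n"
   let ?h = "inverse (real (Suc k))"
   have h: "0 < ?h" "?h <= 1" by (auto simp: field_simps)
   \<comment> \<open>Within radius \<open>R + 1\<close> the mean value theorem bounds the quotient
     by \<open>B\<close>; beyond it both points miss the support, as the step is at most 1.\<close>
   show "norm (q k x) <= indicator (cball 0 (R + 1)) x*B"
   proof (cases "norm x <= R + 1")
    case True
    obtain z where "0 < z" "z < ?h" "f (x + ?h *R axis i 1) - f (x + 0 *R axis i 1) = (?h - 0)*pd i f (x + z *R axis i 1)"
     using MVT2[OF h(1) pd_line[OF tf_diff[OF f]]] by blast
    hence "q k x = pd i f (x + z *R axis i 1)" by (simp add: q_def add.commute)
    thus ?thesis using True B(2) by simp
   next
    case False
    hence "x ~: K" using R[of x] by auto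
    moreover have "?h *R axis i 1 + x ~: K"
    proof
     assume "?h *R axis i 1 + x : K"
     hence "norm (?h *R axis i 1 + x) <= R" by (rule R)
     moreover have "norm x <= norm (?h *R axis i 1 + x) + norm (?h *R axis i (1::real))" by (metis add_diff_cancel_left' norm_triangle_ineq4)
     moreover have "norm (?h *R axis i (1::real)) <= 1" using h by simp
     ultimately show False using False by linarith
    qed
    ultimately show ?thesis using False K(2) by (simp add: q_def)
   qed
  qed
 qed (auto simp: q_def)
 ultimately have "(%k::nat. 0) ----> (LBINT x. pd i f x)" by simp
 thus ?thesis by (simp add: LIMSEQ_const_iff)
qed

lemma integral_pd_by_parts:
 assumes f: "f : test_fun UNIV" and g: "smooth_on g UNIV"
 shows "(LBINT x. pd i f x*g x) = - (LBINT x. f x*pd i g x)"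
proof -
 have t: "(%x. f x*g x) : test_fun UNIV" by (rule tf_mult[OF f g]) simp
 have "pd i (%x. f x*g x) x = f x*pd i g x + pd i f x*g x" for x by (rule pd_mult[OF tf_diff[OF f] smooth_differentiable[OF g]]) auto
 hence "0 = (LBINT x. f x*pd i g x + pd i f x*g x)" using integral_pd_tf[OF t, of i] by simp
 also have "... = (LBINT x. f x*pd i g x) + (LBINT x. pd i f x*g x)"
  by (intro LINT_add tf_integrable[where U=UNIV] tf_mult f tf_pd smooth_pd g) auto
 finally show ?thesis by simp
qed

section \<open>Convolution with a smooth kernel\<close>

text \<open>The counterpart, for functions that are merely in L^2, of membership in
  \<open>test_fun UNIV\<close>.\<close>

definition bounded_support :: "(real^'n => real) => bool" where
 "bounded_support v \<longleftrightarrow> (EX R. ALL x. norm x > R --> v x = 0)"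

lemma tf_bounded_support: "phi : test_fun U ==> bounded_support phi"
proof -
 assume "phi : test_fun U"
 then obtain K where K: "compact K" "!!x. x ~: K ==> phi x = 0" unfolding test_fun_def by blast
 obtain R where "!!x. x : K ==> norm x <= R" using compact_imp_bounded[OF K(1)] by (auto simp: bounded_iff)
 thus ?thesis unfolding bounded_support_def using K(2) by (metis not_le)
qed

lemma tfI_bounded_support:
 assumes "smooth_on phi UNIV" "bounded_support phi"
 shows "phi : test_fun UNIV"
proof -
 obtain R where "!!x. norm x > R ==> phi x = 0" using assms(2) by (auto simp: bounded_support_def)
 thus ?thesis unfolding test_fun_def using assms(1) by (auto intro!: exI[of _ "cball 0 R"])
qed

lemma bounded_support_lincomb:
 assumes "bounded_support u" "bounded_support v"
 shows "bounded_support (%x. u x + c * v x)"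
proof -
 obtain R S where RS: "!!x. norm x > R ==> u x = 0" "!!x. norm x > S ==> v x = 0" using assms unfolding bounded_support_def by blast
 thus ?thesis unfolding bounded_support_def by (intro exI[of _ "max R S"]) auto
qed

lemma bounded_support_mult: "bounded_support v ==> bounded_support (%x. s x * v x)" unfolding bounded_support_def by auto

lemma L2_bounded_support_integrable:
 fixes v :: "real^'n => real"
 assumes "v : L2 lborel" "bounded_support v"
 shows "integrable lborel v"
proof -
 obtain R where R: "!!x. norm x > R ==> v x = 0" using assms(2) by (auto simp: bounded_support_def)
 have "(%x::real^'n. indicator (cball 0 R) x :: real) : L2 lborel"
 proof -
  have sq: "(%x. (indicator (cball 0 R) x)^2) = (indicator (cball 0 R) :: real^'n => real)" by (rule ext) (simp add: indicator_def)
  have "integrable lborel (indicator (cball 0 R) :: real^'n => real)"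
   using emeasure_bounded_finite[OF bounded_cball, of "0::real^'n" R] by (intro integrable_real_indicator) auto
  thus ?thesis unfolding L2_def mem_Collect_eq sq by (simp add: borel_measurable_indicator)
 qed
 hence "integrable lborel (%x. indicator (cball 0 R) x * v x)" using L2_mult_integrable assms(1) by blast
 moreover have "indicator (cball 0 R) x * v x = v x" for x using R[of x] by (auto simp: indicator_def)
 ultimately show ?thesis by simp
qed

lemma L2_mult_bounded:
 assumes "v : L2 mu" "s : borel_measurable mu" "!!x. x : space mu ==> abs (s x) <= B"
 shows "(%x. s x * v x) : L2 mu" "L2_norm mu (%x. s x * v x) <= abs B*L2_norm mu v"
proof -
 have "(s x)^2 <= B^2" if "x : space mu" for x using assms(3)[OF that] by (metis abs_le_square_iff abs_ge_self order_trans power2_abs)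
 hence b: "(s x * v x)^2 <= (abs B * v x)^2" if "x : space mu" for x using that by (auto simp: power_mult_distrib intro: mult_right_mono)
 have i: "integrable mu (%x. (abs B * v x)^2)" using L2_scale[OF assms(1)] L2_integrable_square by blast
 have m: "(%x. s x * v x) : borel_measurable mu" using borel_measurable_times[OF assms(2) L2_measurable[OF assms(1)]] .
 have j: "integrable mu (%x. (s x * v x)^2)" by (rule Lint_bound[OF i]) (use m b in auto)
 thus "(%x. s x * v x) : L2 mu" using m by (simp add: L2_def)
 have "L2_norm mu (%x. s x * v x) <= L2_norm mu (%x. abs B * v x)" unfolding L2_norm_def using b by (intro real_sqrt_le_mono integral_mono i j) auto
 thus "L2_norm mu (%x. s x * v x) <= abs B*L2_norm mu v" by (simp add: L2_norm_scale)
qed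

lemma L2_mult_smooth:
 fixes v :: "real^'n => real"
 assumes "v : L2 lborel" "bounded_support v" "smooth_on s UNIV"
 shows "(%x. s x * v x) : L2 lborel"
proof -
 obtain R where R: "!!x. norm x > R ==> v x = 0" using assms(2) by (auto simp: bounded_support_def)
 have c: "continuous_on UNIV s" by (rule smooth_continuous[OF assms(3)])
 have "bounded (s ` cball 0 R)" by (intro compact_imp_bounded compact_continuous_image continuous_on_subset[OF c]) auto
 then obtain B where "ALL y:s ` cball 0 R. norm y <= B" unfolding bounded_iff by blast
 hence B: "!!x. norm x <= R ==> abs (s x) <= B" by auto
 hence B': "!!x. norm x <= R ==> abs (s x) <= abs B" using abs_ge_self order_trans by blast
 have [measurable]: "s : borel_measurable borel" using c by (rule borel_measurable_continuous_onI)
 have "(%x. (s x*indicator (cball 0 R) x) * v x) : L2 lborel"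
  by (rule L2_mult_bounded[OF assms(1), where B="abs B"]) (use B' in "auto simp: indicator_def")
 moreover have "(s x*indicator (cball 0 R) x) * v x = s x * v x" for x using R[of x] by (auto simp: indicator_def)
 ultimately show ?thesis by simp
qed

definition conv :: "(real^'n => real) => (real^'n => real) => real^'n => real" where
 "conv K v x = (LBINT y. K (x - y) * v y)"

lemma integrable_mult_bounded:
 fixes v s :: "'a => real"
 assumes "integrable M v" "s : borel_measurable M" "!!x. abs (s x) <= B"
 shows "integrable M (%x. s x * v x)"
proof (rule Lint_bound)
 show "integrable M (%x. B * v x)" using assms(1) by simp
 have "abs (s x) <= abs B" for x using assms(3)[of x] by linarith
 thus "AE x in M. norm (s x * v x) <= norm (B * v x)" by (auto simp: abs_mult intro!: mult_right_mono)
qed (use assms in auto)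

lemma conv_integrable:
 assumes "K : test_fun UNIV" "integrable lborel v"
 shows "integrable lborel (%y. K (x - y) * v y)"
proof -
 obtain B where "!!x. abs (K x) <= B" using tf_bounded[OF assms(1)] by metis
 thus ?thesis using tf_measurable[OF assms(1)] by (intro integrable_mult_bounded[OF assms(2)]) auto
qed

text \<open>The Taylor remainder of \<open>K\<close> is bounded by a multiple of
  \<open>(norm h)^2\<close> uniformly in the base point, and integrating it against \<open>v\<close>
  keeps the power of \<open>norm h\<close>.\<close>

lemma conv_has_derivative:
 fixes v :: "real^'n => real"
 assumes K: "K : test_fun UNIV" and v: "integrable lborel v"
 shows "(conv K v has_derivative (%h. SS i. (h$i) *R conv (pd i K) v x)) (at x)"
proof -
 have "ALL i j. EX B. ALL x. abs (pd i (pd j K) x) <= B" using tf_bounded[OF tf_pd[OF tf_pd[OF K]]] by metis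
 then obtain B where B: "!!i j x. abs (pd i (pd j K) x) <= B i j" by metis
 define C where "C = (SS i j. abs (B i j))"
 have BC: "abs (pd i (pd j K) x) <= C" for i j x
 proof -
  have "abs (B i j) <= (SS j. abs (B i j))" by (rule member_le_sum) auto
  also have "... <= C" unfolding C_def by (rule member_le_sum[where f="%i. SS j. abs (B i j)"]) (auto intro: sum_nonneg)
  finally show ?thesis using B[of i j x] by linarith
 qed
 let ?D = "real CARD('n)*(real CARD('n)*C)"
 let ?I = "LBINT y. abs (v y)"
 show ?thesis
 proof (rule has_derivative_quadratic_remainder[where C="?D*?I"])
  show "bounded_linear (%h. SS i. (h$i) *R conv (pd i K) v x)"
   by (intro bounded_linear_sum bounded_linear_compose[OF bounded_linear_scaleR_left bounded_linear_vec_nth])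
  fix h :: "real^'n"
  let ?r = "%z. K (z + h) - K z - (SS i. (h$i) *R pd i K z)"
  have r: "abs (?r z) <= ?D*(norm h)^2" for z by (rule taylor_second_order_bound[OF tf_smooth[OF K] BC])
  have i: "integrable lborel (%y. K ((x + h) - y) * v y)" "integrable lborel (%y. K (x - y) * v y)"
   "!!i. integrable lborel (%y. pd i K (x - y) * v y)" using conv_integrable[OF K v] conv_integrable[OF tf_pd[OF K] v] by auto
  have eq: "conv K v (x + h) - conv K v x - (SS i. (h$i) *R conv (pd i K) v x) = (LBINT y. ?r (x - y) * v y)"
  proof -
   have "(LBINT y. ?r (x - y) * v y) = (LBINT y. K ((x + h) - y) * v y - K (x - y) * v y - (SS i. (h$i)*(pd i K (x - y) * v y)))"
    by (intro LINT_cong) (auto simp: algebra_simps sum_distrib_left)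
   also have "... = conv K v (x + h) - conv K v x - (SS i. (h$i) * conv (pd i K) v x)" unfolding conv_def using i by simp
   finally show ?thesis by simp
  qed
  have "integrable lborel (%y. ?r (x - y) * v y)"
  proof (rule integrable_mult_bounded[OF v _ r])
   have "K : borel_measurable borel" "!!i. pd i K : borel_measurable borel" using tf_measurable[OF K] tf_measurable[OF tf_pd[OF K]] by auto
   thus "(%y. ?r (x - y)) : borel_measurable lborel" by simp
  qed
  hence int: "integrable lborel (%y. abs (?r (x - y) * v y))" by (rule integrable_abs)
  have "abs (LBINT y. ?r (x - y) * v y) <= (LBINT y. abs (?r (x - y) * v y))" by (rule integral_abs_bound)
  also have "... <= (LBINT y. (?D*(norm h)^2)*abs (v y))"
  proof (rule integral_mono[OF int])
   show "abs (?r (x - y) * v y) <= (?D*(norm h)^2)*abs (v y)" for y unfolding abs_mult by (rule mult_right_mono[OF r]) simp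
  qed (use v in simp)
  finally have "abs (LBINT y. ?r (x - y) * v y) <= (LBINT y. (?D*(norm h)^2)*abs (v y))" .
  thus "norm (conv K v (x + h) - conv K v x - (SS i. (h$i) *R conv (pd i K) v x)) <= ?D*?I*(norm h)^2" unfolding eq by (simp add: mult_ac)
 qed
qed

lemma conv_differentiable: "K : test_fun UNIV ==> integrable lborel v ==> conv K v differentiable (at x)"
 using conv_has_derivative differentiableI by blast

lemma conv_pd:
 assumes "K : test_fun UNIV" "integrable lborel v"
 shows "pd i (conv K v) x = conv (pd i K) v x"
proof -
 have "(SS j. (axis i 1$j) *R conv (pd j K) v x) = (SS j. if j = i then conv (pd j K) v x else 0)" by (rule sum.cong) (auto simp: axis_def)
 thus ?thesis using pd_eq[OF conv_has_derivative[OF assms, of x], of i] by simp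
qed

lemma conv_smooth:
 assumes "K : test_fun UNIV" "integrable lborel v"
 shows "smooth_on (conv K v) UNIV"
proof -
 have "Ck_on k (conv K v) UNIV" for k using assms(1)
 proof (induction k arbitrary: K)
  case 0
  thus ?case using conv_differentiable[OF _ assms(2)] by (auto intro!: continuous_at_imp_continuous_on differentiable_imp_continuous_within)
 next
  case (Suc k)
  show ?case by (rule Ck_on_SucI_pd[OF open_UNIV conv_has_derivative[OF Suc.prems assms(2)] Suc.IH[OF tf_pd[OF Suc.prems]]])
 qed
 thus ?thesis by (simp add: smooth_on_def)
qed

lemma conv_bounded_support:
 assumes "bounded_support K" "bounded_support v"
 shows "bounded_support (conv K v)"
proof -
 obtain R S where RS: "!!x. norm x > R ==> K x = 0" "!!x. norm x > S ==> v x = 0" using assms unfolding bounded_support_def by blast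
 have "conv K v x = 0" if "norm x > R + S" for x
 proof -
  have "K (x - y) * v y = 0" for y using RS(1)[of "x - y"] RS(2)[of y] that norm_triangle_ineq[of "x - y" y] by fastforce
  thus ?thesis unfolding conv_def by (simp only: lebesgue_integral_const) simp
 qed
 thus ?thesis unfolding bounded_support_def by blast
qed

lemma conv_tf:
 assumes "K : test_fun UNIV" "integrable lborel v" "bounded_support v"
 shows "conv K v : test_fun UNIV" by (rule tfI_bounded_support[OF conv_smooth[OF assms(1,2)]
    conv_bounded_support[OF tf_bounded_support[OF assms(1)] assms(3)]])

section \<open>Integral operators\<close>

lemma fubini_bounded_kernel:
 fixes v w :: "real^'n => real"
 assumes v: "integrable lborel v" and w: "integrable lborel w"
  and k[measurable]: "(%(x, y). k x y) : borel_measurable (borel \<Otimes>\<^sub>M borel)" and B: "!!x y. abs (k x y) <= B"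
 shows "(LBINT x. w x*(LBINT y. k x y * v y)) = (LBINT y. v y*(LBINT x. k x y*w x))"
proof -
 have [measurable]: "v : borel_measurable borel" "w : borel_measurable borel" using v w by (auto dest: borel_measurable_integrable)
 have 1: "integrable (lborel \<Otimes>\<^sub>M lborel) (%z. w (fst z) * v (snd z))"
 proof (rule lborel_pair.Fubini_integrable)
  show "integrable lborel (%x. LBINT y. norm (w (fst (x, y)) * v (snd (x, y))))" using w v by (simp add: abs_mult)
 qed (use v in auto)
 have "integrable (lborel \<Otimes>\<^sub>M lborel) (%z. (case z of (x, y) => k x y)*(w (fst z) * v (snd z)))"
  by (rule integrable_mult_bounded[OF 1, where B=B]) (use B in auto)
 hence 2: "integrable (lborel \<Otimes>\<^sub>M lborel) (%(x, y). w x*(k x y * v y))"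
  by (rule Bochner_Integration.integrable_cong[THEN iffD1, rotated -1]) (auto simp: mult_ac)
 have "(LBINT x. w x*(LBINT y. k x y * v y)) = (LBINT x. (LBINT y. w x*(k x y * v y)))" by simp
 also have "... = (LBINT y. (LBINT x. w x*(k x y * v y)))" using lborel_pair.Fubini_integral[OF 2] by simp
 also have "... = (LBINT y. v y*(LBINT x. k x y*w x))"
 proof -
  have "(LBINT x. w x*(k x y * v y)) = v y*(LBINT x. k x y*w x)" for y by (subst integral_mult_right_zero[symmetric]) (simp add: mult_ac)
  thus ?thesis by simp
 qed
 finally show ?thesis .
qed

text \<open>Cauchy--Schwarz in \<open>y\<close> with \<open>abs k\<close> split into two factors
  \<open>sqrt (abs k)\<close>, and then Tonelli. It yields the bounds that are uniform in the
  mollification parameter, for mollification itself and for Friedrichs' commutator.\<close>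

lemma schur_test:
 fixes v :: "real^'n => real"
 assumes v: "v : L2 lborel" and k[measurable]: "(%(x, y). k x y) : borel_measurable (borel \<Otimes>\<^sub>M borel)"
  and M: "M >= 0" "!!x. (NN y. ennreal (abs (k x y))) <= ennreal M" "!!y. (NN x. ennreal (abs (k x y))) <= ennreal M"
 shows "(%x. LBINT y. k x y * v y) : L2 lborel & L2_norm lborel (%x. LBINT y. k x y * v y) <= M*L2_norm lborel v"
proof (rule L2_if_nn_integral)
 have [measurable]: "v : borel_measurable borel" using v by (auto simp: L2_def)
 have pt: "ennreal ((LBINT y. k x y * v y)^2) <= ennreal M*(NN y. ennreal (abs (k x y)*(v y)^2))" for x
 proof -
  \<comment> \<open>If the integrand is not integrable, its Bochner integral is 0 and the bound is
    trivial.\<close>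
  have "ennreal (abs (LBINT y. k x y * v y)) <= (NN y. ennreal (abs (k x y * v y)))" using integral_norm_bound_ennreal[of lborel "%y. k x y * v y"]
   by (cases "integrable lborel (%y. k x y * v y)") (auto simp: not_integrable_integral_eq)
  hence "(ennreal (abs (LBINT y. k x y * v y)))^2 <= (NN y. ennreal (abs (k x y * v y)))^2" by (rule power_mono) simp
  also have "(%y. ennreal (abs (k x y * v y))) = (%y. ennreal (sqrt (abs (k x y)))*ennreal (sqrt (abs (k x y))*abs (v y)))"
   by (auto simp: abs_mult ennreal_mult'[symmetric] fun_eq_iff mult.assoc[symmetric])
  also have "(NN y. ennreal (sqrt (abs (k x y)))*ennreal (sqrt (abs (k x y))*abs (v y)))^2 \<le>
   (NN y. (ennreal (sqrt (abs (k x y))))^2)*(NN y. (ennreal (sqrt (abs (k x y))*abs (v y)))^2)" by (rule Cauchy_Schwarz_nn_integral) auto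
  also have "... = (NN y. ennreal (abs (k x y)))*(NN y. ennreal (abs (k x y)*(v y)^2))" by (simp add: ennreal_power power_mult_distrib)
  also have "... <= ennreal M*(NN y. ennreal (abs (k x y)*(v y)^2))" by (rule mult_right_mono[OF M(2)]) simp
  finally show ?thesis by (simp add: ennreal_power)
 qed
 have "(NN x. (NN y. ennreal (abs (k x y)*(v y)^2))) = (NN y. (NN x. ennreal (abs (k x y)*(v y)^2)))" by (rule lborel_pair.Fubini'[symmetric]) simp
 also have "... = (NN y. (NN x. ennreal (abs (k x y)))*ennreal ((v y)^2))" by (simp add: ennreal_mult' nn_integral_multc)
 also have "... <= (NN y. ennreal M*ennreal ((v y)^2))" by (intro nn_integral_mono mult_right_mono M(3)) simp
 also have "... = ennreal M*ennreal ((L2_norm lborel v)^2)" using L2_norm_nn[OF v] by (simp add: nn_integral_cmult)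
 finally have inner: "(NN x. (NN y. ennreal (abs (k x y)*(v y)^2))) <= ennreal M*ennreal ((L2_norm lborel v)^2)" .
 have "(NN x. ennreal ((LBINT y. k x y * v y)^2)) <= (NN x. ennreal M*(NN y. ennreal (abs (k x y)*(v y)^2)))" by (rule nn_integral_mono) (rule pt)
 also have "... = ennreal M*(NN x. (NN y. ennreal (abs (k x y)*(v y)^2)))" by (rule nn_integral_cmult) simp
 also have "... <= ennreal M*(ennreal M*ennreal ((L2_norm lborel v)^2))" by (rule mult_left_mono[OF inner]) simp
 also have "... = ennreal ((M*L2_norm lborel v)^2)" using M(1) by (simp add: ennreal_mult'[symmetric] power_mult_distrib power2_eq_square mult_ac)
 finally show "(NN x. ennreal ((LBINT y. k x y * v y)^2)) <= ennreal ((M*L2_norm lborel v)^2)" .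
 show "0 <= M*L2_norm lborel v" using M(1) L2_norm_nonneg[of lborel v] by simp
 show "(%x. LBINT y. k x y * v y) : borel_measurable lborel" by simp
qed

section \<open>Mollifiers\<close>

text \<open>The standard bump \<open>exp (- 1 / (1 - |x|^2))\<close> on the unit ball, extended by
  zero and not normalized.\<close>

definition bump0 :: "real^'n => real" where
 "bump0 x = flat_fn 0 (1 - x \<bullet> x)"

lemma bump0_tf: "bump0 : test_fun UNIV"
proof (rule tfI_bounded_support)
 show "smooth_on bump0 UNIV" unfolding bump0_def[abs_def] by (rule smooth_compose[OF _ open_UNIV _ smooth_flat_fn])
   (auto intro!: smooth_diff smooth_inner smooth_const smooth_ident)
 show "bounded_support bump0" unfolding bounded_support_def bump0_def
  by (intro exI[of _ 1]) (auto simp: flat_fn_eq_0_iff power2_norm_eq_inner[symmetric])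
qed

text \<open>The normalizing integral is left unevaluated, so unit mass follows once it is known to
  be positive. Its scaling like \<open>e^n\<close> enters in the L^1 norm of the
  derivatives.\<close>

definition moll :: "real => real^'n => real" where
 "moll e x = bump0 (inverse e *R x) / (LBINT y. bump0 (inverse e *R (y :: real^'n)))"

lemma bump0_scaled:
 assumes "e > 0"
 shows "(%x. bump0 (inverse e *R x)) : test_fun UNIV"
  and "bump0 (inverse e *R x) >= 0" "norm x > e ==> bump0 (inverse e *R x) = 0"
  and "pd i (%x. bump0 (inverse e *R x)) x = inverse e*pd i bump0 (inverse e *R x)"
proof -
 show 0: "norm x > e ==> bump0 (inverse e *R x) = 0" for x :: "real^'n"
  using assms by (auto simp: bump0_def flat_fn_eq_0_iff field_simps power2_norm_eq_inner[symmetric] power2_eq_square[symmetric])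
 show "(%x::real^'n. bump0 (inverse e *R x)) : test_fun UNIV"
 proof (rule tfI_bounded_support)
  show "smooth_on (%x::real^'n. bump0 (inverse e *R x)) UNIV" by (rule smooth_compose[OF _ open_UNIV _ tf_smooth[OF bump0_tf]])
    (auto intro!: smooth_bounded_linear[OF bounded_linear_scaleR_right] smooth_ident)
  show "bounded_support (%x::real^'n. bump0 (inverse e *R x))" unfolding bounded_support_def using 0 by blast
 qed
 show "bump0 (inverse e *R x) >= 0" by (simp add: bump0_def flat_fn_nonneg)
 have "((%x. inverse e *R x) has_derivative (%h. inverse e *R h)) (at x)" by (auto intro!: derivative_eq_intros)
 from has_derivative_compose[OF this] tf_diff[OF bump0_tf]
 have "((%x. bump0 (inverse e *R x)) has_derivative (%h. FD bump0 (inverse e *R x) (inverse e *R h))) (at x)"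
  by (auto simp: frechet_derivative_works)
 hence "pd i (%x. bump0 (inverse e *R x)) x = FD bump0 (inverse e *R x) (inverse e *R axis i 1)" by (rule pd_eq)
 thus "pd i (%x. bump0 (inverse e *R x)) x = inverse e*pd i bump0 (inverse e *R x)"
  by (simp only: linear_cmul[OF linear_frechet_derivative[OF tf_diff[OF bump0_tf]]]) (simp add: pd_def)
qed

lemma bump0_integral_pos: "(LBINT x. bump0 (x :: real^'n)) > 0"
proof -
 have i: "integrable lborel (bump0 :: real^'n => real)" by (rule tf_integrable[OF bump0_tf])
 have nn: "bump0 x >= 0" for x :: "real^'n" by (simp add: bump0_def flat_fn_nonneg)
 have "(LBINT x. bump0 (x :: real^'n)) ~= 0"
 proof
  assume "(LBINT x. bump0 (x :: real^'n)) = 0"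
  hence "AE x in lborel. bump0 (x :: real^'n) = 0" using integral_nonneg_eq_0_iff_AE[OF i] nn by simp
  hence "AE x in lborel. x ~: ball (0 :: real^'n) 1"
  proof eventually_elim
   fix x :: "real^'n" assume "bump0 x = 0"
   hence "1 <= (norm x)^2" by (simp add: bump0_def flat_fn_eq_0_iff power2_norm_eq_inner)
   thus "x ~: ball 0 1" using abs_square_less_1[of "norm x"] by simp
  qed
  hence "ball (0 :: real^'n) 1 : null_sets lborel" by (subst AE_iff_null_sets) auto
  hence "negligible (ball (0 :: real^'n) 1)" unfolding negligible_iff_null_sets by (rule null_sets_completionI)
  thus False using open_not_negligible[of "ball (0 :: real^'n) 1"] by simp
 qed
 moreover have "(LBINT x. bump0 (x :: real^'n)) >= 0" using nn by simp
 ultimately show ?thesis by linarith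
qed

lemma nn_integral_test_fun_scaled:
 fixes f :: "real^'n => real"
 assumes f: "f : test_fun UNIV" and e: "e > 0"
 shows "(NN x. ennreal (abs (f (inverse e *R x)))) = ennreal (e^CARD('n)*(LBINT x. abs (f x)))"
proof -
 have [measurable]: "f : borel_measurable borel" by (rule tf_measurable[OF f])
 have "(NN x. ennreal (abs (f (inverse e *R x)))) = ennreal (abs e^CARD('n))*(NN x. ennreal (abs (f (inverse e *R (0 + e *R x)))))"
  by (rule lborel_nn_integral_affine) (use e in auto)
 also have "(NN x. ennreal (abs (f (inverse e *R (0 + e *R x))))) = ennreal (LBINT x. abs (f x))"
  using e tf_integrable[OF f] by (subst nn_integral_eq_integral[symmetric]) auto
 finally show ?thesis using e by (simp add: ennreal_mult')
qed

lemma bump0_nonneg: "bump0 x >= 0" by (simp add: bump0_def flat_fn_nonneg)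

lemma bump0_scaled_integral:
 assumes "e > 0"
 shows "(LBINT x. bump0 (inverse e *R x :: real^'n)) = e^CARD('n)*(LBINT x. bump0 (x :: real^'n))"
proof -
 have "ennreal (LBINT x. bump0 (inverse e *R x :: real^'n)) = (NN x. ennreal (abs (bump0 (inverse e *R x :: real^'n))))"
  using tf_integrable[OF bump0_scaled(1)[OF assms]] by (subst nn_integral_eq_integral) (auto simp: bump0_nonneg)
 also have "... = ennreal (e^CARD('n)*(LBINT x. abs (bump0 (x :: real^'n))))" by (rule nn_integral_test_fun_scaled[OF bump0_tf assms])
 finally show ?thesis using assms by (subst (asm) ennreal_inj) (auto simp: bump0_nonneg)
qed

context
 fixes e :: real
 assumes e: "e > 0"
begin

lemma moll_tf: "moll e : test_fun (UNIV :: (real^'n) set)"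
proof -
 have "moll e = (%x. inverse (LBINT y. bump0 (inverse e *R (y :: real^'n)))*bump0 (inverse e *R (x :: real^'n)))"
  by (auto simp: moll_def fun_eq_iff divide_inverse mult.commute)
 thus ?thesis using tf_cmult[OF bump0_scaled(1)[OF e]] by simp
qed

lemma moll_nonneg: "moll e x >= 0" unfolding moll_def by (intro divide_nonneg_nonneg integral_nonneg_AE) (auto simp: bump0_nonneg)

lemma moll_even: "moll e (- x) = moll e x" by (simp add: moll_def bump0_def)

lemma moll_zero: "norm x > e ==> moll e x = 0" using bump0_scaled(3)[OF e, of x] by (simp add: moll_def)

lemma moll_nn_integral: "(NN x. ennreal (abs (moll e (x :: real^'n)))) = 1"
proof -
 let ?I = "LBINT y. bump0 (inverse e *R (y :: real^'n))"
 have I: "?I > 0" using bump0_scaled_integral[OF e, where 'n='n] bump0_integral_pos[where 'n='n] e by simp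
 have "(NN x. ennreal (abs (moll e (x :: real^'n)))) = ennreal (LBINT x. moll e (x :: real^'n))"
  using tf_integrable[OF moll_tf] by (subst nn_integral_eq_integral) (auto simp: moll_nonneg)
 also have "(LBINT x. moll e (x :: real^'n)) = 1" using I by (simp add: moll_def)
 finally show ?thesis by simp
qed

lemma pd_moll: "pd i (moll e) (x :: real^'n) = inverse e*pd i bump0 (inverse e *R x) / (LBINT y. bump0 (inverse e *R (y :: real^'n)))"
proof -
 have "moll e = (%x. inverse (LBINT y. bump0 (inverse e *R (y :: real^'n)))*bump0 (inverse e *R (x :: real^'n)))"
  by (auto simp: moll_def fun_eq_iff divide_inverse mult.commute)
 hence "pd i (moll e) x = pd i (%x. inverse (LBINT y. bump0 (inverse e *R (y :: real^'n)))*bump0 (inverse e *R (x :: real^'n))) x"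
  by (rule arg_cong)
 thus ?thesis unfolding pd_cmult[OF tf_diff[OF bump0_scaled(1)[OF e]]] bump0_scaled(4)[OF e, of i x] by (simp add: divide_inverse mult_ac)
qed

lemma pd_moll_odd: "pd i (moll e) (- x) = - pd i (moll e) (x :: real^'n)"
 using pd_reflect[of "moll e :: real^'n => real" 0 x i] tf_diff[OF moll_tf[where 'n='n]] by (simp add: moll_even)

lemma pd_moll_zero:
 assumes "norm (x :: real^'n) > e"
 shows "pd i (moll e) x = 0"
proof -
 have "open {x :: real^'n. norm x > e}" by (intro open_Collect_less continuous_intros)
 hence "pd i (moll e) x = pd i (%_. 0) x" by (rule pd_cong_open) (use assms moll_zero in auto)
 thus ?thesis by (simp add: pd_const)
qed

end

text \<open>The L^1 norm of \<open>e * pd i (moll e)\<close>, which is the same for all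
  \<open>e\<close>.\<close>

definition moll_const :: "'n::finite => real" where
 "moll_const i = (LBINT x. abs (pd i bump0 x)) / (LBINT x. bump0 (x :: real^'n))"

lemma moll_const_nonneg: "moll_const i >= 0" unfolding moll_const_def by (intro divide_nonneg_nonneg) (auto simp: bump0_nonneg)

lemma pd_moll_nn_integral:
 assumes e: "e > 0"
 shows "(NN x. ennreal (e*abs (pd i (moll e) (x :: real^'n)))) = ennreal (moll_const i)"
proof -
 define I where "I = (LBINT y. bump0 (inverse e *R (y :: real^'n)))"
 have I: "I = e^CARD('n)*(LBINT x. bump0 (x :: real^'n))" unfolding I_def by (rule bump0_scaled_integral[OF e])
 have Ip: "I > 0" unfolding I using e bump0_integral_pos[where 'n='n] by simp
 have [measurable]: "pd i bump0 : borel_measurable borel" by (rule tf_measurable[OF tf_pd[OF bump0_tf]])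
 have "(NN x. ennreal (e*abs (pd i (moll e) (x :: real^'n)))) = (NN x. ennreal (1 / I)*ennreal (abs (pd i bump0 (inverse e *R (x :: real^'n)))))"
 proof (rule nn_integral_cong)
  fix x :: "real^'n"
  have "e*abs (pd i (moll e) x) = 1 / I*abs (pd i bump0 (inverse e *R x))"
   unfolding pd_moll[OF e] I_def[symmetric] using e Ip by (simp add: abs_mult)
  thus "ennreal (e*abs (pd i (moll e) x)) = ennreal (1 / I)*ennreal (abs (pd i bump0 (inverse e *R x)))"
   using Ip by (simp add: ennreal_mult'[symmetric])
 qed
 also have "... = ennreal (1 / I)*ennreal (e^CARD('n)*(LBINT x. abs (pd i bump0 x)))"
  using nn_integral_test_fun_scaled[OF tf_pd[OF bump0_tf] e, of i] by (simp add: nn_integral_cmult)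
 also have "... = ennreal (moll_const i)" using e bump0_integral_pos[where 'n='n] by (simp add: ennreal_mult'[symmetric] I moll_const_def)
 finally show ?thesis .
qed

lemma nn_integral_shift:
 fixes f :: "real^'n => ennreal"
 assumes "f : borel_measurable borel"
 shows "(NN y. f (x - y)) = (NN y. f y)" "(NN y. f (y - x)) = (NN y. f y)"
 using lborel_nn_integral_reflect[OF assms, of x] lborel_nn_integral_affine[OF assms, of 1 "-x"] by auto

lemma kernel_measurable:
 fixes K :: "real^'n => real"
 assumes [measurable]: "K : borel_measurable borel"
 shows "(%(x, y). K (x - y)) : borel_measurable (borel \<Otimes>\<^sub>M borel)" by measurable

lemma conv_moll_L2:
 fixes v :: "real^'n => real"
 assumes "e > 0" "v : L2 lborel"
 shows "conv (moll e) v : L2 lborel" "L2_norm lborel (conv (moll e) v) <= L2_norm lborel v"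
proof -
 have m[measurable]: "moll e : borel_measurable (borel :: (real^'n) measure)" by (rule tf_measurable[OF moll_tf[OF assms(1)]])
 have mm: "(%x::real^'n. ennreal (abs (moll e x))) : borel_measurable borel" by measurable
 have sh: "(NN y. ennreal (abs (moll e (x - y)))) = 1" "(NN y. ennreal (abs (moll e (y - x)))) = 1" for x :: "real^'n"
  using nn_integral_shift[OF mm, of x] moll_nn_integral[OF assms(1), where 'n='n] by simp_all
 have "conv (moll e) v : L2 lborel & L2_norm lborel (conv (moll e) v) <= 1*L2_norm lborel v" unfolding conv_def[abs_def]
  by (rule schur_test[OF assms(2) kernel_measurable[OF m]]) (simp_all add: sh)
 thus "conv (moll e) v : L2 lborel" "L2_norm lborel (conv (moll e) v) <= L2_norm lborel v" by auto
qed

text \<open>On the support of the kernel the difference of the coefficients is at most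
  \<open>L * e\<close>, which cancels the factor \<open>1/e\<close> produced by differentiating the
  mollifier. The Schur test then gives a bound independent of \<open>e\<close>.\<close>

lemma friedrichs_commutator_L2:
 fixes v :: "real^'n => real"
 assumes e: "e > 0" and v: "v : L2 lborel" and a[measurable]: "a : borel_measurable borel"
  and L: "L >= 0" "!!x y. abs (a x - a y) <= L*norm (x - y)"
 shows "(%x. LBINT y. (a x - a y)*pd i (moll e) (x - y) * v y) : L2 lborel"
  "L2_norm lborel (%x. LBINT y. (a x - a y)*pd i (moll e) (x - y) * v y) <= L*moll_const i*L2_norm lborel v"
proof -
 have m[measurable]: "pd i (moll e) : borel_measurable (borel :: (real^'n) measure)" by (rule tf_measurable[OF tf_pd[OF moll_tf[OF e]]])
 have bd: "abs ((a x - a y)*pd i (moll e) (x - y)) <= L*(e*abs (pd i (moll e) (x - y)))" for x y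
 proof (cases "norm (x - y) > e")
  case True
  thus ?thesis using pd_moll_zero[OF e True] by simp
 next
  case False
  have "abs (a x - a y) <= L*e" using L(2)[of x y] L(1) False by (meson mult_left_mono not_le order_trans)
  thus ?thesis unfolding abs_mult mult.assoc[symmetric] by (rule mult_right_mono) simp
 qed
 have I: "(NN x. ennreal (L*(e*abs (pd i (moll e) (x :: real^'n))))) = ennreal (L*moll_const i)"
  using pd_moll_nn_integral[OF e, of i] L(1) e by (simp add: ennreal_mult' nn_integral_cmult moll_const_nonneg)
 have "(%x. LBINT y. ((a x - a y)*pd i (moll e) (x - y)) * v y) : L2 lborel &
  L2_norm lborel (%x. LBINT y. ((a x - a y)*pd i (moll e) (x - y)) * v y) <= (L*moll_const i)*L2_norm lborel v"
 proof (rule schur_test[OF v])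
  show "(%(x, y). (a x - a y)*pd i (moll e) (x - y)) : borel_measurable (borel \<Otimes>\<^sub>M borel)" by measurable
  show "0 <= L*moll_const i" by (rule mult_nonneg_nonneg[OF L(1) moll_const_nonneg])
  have mm: "(%z. ennreal (L*(e*abs (pd i (moll e) z)))) : borel_measurable (borel :: (real^'n) measure)" by measurable
  show "(NN y. ennreal (abs ((a x - a y)*pd i (moll e) (x - y)))) <= ennreal (L*moll_const i)" for x
  proof -
   have "(NN y. ennreal (abs ((a x - a y)*pd i (moll e) (x - y)))) <= (NN y. ennreal (L*(e*abs (pd i (moll e) (x - y)))))"
    by (intro nn_integral_mono ennreal_leI bd)
   thus ?thesis using nn_integral_shift(1)[OF mm, of x] I by simp
  qed
  show "(NN x. ennreal (abs ((a x - a y)*pd i (moll e) (x - y)))) <= ennreal (L*moll_const i)" for y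
  proof -
   have "(NN x. ennreal (abs ((a x - a y)*pd i (moll e) (x - y)))) <= (NN x. ennreal (L*(e*abs (pd i (moll e) (x - y)))))"
    by (intro nn_integral_mono ennreal_leI bd)
   thus ?thesis using nn_integral_shift(2)[OF mm, of y] I by simp
  qed
 qed
 thus "(%x. LBINT y. (a x - a y)*pd i (moll e) (x - y) * v y) : L2 lborel"
  "L2_norm lborel (%x. LBINT y. (a x - a y)*pd i (moll e) (x - y) * v y) <= L*moll_const i*L2_norm lborel v" by auto
qed

section \<open>Approximation by mollification, and cutoff functions\<close>

lemma tf_lipschitz:
 fixes phi :: "real^'n => real"
 assumes "phi : test_fun UNIV"
 obtains L where "L >= 0" "!!x y. abs (phi x - phi y) <= L*norm (x - y)"
proof -
 have "ALL i. EX B. ALL x. abs (pd i phi x) <= B" using tf_bounded[OF tf_pd[OF assms]] by metis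
 then obtain B where B: "!!i x. abs (pd i phi x) <= B i" by metis
 define C where "C = (SS i. abs (B i))"
 have C: "abs (pd i phi x) <= C" for i x
 proof -
  have "abs (B i) <= C" unfolding C_def by (rule member_le_sum) auto
  thus ?thesis using B[of i x] by linarith
 qed
 show ?thesis
 proof (rule that[of "real CARD('n)*C"])
  show "0 <= real CARD('n)*C" unfolding C_def by (intro mult_nonneg_nonneg sum_nonneg) auto
  show "abs (phi x - phi y) <= real CARD('n)*C*norm (x - y)" for x y by (rule lipschitz_pd_bound[where S=UNIV]) (use C tf_diff[OF assms] in auto)
 qed
qed

text \<open>The mollifier has unit mass and is supported in the ball of radius \<open>e\<close>,
  where a Lipschitz function varies by at most \<open>L * e\<close>. The bound is uniform in
  \<open>x\<close>.\<close>

lemma conv_moll_close: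
 fixes phi :: "real^'n => real"
 assumes e: "e > 0" and m: "phi : borel_measurable borel" and b: "!!x. abs (phi x) <= B"
  and L: "L >= 0" "!!x y. abs (phi x - phi y) <= L*norm (x - y)"
 shows "abs (conv (moll e) phi x - phi x) <= L*e"
proof -
 have mi: "integrable lborel (moll e :: real^'n => real)" by (rule tf_integrable[OF moll_tf[OF e]])
 have mt: "(%y. moll e (x - y)) : test_fun UNIV" by (rule tf_translate[OF moll_tf[OF e]])
 have i0: "integrable lborel (%y. moll e (x - y))" by (rule tf_integrable[OF mt])
 have i1: "integrable lborel (%y. phi y*moll e (x - y))" by (rule integrable_mult_bounded[OF i0 _ b]) (use m in simp)
 have one: "(LBINT y. moll e (x - y)) = 1"
 proof -
  have "ennreal (LBINT y. moll e (x - y)) = (NN y. ennreal (abs (moll e (x - y))))"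
   using i0 by (subst nn_integral_eq_integral) (auto simp: moll_nonneg[OF e])
  also have "... = (\<integral>\<^sup>+y. ennreal (abs (moll e y)) \<partial>(lborel :: (real^'n) measure))"
   by (rule nn_integral_shift(1)[of "%y. ennreal (abs (moll e y))"]) (use tf_measurable[OF moll_tf[OF e, where 'n='n]] in simp)
  also have "... = 1" by (rule moll_nn_integral[OF e])
  finally show ?thesis by (simp add: ennreal_eq_1)
 qed
 have "conv (moll e) phi x - phi x = (LBINT y. phi y*moll e (x - y) - phi x*moll e (x - y))" using i0 i1 one by (simp add: conv_def mult.commute)
 also have "abs ... <= (LBINT y. abs (phi y*moll e (x - y) - phi x*moll e (x - y)))" by (rule integral_abs_bound)
 also have "... <= (LBINT y. (L*e)*moll e (x - y))"
 proof (rule integral_mono)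
  show "integrable lborel (%y. abs (phi y*moll e (x - y) - phi x*moll e (x - y)))" using i0 i1 by auto
  show "integrable lborel (%y. (L*e)*moll e (x - y))" using i0 by simp
  show "abs (phi y*moll e (x - y) - phi x*moll e (x - y)) <= (L*e)*moll e (x - y)" for y
  proof (cases "norm (x - y) > e")
   case True thus ?thesis by (simp add: moll_zero[OF e True])
  next
   case False
   have "abs (phi y - phi x) <= L*e" using L(2)[of x y] mult_left_mono[OF _ L(1), of "norm (x - y)" e] False by (simp add: abs_minus_commute)
   hence "abs (phi y - phi x)*moll e (x - y) <= (L*e)*moll e (x - y)" by (rule mult_right_mono[OF _ moll_nonneg[OF e]])
   thus ?thesis by (simp add: left_diff_distrib[symmetric] abs_mult moll_nonneg[OF e])
  qed
 qed
 also have "... = L*e" using one by simp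
 finally show ?thesis .
qed

lemma conv_even_adjoint:
 fixes v w :: "real^'n => real"
 assumes K: "K : test_fun UNIV" and v: "integrable lborel v" and w: "integrable lborel w"
 shows "(LBINT x. w x * conv K v x) = (LBINT y. v y*(LBINT x. K (x - y)*w x))"
proof -
 obtain B where B: "!!x. abs (K x) <= B" using tf_bounded[OF K] by metis
 show ?thesis unfolding conv_def by (rule fubini_bounded_kernel[OF v w kernel_measurable[OF tf_measurable[OF K]] B])
qed

text \<open>The mollifier is even, so it can be moved to the test function, where mollification
  converges uniformly; integrability of \<open>v\<close> then suffices.\<close>

lemma conv_moll_weak_limit:
 fixes v :: "real^'n => real"
 assumes v: "integrable lborel v" and phi: "phi : test_fun UNIV"
 shows "(%k. LBINT x. conv (moll (1 / Suc k)) v x*phi x) ----> (LBINT x. v x*phi x)"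
proof -
 obtain L where L: "L >= 0" "!!x y. abs (phi x - phi y) <= L*norm (x - y)" using tf_lipschitz[OF phi] by blast
 obtain B where B: "!!x. abs (phi x) <= B" using tf_bounded[OF phi] by metis
 let ?m = "%k. moll (1 / real (Suc k))"
 have phii: "integrable lborel phi" by (rule tf_integrable[OF phi])
 have phim: "phi : borel_measurable borel" by (rule tf_measurable[OF phi])
 have eq: "(LBINT x. conv (?m k) v x*phi x) = (LBINT y. conv (?m k) phi y * v y)" for k
 proof -
  have "(LBINT x. phi x * conv (?m k) v x) = (LBINT y. v y*(LBINT x. ?m k (x - y)*phi x))" by (rule conv_even_adjoint[OF moll_tf v phii]) simp
  moreover have "?m k (x - y) = ?m k (y - x)" for x y :: "real^'n" using moll_even[of "1 / real (Suc k)" "x - y"] by simp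
  ultimately show ?thesis by (simp add: conv_def mult.commute)
 qed
 have close: "abs (conv (?m k) phi y - phi y) <= L*(1 / Suc k)" for k y by (rule conv_moll_close[OF _ phim B L]) simp
 have cm: "conv (?m k) phi : borel_measurable borel" for k
  using smooth_continuous[OF conv_smooth[OF moll_tf phii, of "1 / real (Suc k)"]] by (intro borel_measurable_continuous_onI) auto
 have iv: "integrable lborel (%y. phi y * v y)" by (rule integrable_mult_bounded[OF v _ B]) (use phim in simp)
 have dm: "(%y. conv (?m k) phi y - phi y) : borel_measurable lborel" for k using cm phim by simp
 have id: "integrable lborel (%y. (conv (?m k) phi y - phi y) * v y)" for k by (rule integrable_mult_bounded[OF v dm close])
 have "(%k. (LBINT y. (conv (?m k) phi y - phi y) * v y)) ----> 0"
 proof (rule tendsto_null_bound)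
  show "abs (LBINT y. (conv (?m k) phi y - phi y) * v y) <= L*(1 / Suc k)*(LBINT y. abs (v y))" for k
  proof -
   have "abs (LBINT y. (conv (?m k) phi y - phi y) * v y) <= (LBINT y. abs ((conv (?m k) phi y - phi y) * v y))" by (rule integral_abs_bound)
   also have "... <= (LBINT y. L*(1 / Suc k)*abs (v y))"
   proof (rule integral_mono)
    show "abs ((conv (?m k) phi y - phi y) * v y) <= L*(1 / Suc k)*abs (v y)" for y unfolding abs_mult by (rule mult_right_mono[OF close]) simp
   qed (use id v in auto)
   finally show ?thesis by simp
  qed
  show "(%k. L*(1 / Suc k)*(LBINT y. abs (v y))) ----> L*0*(LBINT y. abs (v y))" by (intro tendsto_mult tendsto_const LIMSEQ_Suc[OF lim_1_over_n])
 qed simp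
 hence "(%k. (LBINT y. (conv (?m k) phi y - phi y) * v y) + (LBINT y. phi y * v y)) ----> 0 + (LBINT y. phi y * v y)"
  by (intro tendsto_add tendsto_const)
 moreover have "(LBINT y. (conv (?m k) phi y - phi y) * v y) + (LBINT y. phi y * v y) = (LBINT y. conv (?m k) phi y * v y)" for k
 proof -
  have "(LBINT y. (conv (?m k) phi y - phi y) * v y + phi y * v y) = (LBINT y. conv (?m k) phi y * v y)"
   by (intro LINT_cong) (auto simp: algebra_simps)
  thus ?thesis using LINT_add[OF id[of k] iv] by simp
 qed
 ultimately show ?thesis unfolding eq by (simp add: mult.commute)
qed

text \<open>Mollifying the indicator of the closed \<open>2d\<close>-neighbourhood of
  \<open>K\<close> at scale \<open>d\<close> gives 1 on the \<open>d\<close>-neighbourhood and 0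
  outside the \<open>3d\<close>-neighbourhood; \<open>d = e/4\<close> keeps the latter inside
  \<open>W\<close>.\<close>

lemma cutoff_exists:
 fixes W :: "(real^'n) set"
 assumes K: "compact K" "K <= W" and W: "open W"
 obtains f N where "f : test_fun W" "!!x. 0 <= f x" "!!x. f x <= 1" "open N" "K <= N" "N <= W" "!!x. x : N ==> f x = 1"
proof -
 obtain e where e: "e > 0" "(\<Union>x\<in>K. ball x e) <= W" using compact_subset_open_imp_ball_epsilon_subset[OF K(1) W K(2)] .
 define d where "d = e / 4"
 have d: "d > 0" using e by (simp add: d_def)
 define V where "V s = {x + y | x y. x : K & y : cball 0 s}" for s
 have V: "compact (V s)" for s unfolding V_def by (rule compact_sums[OF K(1) compact_cball])
 have VW: "V (3*d) <= W"
 proof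
  fix x assume "x : V (3*d)"
  then obtain k y where "x = k + y" "k : K" "norm y <= 3*d" by (auto simp: V_def)
  thus "x : W" using e d by (intro subsetD[OF e(2)] UN_I[of k]) (auto simp: d_def dist_norm)
 qed
 have VI: "y : V (s + t)" if x: "x : V s" "norm (y - x) <= t" for x y s t
 proof -
  obtain k z where "x = k + z" "k : K" "norm z <= s" using x(1) by (auto simp: V_def)
  thus ?thesis unfolding V_def using x(2) norm_triangle_ineq[of z "y - x"] by (intro CollectI exI[of _ k] exI[of _ "z + (y - x)"]) auto
 qed
 have [simp]: "d + d = 2*d" "2*d + d = 3*d" by simp_all
 define f where "f = conv (moll d) (indicator (V (2*d)))"
 have i: "integrable lborel (indicator (V (2*d)) :: real^'n => real)"
  using V by (intro integrable_real_indicator emeasure_compact_finite) (auto intro: borel_compact)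
 have f: "ennreal (f x) = (NN y. ennreal (abs (moll d (x - y)))*indicator (V (2*d)) y)" for x
  unfolding f_def conv_def using conv_integrable[OF moll_tf[OF d] i]
  by (subst nn_integral_eq_integral[symmetric]) (auto simp: moll_nonneg[OF d] indicator_def intro!: nn_integral_cong)
 have one: "(NN y. ennreal (abs (moll d (x - y)))) = 1" for x :: "real^'n" using tf_measurable[OF moll_tf[OF d, where 'n='n]]
  by (subst nn_integral_shift(1)[of "%y. ennreal (abs (moll d y))" x]) (simp_all add: moll_nn_integral[OF d])
 have f0: "f x >= 0" for x unfolding f_def conv_def by (intro LINT_nonneg) (simp add: moll_nonneg[OF d])
 show ?thesis
 proof (rule that[of f "\<Union>x\<in>K. ball x d"])
  have "f x = 0" if "x ~: V (3*d)" for x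
  proof -
   have "moll d (x - y)*indicator (V (2*d)) y = 0" for y
    using VI[of y "2*d" x d] that moll_zero[OF d, of "x - y"] by (fastforce simp: indicator_def not_le)
   thus ?thesis unfolding f_def conv_def by (simp only: lebesgue_integral_const) simp
  qed
  thus "f : test_fun W" unfolding test_fun_def f_def using V VW conv_smooth[OF moll_tf[OF d] i] by blast
  show "f x = 1" if xN: "x : (\<Union>x\<in>K. ball x d)" for x
  proof -
   obtain k where k: "k : K" "dist x k < d" using xN by (auto simp: dist_commute)
   hence "x = k + (x - k)" "x - k : cball 0 d" by (simp_all add: dist_norm norm_minus_commute)
   hence x: "x : V d" unfolding V_def using k(1) by blast
   have "ennreal (abs (moll d (x - y)))*indicator (V (2*d)) y = ennreal (abs (moll d (x - y)))" for y
    using VI[OF x, of y d] moll_zero[OF d, of "x - y"] by (cases "d < norm (x - y)") (auto simp: norm_minus_commute)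
   thus ?thesis using f[of x] one[of x] by (simp add: ennreal_eq_1)
  qed
  show "f x <= 1" for x
  proof -
   have "ennreal (f x) <= (NN y. ennreal (abs (moll d (x - y))))" unfolding f by (intro nn_integral_mono) (auto simp: indicator_def)
   thus ?thesis using one[of x] by simp
  qed
  show "(\<Union>x\<in>K. ball x d) <= W" by (rule order_trans[OF _ e(2)]) (use d in "force simp: d_def")
 qed (use f0 d in auto)
qed

section \<open>Weak derivatives and elliptic regularity\<close>

definition weak_pd :: "'n::finite => (real^'n => real) => (real^'n => real) => bool" where
 "weak_pd i v g \<longleftrightarrow> (ALL phi:test_fun UNIV. L2_inner lborel v (pd i phi) = - L2_inner lborel g phi)"

lemma weak_pdD: "weak_pd i v g ==> phi : test_fun UNIV ==> L2_inner lborel v (pd i phi) = - L2_inner lborel g phi" by (simp add: weak_pd_def)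

lemma weak_pd_tf:
 assumes "v : test_fun UNIV"
 shows "weak_pd i v (pd i v)" unfolding weak_pd_def L2_inner_def using integral_pd_by_parts[OF assms tf_smooth] by fastforce

text \<open>The translate \<open>%y. K (x - y)\<close> is itself an admissible test function; the
  sign from the reflection cancels the sign in \<open>weak_pd\<close>.\<close>

lemma conv_weak_pd:
 assumes K: "K : test_fun UNIV" and w: "weak_pd i v g"
 shows "conv (pd i K) v x = conv K g x"
proof -
 have t: "(%y. K (x - y)) : test_fun UNIV" by (rule tf_translate[OF K])
 have "pd i (%y. K (x - y)) = (%y. - pd i K (x - y))" using pd_reflect[OF tf_diff[OF K]] by (rule ext)
 hence "(LBINT y. v y*(- pd i K (x - y))) = - (LBINT y. g y*K (x - y))" using weak_pdD[OF w t] by (simp add: L2_inner_def)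
 thus ?thesis by (simp add: conv_def mult.commute)
qed

lemma L2_norm_mult_bounded_le:
 assumes "v : L2 mu" "s : borel_measurable mu" "!!x. abs (s x) <= B"
 shows "L2_norm mu (%x. s x * v x) <= B*L2_norm mu v"
proof -
 have "0 <= B" using assms(3) abs_ge_zero order_trans by blast
 thus ?thesis using L2_mult_bounded(2)[OF assms(1,2), of B] assms(3) by simp
qed

text \<open>Coefficients are global, bounded together with their first derivatives, and uniformly
  elliptic. An equation on an open set is brought into this situation by cutting off and extending
  its coefficients by the identity matrix.\<close>

locale elliptic_coefficients =
 fixes a :: "'n::finite => 'n => real^'n => real" and A lam :: real
 assumes a_smooth: "!!i j. smooth_on (a i j) UNIV"
  and a_bound: "!!i j x. abs (a i j x) <= A" and pd_a_bound: "!!i j k x. abs (pd k (a i j) x) <= A"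
  and lam_pos: "lam > 0"
  and elliptic: "!!x xi. lam*(SS i. (xi i)^2) <= (SS i j. a i j x*(xi i * xi j))"
begin

text \<open>The equation sum d_j (a_ij d_i v) = F0 + sum d_i F_i in the sense of distributions. All
  derivatives rest on \<open>phi\<close>, since \<open>v\<close> is only in L^2.\<close>

definition weak_solution :: "(real^'n => real) => (real^'n => real) => ('n => real^'n => real) => bool" where
 "weak_solution v F0 F \<longleftrightarrow> (ALL phi:test_fun UNIV.
  (SS i j. L2_inner lborel v (pd i (%x. a i j x*pd j phi x))) =
  L2_inner lborel F0 phi - (SS i. L2_inner lborel (F i) (pd i phi)))"

lemma a_measurable[measurable]: "a i j : borel_measurable borel" by (rule borel_measurable_continuous_onI[OF smooth_continuous[OF a_smooth]])

lemma pd_a_measurable[measurable]: "pd k (a i j) : borel_measurable borel"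
 by (rule borel_measurable_continuous_onI[OF smooth_continuous[OF smooth_pd[OF a_smooth]]])

lemma A_nonneg: "A >= 0" using a_bound[of undefined undefined undefined] by linarith

lemma a_pd_tf: "phi : test_fun UNIV ==> (%x. a i j x*pd j phi x) : test_fun UNIV" by (rule tf_mult'[OF tf_pd a_smooth]) auto

lemma pd_a_pd:
 assumes "phi : test_fun UNIV"
 shows "pd i (%x. a i j x*pd j phi x) = (%x. a i j x*pd i (pd j phi) x + 1*(pd i (a i j) x*pd j phi x))"
 using pd_mult[OF smooth_differentiable[OF a_smooth] tf_diff[OF tf_pd[OF assms]]] by (simp add: fun_eq_iff)

lemma L2_integrable_prod: "u : L2 lborel ==> v : L2 lborel ==> integrable lborel (%x. u x * v x)" by (rule L2_mult_integrable)

text \<open>Friedrichs' method: the mollified solution satisfies the equation up to a commutator that is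
 bounded in \<open>L^2\<close>, so testing with the mollified solution itself bounds its gradient.\<close>

lemma mollified_gradient_bound:
 assumes v: "v : L2 lborel" "bounded_support v" and F0: "F0 : L2 lborel" and F: "!!i. F i : L2 lborel"
  and sol: "weak_solution v F0 F"
 obtains Q where "!!e i. e > 0 ==> L2_norm lborel (pd i (conv (moll e) v)) <= Q"
proof -
 let ?n = "L2_norm lborel" and ?ip = "L2_inner lborel"
 define L where "L = real CARD('n)*A"
 have L0: "L >= 0" using A_nonneg by (simp add: L_def)
 have Lip: "abs (a i j x - a i j y) <= L*norm (x - y)" for i j x y
  unfolding L_def by (rule lipschitz_pd_bound[where S=UNIV]) (use pd_a_bound smooth_differentiable[OF a_smooth] in auto)
 define K1 where "K1 = (\<Sum>i\<in>(UNIV::'n set). \<Sum>j\<in>(UNIV::'n set). L*moll_const i*?n v + A*?n v) + (SS i. ?n (F i))"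
 define K0 where "K0 = ?n F0*?n v"
 have K1_nonneg: "K1 >= 0" unfolding K1_def by (intro add_nonneg_nonneg sum_nonneg mult_nonneg_nonneg L2_norm_nonneg L0 A_nonneg moll_const_nonneg)
 have K0_nonneg: "K0 >= 0" unfolding K0_def by (intro mult_nonneg_nonneg L2_norm_nonneg)
 have vi: "integrable lborel v" by (rule L2_bounded_support_integrable[OF v])
 have bound: "?n (pd i (conv (moll e) v)) <= 1 + (K1 + K0) / lam" if e: "e > 0" for e i
 proof -
  let ?m = "moll e :: real^'n => real"
  note mt = moll_tf[OF e, where 'n='n]
  define ve where "ve = conv ?m v"
  define w where "w j = pd j ve" for j
  \<comment> \<open>The test function is \<open>v\<close> mollified twice: moving one mollification
    to the other factor leaves the gradient of \<open>ve\<close> on both sides.\<close>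
  define psi where "psi = conv ?m ve"
  have ve: "ve : test_fun UNIV" unfolding ve_def by (rule conv_tf[OF mt vi v(2)])
  have w: "w j : test_fun UNIV" for j unfolding w_def by (rule tf_pd[OF ve])
  note vei = tf_integrable[OF ve] and wi = tf_integrable[OF w] and wL = tf_L2[OF w]
  have psi: "psi : test_fun UNIV" unfolding psi_def by (rule conv_tf[OF mt vei tf_bounded_support[OF ve]])
  have w_eq: "w j = conv (pd j ?m) v" for j unfolding w_def ve_def using conv_pd[OF mt vi] by (rule ext)
  have pdpsi: "pd j psi = conv ?m (w j)" for j
   unfolding psi_def w_def using conv_pd[OF mt vei] conv_weak_pd[OF mt weak_pd_tf[OF ve]] by (simp add: fun_eq_iff)
  have pdpdpsi: "pd i (pd j psi) = conv (pd i ?m) (w j)" for i j unfolding pdpsi using conv_pd[OF mt wi] by (rule ext)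
  have ve_le: "?n ve <= ?n v" unfolding ve_def by (rule conv_moll_L2(2)[OF e v(1)])
  have psi_le: "?n psi <= ?n v" unfolding psi_def using conv_moll_L2(2)[OF e tf_L2[OF ve]] ve_le by linarith
  have pdpsi_le: "?n (pd j psi) <= ?n (w j)" for j unfolding pdpsi by (rule conv_moll_L2(2)[OF e wL])
  define S where "S = sqrt (SS i. (?n (w i))^2)"
  have S2: "S^2 = (SS i. (?n (w i))^2)" unfolding S_def by (simp add: sum_nonneg)
  have S0: "S >= 0" unfolding S_def by (simp add: sum_nonneg)
  have wS: "?n (w j) <= S" for j
  proof (rule power2_le_imp_le[OF _ S0])
   show "(?n (w j))^2 <= S^2" unfolding S2 by (rule member_le_sum) auto
  qed
  define av where "av i j = (%x. a i j x * v x)" for i j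
  have avi: "integrable lborel (av i j)" for i j unfolding av_def by (rule integrable_mult_bounded[OF vi _ a_bound]) simp
  define R where "R i j x = (LBINT y. (a i j x - a i j y)*pd i ?m (x - y) * v y)" for i j x
  have R: "R i j : L2 lborel" "?n (R i j) <= L*moll_const i*?n v" for i j unfolding R_def[abs_def]
   using friedrichs_commutator_L2[OF e v(1) _ L0 Lip] by (auto intro: borel_measurable_continuous_onI)
  \<comment> \<open>Friedrichs' identity: multiplication by \<open>a i j\<close> commutes with the
    mollified derivative up to \<open>R i j\<close>, which is bounded in L^2 uniformly in
    \<open>e\<close>.\<close>
  have awR: "a i j x*w i x = conv (pd i ?m) (av i j) x + R i j x" for i j x
  proof -
   have "R i j x = (LBINT y. a i j x*(pd i ?m (x - y) * v y) - pd i ?m (x - y)*av i j y)"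
    unfolding R_def av_def by (intro LINT_cong) (auto simp: algebra_simps)
   also have "... = a i j x * conv (pd i ?m) v x - conv (pd i ?m) (av i j) x"
    using conv_integrable[OF tf_pd[OF mt] vi] conv_integrable[OF tf_pd[OF mt] avi] by (simp add: conv_def)
   finally show ?thesis by (simp add: w_eq)
  qed
  have convL2: "conv (pd i ?m) (av i j) : L2 lborel" for i j
  proof -
   have "conv (pd i ?m) (av i j) = (%x. a i j x*w i x + (-1) * R i j x)" using awR by (auto simp: fun_eq_iff)
   moreover have "(%x. a i j x*w i x) : L2 lborel" by (rule L2_mult_bounded(1)[OF wL _ a_bound]) simp
   ultimately show ?thesis using L2_lincomb[OF _ R(1)[of i j], of "%x. a i j x*w i x" "-1"] by simp
  qed
  have adj: "?ip (w j) (conv (pd i ?m) (av i j)) = - ?ip v (%x. a i j x*pd i (pd j psi) x)" for i j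
  proof -
   have r: "(LBINT x. pd i ?m (x - y)*w j x) = - conv (pd i ?m) (w j) y" for y
   proof -
    have "pd i ?m (x - y) = - pd i ?m (y - x)" for x using pd_moll_odd[OF e, of i "y - x"] by simp
    thus ?thesis by (simp add: conv_def)
   qed
   have "?ip (w j) (conv (pd i ?m) (av i j)) = (LBINT y. av i j y*(LBINT x. pd i ?m (x - y)*w j x))"
    unfolding L2_inner_def by (rule conv_even_adjoint[OF tf_pd[OF mt] avi wi])
   thus ?thesis unfolding r by (simp add: L2_inner_def pdpdpsi av_def mult_ac)
  qed
  have trm: "?ip v (pd i (%x. a i j x*pd j psi x)) = - ?ip (w j) (conv (pd i ?m) (av i j)) + ?ip v (%x. pd i (a i j) x*pd j psi x)" for i j
  proof -
   have "(%x. a i j x*pd i (pd j psi) x) : L2 lborel" by (rule L2_mult_bounded(1)[OF tf_L2[OF tf_pd[OF tf_pd[OF psi]]] _ a_bound]) simp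
   moreover have "(%x. pd i (a i j) x*pd j psi x) : L2 lborel" by (rule L2_mult_bounded(1)[OF tf_L2[OF tf_pd[OF psi]] _ pd_a_bound]) simp
   ultimately show ?thesis unfolding pd_a_pd[OF psi] adj using L2_inner_lincomb_right[OF v(1), of "%x. a i j x*pd i (pd j psi) x" _ 1] by simp
  qed
  have energy: "(SS i j. ?ip (w j) (%x. a i j x*w i x)) =
    (SS i j. ?ip (w j) (R i j) + ?ip v (%x. pd i (a i j) x*pd j psi x))
    - ?ip F0 psi + (SS i. ?ip (F i) (pd i psi))"
  proof -
   have "?ip (w j) (%x. a i j x*w i x) = ?ip (w j) (R i j) + ?ip v (%x. pd i (a i j) x*pd j psi x) - ?ip v (pd i (%x. a i j x*pd j psi x))" for i j
    unfolding awR trm using L2_inner_add_right[OF wL convL2 R(1)] by simp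
   hence "(SS i j. ?ip (w j) (%x. a i j x*w i x)) =
    (SS i j. ?ip (w j) (R i j) + ?ip v (%x. pd i (a i j) x*pd j psi x))
    - (SS i j. ?ip v (pd i (%x. a i j x*pd j psi x)))" by (simp only: sum_subtractf)
   thus ?thesis using sol[unfolded weak_solution_def, rule_format, OF psi] by simp
  qed
  have "lam*S^2 <= (SS i j. ?ip (w j) (%x. a i j x*w i x))"
  proof -
   have i1: "integrable lborel (%x. w j x*(a i j x*w i x))" for i j by (rule L2_integrable_prod[OF wL L2_mult_bounded(1)[OF wL _ a_bound]]) simp
   have i2: "integrable lborel (%x. (w i x)^2)" for i using wL L2_integrable_square by blast
   have "lam*S^2 = (LBINT x. lam*(SS i. (w i x)^2))"
   proof -
    have nw: "(?n (w i))^2 = (LBINT x. (w i x)^2)" for i unfolding L2_norm_sq by (simp add: L2_inner_def power2_eq_square)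
    show ?thesis unfolding S2 nw using i2 by simp
   qed
   also have "... <= (LBINT x. (SS i j. w j x*(a i j x*w i x)))"
   proof (rule integral_mono)
    show "integrable lborel (%x. SS i j. w j x*(a i j x*w i x))" by (intro Lint_sum i1)
    show "lam*(SS i. (w i x)^2) <= (SS i j. w j x*(a i j x*w i x))" for x using elliptic[of "%i. w i x" x] by (simp add: mult_ac)
   qed (use i2 in auto)
   also have "... = (SS i j. ?ip (w j) (%x. a i j x*w i x))" using i1 by (simp add: L2_inner_def)
   finally show ?thesis .
  qed
  also have "... <= S*K1 + K0"
  proof -
   have tb: "?ip (w j) (R i j) + ?ip v (%x. pd i (a i j) x*pd j psi x) <= S*(L*moll_const i*?n v + A*?n v)" for i j
   proof -
    have "?ip (w j) (R i j) <= ?n (w j)*?n (R i j)" using L2_Cauchy_Schwarz[OF wL[of j] R(1)[of i j]] by simp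
    also have "... <= S*(L*moll_const i*?n v)" by (intro mult_mono wS R S0 L2_norm_nonneg)
    finally have 1: "?ip (w j) (R i j) <= S*(L*moll_const i*?n v)" .
    have "?n (%x. pd i (a i j) x*pd j psi x) <= A*?n (pd j psi)" by (rule L2_norm_mult_bounded_le[OF tf_L2[OF tf_pd[OF psi]] _ pd_a_bound]) simp
    also have "... <= A*S" using pdpsi_le[of j] wS[of j] by (intro mult_left_mono A_nonneg) linarith
    finally have "?n v * ?n (%x. pd i (a i j) x*pd j psi x) <= ?n v * (A*S)" by (intro mult_left_mono L2_norm_nonneg)
    moreover have "?ip v (%x. pd i (a i j) x*pd j psi x) <= ?n v * ?n (%x. pd i (a i j) x*pd j psi x)"
    proof -
     have "(%x. pd i (a i j) x*pd j psi x) : L2 lborel" by (rule L2_mult_bounded(1)[OF tf_L2[OF tf_pd[OF psi]] _ pd_a_bound]) simp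
     thus ?thesis using L2_Cauchy_Schwarz[OF v(1), of "%x. pd i (a i j) x*pd j psi x"] by linarith
    qed
    ultimately show ?thesis using 1 by (simp add: algebra_simps)
   qed
   have "(SS i j. ?ip (w j) (R i j) + ?ip v (%x. pd i (a i j) x*pd j psi x)) \<le>
    (\<Sum>i\<in>(UNIV::'n set). \<Sum>j\<in>(UNIV::'n set). S*(L*moll_const i*?n v + A*?n v))" by (intro sum_mono tb)
   also have "... = S*(\<Sum>i\<in>(UNIV::'n set). \<Sum>j\<in>(UNIV::'n set). L*moll_const i*?n v + A*?n v)" by (simp only: sum_distrib_left)
   finally have 1: "(SS i j. ?ip (w j) (R i j) + ?ip v (%x. pd i (a i j) x*pd j psi x)) \<le>
    S*(\<Sum>i\<in>(UNIV::'n set). \<Sum>j\<in>(UNIV::'n set). L*moll_const i*?n v + A*?n v)" .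
   have "abs (?ip F0 psi) <= ?n F0*?n psi" by (rule L2_Cauchy_Schwarz[OF F0 tf_L2[OF psi]])
   also have "... <= K0" unfolding K0_def by (intro mult_left_mono psi_le L2_norm_nonneg)
   finally have 2: "- ?ip F0 psi <= K0" by simp
   have Fb: "?ip (F i) (pd i psi) <= S*?n (F i)" for i
   proof -
    have "?ip (F i) (pd i psi) <= ?n (F i)*?n (pd i psi)" using L2_Cauchy_Schwarz[OF F[of i] tf_L2[OF tf_pd[OF psi, of i]]] by simp
    also have "... <= ?n (F i)*S" using pdpsi_le[of i] wS[of i] by (intro mult_left_mono L2_norm_nonneg) linarith
    finally show ?thesis by (simp add: mult.commute)
   qed
   have "(SS i. ?ip (F i) (pd i psi)) <= (SS i. S*?n (F i))" by (intro sum_mono Fb)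
   hence 3: "(SS i. ?ip (F i) (pd i psi)) <= S*(SS i. ?n (F i))" by (simp only: sum_distrib_left)
   show ?thesis unfolding energy K1_def distrib_left using 1 2 3 by linarith
  qed
  finally have fin: "lam*S^2 <= S*K1 + K0" .
  \<comment> \<open>For \<open>S > 1\<close> the term \<open>K0\<close> is at most
    \<open>S * K0\<close>, and one factor \<open>S\<close> cancels.\<close>
  have "S <= 1 + (K1 + K0) / lam"
  proof (cases "S <= 1")
   case True
   have "0 <= (K1 + K0) / lam" using K1_nonneg K0_nonneg lam_pos by simp
   thus ?thesis using True by linarith
  next
   case False
   hence "K0 <= S*K0" using K0_nonneg by (simp add: mult_le_cancel_right1)
   hence "S*(lam*S) <= S*(K1 + K0)" using fin by (simp add: power2_eq_square algebra_simps)
   hence "lam*S <= K1 + K0" using False by simp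
   hence "S <= (K1 + K0) / lam" using lam_pos by (simp add: pos_le_divide_eq mult.commute)
   thus ?thesis by simp
  qed
  thus ?thesis using wS[of i] unfolding w_def ve_def by linarith
 qed
 thus ?thesis using that by blast
qed

end

text \<open>The offset 2 makes the argument exceed 1 on the open set \<open>|x|^2 < R^2 + 1\<close>,
  so that on the closed ball of radius \<open>abs R\<close> not only is the value 1 but the
  derivatives vanish.\<close>

definition ball_cutoff :: "real => real^'n => real" where
 "ball_cutoff R x = smooth_step (2 + R^2 - x \<bullet> x)"

lemma ball_cutoff:
 shows ball_cutoff_tf: "ball_cutoff R : test_fun UNIV"
  and ball_cutoff_1: "norm x <= abs R ==> ball_cutoff R x = 1"
  and pd_ball_cutoff_0: "norm x <= abs R ==> pd i (ball_cutoff R) x = 0"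
proof -
 have sq: "x \<bullet> x = (norm x)^2" for x :: "real^'n" by (simp add: power2_norm_eq_inner)
 show "ball_cutoff R : test_fun (UNIV :: (real^'n) set)"
 proof (rule tfI_bounded_support)
  show "smooth_on (ball_cutoff R :: real^'n => real) UNIV" unfolding ball_cutoff_def[abs_def]
   by (rule smooth_compose[OF _ open_UNIV _ smooth_smooth_step]) (auto intro!: smooth_diff smooth_inner smooth_const smooth_ident)
  have "ball_cutoff R x = 0" if "norm x > R^2 + 2" for x :: "real^'n"
  proof -
   have "(norm x)^2 >= norm x*1" unfolding power2_eq_square using that by (intro mult_left_mono) (auto intro: order_trans[of 1 "2 + R^2"])
   thus ?thesis using that unfolding ball_cutoff_def sq by (intro smooth_step_0) simp
  qed
  thus "bounded_support (ball_cutoff R :: real^'n => real)" unfolding bounded_support_def by blast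
 qed
 let ?S = "{x :: real^'n. x \<bullet> x < R^2 + 1}"
 have 1: "ball_cutoff R x = 1" if "x : ?S" for x :: "real^'n" using that unfolding ball_cutoff_def by (intro smooth_step_1) auto
 have S: "x : ?S" if "norm x <= abs R" for x using that power_mono[of "norm x" "abs R" 2] by (simp add: sq)
 show "norm x <= abs R ==> ball_cutoff R x = 1" using 1 S by blast
 show "pd i (ball_cutoff R) x = 0" if "norm x <= abs R"
 proof -
  have "open ?S" by (intro open_Collect_less continuous_intros)
  hence "pd i (ball_cutoff R) x = pd i (%_. 1) x" by (rule pd_cong_open[OF _ S[OF that] 1])
  thus ?thesis by (simp add: pd_const)
 qed
qed

text \<open>In the limit the mollified derivatives bound \<open>(v, pd i phi)\<close> by
  \<open>Q\<close> times the norm of \<open>phi\<close>, so this functional is represented by an L^2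
  function \<open>g\<close>. Multiplying \<open>g\<close> by a cutoff that is 1 where
  \<open>v\<close> lives gives it bounded support and does not affect the pairing.\<close>

lemma weak_pd_exists:
 fixes v :: "real^'n => real"
 assumes v: "v : L2 lborel" "bounded_support v"
  and Q: "!!e. e > 0 ==> L2_norm lborel (pd i (conv (moll e) v)) <= Q"
 shows "EX g. g : L2 lborel & bounded_support g & weak_pd i v g"
proof -
 have vi: "integrable lborel v" by (rule L2_bounded_support_integrable[OF v])
 have bd: "abs (- L2_inner lborel v (pd i phi)) <= Q*L2_norm lborel phi" if phi: "phi : test_fun UNIV" for phi
 proof -
  let ?m = "%k. moll (1 / real (Suc k)) :: real^'n => real"
  have t: "conv (?m k) v : test_fun UNIV" for k by (rule conv_tf[OF moll_tf vi v(2)]) simp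
  have "abs (L2_inner lborel (conv (?m k) v) (pd i phi)) <= Q*L2_norm lborel phi" for k
  proof -
   have "abs (L2_inner lborel (conv (?m k) v) (pd i phi)) = abs (L2_inner lborel (pd i (conv (?m k) v)) phi)"
    using weak_pdD[OF weak_pd_tf[OF t[of k]] phi, of i] by simp
   also have "... <= L2_norm lborel (pd i (conv (?m k) v))*L2_norm lborel phi" by (rule L2_Cauchy_Schwarz[OF tf_L2[OF tf_pd[OF t]] tf_L2[OF phi]])
   also have "... <= Q*L2_norm lborel phi" by (intro mult_right_mono Q L2_norm_nonneg) simp
   finally show ?thesis .
  qed
  moreover have "(%k. abs (L2_inner lborel (conv (?m k) v) (pd i phi))) ----> abs (L2_inner lborel v (pd i phi))"
   unfolding L2_inner_def by (rule tendsto_rabs[OF conv_moll_weak_limit[OF vi tf_pd[OF phi]]])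
  ultimately have "abs (L2_inner lborel v (pd i phi)) <= Q*L2_norm lborel phi" by (intro Lim_bounded[where M=0]) auto
  thus ?thesis by simp
 qed
 have "EX g s. g : L2 lborel & (ALL j. s j : test_fun UNIV) & L2_lim lborel s g & (ALL phi:test_fun UNIV. - L2_inner lborel v (pd i phi) = L2_inner lborel g phi)"
 proof (rule L2_riesz[where C=Q, OF _ _ tf_lincomb _ bd])
  show "test_fun UNIV <= L2 (lborel :: (real^'n) measure)" using tf_L2 by blast
  show "test_fun UNIV ~= ({} :: (real^'n => real) set)" using tf_zero by blast
  fix phi psi :: "real^'n => real" and c :: real
  assume t: "phi : test_fun UNIV" "psi : test_fun UNIV"
  have "pd i (%x. phi x + c*psi x) = (%x. pd i phi x + c*pd i psi x)" using pd_add[OF tf_diff[OF t(1)] tf_diff[OF tf_cmult[OF t(2)]]]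
    pd_cmult[OF tf_diff[OF t(2)]] by (simp add: fun_eq_iff)
  thus "- L2_inner lborel v (pd i (%x. phi x + c*psi x)) = - L2_inner lborel v (pd i phi) + c * - L2_inner lborel v (pd i psi)"
   using L2_inner_lincomb_right[OF v(1) tf_L2[OF tf_pd[OF t(1)]] tf_L2[OF tf_pd[OF t(2)]]] by simp
 qed
 then obtain g where g: "g : L2 lborel" "!!phi. phi : test_fun UNIV ==> - L2_inner lborel v (pd i phi) = L2_inner lborel g phi" by blast
 obtain R where R: "!!x. norm x > R ==> v x = 0" using v(2) unfolding bounded_support_def by blast
 define cut where "cut = (ball_cutoff R :: real^'n => real)"
 have cut: "cut : test_fun UNIV" unfolding cut_def by (rule ball_cutoff_tf)
 obtain B where B: "!!x. abs (cut x) <= B" using tf_bounded[OF cut] by metis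
 define h where "h = (%x. cut x*g x)"
 have "h : L2 lborel" unfolding h_def by (rule L2_mult_bounded(1)[OF g(1) _ B]) (use tf_measurable[OF cut] in simp)
 moreover have "bounded_support h" using tf_bounded_support[OF cut] unfolding bounded_support_def h_def by auto
 moreover have "weak_pd i v h" unfolding weak_pd_def
 proof
  fix phi :: "real^'n => real" assume phi: "phi : test_fun UNIV"
  have t: "(%x. cut x*phi x) : test_fun UNIV" by (rule tf_mult[OF cut tf_smooth[OF phi]]) simp
  have eq: "v x*pd i (%x. cut x*phi x) x = v x*pd i phi x" for x
  proof (cases "norm x > R")
   case False
   hence n: "norm x <= abs R" by simp
   show ?thesis using pd_mult[OF tf_diff[OF cut] tf_diff[OF phi], of i x]
     ball_cutoff_1[OF n] pd_ball_cutoff_0[OF n, of i] by (simp add: cut_def)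
  qed (use R in simp)
  have "L2_inner lborel v (pd i phi) = L2_inner lborel v (pd i (%x. cut x*phi x))" by (simp only: L2_inner_def eq)
  also have "... = - L2_inner lborel g (%x. cut x*phi x)" using g(2)[OF t] by simp
  finally show "L2_inner lborel v (pd i phi) = - L2_inner lborel h phi" by (simp add: L2_inner_def h_def mult_ac)
 qed
 ultimately show ?thesis by blast
qed

section \<open>Sobolev spaces of functions with bounded support\<close>

text \<open>The Sobolev space H^m, restricted to bounded support. The support condition at every
  level keeps products with arbitrary smooth functions in the space, whatever their growth.\<close>

primrec Hc :: "nat => (real^'n => real) => bool" where
 "Hc 0 v \<longleftrightarrow> v : L2 lborel & bounded_support v"
| "Hc (Suc m) v \<longleftrightarrow> v : L2 lborel & bounded_support v & (ALL i. EX g. weak_pd i v g & Hc m g)"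

lemma Hc_L2: "Hc m v ==> v : L2 lborel"
 and Hc_bounded_support: "Hc m v ==> bounded_support v"
 by (cases m; simp)+

lemma Hc_Suc_imp: "Hc (Suc m) v ==> Hc m v"
proof (induction m arbitrary: v)
 case (Suc m)
 thus ?case by (metis Hc.simps(2))
qed simp

lemma Hc_lincomb:
 assumes "Hc m u" "Hc m v"
 shows "Hc m (%x. u x + c * v x)" using assms
proof (induction m arbitrary: u v)
 case 0
 thus ?case by (simp add: L2_lincomb bounded_support_lincomb)
next
 case (Suc m)
 have "EX g. weak_pd i (%x. u x + c * v x) g & Hc m g" for i
 proof -
  obtain g h where gh: "weak_pd i u g" "Hc m g" "weak_pd i v h" "Hc m h" using Suc.prems by (meson Hc.simps(2))
  have "weak_pd i (%x. u x + c * v x) (%x. g x + c*h x)" unfolding weak_pd_def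
  proof
   fix phi :: "real^'a => real" assume phi: "phi : test_fun UNIV"
   show "L2_inner lborel (%x. u x + c * v x) (pd i phi) = - L2_inner lborel (%x. g x + c*h x) phi"
    using L2_inner_lincomb_left[OF tf_L2[OF tf_pd[OF phi, of i]] Hc_L2[OF Suc.prems(1)] Hc_L2[OF Suc.prems(2)], of c]
     L2_inner_lincomb_left[OF tf_L2[OF phi] Hc_L2[OF gh(2)] Hc_L2[OF gh(4)], of c]
     weak_pdD[OF gh(1) phi] weak_pdD[OF gh(3) phi] by (simp add: algebra_simps)
  qed
  thus ?thesis using Suc.IH[OF gh(2,4)] by blast
 qed
 moreover have "(%x. u x + c * v x) : L2 lborel" "bounded_support (%x. u x + c * v x)"
  using Suc.prems by (auto intro: L2_lincomb bounded_support_lincomb)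
 ultimately show ?case by simp
qed

lemma Hc_zero: "Hc m (%x. 0)"
proof (induction m)
 case (Suc m)
 have "weak_pd i (%x. 0) (%x. 0)" for i :: 'a by (simp add: weak_pd_def L2_inner_def)
 thus ?case using Suc by (auto simp: L2_zero bounded_support_def)
qed (auto simp: L2_zero bounded_support_def)

lemma Hc_sum:
 assumes "!!j. j : J ==> Hc m (f j)"
 shows "Hc m (%x. \<Sum>j\<in>J. f j x)" using assms
proof (induction J rule: infinite_finite_induct)
 case (insert j J)
 thus ?case using Hc_lincomb[of m "f j" "%x. \<Sum>j\<in>J. f j x" 1] by simp
qed (auto simp: Hc_zero)

text \<open>Leibniz's rule, from testing the weak derivative with \<open>s * phi\<close>. The factor
  1 makes the result literally an instance of \<open>Hc_lincomb\<close>.\<close>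

lemma weak_pd_mult:
 assumes s: "smooth_on s UNIV" and w: "weak_pd i v g"
  and v: "v : L2 lborel" "bounded_support v" and g: "g : L2 lborel" "bounded_support g"
 shows "weak_pd i (%x. s x * v x) (%x. s x*g x + 1*(pd i s x * v x))" unfolding weak_pd_def
proof
 fix phi :: "real^'a => real" assume phi: "phi : test_fun UNIV"
 have t: "(%x. s x*phi x) : test_fun UNIV" by (rule tf_mult'[OF phi s]) simp
 have t2: "(%x. pd i s x*phi x) : test_fun UNIV" by (rule tf_mult'[OF phi smooth_pd[OF s]]) simp
 have "pd i (%x. s x*phi x) = (%x. s x*pd i phi x + pd i s x*phi x)"
  using pd_mult[OF smooth_differentiable[OF s] tf_diff[OF phi]] by (simp add: fun_eq_iff)
 hence "L2_inner lborel (%x. s x * v x) (pd i phi) = L2_inner lborel v (%x. pd i (%x. s x*phi x) x - pd i s x*phi x)"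
  by (simp add: L2_inner_def mult_ac)
 also have "... = L2_inner lborel v (pd i (%x. s x*phi x)) - L2_inner lborel v (%x. pd i s x*phi x)"
  by (rule L2_inner_diff_right[OF v(1) tf_L2[OF tf_pd[OF t]] tf_L2[OF t2]])
 also have "... = - L2_inner lborel g (%x. s x*phi x) - L2_inner lborel v (%x. pd i s x*phi x)" by (simp add: weak_pdD[OF w t])
 also have "... = - (L2_inner lborel (%x. s x*g x) phi + 1*L2_inner lborel (%x. pd i s x * v x) phi)" by (simp add: L2_inner_def mult_ac)
 also have "... = - L2_inner lborel (%x. s x*g x + 1*(pd i s x * v x)) phi"
  using L2_inner_lincomb_left[OF tf_L2[OF phi] L2_mult_smooth[OF g s] L2_mult_smooth[OF v smooth_pd[OF s, of i]], of 1] by simp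
 finally show "L2_inner lborel (%x. s x * v x) (pd i phi) = - L2_inner lborel (%x. s x*g x + 1*(pd i s x * v x)) phi" .
qed

lemma Hc_mult:
 assumes "smooth_on s UNIV" "Hc m v"
 shows "Hc m (%x. s x * v x)" using assms
proof (induction m arbitrary: s v)
 case 0
 thus ?case by (simp add: L2_mult_smooth bounded_support_mult)
next
 case (Suc m)
 have "EX g. weak_pd i (%x. s x * v x) g & Hc m g" for i
 proof -
  obtain g where g: "weak_pd i v g" "Hc m g" using Suc.prems by (meson Hc.simps(2))
  have "Hc m (%x. s x*g x + 1*(pd i s x * v x))"
   by (rule Hc_lincomb[OF Suc.IH[OF Suc.prems(1) g(2)] Suc.IH[OF smooth_pd[OF Suc.prems(1)] Hc_Suc_imp[OF Suc.prems(2)]]])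
  thus ?thesis using weak_pd_mult[OF Suc.prems(1) g(1)] Hc_L2[OF g(2)] Hc_bounded_support[OF g(2)] Suc.prems(2) by auto
 qed
 thus ?case using Suc.prems by (simp add: L2_mult_smooth bounded_support_mult)
qed

context elliptic_coefficients
begin

text \<open>The equation for \<open>v\<close> is tested with \<open>pd k phi\<close>, and
  \<open>pd k\<close> is commuted past the coefficients. The commutator
  \<open>pd k (a i j) * g i\<close> contains only first derivatives of \<open>v\<close> and joins
  the divergence terms, where the regularity already known for \<open>g\<close> is enough.\<close>

lemma weak_solution_pd:
 assumes sol: "weak_solution v F0 F" and vL: "v : L2 lborel" "bounded_support v"
  and g: "!!i. weak_pd i v (g i)" "!!i. g i : L2 lborel" "!!i. bounded_support (g i)"
  and f0: "weak_pd k F0 f0" and f: "!!i. weak_pd k (F i) (f i)" "!!i. f i : L2 lborel"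
 shows "weak_solution (g k) f0 (%j x. f j x + (-1)*(SS i. pd k (a i j) x*g i x))" unfolding weak_solution_def
proof
 fix phi :: "real^'n => real" assume phi: "phi : test_fun UNIV"
 let ?ip = "L2_inner lborel"
 have p: "pd l phi : test_fun UNIV" for l by (rule tf_pd[OF phi])
 have comm: "pd i (pd j psi) = pd j (pd i psi)" if "psi : test_fun UNIV" for i j psi
  using pd_commute[OF tf_smooth[OF that]] by (simp add: fun_eq_iff)
 have ta: "(%x. pd k (a i j) x*pd j phi x) : test_fun UNIV" for i j by (rule tf_mult'[OF p smooth_pd[OF a_smooth]]) simp
 have 1: "?ip (g k) (pd i (%x. a i j x*pd j phi x)) = ?ip (%x. pd k (a i j) x*g i x) (pd j phi) - ?ip v (pd i (%x. a i j x*pd j (pd k phi) x))" for i j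
 proof -
  have t1: "(%x. a i j x*pd j (pd k phi) x) : test_fun UNIV" by (rule a_pd_tf[OF p])
  have eq1: "pd k (%x. a i j x*pd j phi x) = (%x. a i j x*pd j (pd k phi) x + pd k (a i j) x*pd j phi x)"
  proof (rule ext)
   fix x
   have "pd k (%x. a i j x*pd j phi x) x = a i j x*pd k (pd j phi) x + pd k (a i j) x*pd j phi x"
    by (rule pd_mult[OF smooth_differentiable[OF a_smooth] tf_diff[OF p]]) auto
   thus "pd k (%x. a i j x*pd j phi x) x = a i j x*pd j (pd k phi) x + pd k (a i j) x*pd j phi x" using comm[OF phi, of k j] by simp
  qed
  have "pd i (pd k (%x. a i j x*pd j phi x)) = (%x. pd i (%x. a i j x*pd j (pd k phi) x) x + pd i (%x. pd k (a i j) x*pd j phi x) x)"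
   unfolding eq1 using pd_add[OF tf_diff[OF t1] tf_diff[OF ta]] by (simp add: fun_eq_iff)
  hence "?ip v (pd k (pd i (%x. a i j x*pd j phi x))) = ?ip v (pd i (%x. a i j x*pd j (pd k phi) x)) + ?ip v (pd i (%x. pd k (a i j) x*pd j phi x))"
   using comm[OF a_pd_tf[OF phi, of i j], of k i] L2_inner_add_right[OF vL(1) tf_L2[OF tf_pd[OF t1, of i]] tf_L2[OF tf_pd[OF ta[of i j], of i]]] by simp
  moreover have "?ip v (pd k (pd i (%x. a i j x*pd j phi x))) = - ?ip (g k) (pd i (%x. a i j x*pd j phi x))"
   by (rule weak_pdD[OF g(1) tf_pd[OF a_pd_tf[OF phi]]])
  moreover have "?ip v (pd i (%x. pd k (a i j) x*pd j phi x)) = - ?ip (%x. pd k (a i j) x*g i x) (pd j phi)"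
   using weak_pdD[OF g(1)[of i] ta[of i j]] by (simp add: L2_inner_def mult_ac)
  ultimately show ?thesis by simp
 qed
 have agL: "(%x. pd k (a i j) x*g i x) : L2 lborel" for i j by (rule L2_mult_smooth[OF g(2,3) smooth_pd[OF a_smooth]])
 have sL: "(%x. SS i. pd k (a i j) x*g i x) : L2 lborel" for j
 proof -
  have "(%x. \<Sum>i\<in>I. pd k (a i j) x*g i x) : L2 lborel" for I :: "'n set"
   by (induction I rule: infinite_finite_induct) (auto intro: L2_add agL L2_zero)
  thus ?thesis .
 qed
 have 2: "(SS i. ?ip (%x. pd k (a i j) x*g i x) (pd j phi)) = ?ip (%x. SS i. pd k (a i j) x*g i x) (pd j phi)" for j
  unfolding L2_inner_def using L2_mult_integrable[OF agL tf_L2[OF p]] by (simp add: sum_distrib_right)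
 have 3: "?ip (%x. f j x + (-1)*(SS i. pd k (a i j) x*g i x)) (pd j phi) =
  ?ip (f j) (pd j phi) - ?ip (%x. SS i. pd k (a i j) x*g i x) (pd j phi)" for j
  using L2_inner_lincomb_left[OF tf_L2[OF p[of j]] f(2)[of j] sL[of j], of "-1"] by simp
 have "(SS i j. ?ip (g k) (pd i (%x. a i j x*pd j phi x))) =
  (SS i j. ?ip (%x. pd k (a i j) x*g i x) (pd j phi)) - (SS i j. ?ip v (pd i (%x. a i j x*pd j (pd k phi) x)))"
  unfolding 1 by (simp only: sum_subtractf)
 also have "(SS i j. ?ip (%x. pd k (a i j) x*g i x) (pd j phi)) = (SS j. ?ip (%x. SS i. pd k (a i j) x*g i x) (pd j phi))"
  unfolding 2[symmetric] by (rule sum.swap)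
 also have "(SS i j. ?ip v (pd i (%x. a i j x*pd j (pd k phi) x))) = ?ip F0 (pd k phi) - (SS i. ?ip (F i) (pd i (pd k phi)))"
  using sol p unfolding weak_solution_def by blast
 also have "?ip F0 (pd k phi) = - ?ip f0 phi" by (rule weak_pdD[OF f0 phi])
 also have "(SS i. ?ip (F i) (pd i (pd k phi))) = - (SS i. ?ip (f i) (pd i phi))"
  unfolding comm[OF phi, of _ k] weak_pdD[OF f(1) p] by (rule sum_negf)
 finally show "(SS i j. ?ip (g k) (pd i (%x. a i j x*pd j phi x))) =
  ?ip f0 phi - (SS j. ?ip (%x. f j x + (-1)*(SS i. pd k (a i j) x*g i x)) (pd j phi))" unfolding 3 sum_subtractf by simp
qed

text \<open>The gain is one order over the data, also for data in divergence form. In the step,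
  weaker data first put \<open>v\<close> into \<open>Hc (Suc m)\<close>; then each derivative
  \<open>g k\<close> solves an equation whose data lie in \<open>Hc m\<close>, and the induction
  hypothesis applies to \<open>g k\<close>.\<close>

lemma elliptic_regularity:
 assumes "v : L2 lborel" "bounded_support v" "Hc m F0" "!!i. Hc m (F i)" "weak_solution v F0 F"
 shows "Hc (Suc m) v" using assms
proof (induction m arbitrary: v F0 F)
 case 0
 obtain Q where Q: "!!e i. e > 0 ==> L2_norm lborel (pd i (conv (moll e) v)) <= Q" using mollified_gradient_bound[OF 0(1,2) _ _ 0(5)] 0(3,4) by auto
 hence "ALL i. EX g. weak_pd i v g & Hc 0 g" using weak_pd_exists[OF 0(1,2) Q] by (metis Hc.simps(1))
 thus ?case using 0(1,2) by simp
next
 case (Suc m)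
 have v1: "Hc (Suc m) v" by (rule Suc.IH[OF Suc.prems(1,2) Hc_Suc_imp[OF Suc.prems(3)] Hc_Suc_imp[OF Suc.prems(4)] Suc.prems(5)])
 hence "ALL i. EX g. weak_pd i v g & Hc m g" by simp
 then obtain g where "ALL i. weak_pd i v (g i) & Hc m (g i)" unfolding choice_iff by blast
 hence g: "!!i. weak_pd i v (g i)" "!!i. Hc m (g i)" by blast+
 have "Hc (Suc m) (g k)" for k
 proof -
  obtain f0 where f0: "weak_pd k F0 f0" "Hc m f0" using Suc.prems(3) by (meson Hc.simps(2))
  have "ALL i. EX f. weak_pd k (F i) f & Hc m f" using Suc.prems(4) by simp
  then obtain f where "ALL i. weak_pd k (F i) (f i) & Hc m (f i)" unfolding choice_iff by blast
  hence f: "!!i. weak_pd k (F i) (f i)" "!!i. Hc m (f i)" by blast+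
  have s: "weak_solution (g k) f0 (%j x. f j x + (-1)*(SS i. pd k (a i j) x*g i x))"
   by (rule weak_solution_pd[OF Suc.prems(5,1,2) g(1) Hc_L2[OF g(2)] Hc_bounded_support[OF g(2)] f0(1) f(1) Hc_L2[OF f(2)]])
  show ?thesis by (rule Suc.IH[OF Hc_L2[OF g(2)] Hc_bounded_support[OF g(2)] f0(2) _ s])
    (intro Hc_lincomb f(2) Hc_sum Hc_mult smooth_pd a_smooth g(2))
 qed
 thus ?case using g Suc.prems(1,2) by (auto simp del: Hc.simps(2) simp: Hc.simps(2)[of "Suc m"])
qed

end

section \<open>Smoothness from weak derivatives of all orders\<close>

lemma Basis_vec_eq: "(Basis :: (real^'n) set) = (%i. axis i 1) ` UNIV" by (auto simp: Basis_vec_def)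

lemma sum_axis_component: "(\<Sum>i\<in>I. c i *R axis i 1 :: real^'n)$j = (if j : I then c j else 0)"
proof -
 have "(\<Sum>i\<in>I. c i *R axis i 1 :: real^'n)$j = (\<Sum>i\<in>I. if i = j then c i else 0)"
  unfolding sum_component by (rule sum.cong) (auto simp: axis_def)
 thus ?thesis by simp
qed

lemma sum_mult_axis_component: "(\<Sum>i\<in>I. c i*(axis i 1 :: real^'n)$j) = (if j : I then c j else 0)"
 using sum_axis_component[of c I j] by simp

section \<open>Sup bounds by L^1 norms of mixed derivatives\<close>

text \<open>Lets successive integrations over single coordinates be assembled into an integral over
  R^n.\<close>

lemma lborel_vec_PiM:
 "(lborel :: (real^'n) measure) = distr (PiM UNIV (%_. lborel)) borel (%y. SS i. y i *R axis i 1)"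
proof (rule lborel_eqI)
 interpret product_sigma_finite "%_::'n. lborel :: real measure" ..
 have [measurable]: "(%y. SS i. y i *R axis i 1 :: real^'n) : PiM UNIV (%_. lborel) \<rightarrow>\<^sub>M borel" by measurable
 fix l u :: "real^'n" assume lu: "!!b. b : Basis ==> l \<bullet> b <= u \<bullet> b"
 have le: "l$i <= u$i" for i using lu[of "axis i 1"] by (simp add: Basis_vec_eq inner_axis)
 have "(%y. SS i. y i *R axis i 1) -` box l u \<inter> space (PiM UNIV (%_. lborel)) = PiE UNIV (%i. {l$i<..<u$i})"
  by (auto simp: mem_box_cart sum_mult_axis_component space_PiM PiE_iff)
 hence "emeasure (distr (PiM UNIV (%_. lborel)) borel (%y. SS i. y i *R axis i 1)) (box l u) = (\<Prod>i\<in>UNIV. ennreal (u$i - l$i))"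
  using le by (subst emeasure_distr) (auto simp: emeasure_PiM)
 also have "... = (\<Prod>b\<in>Basis. (u - l) \<bullet> b)"
  using le by (simp add: prod_ennreal Basis_vec_eq prod.reindex inj_on_def axis_eq_axis inner_axis)
 finally show "emeasure (distr (PiM UNIV (%_. lborel)) borel (%y. SS i. y i *R axis i 1)) (box l u) = (\<Prod>b\<in>Basis. (u - l) \<bullet> b)" .
qed simp

primrec pds :: "'n::finite list => (real^'n => real) => real^'n => real" where
 "pds [] f = f"
| "pds (i # l) f = pd i (pds l f)"

lemma pds_append: "pds (k @ l) f = pds k (pds l f)" by (induction k) auto

lemma pds_tf: "phi : test_fun U ==> pds l phi : test_fun U" by (induction l) (auto intro: tf_pd)

text \<open>The fundamental theorem of calculus along the \<open>i\<close>-th axis, started beyond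
  the support. The argument on the right is \<open>z\<close> with its \<open>i\<close>-th coordinate
  replaced by \<open>s\<close>.\<close>

lemma tf_line_bound:
 assumes phi: "phi : test_fun UNIV"
 shows "ennreal (abs (phi z)) <= (NN s. ennreal (abs (pd i phi (z + (s - z$i) *R axis i 1))))"
proof -
 obtain R where R: "!!x. norm x > R ==> phi x = 0" using tf_bounded_support[OF phi] unfolding bounded_support_def by blast
 define G where "G s = phi (z + (s - z$i) *R axis i 1)" for s
 define g where "g s = pd i phi (z + (s - z$i) *R axis i 1)" for s
 have c: "continuous_on UNIV g" unfolding g_def using smooth_continuous[OF tf_smooth[OF tf_pd[OF phi, of i]]]
  by (rule continuous_on_compose2) (auto intro!: continuous_intros)
 have d: "(G has_vector_derivative g s) (at s)" for s
 proof -
  have "((%t. phi ((z - (z$i) *R axis i 1) + t *R axis i 1)) has_field_derivative pd i phi ((z - (z$i) *R axis i 1) + s *R axis i 1)) (at s)"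
   by (rule pd_line[OF tf_diff[OF phi]])
  thus ?thesis unfolding G_def g_def has_real_derivative_iff_has_vector_derivative by (simp add: algebra_simps)
 qed
 \<comment> \<open>The \<open>i\<close>-th coordinate of the starting point alone has absolute value
   above \<open>abs R\<close>, so the point is outside the support; and \<open>a\<close> lies below
   \<open>z$i\<close>.\<close>
 define a where "a = - abs R - abs (z$i) - 1"
 have a: "a <= z$i" by (simp add: a_def)
 have "G a = 0"
 proof -
  have "(z + (a - z$i) *R axis i 1)$i = a" by (simp add: axis_def)
  hence "abs a <= norm (z + (a - z$i) *R axis i 1)" using component_le_norm_cart by metis
  thus ?thesis unfolding G_def by (intro R) (simp add: a_def)
 qed
 moreover have "(LBINT s. indicator {a..z$i} s *R g s) = G (z$i) - G a"
  using c d by (intro integral_FTC_Icc a) (auto intro: continuous_on_subset has_vector_derivative_at_within)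
 ultimately have eqz: "phi z = (LBINT s. indicator {a..z$i} s *R g s)" by (simp add: G_def)
 have "ennreal (abs (phi z)) <= (NN s. ennreal (norm (indicator {a..z$i} s *R g s)))"
 proof -
  have "integrable lborel (%s. indicator {a..z$i} s *R g s)" using c by (intro borel_integrable_compact) (auto intro: continuous_on_subset)
  from integral_norm_bound_ennreal[OF this] have "ennreal (norm (phi z)) <= (NN s. ennreal (norm (indicator {a..z$i} s *R g s)))"
   unfolding eqz[symmetric] .
  thus ?thesis by simp
 qed
 also have "... <= (NN s. ennreal (abs (g s)))" by (intro nn_integral_mono ennreal_leI) (auto simp: indicator_def)
 finally show ?thesis by (simp add: g_def)
qed

text \<open>One coordinate is integrated at a time; the argument on the right is \<open>x\<close>
  with the coordinates listed in \<open>l\<close> replaced by those of \<open>y\<close>. When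
  \<open>l\<close> lists all of them, the dependence on \<open>x\<close> disappears.\<close>

lemma tf_partial_integral_bound:
 assumes "distinct l" "phi : test_fun UNIV"
 shows "ennreal (abs (phi x)) <= (\<integral>\<^sup>+y. ennreal (abs (pds l phi (x + (\<Sum>i\<in>set l. (y i - x$i) *R axis i 1)))) \<partial>PiM (set l) (%_. lborel))"
 using assms
proof (induction l)
 case Nil
 thus ?case by (simp add: PiM_empty nn_integral_count_space_finite)
next
 case (Cons i l)
 interpret product_sigma_finite "%_::'a. lborel :: real measure" ..
 have [measurable]: "pds k phi : borel_measurable borel" for k by (rule tf_measurable[OF pds_tf[OF Cons.prems(2)]])
 let ?X = "%y. x + (\<Sum>j\<in>set l. (y j - x$j) *R axis j 1)"
 have i: "i ~: set l" using Cons.prems by simp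
 have "ennreal (abs (phi x)) <= (\<integral>\<^sup>+y. ennreal (abs (pds l phi (?X y))) \<partial>PiM (set l) (%_. lborel))" using Cons by simp
 also have "... <= (\<integral>\<^sup>+y. (NN s. ennreal (abs (pds (i # l) phi (?X y + (s - ?X y$i) *R axis i 1)))) \<partial>PiM (set l) (%_. lborel))"
  by (rule nn_integral_mono, unfold pds.simps, rule tf_line_bound[OF pds_tf[OF Cons.prems(2)]])
 also have "... = (\<integral>\<^sup>+y. (NN s. ennreal (abs (pds (i # l) phi (x + (\<Sum>j\<in>insert i (set l). ((y(i := s)) j - x$j) *R axis j 1))))) \<partial>PiM (set l) (%_. lborel))"
 proof -
  have "?X y + (s - ?X y$i) *R axis i 1 = x + (\<Sum>j\<in>insert i (set l). ((y(i := s)) j - x$j) *R axis j 1)" for y s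
  proof -
   have "?X y$i = x$i" using i by (simp add: sum_mult_axis_component)
   moreover have "(\<Sum>j\<in>set l. ((y(i := s)) j - x$j) *R axis j 1) = (\<Sum>j\<in>set l. (y j - x$j) *R axis j (1::real))"
    using i by (intro sum.cong) auto
   ultimately show ?thesis using i by simp
  qed
  thus ?thesis by (simp only:)
 qed
 also have "... = (\<integral>\<^sup>+y. ennreal (abs (pds (i # l) phi (x + (\<Sum>j\<in>insert i (set l). (y j - x$j) *R axis j 1)))) \<partial>PiM (insert i (set l)) (%_. lborel))"
  using i by (subst product_nn_integral_insert) (auto simp del: pds.simps)
 finally show ?case by simp
qed

text \<open>The list contains every coordinate once: the embedding of W^(n,1) into the bounded
  functions. It is crude in the number of derivatives, but derivatives of all orders will be at
  hand.\<close>

lemma tf_sup_bound: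
 obtains l :: "'n::finite list" where
  "!!(phi :: real^'n => real) x. phi : test_fun UNIV ==> ennreal (abs (phi x)) <= (NN y. ennreal (abs (pds l phi y)))"
proof -
 obtain l :: "'n list" where l: "set l = UNIV" "distinct l" using finite_distinct_list[of "UNIV :: 'n set"] by auto
 have "ennreal (abs (phi x)) <= (NN y. ennreal (abs (pds l phi y)))" if phi: "phi : test_fun UNIV" for phi :: "real^'n => real" and x
 proof -
  have [measurable]: "pds l phi : borel_measurable borel" by (rule tf_measurable[OF pds_tf[OF phi]])
  have eq: "x + (SS i. (y i - x$i) *R axis i 1) = (SS i. y i *R axis i 1)" for y by (simp add: scaleR_diff_left sum_subtractf vec_basis_expansion)
  have "ennreal (abs (phi x)) <= (\<integral>\<^sup>+y. ennreal (abs (pds l phi (SS i. y i *R axis i 1))) \<partial>PiM UNIV (%_. lborel))"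
   using tf_partial_integral_bound[OF l(2) phi, of x] unfolding l(1) eq .
  also have "... = (NN y. ennreal (abs (pds l phi y)))" by (subst lborel_vec_PiM, subst nn_integral_distr) auto
  finally show ?thesis .
 qed
 thus ?thesis using that by blast
qed

text \<open>Cutoffs that equal 1 on a compact set and are supported in shrinking neighbourhoods give
  integral 0 over every closed set. Closed sets form a generator stable under intersections, so all
  Borel integrals vanish, and then so does the density almost everywhere.\<close>

lemma integral_test_fun_eq_0_imp_AE_0:
 fixes g :: "real^'n => real"
 assumes g: "integrable lborel g" "bounded_support g" and 0: "!!phi. phi : test_fun UNIV ==> (LBINT x. g x*phi x) = 0"
 shows "AE x in lborel. g x = 0"
proof -
 have [measurable]: "g : borel_measurable borel" using g(1) by (auto dest: borel_measurable_integrable)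
 obtain R where R: "!!x. norm x > R ==> g x = 0" using g(2) unfolding bounded_support_def by blast
 have closed: "(LBINT x. indicator C x*g x) = 0" if C: "closed C" for C
 proof -
  define K where "K = C \<inter> cball 0 R"
  have CK: "indicator C x*g x = indicator K x*g x" for x using R[of x] by (cases "norm x <= R") (auto simp: K_def indicator_def)
  have K: "compact K" unfolding K_def using C by (intro closed_Int_compact) auto
  define U where "U k = {x. infdist x K < 1 / Suc k}" for k
  have "EX f. f : test_fun (U k) & (ALL x. 0 <= f x & f x <= 1) & (ALL x:K. f x = 1)" for k
  proof -
   have U: "open (U k)" unfolding U_def by (intro open_Collect_less continuous_intros)
   have "K <= U k" by (auto simp: U_def)
   from cutoff_exists[OF K this U] show ?thesis by (metis subsetD)
  qed
  then obtain p where p: "!!k. p k : test_fun (U k)" "!!k x. 0 <= p k x & p k x <= 1" "!!k x. x : K ==> p k x = 1" by metis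
  have lim: "(%k. p k x*g x) ----> indicator K x*g x" if "K ~= {}" for x
  proof (cases "x : K")
   case False
   hence "infdist x K > 0" using K that by (simp add: infdist_pos_not_in_closed compact_imp_closed)
   hence "eventually (%k. 1 / Suc k < infdist x K) sequentially" by (rule order_tendstoD[OF LIMSEQ_Suc[OF lim_1_over_n]])
   hence "eventually (%k. p k x = 0) sequentially" by eventually_elim (use p(1) in "fastforce simp: U_def test_fun_def")
   hence "eventually (%k. p k x*g x = 0) sequentially" by eventually_elim simp
   thus ?thesis using False by (simp add: tendsto_eventually)
  qed (simp add: p(3))
  have "(%k. LBINT x. p k x*g x) ----> (LBINT x. indicator K x*g x)" if "K ~= {}"
  proof (rule integral_dominated_convergence[where w="%x. abs (g x)"])
   show "(%x. p k x*g x) : borel_measurable lborel" for k using tf_measurable[OF p(1)] by simp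
   show "AE x in lborel. norm (p k x*g x) <= abs (g x)" for k using p(2) by (intro AE_I2) (auto simp: abs_mult intro: mult_left_le_one_le)
   show "(%x. indicator K x*g x) : borel_measurable lborel" using borel_compact[OF K] by simp
  qed (use g lim[OF that] in auto)
  moreover have "p k : test_fun UNIV" for k using p(1)[of k] by (auto simp: test_fun_def)
  hence "(LBINT x. p k x*g x) = 0" for k using 0[of "p k"] by (simp add: mult.commute)
  ultimately show ?thesis unfolding CK by (cases "K = {}") (simp_all add: LIMSEQ_const_iff)
 qed
 have iA: "integrable lborel (%x. indicator A x*g x)" if "A : sets borel" for A
  by (rule integrable_mult_bounded[OF g(1), where B=1]) (use that in "auto simp: indicator_def")
 have all: "(LBINT x. indicator A x*g x) = 0" if "A : sets borel" for A
 proof -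
  have bs: "sets borel = sigma_sets UNIV (Collect closed)" unfolding borel_eq_closed by (rule sets_measure_of) auto
  have Is: "Int_stable (Collect closed)" by (rule Int_stableI) auto
  have sub: "Collect closed <= Pow UNIV" by simp
  from Is sub that[unfolded bs] show ?thesis
  proof (induction rule: sigma_sets_induct_disjoint)
   case (basic A)
   thus ?case using closed by auto
  next
   case (compl A)
   hence A: "A : sets borel" by (simp add: bs)
   have "indicator (UNIV - A) x*g x = g x - indicator A x*g x" for x by (auto simp: indicator_def)
   thus ?case using iA[OF A] g(1) closed[OF closed_UNIV] compl by simp
  next
   case (union A)
   hence A: "!!i. A i : sets borel" by (auto simp: bs)
   have "(LINT x:(\<Union>i. A i)|lborel. g x) = (\<Sum>i. (LINT x:(A i)|lborel. g x))"
   proof (rule lebesgue_integral_countable_add)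
    show "set_integrable lborel (\<Union>i. A i) g" unfolding set_integrable_def using iA[of "\<Union>i. A i"] A by auto
    show "A i \<inter> A j = {}" if "i ~= j" for i j using union(1) that by (auto simp: disjoint_family_on_def)
   qed (use A in simp)
   thus ?case using union(3) by (simp add: set_lebesgue_integral_def)
  qed auto
 qed
 show ?thesis by (rule density_unique_real[OF g(1), of "%_. 0"]) (use all in "auto simp: set_lebesgue_integral_def")
qed

text \<open>The reversed induction peels off the derivative that acts first: it turns the
  mollification of \<open>v\<close> into that of its weak derivative \<open>g\<close>, for which one
  derivative less is required.\<close>

lemma Hc_mollified_derivatives:
 assumes "Hc (length l) v"
 shows "EX w. w : L2 lborel & bounded_support w & (ALL e>0. pds l (conv (moll e) v) = conv (moll e) w)" using assms
proof (induction l arbitrary: v rule: rev_induct)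
 case Nil
 thus ?case by auto
next
 case (snoc i l)
 have vL: "v : L2 lborel" "bounded_support v" using Hc_L2[OF snoc.prems] Hc_bounded_support[OF snoc.prems] .
 obtain g where g: "weak_pd i v g" "Hc (length l) g" using snoc.prems by (auto simp del: Hc.simps simp: Hc.simps(2))
 obtain w where w: "w : L2 lborel" "bounded_support w" "!!e. e > 0 ==> pds l (conv (moll e) g) = conv (moll e) w" using snoc.IH[OF g(2)] by blast
 have "pds (l @ [i]) (conv (moll e) v) = conv (moll e) w" if "e > 0" for e
 proof -
  have "pd i (conv (moll e) v) = conv (moll e) g"
   using conv_pd[OF moll_tf[OF that] L2_bounded_support_integrable[OF vL]] conv_weak_pd[OF moll_tf[OF that] g(1)] by (simp add: fun_eq_iff)
  thus ?thesis using w(3)[OF that] by (simp add: pds_append)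
 qed
 thus ?case using w by blast
qed

lemma conv_moll_L1:
 fixes w :: "real^'n => real"
 assumes e: "e > 0" and w: "integrable lborel w"
 shows "(NN x. ennreal (abs (conv (moll e) w x))) <= (NN x. ennreal (abs (w x)))"
proof -
 have [measurable]: "w : borel_measurable borel" using w by (auto dest: borel_measurable_integrable)
 have m[measurable]: "moll e : borel_measurable (borel :: (real^'n) measure)" by (rule tf_measurable[OF moll_tf[OF e]])
 have mm: "(%x::real^'n. ennreal (abs (moll e x))) : borel_measurable borel" by measurable
 have "(NN x. ennreal (abs (conv (moll e) w x))) <= (NN x. (NN y. ennreal (abs (moll e (x - y)))*ennreal (abs (w y))))"
 proof (rule nn_integral_mono)
  fix x
  show "ennreal (abs (conv (moll e) w x)) <= (NN y. ennreal (abs (moll e (x - y)))*ennreal (abs (w y)))"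
   using integral_norm_bound_ennreal[OF conv_integrable[OF moll_tf[OF e] w, of x]] by (simp add: conv_def abs_mult ennreal_mult')
 qed
 also have "... = (NN y. (NN x. ennreal (abs (moll e (x - y)))*ennreal (abs (w y))))" by (rule lborel_pair.Fubini'[symmetric]) simp
 also have "... = (NN y. ennreal (abs (w y)))"
  using nn_integral_shift(2)[OF mm] moll_nn_integral[OF e, where 'n='n] by (simp add: nn_integral_multc)
 finally show ?thesis .
qed

text \<open>Each derivative of the mollifications \<open>F k\<close> is bounded uniformly in
  \<open>k\<close>, because its sup is controlled by the L^1 norm of a mollified integrable
  function. All derivatives then converge pointwise, and the quadratic Taylor bound passes to the
  limits, making \<open>f (i # l)\<close> the \<open>i\<close>-th partial derivative of
  \<open>f l\<close>.\<close>

theorem smooth_representative: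
 fixes v :: "real^'n => real"
 assumes v: "!!m. Hc m v"
 shows "EX f. smooth_on f UNIV & (AE x in lborel. v x = f x)"
proof -
 have vL: "v : L2 lborel" "bounded_support v" using Hc_L2[OF v] Hc_bounded_support[OF v] .
 note vi = L2_bounded_support_integrable[OF vL]
 \<comment> \<open>\<open>en\<close> lists the coordinates, so bounding the derivative
   \<open>pds l\<close> costs the further derivatives in \<open>pds (en @ l)\<close>.\<close>
 obtain en :: "'n list" where en: "!!(phi :: real^'n => real) x. phi : test_fun UNIV ==> ennreal (abs (phi x)) <= (NN y. ennreal (abs (pds en phi y)))"
  using tf_sup_bound by blast
 define E where "E k = 1 / real (Suc k)" for k
 have E: "E k > 0" "E k <= 1" for k by (auto simp: E_def)
 define F where "F k = conv (moll (E k)) v" for k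
 have Ft: "F k : test_fun UNIV" for k unfolding F_def by (rule conv_tf[OF moll_tf[OF E(1)] vi vL(2)])
 have Fl: "pds l (F k) : test_fun UNIV" for l k by (rule pds_tf[OF Ft])
 have w: "EX w. w : L2 lborel & bounded_support w & (ALL k. pds l (F k) = conv (moll (E k)) w)" for l
  using Hc_mollified_derivatives[OF v] E(1) unfolding F_def by blast
 have "EX C. ALL k x. abs (pds l (F k) x) <= C" for l
 proof -
  obtain w where w: "w : L2 lborel" "bounded_support w" "!!k. pds (en @ l) (F k) = conv (moll (E k)) w" using w[of "en @ l"] by blast
  note wi = L2_bounded_support_integrable[OF w(1,2)]
  have "abs (pds l (F k) x) <= (LBINT y. abs (w y))" for k x
  proof -
   have "ennreal (abs (pds l (F k) x)) <= (NN y. ennreal (abs (conv (moll (E k)) w y)))"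
    using en[OF Fl, of l k x] w(3)[of k] by (simp add: pds_append)
   also have "... <= (NN y. ennreal (abs (w y)))" by (rule conv_moll_L1[OF E(1) wi])
   also have "... = ennreal (LBINT y. abs (w y))" using wi by (intro nn_integral_eq_integral) auto
   finally show ?thesis by (subst (asm) ennreal_le_iff) auto
  qed
  thus ?thesis by blast
 qed
 then obtain C where C: "!!l k x. abs (pds l (F k) x) <= C l" by metis
 define D where "D l = (SS i j. C (i # j # l)) + (SS i. C (i # l))" for l
 have Cnn: "C l >= 0" for l using C[of l 0 0] by linarith
 have D1: "abs (pd i (pds l (F k)) x) <= D l" for i l k x
 proof -
  have "C (i # l) <= (SS i. C (i # l))" by (rule member_le_sum) (auto simp: Cnn)
  moreover have "0 <= (SS i j. C (i # j # l))" by (intro sum_nonneg Cnn)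
  ultimately show ?thesis using C[of "i # l" k x] by (simp add: D_def)
 qed
 have D2: "abs (pd i (pd j (pds l (F k))) x) <= D l" for i j l k x
 proof -
  have "C (i # j # l) <= (SS j. C (i # j # l))" by (rule member_le_sum[where f="%j. C (i # j # l)"]) (auto simp: Cnn)
  also have "... <= (SS i j. C (i # j # l))" by (rule member_le_sum[where f="%i. SS j. C (i # j # l)"]) (auto intro: sum_nonneg Cnn)
  moreover have "0 <= (SS i. C (i # l))" by (intro sum_nonneg Cnn)
  ultimately show ?thesis using C[of "i # j # l" k x] by (simp add: D_def)
 qed
 have Dnn: "D l >= 0" for l unfolding D_def by (intro add_nonneg_nonneg sum_nonneg Cnn)
 define L where "L l = real CARD('n)*D l" for l
 have L: "abs (pds l (F k) x - pds l (F k) y) <= L l*norm (x - y)" for l k x y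
  unfolding L_def by (rule lipschitz_pd_bound[where S=UNIV]) (use D1 tf_diff[OF Fl] in auto)
 have L0: "L l >= 0" for l unfolding L_def using Dnn by simp
 \<comment> \<open>Averages with a fixed mollifier of scale \<open>r\<close> converge, by weak
   convergence of the mollifications; the uniform Lipschitz bound makes each average differ from the
   value by at most \<open>L l * r < e / 3\<close>.\<close>
 have Cau: "Cauchy (%k. pds l (F k) x)" for l x
 proof (rule metric_CauchyI)
  fix e :: real assume e: "e > 0"
  define r where "r = e / (4*(L l + 1))"
  have r: "r > 0" "L l*r < e / 3"
  proof -
   show "r > 0" using e L0[of l] by (simp add: r_def)
   have "L l*r <= (L l + 1)*r" using \<open>r > 0\<close> by simp
   also have "... = e / 4" using L0[of l] by (simp add: r_def field_simps)
   finally show "L l*r < e / 3" using e by simp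
  qed
  obtain w where w: "w : L2 lborel" "bounded_support w" "!!k. pds l (F k) = conv (moll (E k)) w" using w[of l] by blast
  have "(%k. LBINT y. conv (moll (E k)) w y*moll r (x - y)) ----> (LBINT y. w y*moll r (x - y))"
   unfolding E_def by (rule conv_moll_weak_limit[OF L2_bounded_support_integrable[OF w(1,2)] tf_translate[OF moll_tf[OF r(1)]]])
  moreover have "(LBINT y. conv (moll (E k)) w y*moll r (x - y)) = conv (moll r) (pds l (F k)) x" for k
   unfolding w(3) conv_def[of "moll r"] by (simp add: mult.commute)
  ultimately have "convergent (%k. conv (moll r) (pds l (F k)) x)" by (simp add: convergentI)
  then obtain N where N: "!!m n. m >= N ==> n >= N ==> abs (conv (moll r) (pds l (F m)) x - conv (moll r) (pds l (F n)) x) < e / 3"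
   using metric_CauchyD[OF convergent_Cauchy[OF \<open>convergent _\<close>], of "e / 3"] e unfolding dist_real_def by auto
  have cl: "abs (conv (moll r) (pds l (F m)) x - pds l (F m) x) <= L l*r" for m by (rule conv_moll_close[OF r(1) tf_measurable[OF Fl] C L0 L])
  show "EX M. ALL m>=M. ALL n>=M. dist (pds l (F m) x) (pds l (F n) x) < e"
  proof (intro exI allI impI)
   fix m n assume "m >= N" "n >= N"
   thus "dist (pds l (F m) x) (pds l (F n) x) < e" using N[of m n] cl[of m] cl[of n] r(2) unfolding dist_real_def by linarith
  qed
 qed
 define f where "f l x = lim (%k. pds l (F k) x)" for l x
 have flim: "(%k. pds l (F k) x) ----> f l x" for l x unfolding f_def using Cauchy_convergent[OF Cau] by (simp add: convergent_LIMSEQ_iff)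
 have fd: "(f l has_derivative (%h. SS i. (h$i) *R f (i # l) x)) (at x)" for l x
 proof (rule has_derivative_quadratic_remainder)
  show "bounded_linear (%h. SS i. (h$i) *R f (i # l) x)"
   by (intro bounded_linear_sum bounded_linear_compose[OF bounded_linear_scaleR_left bounded_linear_vec_nth])
  fix h :: "real^'n"
  have lim: "(%k. abs (pds l (F k) (x + h) - pds l (F k) x - (SS i. (h$i) *R pds (i # l) (F k) x)))
    ----> abs (f l (x + h) - f l x - (SS i. (h$i) *R f (i # l) x))"
   by (intro tendsto_rabs tendsto_diff tendsto_sum tendsto_scaleR tendsto_const flim)
  have "abs (pds l (F k) (x + h) - pds l (F k) x - (SS i. (h$i) *R pds (i # l) (F k) x)) <= real CARD('n)*(real CARD('n)*D l)*(norm h)^2" for k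
   unfolding pds.simps by (rule taylor_second_order_bound[OF tf_smooth[OF Fl] D2])
  hence "abs (f l (x + h) - f l x - (SS i. (h$i) *R f (i # l) x)) <= real CARD('n)*(real CARD('n)*D l)*(norm h)^2"
   by (intro Lim_bounded[OF lim, where M=0]) auto
  thus "norm (f l (x + h) - f l x - (SS i. (h$i) *R f (i # l) x)) <= real CARD('n)*(real CARD('n)*D l)*(norm h)^2" by simp
 qed
 have fck: "Ck_on k (f l) UNIV" for k l
 proof (induction k arbitrary: l)
  case 0
  have "isCont (f l) x" for x using has_derivative_continuous[OF fd] by simp
  thus ?case by (simp add: continuous_at_imp_continuous_on)
 next
  case (Suc k)
  show ?case by (rule Ck_on_SucI_pd[OF open_UNIV fd Suc.IH])
 qed
 hence fs: "smooth_on (f []) UNIV" by (simp add: smooth_on_def)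
 obtain R where R: "!!x. norm x > R ==> v x = 0" using vL(2) unfolding bounded_support_def by blast
 have "F k x = 0" if "norm x > R + 1" for k x
 proof -
  have "moll (E k) (x - y) * v y = 0" for y
   using moll_zero[OF E(1), of k "x - y"] R[of y] that E(2)[of k] norm_triangle_ineq[of "x - y" y] by fastforce
  thus ?thesis unfolding F_def conv_def by (simp only: lebesgue_integral_const) simp
 qed
 hence f0: "f [] x = 0" if "norm x > R + 1" for x using flim[of "[]" x] that by (simp add: LIMSEQ_const_iff)
 have ft: "f [] : test_fun UNIV" by (rule tfI_bounded_support[OF fs]) (use f0 in "auto simp: bounded_support_def")
 have fi: "integrable lborel (f [])" by (rule tf_integrable[OF ft])
 have "AE x in lborel. v x + (-1)*f [] x = 0"
 proof (rule integral_test_fun_eq_0_imp_AE_0)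
  show "integrable lborel (%x. v x + (-1)*f [] x)" using vi fi by simp
  show "bounded_support (%x. v x + (-1)*f [] x)" by (rule bounded_support_lincomb[OF vL(2) tf_bounded_support[OF ft]])
  fix phi :: "real^'n => real" assume phi: "phi : test_fun UNIV"
  have "(%k. LBINT x. F k x*phi x) ----> (LBINT x. v x*phi x)" unfolding F_def E_def by (rule conv_moll_weak_limit[OF vi phi])
  moreover have "(%k. LBINT x. F k x*phi x) ----> (LBINT x. f [] x*phi x)"
  proof (rule integral_dominated_convergence[where w="%x. C []*abs (phi x)"])
   show "AE x in lborel. (%k. F k x*phi x) ----> f [] x*phi x" using flim[of "[]"] by (intro AE_I2 tendsto_mult tendsto_const) simp
   show "AE x in lborel. norm (F k x*phi x) <= C []*abs (phi x)" for k
    using C[of "[]" k] by (intro AE_I2) (auto simp: abs_mult intro: mult_right_mono)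
   show "(%x. F k x*phi x) : borel_measurable lborel" for k using tf_measurable[OF Ft[of k]] tf_measurable[OF phi] by simp
   show "(%x. f [] x*phi x) : borel_measurable lborel" using tf_measurable[OF ft] tf_measurable[OF phi] by simp
   show "integrable lborel (%x. C []*abs (phi x))" using tf_integrable[OF phi] by simp
  qed
  ultimately have "(LBINT x. v x*phi x) = (LBINT x. f [] x*phi x)" by (rule LIMSEQ_unique)
  thus "(LBINT x. (v x + (-1)*f [] x)*phi x) = 0"
   using L2_inner_lincomb_left[OF tf_L2[OF phi] vL(1) tf_L2[OF ft], of "-1"] by (simp add: L2_inner_def)
 qed
 thus ?thesis using fs by (intro exI[of _ "f []"]) auto
qed

lemma tf_bounded_ex: "phi : test_fun U ==> EX B. ALL x. abs (phi x) <= B" by (rule tf_bounded[of phi U]) auto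

lemma tf_outside: "phi : test_fun W ==> x ~: W ==> phi x = 0" unfolding test_fun_def by blast

lemma finite_family_bound:
 fixes g :: "'i::finite => 'a => real"
 assumes "!!i. EX B. ALL x. abs (g i x) <= B"
 shows "EX B. ALL i x. abs (g i x) <= B"
proof -
 obtain B where B: "!!i x. abs (g i x) <= B i" using assms by metis
 have "abs (g i x) <= (SS i. abs (B i))" for i x
 proof -
  have "abs (B i) <= (SS i. abs (B i))" by (rule member_le_sum) auto
  thus ?thesis using B[of i x] by linarith
 qed
 thus ?thesis by blast
qed

section \<open>Interior regularity for equations on an open set\<close>

text \<open>The quadratic form is continuous and positive on the compact product of \<open>K\<close>
  with the unit sphere; \<open>m\<close> is its minimum there, and homogeneity does the
  rest.\<close>

lemma uniform_ellipticity_on_compact: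
 fixes a :: "'n::finite => 'n => real^'n => real"
 assumes K: "compact K" and a: "!!i j. continuous_on K (a i j)"
  and pos: "!!x xi. x : K ==> (xi :: real^'n) ~= 0 ==> 0 < (SS i j. a i j x*(xi$i * xi$j))"
 obtains m where "m > 0" "!!x xi. x : K ==> m*(SS i. (xi i)^2) <= (SS i j. a i j x*(xi i * xi j))"
proof (cases "K = {}")
 case True
 show ?thesis by (rule that[of 1]) (use True in auto)
next
 case False
 let ?S = "K \<times> sphere (0 :: real^'n) 1"
 define q where "q z = (SS i j. a i j (fst z)*(snd z$i * snd z$j))" for z :: "(real^'n) \<times> (real^'n)"
 have c: "continuous_on ?S q" unfolding q_def by (intro continuous_intros continuous_on_compose2[OF a]) auto
 have "compact ?S" using K by (intro compact_Times) auto
 moreover have "?S ~= {}"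
 proof -
  have "axis undefined 1 : sphere (0 :: real^'n) 1" by simp
  thus ?thesis using False by blast
 qed
 ultimately obtain z where z: "z : ?S" "!!y. y : ?S ==> q z <= q y" using continuous_attains_inf[OF _ _ c] by blast
 show ?thesis
 proof (rule that[of "q z"])
  have "snd z ~= 0" using z(1) by auto
  thus "q z > 0" unfolding q_def using z(1) by (intro pos) auto
  fix x and xi :: "'n => real" assume x: "x : K"
  define v where "v = (vec_lambda xi :: real^'n)"
  have n2: "(SS i. (xi i)^2) = (norm v)^2" unfolding power2_norm_eq_inner v_def inner_vec_def by (simp add: power2_eq_square)
  show "q z*(SS i. (xi i)^2) <= (SS i j. a i j x*(xi i * xi j))"
  proof (cases "v = 0")
   case True
   hence "xi i = 0" for i by (metis v_def vec_lambda_beta zero_index)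
   thus ?thesis by simp
  next
   case v: False
   have "(x, inverse (norm v) *R v) : ?S" using x v by simp
   hence "q z <= q (x, inverse (norm v) *R v)" by (rule z(2))
   also have "... = (inverse (norm v))^2*(SS i j. a i j x*(xi i * xi j))" by (simp add: q_def v_def sum_distrib_left power2_eq_square mult_ac)
   finally have "q z*(norm v)^2 <= ((inverse (norm v))^2*(SS i j. a i j x*(xi i * xi j)))*(norm v)^2" by (rule mult_right_mono) simp
   also have "... = (SS i j. a i j x*(xi i * xi j))" using v by (simp add: power_inverse field_simps)
   finally show ?thesis unfolding n2 .
  qed
 qed
qed

text \<open>The equation sum d_j (a_ij d_i u) = b u on \<open>W\<close> in weak form. All
  information is confined to \<open>W\<close>: there \<open>u\<close> is locally square integrable
  and the coefficients are smooth, with no bounds up to the boundary.\<close>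

locale local_equation =
 fixes W :: "(real^'n) set" and a :: "'n => 'n => real^'n => real" and b u :: "real^'n => real"
 assumes W: "open W" and a: "!!i j. smooth_on (a i j) W" and b: "smooth_on b W"
  and pos: "!!x xi. x : W ==> (xi :: real^'n) ~= 0 ==> 0 < (SS i j. a i j x*(xi$i * xi$j))"
  and u_measurable: "u : borel_measurable borel"
  and u_L2: "!!K. compact K ==> K <= W ==> (%x. indicator K x*u x) : L2 lborel"
  and weak: "!!phi. phi : test_fun W ==>
   (SS i j. L2_inner lborel u (pd i (%x. a i j x*pd j phi x))) = L2_inner lborel u (%x. b x*phi x)"
begin

lemma test_mult_L2:
 assumes t: "t : test_fun W"
 shows "(%x. t x*u x) : L2 lborel" "bounded_support (%x. t x*u x)"
proof -
 obtain K where K: "compact K" "K <= W" "!!x. x ~: K ==> t x = 0" using t unfolding test_fun_def by blast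
 obtain B where B: "!!x. abs (t x) <= B" using tf_bounded[OF t] by metis
 have "(%x. t x*(indicator K x*u x)) : L2 lborel" by (rule L2_mult_bounded(1)[OF u_L2[OF K(1,2)] _ B]) (use tf_measurable[OF t] in simp)
 moreover have "t x*(indicator K x*u x) = t x*u x" for x using K(3)[of x] by (auto simp: indicator_def)
 ultimately show "(%x. t x*u x) : L2 lborel" by simp
 show "bounded_support (%x. t x*u x)" using tf_bounded_support[OF t] unfolding bounded_support_def by auto
qed

lemma test_mult_integrable: "t : test_fun W ==> integrable lborel (%x. u x*t x)"
 using L2_bounded_support_integrable[OF test_mult_L2] by (simp add: mult.commute)

lemma a_pd_test: "phi : test_fun W ==> (%x. a i j x*pd j phi x) : test_fun W" by (rule tf_mult'[OF tf_pd a W])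

text \<open>Leibniz's rule on \<open>W\<close>. Outside \<open>W\<close> each term has a factor that
  is supported in \<open>W\<close>, so the identity can be integrated over the whole space.\<close>

lemma cutoff_commutator:
 assumes c: "c : test_fun W" and phi: "phi : test_fun UNIV"
 shows "c x*pd i (%x. a i j x*pd j phi x) x = pd i (%x. a i j x*pd j (%x. c x*phi x) x) x
  - (a i j x*pd i c x)*pd j phi x - pd i (%x. a i j x*pd j c x) x*phi x - (a i j x*pd j c x)*pd i phi x"
proof (cases "x : W")
 case False
 have "(%x. c x*phi x) : test_fun W" by (rule tf_mult[OF c smooth_subset[OF tf_smooth[OF phi]] W]) (use W in auto)
 thus ?thesis using tf_outside[OF c False] tf_outside[OF tf_pd[OF c] False]
   tf_outside[OF tf_pd[OF a_pd_test[OF c]] False] tf_outside[OF tf_pd[OF a_pd_test] False] by simp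
next
 case True
 note dc = tf_diff[OF c] and dphi = tf_diff[OF phi]
 have da: "a i j differentiable (at y)" if "y : W" for y using smooth_differentiable[OF a W that] .
 have dpc: "pd j c differentiable (at y)" for y by (rule tf_diff[OF tf_pd[OF c]])
 have dpphi: "pd j phi differentiable (at y)" for y by (rule tf_diff[OF tf_pd[OF phi]])
 have eq: "a i j y*pd j (%x. c x*phi x) y = c y*(a i j y*pd j phi y) + (a i j y*pd j c y)*phi y" for y
  using pd_mult[OF dc dphi, of j y] by (simp add: algebra_simps)
 have d1: "(%y. a i j y*pd j phi y) differentiable (at x)" using da[OF True] dpphi by (rule differentiable_mult)
 have d2: "(%y. a i j y*pd j c y) differentiable (at x)" using da[OF True] dpc by (rule differentiable_mult)
 have "pd i (%x. a i j x*pd j (%x. c x*phi x) x) x = pd i (%y. c y*(a i j y*pd j phi y) + (a i j y*pd j c y)*phi y) x" unfolding eq ..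
 also have "... = pd i (%y. c y*(a i j y*pd j phi y)) x + pd i (%y. (a i j y*pd j c y)*phi y) x"
  by (rule pd_add[OF differentiable_mult[OF dc d1] differentiable_mult[OF d2 dphi]])
 also have "... = (c x*pd i (%y. a i j y*pd j phi y) x + pd i c x*(a i j x*pd j phi x))
  + ((a i j x*pd j c x)*pd i phi x + pd i (%y. a i j y*pd j c y) x*phi x)" unfolding pd_mult[OF dc d1] pd_mult[OF d2 dphi] ..
 finally show ?thesis by (simp add: algebra_simps)
qed

text \<open>The coefficients are changed only away from the support of \<open>c\<close>, so
  \<open>c * u\<close> solves a uniformly elliptic equation on R^n. Its data are products of
  \<open>u\<close> with other test functions, \<open>t0\<close> and \<open>t1\<close>; this is why
  the induction hypothesis ranges over all test functions.\<close>

lemma Hc_localized_step: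
 assumes IH: "!!t. t : test_fun W ==> Hc m (%x. t x*u x)" and c: "c : test_fun W"
 shows "Hc (Suc m) (%x. c x*u x)"
proof -
 obtain K where K: "compact K" "K <= W" "!!x. x ~: K ==> c x = 0" using c unfolding test_fun_def by blast
 obtain c2 N where c2: "c2 : test_fun W" "!!x. 0 <= c2 x" "!!x. c2 x <= 1" "open N" "K <= N" "N <= W" "!!x. x : N ==> c2 x = 1"
  using cutoff_exists[OF K(1,2) W] by blast
 obtain K2 where K2: "compact K2" "K2 <= W" "!!x. x ~: K2 ==> c2 x = 0" using c2(1) unfolding test_fun_def by blast
 define delta where "delta i j = (if i = j then 1 else 0 :: real)" for i j :: 'n
 define t where "t i j x = c2 x*(a i j x - delta i j)" for i j x
 have t: "t i j : test_fun W" for i j unfolding t_def[abs_def] by (rule tf_mult[OF c2(1) _ W]) (intro smooth_diff a smooth_const W)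
 \<comment> \<open>The convex combination of the identity and \<open>a\<close> with weights
   \<open>1 - c2\<close> and \<open>c2\<close>: uniformly elliptic, equal to \<open>a\<close> where
   \<open>c2 = 1\<close>, and equal to the identity outside a compact set.\<close>
 define aa where "aa i j x = delta i j + t i j x" for i j x
 obtain B1 where B1: "!!i j x. abs (t i j x) <= B1"
 proof -
  have "EX B. ALL ij x. abs ((case ij of (i, j) => t i j) x) <= B"
  proof (rule finite_family_bound)
   fix ij show "EX B. ALL x. abs ((case ij of (i, j) => t i j) x) <= B" by (cases ij) (simp add: tf_bounded_ex[OF t])
  qed
  thus ?thesis using that by (metis case_prod_conv)
 qed
 obtain B2 where B2: "!!i j k x. abs (pd k (t i j) x) <= B2"
 proof -
  have "EX B. ALL ijk x. abs ((case ijk of (i, j, k) => pd k (t i j)) x) <= B"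
  proof (rule finite_family_bound)
   fix ijk show "EX B. ALL x. abs ((case ijk of (i, j, k) => pd k (t i j)) x) <= B" by (cases ijk) (simp add: tf_bounded_ex[OF tf_pd[OF t]])
  qed
  thus ?thesis using that by (metis case_prod_conv)
 qed
 obtain m0 where m0: "m0 > 0" "!!x xi. x : K2 ==> m0*(SS i. (xi i)^2) <= (SS i j. a i j x*(xi i * xi j))"
 proof (rule uniform_ellipticity_on_compact[OF K2(1), of a])
  show "continuous_on K2 (a i j)" for i j using continuous_on_subset[OF smooth_continuous[OF a] K2(2)] .
 qed (use pos K2(2) in auto)
 interpret elliptic_coefficients aa "1 + abs B1 + abs B2" "min 1 m0"
 proof
  show "smooth_on (aa i j) UNIV" for i j unfolding aa_def[abs_def] by (intro smooth_add smooth_const tf_smooth[OF t]) auto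
  show "abs (aa i j x) <= 1 + abs B1 + abs B2" for i j x using B1[of i j x] by (auto simp: aa_def delta_def)
  show "abs (pd k (aa i j) x) <= 1 + abs B1 + abs B2" for i j k x
  proof -
   have "pd k (aa i j) x = pd k (t i j) x"
    unfolding aa_def[abs_def] using pd_add[of "%_. delta i j" x "t i j" k] tf_diff[OF t] by (simp add: pd_const)
   thus ?thesis using B2[of k i j x] by linarith
  qed
  show "0 < min 1 m0" using m0 by simp
  fix x :: "real^'n" and xi :: "'n => real"
  let ?s = "SS i. (xi i)^2" and ?q = "SS i j. a i j x*(xi i * xi j)"
  have s0: "0 <= ?s" by (intro sum_nonneg) auto
  have d: "(SS i j. delta i j*(xi i * xi j)) = ?s"
  proof (rule sum.cong)
   fix i
   have "(SS j. delta i j*(xi i * xi j)) = (SS j. if j = i then xi i * xi j else 0)" by (rule sum.cong) (auto simp: delta_def)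
   thus "(SS j. delta i j*(xi i * xi j)) = (xi i)^2" by (simp add: power2_eq_square)
  qed simp
  have "(SS i j. aa i j x*(xi i * xi j)) =
   (SS i j. (1 - c2 x)*(delta i j*(xi i * xi j)) + c2 x*(a i j x*(xi i * xi j)))" by (intro sum.cong refl) (simp add: aa_def t_def algebra_simps)
  also have "... = (1 - c2 x)*?s + c2 x*?q" by (simp only: sum.distrib sum_distrib_left[symmetric] d)
  finally have e: "(SS i j. aa i j x*(xi i * xi j)) = (1 - c2 x)*?s + c2 x*?q" .
  have "c2 x*(min 1 m0*?s) <= c2 x*?q"
  proof (cases "x : K2")
   case True
   have "min 1 m0*?s <= m0*?s" by (intro mult_right_mono s0) simp
   thus ?thesis using m0(2)[OF True, of xi] by (intro mult_left_mono c2(2)) linarith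
  qed (use K2(3) in simp)
  moreover have "(1 - c2 x)*(min 1 m0*?s) <= (1 - c2 x)*?s"
   using s0 c2(3)[of x] by (intro mult_left_mono mult_left_le_one_le) (auto simp: m0 less_imp_le)
  ultimately have "(1 - c2 x)*(min 1 m0*?s) + c2 x*(min 1 m0*?s) <= (1 - c2 x)*?s + c2 x*?q" by linarith
  thus "min 1 m0*?s <= (SS i j. aa i j x*(xi i * xi j))" unfolding e by (simp add: algebra_simps)
 qed
 \<comment> \<open>Commutator terms without a derivative of \<open>phi\<close> go into
   \<open>t0\<close>, together with the zeroth order term; those with \<open>pd k phi\<close> are
   collected in \<open>t1 k\<close> and treated as divergence terms.\<close>
 define t0 where "t0 x = c x*b x + (-1)*(SS i j. pd i (%x. a i j x*pd j c x) x)" for x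
 define t1 where "t1 k x = (SS j. a j k x*pd j c x + a k j x*pd j c x)" for k x
 have t0: "t0 : test_fun W" unfolding t0_def[abs_def] by (intro tf_lincomb tf_mult[OF c b W] tf_sum tf_pd a_pd_test c)
 have t1: "t1 k : test_fun W" for k unfolding t1_def[abs_def] by (intro tf_sum tf_add tf_mult'[OF tf_pd[OF c] a W])
 have sol: "weak_solution (%x. c x*u x) (%x. t0 x*u x) (%k x. t1 k x*u x)" unfolding weak_solution_def
 proof
  fix phi :: "real^'n => real" assume phi: "phi : test_fun UNIV"
  let ?ip = "L2_inner lborel"
  have sm: "smooth_on phi W" "smooth_on (pd k phi) W" for k
   using smooth_subset[OF tf_smooth[OF phi]] smooth_subset[OF tf_smooth[OF tf_pd[OF phi]]] W by auto
  have cphi: "(%x. c x*phi x) : test_fun W" by (rule tf_mult[OF c sm(1) W])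
  have pt: "(c x*u x)*pd i (%x. aa i j x*pd j phi x) x = u x*(c x*pd i (%x. a i j x*pd j phi x) x)" for i j x
  proof (cases "x : K")
   case True
   hence "x : N" using c2(5) by blast
   hence "pd i (%x. aa i j x*pd j phi x) x = pd i (%x. a i j x*pd j phi x) x" by (intro pd_cong_open[OF c2(4)]) (simp_all add: aa_def t_def c2(7))
   thus ?thesis by simp
  qed (simp add: K(3))
  define T1 where "T1 i j = pd i (%x. a i j x*pd j (%x. c x*phi x) x)" for i j
  define T2 where "T2 i j x = (a i j x*pd i c x)*pd j phi x" for i j x
  define T3 where "T3 i j x = pd i (%x. a i j x*pd j c x) x*phi x" for i j x
  define T4 where "T4 i j x = (a i j x*pd j c x)*pd i phi x" for i j x
  have T: "T1 i j : test_fun W" "T2 i j : test_fun W" "T3 i j : test_fun W" "T4 i j : test_fun W" for i j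
   unfolding T1_def T2_def[abs_def] T3_def[abs_def] T4_def[abs_def]
   by (intro tf_pd a_pd_test cphi tf_mult[OF _ sm(2) W] tf_mult[OF _ sm(1) W] tf_mult'[OF tf_pd[OF c] a W] c)+
  note Ti = T[THEN test_mult_integrable]
  have split: "?ip (%x. c x*u x) (pd i (%x. aa i j x*pd j phi x)) = ?ip u (T1 i j) - ?ip u (T2 i j) - ?ip u (T3 i j) - ?ip u (T4 i j)" for i j
  proof -
   have "?ip (%x. c x*u x) (pd i (%x. aa i j x*pd j phi x)) = (LBINT x. u x*T1 i j x - u x*T2 i j x - u x*T3 i j x - u x*T4 i j x)"
    unfolding L2_inner_def pt cutoff_commutator[OF c phi] T1_def T2_def T3_def T4_def by (simp only: right_diff_distrib)
   also have "... = ?ip u (T1 i j) - ?ip u (T2 i j) - ?ip u (T3 i j) - ?ip u (T4 i j)" unfolding L2_inner_def using Ti by simp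
   finally show ?thesis .
  qed
  have S1: "(SS i j. ?ip u (T1 i j)) = ?ip u (%x. b x*(c x*phi x))" unfolding T1_def by (rule weak[OF cphi])
  have S3: "(SS i j. ?ip u (T3 i j)) = ?ip u (%x. (SS i j. pd i (%x. a i j x*pd j c x) x)*phi x)"
  proof -
   have "?ip u (%x. (SS i j. pd i (%x. a i j x*pd j c x) x)*phi x) = (LBINT x. (SS i j. u x*T3 i j x))"
    unfolding L2_inner_def T3_def by (simp only: sum_distrib_left sum_distrib_right)
   also have "... = (SS i j. ?ip u (T3 i j))" unfolding L2_inner_def using Ti(3) by simp
   finally show ?thesis ..
  qed
  have S24: "(SS i j. ?ip u (T2 i j)) + (SS i j. ?ip u (T4 i j)) = (SS k. ?ip (%x. t1 k x*u x) (pd k phi))"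
  proof -
   have "?ip (%x. t1 k x*u x) (pd k phi) = (LBINT x. (SS j. u x*T2 j k x + u x*T4 k j x))" for k
    unfolding L2_inner_def t1_def T2_def T4_def by (simp add: sum_distrib_left sum_distrib_right algebra_simps)
   hence "?ip (%x. t1 k x*u x) (pd k phi) = (SS j. ?ip u (T2 j k)) + (SS j. ?ip u (T4 k j))" for k
    unfolding L2_inner_def using Ti(2,4) by (simp add: sum.distrib)
   thus ?thesis by (simp add: sum.distrib) (rule sum.swap)
  qed
  have S0: "?ip (%x. t0 x*u x) phi = ?ip u (%x. b x*(c x*phi x)) - ?ip u (%x. (SS i j. pd i (%x. a i j x*pd j c x) x)*phi x)"
  proof -
   have "(%x. b x*(c x*phi x)) : test_fun W" by (rule tf_mult'[OF cphi b W])
   moreover have "(%x. (SS i j. pd i (%x. a i j x*pd j c x) x)*phi x) : test_fun W" by (intro tf_mult[OF _ sm(1) W] tf_sum tf_pd a_pd_test c)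
   ultimately have "(LBINT x. u x*(b x*(c x*phi x)) - u x*((SS i j. pd i (%x. a i j x*pd j c x) x)*phi x)) =
    ?ip u (%x. b x*(c x*phi x)) - ?ip u (%x. (SS i j. pd i (%x. a i j x*pd j c x) x)*phi x)"
    unfolding L2_inner_def by (intro LINT_diff test_mult_integrable)
   moreover have "(t0 x*u x)*phi x = u x*(b x*(c x*phi x)) - u x*((SS i j. pd i (%x. a i j x*pd j c x) x)*phi x)" for x
    unfolding t0_def by (simp add: algebra_simps)
   ultimately show ?thesis unfolding L2_inner_def by (simp only:)
  qed
  have "(SS i j. ?ip (%x. c x*u x) (pd i (%x. aa i j x*pd j phi x))) =
   (SS i j. ?ip u (T1 i j)) - (SS i j. ?ip u (T2 i j)) - (SS i j. ?ip u (T3 i j)) - (SS i j. ?ip u (T4 i j))"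
   unfolding split by (simp only: sum_subtractf)
  thus "(SS i j. ?ip (%x. c x*u x) (pd i (%x. aa i j x*pd j phi x))) =
   ?ip (%x. t0 x*u x) phi - (SS k. ?ip (%x. t1 k x*u x) (pd k phi))" using S0 S1 S3 S24 by linarith
 qed
 show ?thesis by (rule elliptic_regularity[OF test_mult_L2[OF c] IH[OF t0] IH[OF t1] sol])
qed

lemma Hc_localized: "t : test_fun W ==> Hc m (%x. t x*u x)"
proof (induction m arbitrary: t)
 case 0
 thus ?case using test_mult_L2 by simp
next
 case (Suc m)
 show ?case by (rule Hc_localized_step[OF Suc.IH Suc.prems])
qed

theorem local_regularity:
 assumes p: "p : W"
 shows "EX r>0. EX f. ball p r <= W & smooth_on f UNIV & (AE x in lborel. x : ball p r --> u x = f x)"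
proof -
 obtain c N where c: "c : test_fun W" "open N" "{p} <= N" "N <= W" "!!x. x : N ==> c x = 1"
  using cutoff_exists[of "{p}" W] p W by (metis bot_least compact_sing insert_subset)
 obtain r where r: "r > 0" "ball p r <= N" using c(2,3) open_contains_ball by (metis insert_subset)
 obtain f where f: "smooth_on f UNIV" "AE x in lborel. c x*u x = f x" using smooth_representative[OF Hc_localized[OF c(1)]] by blast
 have "AE x in lborel. x : ball p r --> u x = f x" using f(2) by eventually_elim (use r(2) c(5) in auto)
 thus ?thesis using r c(4) f(1) by blast
qed

end

text \<open>The substitution rule of the library needs a well-ordered index type; a copy of an arbitrary
 finite index type is well-ordered through some injection into the naturals.\<close>

typedef 'n wo = "UNIV :: 'n set" ..

instance wo :: (finite) finite
proof
 have "(UNIV :: 'a wo set) = range Abs_wo" by (metis Rep_wo_inverse surjI)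
 thus "finite (UNIV :: 'a wo set)" using finite_imageI[OF finite_class.finite_UNIV] by metis
qed

definition wo_nat :: "'n::finite wo => nat" where
 "wo_nat k = (SOME f. inj (f :: 'n => nat)) (Rep_wo k)"

lemma inj_wo_nat: "inj (wo_nat :: 'n::finite wo => nat)"
proof -
 have "EX f. inj (f :: 'n => nat)" using finite_imp_inj_to_nat_seg[OF finite_class.finite_UNIV] by metis
 hence "inj (SOME f. inj (f :: 'n => nat))" by (rule someI_ex)
 from injD[OF this] show ?thesis by (intro injI) (unfold wo_nat_def, metis (no_types) Rep_wo_inject)
qed

instantiation wo :: (finite) wellorder
begin
definition "less_eq_wo (a :: 'a wo) (b :: 'a wo) \<longleftrightarrow> wo_nat a <= wo_nat b"
definition "less_wo (a :: 'a wo) (b :: 'a wo) \<longleftrightarrow> wo_nat a < wo_nat b"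
instance
proof
 fix P :: "'a wo => bool" and a
 assume *: "!!x. (!!y. y < x ==> P y) ==> P x"
 show "P a" by (induction "wo_nat a" arbitrary: a rule: less_induct) (use*in "auto simp: less_wo_def")
qed (use injD[OF inj_wo_nat] in "auto simp: less_eq_wo_def less_wo_def")
end

lemma bij_Rep_wo: "bij (Rep_wo :: 'n wo => 'n)" by (metis Abs_wo_inverse Rep_wo_inverse UNIV_I bijI')

section \<open>Change of variables for arbitrary coordinate types\<close>

text \<open>The permutations of the two index types correspond by conjugation with \<open>f\<close>,
  which preserves signs.\<close>

lemma det_reindex:
 fixes A :: "real^'n ^ 'n" and f :: "'k::finite => 'n::finite"
 assumes f: "bij f"
 shows "det (\<chi> i j. A$f i$f j) = det A"
proof -
 have b: "bij_betw (map_permutation UNIV f) {p. p permutes (UNIV :: 'k set)} {p. p permutes (UNIV :: 'n set)}"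
  using bij_betw_permutations[OF f] by (simp add: map_permutation_def[abs_def] restrict_id_def o_def bij_is_surj[OF f])
 have "det A = (\<Sum>p | p permutes (UNIV :: 'k set). of_int (sign (map_permutation UNIV f p))*(\<Prod>i\<in>UNIV. A$i$map_permutation UNIV f p i))"
  unfolding det_def by (rule sum.reindex_bij_betw[OF b, symmetric])
 also have "... = (\<Sum>p | p permutes (UNIV :: 'k set). of_int (sign p)*(\<Prod>i\<in>UNIV. A$f i$f (p i)))"
 proof (rule sum.cong[OF refl])
  fix p :: "'k => 'k" assume p: "p : {p. p permutes UNIV}"
  have "(\<Prod>i\<in>UNIV. A$i$map_permutation UNIV f p i) = (\<Prod>i\<in>UNIV. A$f i$map_permutation UNIV f p (f i))"
   by (rule prod.reindex_bij_betw[OF f, symmetric])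
  thus "of_int (sign (map_permutation UNIV f p))*(\<Prod>i\<in>UNIV. A$i$map_permutation UNIV f p i)
    = of_int (sign p)*(\<Prod>i\<in>UNIV. A$f i$f (p i))"
   using p sign_map_permutation[OF bij_is_inj[OF f], of p] map_permutation_apply[OF bij_is_inj[OF f], of _ p] by simp
 qed
 finally show ?thesis by (simp add: det_def)
qed

definition reindex :: "real^'n => real^'n wo" where
 "reindex x = (\<chi> k. x$Rep_wo k)"

definition unindex :: "real^'n wo => real^'n" where
 "unindex x = (\<chi> k. x$Abs_wo k)"

lemma reindex_unindex[simp]: "reindex (unindex x) = x" "unindex (reindex y) = y"
 by (simp_all add: reindex_def unindex_def vec_eq_iff Rep_wo_inverse Abs_wo_inverse)

lemma bounded_linear_reindex: "bounded_linear (reindex :: real^'n => real^'n wo)"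
 "bounded_linear (unindex :: real^'n wo => real^'n)"
 by (rule linear_conv_bounded_linear[THEN iffD1], rule linearI; simp add: reindex_def unindex_def vec_eq_iff)+

lemma borel_reindex[measurable]: "reindex : borel_measurable borel" "unindex : borel_measurable borel"
 by (intro borel_measurable_continuous_onI linear_continuous_on bounded_linear_reindex)+

lemma lborel_unindex: "lborel = distr lborel borel (unindex :: real^'n wo => real^'n)"
proof (rule lborel_eqI)
 fix l u :: "real^'n" assume lu: "!!b. b : Basis ==> l \<bullet> b <= u \<bullet> b"
 have le: "l$i <= u$i" for i using lu[of "axis i 1"] by (simp add: Basis_vec_eq inner_axis)
 have s: "unindex -` box l u = box (reindex l) (reindex u)" by (auto simp: box_def Basis_vec_eq inner_axis reindex_def unindex_def Rep_wo_inverse)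
   (metis Rep_wo_inverse Abs_wo_inverse UNIV_I)+
 have "emeasure (distr lborel borel unindex) (box l u) = emeasure lborel (box (reindex l) (reindex u))" by (subst emeasure_distr) (simp_all add: s)
 also have "... = ennreal (\<Prod>b\<in>Basis. (reindex u - reindex l) \<bullet> b)"
  by (intro emeasure_lborel_box) (auto simp: Basis_vec_eq inner_axis reindex_def le)
 also have "(\<Prod>b\<in>Basis. (reindex u - reindex l) \<bullet> b) = (\<Prod>k\<in>UNIV. u$Rep_wo k - l$Rep_wo k)"
  unfolding Basis_vec_eq by (subst prod.reindex) (auto simp: inj_on_def axis_eq_axis inner_axis reindex_def)
 also have "... = (\<Prod>i\<in>UNIV. u$i - l$i)" by (rule prod.reindex_bij_betw[OF bij_Rep_wo])
 also have "... = (\<Prod>b\<in>Basis. (u - l) \<bullet> b)"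
  unfolding Basis_vec_eq by (subst prod.reindex) (auto simp: inj_on_def axis_eq_axis inner_axis)
 finally show "emeasure (distr lborel borel unindex) (box l u) = ennreal (\<Prod>b\<in>Basis. (u - l) \<bullet> b)" .
qed simp

text \<open>The half of the substitution rule that the comparison of two chart measures uses. If the
  right side is infinite there is nothing to show; otherwise \<open>h\<close> is integrable over
  \<open>S\<close>, and so is \<open>f\<close> over the image, with the bound.\<close>

lemma nn_integral_image_le_wellorder:
 fixes tau :: "real^'n::{finite,wellorder} => real^'n::_"
 assumes S: "S : sets borel" and der: "!!x. x : S ==> (tau has_derivative tau' x) (at x within S)"
  and h: "!!x. x : S ==> h x = abs (det (matrix (tau' x)))*f (tau x)"
  and f: "!!x. 0 <= f x" and hm: "h : borel_measurable borel"
 shows "(NN x. ennreal (f x)*indicator (tau ` S) x) <= (NN x. ennreal (h x)*indicator S x)"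
proof (cases "(NN x. ennreal (h x)*indicator S x) < \<infinity>")
 case True
 have h0: "x : S ==> 0 <= h x" for x using h f by simp
 have [measurable]: "S : sets borel" "h : borel_measurable borel" by fact+
 have e: "(NN x. ennreal (h x)*indicator S x) = (NN x. ennreal (indicator S x*h x))" by (rule nn_integral_cong) (auto simp: indicator_def)
 have "(%x. indicator S x*h x) integrable_on UNIV" by (rule nn_integral_integrable_on) (use True[unfolded e] h0 in "auto simp: indicator_def")
 hence hI: "h integrable_on S" by (subst (asm) integrable_cong[of _ _ "%x. if x : S then h x else 0"])
   (auto simp: integrable_restrict_UNIV indicator_def)
 hence D: "(%x. abs (det (matrix (tau' x)))*f (tau x)) integrable_on S" by (rule integrable_eq) (rule h)
 have *: "f integrable_on (tau ` S)" "integral (tau ` S) f <= integral S h"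
  using integral_on_image_ubound_nonneg[OF f der D] h by (auto cong: integral_cong)
 have "(NN x. ennreal (f x)*indicator (tau ` S) x) = ennreal (integral (tau ` S) f)"
  by (rule nn_integral_has_integral_lebesgue') (use f *(1) in auto)
 also have "... <= ennreal (integral S h)" using *(2) by (rule ennreal_leI)
 also have "... = (NN x. ennreal (h x)*indicator S x)" by (rule nn_integral_has_integral_lebesgue'[symmetric]) (use h0 hI in auto)
 finally show ?thesis .
qed (simp add: not_less top_unique)

text \<open>Conjugation with the relabelling of coordinates preserves Lebesgue measure and the
  determinant of the derivative.\<close>

lemma nn_integral_image_le:
 fixes tau :: "real^'n => real^'n"
 assumes S: "S : sets borel" "tau ` S : sets borel" and der: "!!x. x : S ==> (tau has_derivative tau' x) (at x)"
  and h: "!!x. x : S ==> h x = abs (det (matrix (tau' x)))*f (tau x)"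
  and f: "!!x. 0 <= f x" and hm: "h : borel_measurable borel" "f : borel_measurable borel"
 shows "(NN x. ennreal (f x)*indicator (tau ` S) x) <= (NN x. ennreal (h x)*indicator S x)"
proof -
 have [measurable]: "S : sets borel" "tau ` S : sets borel" "h : borel_measurable borel" "f : borel_measurable borel" by fact+
 let ?S = "unindex -` S" and ?t = "%x. reindex (tau (unindex x))" and ?t' = "%x y. reindex (tau' (unindex x) (unindex y))"
 have det: "det (matrix (?t' x)) = det (matrix (tau' (unindex x)))" for x
 proof -
  have u: "unindex (axis j 1) = axis (Rep_wo j) (1::real)" for j :: "'n wo"
   by (auto simp: vec_eq_iff unindex_def axis_def Abs_wo_inverse Rep_wo_inverse)
  have "matrix (?t' x) = (\<chi> i j. matrix (tau' (unindex x))$Rep_wo i$Rep_wo j)" by (simp add: matrix_def vec_eq_iff u) (simp add: reindex_def)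
  thus ?thesis using det_reindex[OF bij_Rep_wo] by metis
 qed
 have im: "?t ` ?S = unindex -` (tau ` S)"
 proof (safe)
  fix x s assume "unindex x = tau s" "s : S"
  thus "x : ?t ` ?S" by (intro image_eqI[of _ _ "reindex s"]) (auto, metis reindex_unindex)
 qed simp
 have "(NN x. ennreal (f x)*indicator (tau ` S) x) = (NN x. ennreal (f (unindex x))*indicator (?t ` ?S) x)"
  unfolding im by (subst lborel_unindex, subst nn_integral_distr) (auto simp: indicator_def)
 also have "... <= (NN x. ennreal (h (unindex x))*indicator ?S x)"
 proof (rule nn_integral_image_le_wellorder[where tau' = ?t'])
  show "?S : sets borel" using measurable_sets_borel[OF borel_reindex(2) S(1)] .
  show "(?t has_derivative ?t' x) (at x within ?S)" if "x : ?S" for x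
  proof -
   have "((tau o unindex) has_derivative tau' (unindex x) o unindex) (at x)"
    by (rule diff_chain_at[OF bounded_linear_imp_has_derivative[OF bounded_linear_reindex(2)]]) (use that der in simp)
   hence "((reindex o (tau o unindex)) has_derivative reindex o (tau' (unindex x) o unindex)) (at x)"
    by (rule diff_chain_at) (rule bounded_linear_imp_has_derivative[OF bounded_linear_reindex(1)])
   thus ?thesis by (simp add: o_def has_derivative_at_withinI)
  qed
 qed (use h f in "auto simp: det")
 also have "... = (NN x. ennreal (h x)*indicator S x)" by (subst (2) lborel_unindex, subst nn_integral_distr) (auto simp: indicator_def)
 finally show ?thesis .
qed

section \<open>Immersed coordinate patches\<close>

lemma matrix_inv_mult:
 fixes M :: "real^'n ^ 'n"
 assumes "det M ~= 0"
 shows "M ** matrix_inv M = mat 1" "matrix_inv M ** M = mat 1"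
proof -
 have "EX B. M ** B = mat 1 & B ** M = mat 1" using assms invertible_det_nz invertible_def by blast
 from someI_ex[OF this] show "M ** matrix_inv M = mat 1" "matrix_inv M ** M = mat 1" unfolding matrix_inv_def by blast+
qed

text \<open>Cramer's rule for a column of the inverse. As a quotient of determinants, each entry of
  the inverse metric is visibly smooth.\<close>

lemma matrix_inv_entry:
 fixes M :: "real^'n ^ 'n"
 assumes "det M ~= 0"
 shows "matrix_inv M$k$l = det (\<chi> i j. if j = k then axis l 1$i else M$i$j) / det M"
proof -
 have "M *v (matrix_inv M *v axis l 1) = axis l 1" by (simp add: matrix_vector_mul_assoc matrix_inv_mult[OF assms])
 hence "matrix_inv M *v axis l 1 = (\<chi> k. det (\<chi> i j. if j = k then axis l 1$i else M$i$j) / det M)" by (rule iffD1[OF cramer[OF assms]])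
 hence "(matrix_inv M *v axis l 1)$k = det (\<chi> i j. if j = k then axis l 1$i else M$i$j) / det M" by simp
 thus ?thesis by (simp add: matrix_vector_mult_basis column_def)
qed

lemma smooth_det:
 fixes M :: "'a::euclidean_space => real^'n ^ 'n"
 assumes "open S" "!!i j. smooth_on (%p. M p$i$j) S"
 shows "smooth_on (%p. det (M p)) S" unfolding det_def using assms by (intro smooth_sum smooth_mult smooth_prod smooth_const) auto

text \<open>The segment from the identity to \<open>M\<close> consists of positive definite
  matrices, so the determinant has no zero along it and keeps the sign it has at the
  identity.\<close>

lemma det_pos_if_positive_definite:
 fixes M :: "real^'n ^ 'n"
 assumes pos: "!!xi. xi ~= 0 ==> 0 < xi \<bullet> (M *v xi)"
 shows "0 < det M"
proof (rule ccontr)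
 define N where "N t = (1 - t) *R mat 1 + t *R M" for t :: real
 assume "~ 0 < det M"
 hence "det (N 1) <= 0" "det (N 0) >= 0" by (simp_all add: N_def)
 moreover have "continuous_on {0..1} (%t. det (N t))" unfolding det_def N_def by (auto intro!: continuous_intros)
 ultimately obtain t where t: "0 <= t" "t <= 1" "det (N t) = 0" using IVT2'[of "%t. det (N t)" 1 0 0] by auto
 then obtain xi where xi: "N t *v xi = 0" "xi ~= 0"
  using invertible_det_nz[of "N t"] unfolding invertible_left_inverse matrix_left_invertible_ker by blast
 have "xi \<bullet> (N t *v xi) = (1 - t)*(xi \<bullet> xi) + t*(xi \<bullet> (M *v xi))"
  by (simp add: N_def matrix_vector_mult_add_rdistrib scaleR_matrix_vector_assoc[symmetric] inner_add_right)
 moreover have "... > 0"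
 proof (cases "t = 1")
  case False
  hence "(1 - t)*(xi \<bullet> xi) > 0" using t xi by simp
  moreover have "t*(xi \<bullet> (M *v xi)) >= 0" using t pos[OF xi(2)] by simp
  ultimately show ?thesis by linarith
 qed (use pos[OF xi(2)] in simp)
 ultimately show False using xi(1) by simp
qed

text \<open>The components of the gradient of \<open>f\<close> in the coordinate frame
  \<open>pd i X\<close>.\<close>

definition flux :: "(real^'n => 'e::euclidean_space) => (real^'n => real) => 'n => real^'n => real" where
 "flux X f i p = (SS j. matrix_inv (metric X p)$i$j*pd j f p)"

text \<open>The density of the weighted measure with respect to Lebesgue measure in the
  coordinates.\<close>

definition weight :: "(real^'n => 'e::euclidean_space) => real^'n => real" where
 "weight X p = vol_density X p*exp ((norm (X p))^2 / 4)"

text \<open>The drifted Laplacian in divergence form: with the exponential factor absorbed into the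
  density the drift term disappears, and symmetry becomes an integration by parts in the
  coordinates.\<close>

definition drift_coord :: "(real^'n => 'e::euclidean_space) => (real^'n => real) => real^'n => real" where
 "drift_coord X f p = 1 / weight X p * (SS i. pd i (%q. weight X q*flux X f i q) p)"

lemma grad_coord_flux: "grad_coord X f p = (SS i. flux X f i p *R pd i X p)" by (simp add: grad_coord_def flux_def scaleR_left.sum)

lemma metric_quadratic:
 fixes X :: "real^'n => 'e::euclidean_space"
 assumes "X differentiable (at p)"
 shows "eta \<bullet> (metric X p *v xi) = FD X p eta \<bullet> FD X p xi"
 unfolding frechet_derivative_pd[OF assms] inner_sum_left inner_sum_right inner_scaleR_left inner_scaleR_right
 by (simp add: inner_vec_def matrix_vector_mult_def metric_def sum_distrib_left mult_ac) (subst sum.swap, simp add: mult_ac)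

lemma metric_compose:
 fixes Y :: "real^'n => 'e::euclidean_space"
 assumes t: "(tau has_derivative tau') (at p)" and Y: "Y differentiable (at (tau p))"
  and S: "open S" "p : S" "!!q. q : S ==> X q = Y (tau q)"
 shows "metric X p = transpose (matrix tau') ** metric Y (tau p) ** matrix tau'"
  and "FD X p = FD Y (tau p) o tau'" "X differentiable (at p)"
proof -
 have "((Y o tau) has_derivative FD Y (tau p) o tau') (at p)" by (rule diff_chain_at[OF t]) (use Y frechet_derivative_works in blast)
 hence D: "(X has_derivative FD Y (tau p) o tau') (at p)" by (rule has_derivative_transform_within_open[OF _ S(1,2)]) (use S(3) in simp)
 show fd: "FD X p = FD Y (tau p) o tau'" using frechet_derivative_at[OF D] by simp
 show "X differentiable (at p)" using D differentiableI by blast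
 have "metric X p$i$j = (transpose (matrix tau') ** metric Y (tau p) ** matrix tau')$i$j" for i j
 proof -
  have "metric X p$i$j = tau' (axis i 1) \<bullet> (metric Y (tau p) *v tau' (axis j 1))"
   unfolding metric_quadratic[OF Y] by (simp add: metric_def pd_def fd)
  also have "... = (SS k l. matrix tau'$k$i*(metric Y (tau p)$k$l*matrix tau'$l$j))"
   by (simp add: inner_vec_def matrix_vector_mult_def matrix_def sum_distrib_left)
  also have "... = (transpose (matrix tau') ** (metric Y (tau p) ** matrix tau'))$i$j"
   by (simp add: matrix_matrix_mult_def transpose_def sum_distrib_left)
  finally show ?thesis by (simp add: matrix_mul_assoc)
 qed
 thus "metric X p = transpose (matrix tau') ** metric Y (tau p) ** matrix tau'" by (simp add: vec_eq_iff)
qed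

locale immersed_patch =
 fixes W :: "(real^'n) set" and X :: "real^'n => 'e::euclidean_space"
 assumes W: "open W" and X: "smooth_on X W" and immersion: "!!p. p : W ==> inj (FD X p)"
begin

abbreviation "ginv p \<equiv> matrix_inv (metric X p)"

lemma X_differentiable: "p : W ==> X differentiable (at p)" by (rule smooth_differentiable[OF X W])

lemma linear_dX: "p : W ==> linear (FD X p)" by (rule linear_frechet_derivative[OF X_differentiable])

lemma metric_sym: "metric X p$i$j = metric X p$j$i" by (simp add: metric_def inner_commute)

lemma metric_smooth: "smooth_on (%p. metric X p$i$j) W" by (simp add: metric_def smooth_inner[OF W] smooth_pd'[OF X])

lemma metric_pos: "p : W ==> xi ~= 0 ==> 0 < xi \<bullet> (metric X p *v xi)" unfolding metric_quadratic[OF X_differentiable]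
 using linear_injective_0[OF linear_dX[of p]] immersion[of p] by (metis inner_gt_zero_iff)

lemma det_pos: "p : W ==> 0 < det (metric X p)" by (rule det_pos_if_positive_definite) (rule metric_pos)

lemma det_nz: "p : W ==> det (metric X p) ~= 0" using det_pos[of p] by simp

lemma ginv_metric: "p : W ==> (SS j. ginv p$i$j*metric X p$j$k) = (if i = k then 1 else 0)"
 using arg_cong[OF matrix_inv_mult(2)[OF det_nz[of p]], of "%M. M$i$k"] by (simp add: matrix_matrix_mult_def mat_def)

lemma ginv_smooth: "smooth_on (%p. ginv p$k$l) W"
proof -
 have "smooth_on (%p. det (\<chi> i j. if j = k then axis l 1$i else metric X p$i$j) / det (metric X p)) W"
 proof (rule smooth_divide[OF W smooth_det[OF W] smooth_det[OF W metric_smooth] det_nz])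
  fix i j show "smooth_on (%p. (\<chi> i j. if j = k then axis l 1$i else metric X p$i$j)$i$j) W"
   by (cases "j = k") (simp_all add: smooth_const[OF W] metric_smooth)
 qed
 thus ?thesis by (subst smooth_cong[OF W matrix_inv_entry[OF det_nz]])
qed

lemma metric_ginv_vec: "p : W ==> metric X p *v (ginv p *v xi) = xi" "p : W ==> ginv p *v (metric X p *v xi) = xi"
 using matrix_inv_mult[OF det_nz[of p]] by (simp_all add: matrix_vector_mul_assoc)

lemma metric_self_adjoint: "xi \<bullet> (metric X p *v eta) = (metric X p *v xi) \<bullet> eta"
 by (simp add: inner_vec_def matrix_vector_mult_def sum_distrib_left sum_distrib_right)
  (subst sum.swap, simp add: metric_sym mult_ac)

lemma ginv_pos:
 assumes "p : W" "xi ~= 0" shows "0 < xi \<bullet> (ginv p *v xi)"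
proof -
 have "ginv p *v xi ~= 0" using metric_ginv_vec(1)[OF assms(1), of xi] assms(2) by auto
 from metric_pos[OF assms(1) this] show ?thesis by (simp add: metric_ginv_vec(1)[OF assms(1)] inner_commute)
qed

lemma ginv_sym:
 assumes "p : W" shows "ginv p$i$j = ginv p$j$i"
proof -
 have "transpose (metric X p) = metric X p" by (simp add: vec_eq_iff transpose_def metric_sym)
 hence "transpose (ginv p) ** metric X p = mat 1"
  using matrix_transpose_mul[of "metric X p" "ginv p"] matrix_inv_mult(1)[OF det_nz[OF assms]] by simp
 hence "transpose (ginv p) = ginv p" using matrix_inv_mult(1)[OF det_nz[OF assms]] by (metis matrix_mul_assoc matrix_mul_lid matrix_mul_rid)
 from arg_cong[OF this, of "%M. M$j$i"] show ?thesis by (simp add: transpose_def)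
qed

lemma vol_pos: "p : W ==> 0 < vol_density X p" by (simp add: vol_density_def det_pos)

lemma vol_smooth: "smooth_on (vol_density X) W"
 unfolding vol_density_def[abs_def] by (rule smooth_sqrt_compose[OF W smooth_det[OF W metric_smooth] det_pos])

lemma gauss_smooth: "smooth_on (%p. exp ((norm (X p))^2 / 4)) W"
proof -
 have "smooth_on (%p. exp ((1/4)*(X p \<bullet> X p))) W" by (intro smooth_exp_compose smooth_mult smooth_inner smooth_const W X)
 thus ?thesis by (simp add: power2_norm_eq_inner)
qed

lemma weight_pos: "p : W ==> 0 < weight X p" by (simp add: weight_def vol_pos)

lemma weight_smooth: "smooth_on (weight X) W" unfolding weight_def[abs_def] by (rule smooth_mult[OF W vol_smooth gauss_smooth])

lemma flux_smooth: "smooth_on f W ==> smooth_on (flux X f i) W"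
 unfolding flux_def[abs_def] by (intro smooth_sum smooth_mult W ginv_smooth smooth_pd')

lemma drift_coord_smooth: "smooth_on f W ==> smooth_on (drift_coord X f) W" unfolding drift_coord_def[abs_def]
 by (intro smooth_sum smooth_mult smooth_divide smooth_const W smooth_pd' flux_smooth weight_smooth) (use weight_pos in force)+

lemma grad_coord_smooth: "smooth_on f W ==> smooth_on (grad_coord X f) W"
 unfolding grad_coord_flux[abs_def] by (intro smooth_sum smooth_scaleR W flux_smooth smooth_pd' X)

lemma grad_coord_derivative:
 assumes "p : W"
 shows "grad_coord X f p = FD X p (\<chi> i. flux X f i p)" by (simp add: frechet_derivative_pd[OF X_differentiable[OF assms]] grad_coord_flux)

lemma grad_coord_inner:
 assumes p: "p : W" and f: "f differentiable (at p)"
 shows "grad_coord X f p \<bullet> FD X p xi = FD f p xi"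
proof -
 let ?d = "\<chi> j. pd j f p"
 have "(\<chi> i. flux X f i p) = ginv p *v ?d" by (simp add: vec_eq_iff flux_def matrix_vector_mult_def)
 hence "grad_coord X f p \<bullet> FD X p xi = (metric X p *v (ginv p *v ?d)) \<bullet> xi"
  unfolding grad_coord_derivative[OF p] metric_quadratic[OF X_differentiable[OF p], symmetric] metric_self_adjoint by simp
 thus ?thesis by (simp add: metric_ginv_vec[OF p] frechet_derivative_pd[OF f] inner_vec_def mult.commute)
qed

text \<open>A tangent vector is determined by its inner products with tangent vectors. This
  describes the gradient by the tangent space and the differential, and so prepares its independence
  of the chart.\<close>

lemma grad_coord_unique:
 assumes p: "p : W" and f: "f differentiable (at p)" and v: "v : range (FD X p)"
  and eq: "!!xi. v \<bullet> FD X p xi = FD f p xi"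
 shows "v = grad_coord X f p"
proof -
 obtain xi where xi: "v - grad_coord X f p = FD X p xi"
  using v unfolding grad_coord_derivative[OF p] by (metis (no_types) linear_diff[OF linear_dX[OF p]] imageE)
 have "(v - grad_coord X f p) \<bullet> (v - grad_coord X f p) = 0"
  unfolding xi using eq[of xi] grad_coord_inner[OF p f, of xi] xi by (metis inner_diff_left right_minus_eq)
 thus ?thesis by simp
qed

lemma grad_coord_inner_grad_coord:
 assumes p: "p : W" and f: "f differentiable (at p)"
 shows "grad_coord X f p \<bullet> grad_coord X h p = (SS i. pd i f p*flux X h i p)" using grad_coord_inner[OF p f, of "\<chi> i. flux X h i p"]
 by (simp add: grad_coord_derivative[OF p, of h] frechet_derivative_pd[OF f] mult.commute)

text \<open>The \<open>i\<close>-th derivative of \<open>exp (|X|^2 / 4)\<close> is the function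
  itself times half the inner product of \<open>X\<close> and \<open>pd i X\<close>; summed against
  the flux this is the drift term.\<close>

lemma drift_coord_eq:
 assumes p: "p : W" and f: "smooth_on f W"
 shows "laplace_coord X f p + 1/2*(X p \<bullet> grad_coord X f p) = drift_coord X f p"
proof -
 let ?v = "vol_density X" and ?E = "%p. exp ((norm (X p))^2 / 4)"
 have d: "g differentiable (at p)" if "smooth_on g W" for g :: "real^'n => real" using smooth_differentiable[OF that W p] .
 have E: "pd i ?E p = ?E p*(1/2*(X p \<bullet> pd i X p))" for i
 proof -
  have "((%q. exp (X q \<bullet> X q / 4)) has_derivative
   (%h. (X p \<bullet> FD X p h + FD X p h \<bullet> X p) / 4*exp (X p \<bullet> X p / 4))) (at p)"
   by (rule has_derivative_compose[of "%q. X q \<bullet> X q / 4" _ p UNIV exp "%h. h*exp (X p \<bullet> X p / 4)", simplified])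
    (auto intro!: derivative_eq_intros X_differentiable[OF p, unfolded frechet_derivative_works] simp: field_simps)
  from pd_eq[OF this] show ?thesis unfolding power2_norm_eq_inner by (simp add: pd_def inner_commute)
 qed
 have "pd i (%q. weight X q*flux X f i q) p
   = ?E p*(pd i (%q. ?v q*flux X f i q) p + ?v p*(flux X f i p*(1/2*(X p \<bullet> pd i X p))))" for i
 proof -
  have "pd i (%q. weight X q*flux X f i q) p = pd i (%q. (?v q*flux X f i q)*?E q) p" by (simp add: weight_def mult_ac)
  also have "... = ?v p*flux X f i p*pd i ?E p + pd i (%q. ?v q*flux X f i q) p*?E p"
   by (rule pd_mult) (rule d, intro smooth_mult W vol_smooth flux_smooth f gauss_smooth)+
  finally show ?thesis unfolding E by (simp add: algebra_simps)
 qed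
 hence "drift_coord X f p = 1 / ?v p * (SS i. pd i (%q. ?v q*flux X f i q) p + ?v p*(flux X f i p*(1/2*(X p \<bullet> pd i X p))))"
  by (simp add: drift_coord_def weight_def sum_distrib_left[symmetric])
 also have "... = laplace_coord X f p + (SS i. flux X f i p*(1/2*(X p \<bullet> pd i X p)))"
  using vol_pos[OF p] by (simp add: sum.distrib distrib_left laplace_coord_def flux_def sum_divide_distrib)
 also have "(SS i. flux X f i p*(1/2*(X p \<bullet> pd i X p))) = 1/2*(X p \<bullet> grad_coord X f p)"
  by (simp add: grad_coord_flux inner_sum_right sum_distrib_left mult_ac)
 finally show ?thesis by simp
qed

end

section \<open>Charts and the glued volume\<close>

locale immersed_manifold =
 fixes A :: "('n::finite, 'm::{t2_space, second_countable_topology}) param set" and F :: "'m => 'e::euclidean_space"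
 assumes atlas: "smooth_atlas A" and immersion: "smooth_immersion A F"
begin

lemma chart_open: "(W, psi) : A ==> open W" and chart_image_open: "(W, psi) : A ==> open (psi ` W)"
 using atlas unfolding smooth_atlas_def by fastforce+

lemma chart_inj: "(W, psi) : A ==> inj_on psi W"
 and chart_continuous: "(W, psi) : A ==> continuous_on W psi"
 and chart_inv_continuous: "(W, psi) : A ==> continuous_on (psi ` W) (inv_into W psi)"
proof -
 assume c: "(W, psi) : A"
 then obtain phi where h: "homeomorphism W (psi ` W) psi phi" using atlas unfolding smooth_atlas_def by fastforce
 thus i: "inj_on psi W" by (metis homeomorphism_def inj_on_inverseI)
 show "continuous_on W psi" using h by (simp add: homeomorphism_def)
 have "inv_into W psi x = phi x" if "x : psi ` W" for x using that h i by (auto simp: homeomorphism_def)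
 thus "continuous_on (psi ` W) (inv_into W psi)" using h by (simp add: homeomorphism_def cong: continuous_on_cong)
qed

lemma chart_at: obtains W psi where "(W, psi) : A" "x : psi ` W" using atlas unfolding smooth_atlas_def by blast

lemma chart_inv: "(W, psi) : A ==> p : W ==> inv_into W psi (psi p) = p" using chart_inj by (rule inv_into_f_f)

lemma patch: "(W, psi) : A ==> immersed_patch W (F o psi)"
 using immersion chart_open unfolding smooth_immersion_def smooth_map_def by unfold_locales fastforce+

lemma smooth_mapD: "smooth_map A u ==> (W, psi) : A ==> smooth_on (u o psi) W" unfolding smooth_map_def by fastforce

lemma smooth_map_differentiable: "smooth_map A u ==> (W, psi) : A ==> p : W ==> (u o psi) differentiable (at p)"
 by (rule smooth_differentiable[OF smooth_mapD chart_open])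

lemma open_chart_image: "(W, psi) : A ==> open S ==> S <= W ==> open (psi ` S)"
proof -
 assume c: "(W, psi) : A" and S: "open S" "S <= W"
 have "psi ` S = inv_into W psi -` S \<inter> psi ` W" using S(2) chart_inv[OF c] by force
 thus ?thesis using chart_inv_continuous[OF c, unfolded continuous_on_open_vimage[OF chart_image_open[OF c]]] S(1) by simp
qed

lemma open_chart_preimage: "(W, psi) : A ==> open U ==> open {p : W. psi p : U}"
 using continuous_open_preimage[OF chart_continuous[of W psi] chart_open[of W psi], of U] by (simp add: vimage_def Int_def)

lemma transition:
 assumes c: "(W, psi) : A" and d: "(V, eta) : A"
 shows "open {p : W. psi p : eta ` V}" "smooth_on (inv_into V eta o psi) {p : W. psi p : eta ` V}"
  and "p : W ==> psi p : eta ` V ==> inv_into V eta (psi p) : V"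
  and "p : W ==> psi p : eta ` V ==> eta (inv_into V eta (psi p)) = psi p"
 using open_chart_preimage[OF c chart_image_open[OF d]] atlas c d unfolding smooth_atlas_def by (fastforce intro: inv_into_into f_inv_into_f)+

text \<open>The transformation rules in one package. Surjectivity of \<open>tau'\<close> comes from
  injectivity of the differential of \<open>F o psi\<close> in equal dimensions, and it gives both
  charts the same tangent space.\<close>

lemma transition_derivative:
 assumes c: "(W, psi) : A" and d: "(V, eta) : A" and p: "p : W" "psi p : eta ` V"
 defines "tau \<equiv> inv_into V eta o psi"
 obtains tau' where "(tau has_derivative tau') (at p)" "surj tau'"
  "vol_density (F o psi) p = abs (det (matrix tau')) * vol_density (F o eta) (tau p)"
  "FD (F o psi) p = FD (F o eta) (tau p) o tau'"
  "!!u. smooth_map A u ==> FD (u o psi :: _ => real) p = FD (u o eta) (tau p) o tau'"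
proof -
 let ?O = "{p : W. psi p : eta ` V}"
 interpret c: immersed_patch W "F o psi" by (rule patch[OF c])
 interpret d: immersed_patch V "F o eta" by (rule patch[OF d])
 note t = transition[OF c d]
 define tau' where "tau' = FD tau p"
 have tp: "tau p : V" "p : ?O" using t(3) p by (auto simp: tau_def)
 have D: "(tau has_derivative tau') (at p)" unfolding tau_def tau'_def by (rule smooth_has_derivative[OF t(2,1) tp(2)])
 have eq: "(u o psi) q = (u o eta) (tau q)" if "q : ?O" for q and u :: "'m => 'b" using t(4) that by (simp add: tau_def)
 note m = metric_compose[OF D d.X_differentiable[OF tp(1)] t(1) tp(2) eq]
 have lin: "linear tau'" using D has_derivative_linear by blast
 have "inj tau'" using c.immersion[OF p(1)] fun_cong[OF m(2)] by (simp add: inj_def o_def)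
 hence surj: "surj tau'" by (rule linear_injective_imp_surjective[OF lin]) simp
 have "det (metric (F o psi) p) = (det (matrix tau'))^2*det (metric (F o eta) (tau p))"
  using arg_cong[OF m(1), of det] by (simp add: det_mul det_transpose power2_eq_square o_def)
 hence v: "vol_density (F o psi) p = abs (det (matrix tau')) * vol_density (F o eta) (tau p)" by (simp add: vol_density_def real_sqrt_mult)
 have "FD (u o psi) p = FD (u o eta) (tau p) o tau'" if "smooth_map A u" for u :: "'m => real"
  by (rule metric_compose(2)[OF D smooth_map_differentiable[OF that d tp(1)] t(1) tp(2) eq])
 from that[OF D surj v m(2) this] show ?thesis by blast
qed

lemma grad_coord_transition:
 assumes c: "(W, psi) : A" and d: "(V, eta) : A" and p: "p : W" "psi p : eta ` V" and u: "smooth_map A u"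
 shows "grad_coord (F o eta) (u o eta) (inv_into V eta (psi p)) = grad_coord (F o psi) (u o psi) p"
proof -
 interpret c: immersed_patch W "F o psi" by (rule patch[OF c])
 interpret d: immersed_patch V "F o eta" by (rule patch[OF d])
 obtain tau' where "((inv_into V eta o psi) has_derivative tau') (at p)" and t1: "surj tau'"
  and "vol_density (F o psi) p = abs (det (matrix tau')) * vol_density (F o eta) ((inv_into V eta o psi) p)"
  and t2: "FD (F o psi) p = FD (F o eta) ((inv_into V eta o psi) p) o tau'"
  and t3: "!!u. smooth_map A u ==> FD (u o psi :: _ => real) p = FD (u o eta) ((inv_into V eta o psi) p) o tau'"
  by (rule transition_derivative[OF c d p]) (rule that)
 note t = t1 fun_cong[OF t2] fun_cong[OF t3[OF u]]
 note q = transition(3)[OF c d p]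
 show ?thesis
 proof (rule c.grad_coord_unique[OF p(1) smooth_map_differentiable[OF u c p(1)]])
  show "grad_coord (F o eta) (u o eta) (inv_into V eta (psi p)) : range (FD (F o psi) p)"
   using surjD[OF t(1), of "\<chi> i. flux (F o eta) (u o eta) i (inv_into V eta (psi p))"] t(2) unfolding d.grad_coord_derivative[OF q] by (auto simp: o_def)
  show "grad_coord (F o eta) (u o eta) (inv_into V eta (psi p)) \<bullet> FD (F o psi) p xi
    = FD (u o psi) p xi" for xi using d.grad_coord_inner[OF q smooth_map_differentiable[OF u d q], of "tau' xi"] t(2,3)[of xi] by (simp add: o_def)
 qed
qed

lemma param_at: obtains V eta where "param_at A x = (V, eta)" "(V, eta) : A" "x : eta ` V"
proof -
 have "EX c. c : A & x : snd c ` fst c" using chart_at[of x] by (metis fst_conv snd_conv)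
 from someI_ex[OF this] have "param_at A x : A & x : snd (param_at A x) ` fst (param_at A x)" by (simp only: param_at_def)
 thus ?thesis by (cases "param_at A x") (use that in auto)
qed

lemma grad_chart:
 assumes c: "(W, psi) : A" and p: "p : W" and u: "smooth_map A u"
 shows "grad A F u (psi p) = grad_coord (F o psi) (u o psi) p"
proof -
 obtain V eta where "param_at A (psi p) = (V, eta)" "(V, eta) : A" "psi p : eta ` V" by (rule param_at)
 with grad_coord_transition[OF c _ p _ u, of V eta] show ?thesis by (simp add: grad_def)
qed

section \<open>The glued volume and the weighted measure in a chart\<close>

definition chart_measure :: "(real^'n) set => (real^'n => 'm) => 'm measure" where
 "chart_measure W psi = distr (density (restrict_space lborel W) (%p. ennreal (vol_density (F o psi) p))) borel psi"

lemma chart_measurable: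
 assumes c: "(W, psi) : A"
 shows "W : sets borel" "psi : borel_measurable (restrict_space borel W)"
  "vol_density (F o psi) : borel_measurable (restrict_space borel W)"
  "weight (F o psi) : borel_measurable (restrict_space borel W)"
  "B : sets borel ==> {p : W. psi p : B} : sets borel"
proof -
 interpret c: immersed_patch W "F o psi" by (rule patch[OF c])
 show W: "W : sets borel" using c.W by simp
 show m: "psi : borel_measurable (restrict_space borel W)" by (rule borel_measurable_continuous_on_restrict[OF chart_continuous[OF c]])
 show "vol_density (F o psi) : borel_measurable (restrict_space borel W)" "weight (F o psi) : borel_measurable (restrict_space borel W)"
  by (intro borel_measurable_continuous_on_restrict smooth_continuous c.vol_smooth c.weight_smooth)+
 assume "B : sets borel"
 from measurable_sets[OF m this] W show "{p : W. psi p : B} : sets borel"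
  by (simp add: space_restrict_space sets_restrict_space_iff vimage_def Int_def conj_commute)
qed

lemma nn_integral_chart_measure:
 assumes c: "(W, psi) : A" and [measurable]: "f : borel_measurable borel"
 shows "(\<integral>\<^sup>+x. f x \<partial>chart_measure W psi) = (NN p. indicator W p*ennreal (vol_density (F o psi) p)*f (psi p))"
proof -
 note [measurable] = chart_measurable(2,3)[OF c]
 have r: "sets (restrict_space lborel W) = sets (restrict_space borel W)" by (simp add: sets_restrict_space)
 have m: "psi : borel_measurable (restrict_space lborel W)" "vol_density (F o psi) : borel_measurable (restrict_space lborel W)"
  using chart_measurable(2,3)[OF c] measurable_cong_sets[OF r refl] by blast+
 note [measurable] = m
 have "(\<integral>\<^sup>+x. f x \<partial>chart_measure W psi) = (\<integral>\<^sup>+p. ennreal (vol_density (F o psi) p)*f (psi p) \<partial>restrict_space lborel W)"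
  unfolding chart_measure_def by (subst nn_integral_distr) (auto simp: nn_integral_density)
 thus ?thesis by (subst (asm) nn_integral_restrict_space) (use chart_measurable(1)[OF c] in "auto simp: mult_ac")
qed

lemma emeasure_chart_measure:
 assumes c: "(W, psi) : A" and B: "B : sets borel"
 shows "emeasure (chart_measure W psi) B
  = (NN p. ennreal (indicator W p * vol_density (F o psi) p)*indicator {p : W. psi p : B} p)"
proof -
 have "emeasure (chart_measure W psi) B = (\<integral>\<^sup>+x. indicator B x \<partial>chart_measure W psi)"
  using B by (simp add: chart_measure_def)
 also have "... = (NN p. ennreal (indicator W p * vol_density (F o psi) p)*indicator {p : W. psi p : B} p)"
  using B by (subst nn_integral_chart_measure[OF c]) (auto intro!: nn_integral_cong simp: indicator_def)
 finally show ?thesis .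
qed

text \<open>\<open>vol_density\<close> transforms by the Jacobian of the transition map, so this is
  the substitution inequality for that map.\<close>

lemma chart_measure_overlap_le:
 assumes c: "(W, psi) : A" and d: "(V, eta) : A" and B: "B : sets borel" "B <= psi ` W" "B <= eta ` V"
 shows "emeasure (chart_measure V eta) B <= emeasure (chart_measure W psi) B"
proof -
 interpret c: immersed_patch W "F o psi" by (rule patch[OF c])
 interpret d: immersed_patch V "F o eta" by (rule patch[OF d])
 let ?S = "{p : W. psi p : B}" and ?t = "inv_into V eta o psi"
 have im: "?t ` ?S = {q : V. eta q : B}"
 proof (intro equalityI subsetI)
  fix q assume q: "q : {q : V. eta q : B}"
  then obtain p where "p : W" "psi p = eta q" using B(2) by force
  thus "q : ?t ` ?S" using q chart_inv[OF d] by (intro image_eqI[of _ _ p]) auto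
 next
  fix q assume "q : ?t ` ?S"
  then obtain p where "p : W" "psi p : B" "q = inv_into V eta (psi p)" by auto
  thus "q : {q : V. eta q : B}" using transition(3,4)[OF c d, of p] B(3) by auto
 qed
 have "ALL p:?S. EX tau'. (?t has_derivative tau') (at p) & vol_density (F o psi) p = abs (det (matrix tau')) * vol_density (F o eta) (?t p)"
  using transition_derivative[OF c d] B(3) by (metis (no_types, lifting) mem_Collect_eq subsetD)
 then obtain t' where t': "!!p. p : ?S ==> (?t has_derivative t' p) (at p) & vol_density (F o psi) p = abs (det (matrix (t' p))) * vol_density (F o eta) (?t p)"
  unfolding bchoice_iff by blast+
 show ?thesis unfolding emeasure_chart_measure[OF c B(1)] emeasure_chart_measure[OF d B(1)] im[symmetric]
 proof (rule nn_integral_image_le[where tau' = t'])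
  show "?S : sets borel" "?t ` ?S : sets borel" unfolding im by (rule chart_measurable(5)[OF _ B(1)], fact)+
  show "indicator W p * vol_density (F o psi) p = abs (det (matrix (t' p)))*(indicator V (?t p) * vol_density (F o eta) (?t p))"
   if "p : ?S" for p using t'[OF that] that transition(3)[OF c d, of p] B(3) by auto
  show "0 <= indicator V q * vol_density (F o eta) q" for q using d.vol_pos[of q] by (auto simp: indicator_def)
  show "(%p. indicator W p * vol_density (F o psi) p) : borel_measurable borel" "(%p. indicator V p * vol_density (F o eta) p) : borel_measurable borel"
   using borel_measurable_continuous_on_indicator[OF _ smooth_continuous[OF c.vol_smooth]]
    borel_measurable_continuous_on_indicator[OF _ smooth_continuous[OF d.vol_smooth]] c.W d.W by auto
 qed (use t' in blast)
qed

lemma volume_alt: "volume A F = (SUP c\<in>A. chart_measure (fst c) (snd c))" by (simp add: volume_def chart_measure_def case_prod_beta)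

lemma sets_volume[simp]: "sets (volume A F) = sets borel" and space_volume[simp]: "space (volume A F) = UNIV"
proof -
 have "A ~= {}" using chart_at by blast
 thus s: "sets (volume A F) = sets borel" unfolding volume_alt by (intro sets_SUP) (auto simp: chart_measure_def)
 thus "space (volume A F) = UNIV" by (metis sets_eq_imp_space_eq space_borel)
qed

text \<open>The supremum of measures is not computed but enclosed. From above it is bounded by the
  measure \<open>M\<close> that agrees with the chart measure on subsets of the image of the chart
  and is infinite on all other Borel sets; every chart measure lies below \<open>M\<close> by the
  comparison on overlaps.\<close>

lemma emeasure_volume_chart:
 assumes c: "(W, psi) : A" and B: "B : sets borel" "B <= psi ` W"
 shows "emeasure (volume A F) B = emeasure (chart_measure W psi) B"
proof (rule antisym)
 define nu where "nu C = (if C <= psi ` W then emeasure (chart_measure W psi) C else \<infinity>)" for C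
 define M where "M = measure_of UNIV (sets borel) nu"
 have ca: "countably_additive (sets borel) nu"
 proof (rule countably_additiveI)
  fix C :: "nat => 'm set" assume C: "range C <= sets borel" "disjoint_family C"
  show "(\<Sum>i. nu (C i)) = nu (\<Union>i. C i)"
  proof (cases "ALL i. C i <= psi ` W")
   case True
   thus ?thesis using suminf_emeasure[of C "chart_measure W psi"] C by (auto simp: nu_def chart_measure_def)
  next
   case False
   then obtain i where i: "~ C i <= psi ` W" by blast
   hence "(\<Sum>i. nu (C i)) >= \<infinity>" using sum_le_suminf[of "%i. nu (C i)" "{i}"] by (auto simp: nu_def)
   thus ?thesis using i by (auto simp: nu_def top_unique)
  qed
 qed
 have "positive (sets borel) nu" by (auto simp: positive_def nu_def)
 hence eM: "emeasure M C = nu C" if "C : sets borel" for C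
  unfolding M_def using emeasure_measure_of_sigma[OF _ _ ca that] sets.sigma_algebra_axioms[of borel] by simp
 have sM: "sets M = sets borel" unfolding M_def using sets.sets_measure_of_eq[of borel] by simp
 have "volume A F <= M" unfolding volume_alt
 proof (rule SUP_least)
  fix d assume "d : A"
  then obtain V eta where d: "(V, eta) : A" "d = (V, eta)" by (cases d) auto
  have "emeasure (chart_measure V eta) C <= emeasure M C" if C: "C : sets borel" for C
  proof (cases "C <= psi ` W")
   case True
   have i: "eta ` V \<inter> C : sets borel" using chart_image_open[OF d(1)] C by auto
   have "emeasure (chart_measure V eta) C = emeasure (chart_measure V eta) (eta ` V \<inter> C)"
    unfolding emeasure_chart_measure[OF d(1) C] emeasure_chart_measure[OF d(1) i] by (intro nn_integral_cong) (auto simp: indicator_def)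
   also have "... <= emeasure (chart_measure W psi) (eta ` V \<inter> C)" by (rule chart_measure_overlap_le[OF c d(1) i]) (use True in auto)
   also have "... <= emeasure (chart_measure W psi) C" using C by (intro emeasure_mono) (auto simp: chart_measure_def)
   finally show ?thesis using True by (simp add: eM[OF C] nu_def)
  qed (simp add: eM[OF C] nu_def)
  thus "chart_measure (fst d) (snd d) <= M" by (subst le_measure) (auto simp: d sM chart_measure_def le_fun_def)
 qed
 hence "emeasure (volume A F) B <= emeasure M B" using B by (subst (asm) le_measure) (auto simp: sM le_fun_def)
 thus "emeasure (volume A F) B <= emeasure (chart_measure W psi) B" using B by (simp add: eM nu_def)
 have "chart_measure W psi <= volume A F" unfolding volume_alt using SUP_upper[OF c, of "%c. chart_measure (fst c) (snd c)"] by simp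
 thus "emeasure (chart_measure W psi) B <= emeasure (volume A F) B" using B by (subst (asm) le_measure) (auto simp: chart_measure_def le_fun_def)
qed

abbreviation "mu == weighted_measure A F"

abbreviation "TF == test_functions A"

lemma sets_weighted[simp, measurable_cong]: "sets mu = sets borel" and space_weighted[simp]: "space mu = UNIV"
 by (simp_all add: weighted_measure_def)

lemma continuous_on_charts:
 assumes "!!W psi. (W, psi) : A ==> continuous_on W (%p. g (psi p))"
 shows "continuous_on UNIV g"
proof -
 have "continuous_on (\<Union>c\<in>A. snd c ` fst c) g"
 proof (rule continuous_on_open_UN)
  fix c assume "c : A"
  then obtain W psi where c: "(W, psi) : A" "c = (W, psi)" by (cases c) auto
  show "open (snd c ` fst c)" using chart_image_open[OF c(1)] c by simp
  have "continuous_on (psi ` W) ((%p. g (psi p)) o inv_into W psi)" by (rule continuous_on_compose[OF chart_inv_continuous[OF c(1)]])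
    (use chart_inv[OF c(1)] assms[OF c(1)] in "simp add: image_image")
  hence "continuous_on (psi ` W) g" by (rule continuous_on_eq) (simp add: f_inv_into_f)
  thus "continuous_on (snd c ` fst c) g" using c by simp
 qed
 moreover have "(\<Union>c\<in>A. snd c ` fst c) = UNIV"
 proof (intro equalityI subsetI UNIV_I)
  fix x show "x : (\<Union>c\<in>A. snd c ` fst c)" by (rule chart_at[of x]) force
 qed
 ultimately show ?thesis by simp
qed

lemma F_continuous: "continuous_on UNIV F"
 by (rule continuous_on_charts) (use smooth_continuous[OF immersed_patch.X[OF patch]] in "simp add: o_def")

lemma density_weighted_chart:
 assumes c: "(W, psi) : A"
 shows "density mu (indicator (psi ` W)) = distr (density (restrict_space lborel W) (%p. ennreal (weight (F o psi) p))) borel psi"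
  (is "?L = ?R")
proof (rule measure_eqI)
 have [measurable]: "F : borel_measurable borel" by (rule borel_measurable_continuous_onI[OF F_continuous])
 have r: "sets (restrict_space lborel W) = sets (restrict_space borel W)" by (simp add: sets_restrict_space)
 have m: "psi : borel_measurable (restrict_space lborel W)" "weight (F o psi) : borel_measurable (restrict_space lborel W)"
  using chart_measurable(2,4)[OF c] measurable_cong_sets[OF r refl] by blast+
 note [measurable] = m
 have U[measurable]: "psi ` W : sets borel" using chart_image_open[OF c] by simp
 have s: "(%x. f x) : borel_measurable (volume A F) \<longleftrightarrow> f : borel_measurable borel" for f :: "'m => ennreal"
  by (rule arg_cong[OF measurable_cong_sets]) auto
 have U': "(indicator (psi ` W) :: _ => ennreal) : borel_measurable borel" using U by simp
 have dv: "density (volume A F) (indicator (psi ` W)) = chart_measure W psi"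
 proof (rule measure_eqI)
  fix B assume "B : sets (density (volume A F) (indicator (psi ` W)))"
  hence B: "B : sets borel" "psi ` W \<inter> B : sets borel" using U by auto
  have "emeasure (density (volume A F) (indicator (psi ` W))) B = emeasure (volume A F) (psi ` W \<inter> B)"
   using B by (subst emeasure_density) (auto simp: s U' nn_integral_indicator indicator_inter_arith[symmetric])
  also have "... = emeasure (chart_measure W psi) B"
   unfolding emeasure_volume_chart[OF c B(2) Int_lower1] emeasure_chart_measure[OF c B(1)] emeasure_chart_measure[OF c B(2)]
   by (intro nn_integral_cong) (auto simp: indicator_def)
  finally show "emeasure (density (volume A F) (indicator (psi ` W))) B = emeasure (chart_measure W psi) B" .
 qed (simp add: chart_measure_def)
 fix B assume "B : sets ?L"
 hence [measurable]: "B : sets borel" by simp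
 have "emeasure ?L B = (\<integral>\<^sup>+x. ennreal (exp ((norm (F x))^2 / 4))*(indicator (psi ` W) x*indicator B x) \<partial>volume A F)"
  unfolding weighted_measure_def by (subst emeasure_density, simp_all add: s U', subst nn_integral_density) (simp_all add: s U' mult_ac)
 also have "... = (\<integral>\<^sup>+x. ennreal (exp ((norm (F x))^2 / 4))*indicator B x \<partial>chart_measure W psi)"
  unfolding dv[symmetric] by (subst nn_integral_density) (simp_all add: s U' mult_ac)
 also have "... = (NN p. indicator W p*ennreal (weight (F o psi) p)*indicator B (psi p))"
 proof (subst nn_integral_chart_measure[OF c], simp, rule nn_integral_cong)
  fix p
  interpret c: immersed_patch W "F o psi" by (rule patch[OF c])
  show "indicator W p*ennreal (vol_density (F o psi) p)*(ennreal (exp ((norm (F (psi p)))^2 / 4))*indicator B (psi p))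
   = indicator W p*ennreal (weight (F o psi) p)*indicator B (psi p)" using c.vol_pos[of p] by (auto simp: weight_def ennreal_mult indicator_def)
 qed
 also have "... = (\<integral>\<^sup>+p. ennreal (weight (F o psi) p)*indicator B (psi p) \<partial>restrict_space lborel W)"
  by (subst nn_integral_restrict_space) (use chart_measurable(1)[OF c] in "auto simp: mult_ac")
 also have "... = (\<integral>\<^sup>+p. indicator B (psi p) \<partial>density (restrict_space lborel W) (%p. ennreal (weight (F o psi) p)))"
  by (subst nn_integral_density) auto
 also have "... = (\<integral>\<^sup>+x. indicator B x \<partial>?R)" by (subst nn_integral_distr) auto
 finally show "emeasure ?L B = emeasure ?R B" by simp
qed simp

text \<open>Density and indicator are part of the pulled back function, so the integral over the
  manifold of a function supported in the chart is a plain \<open>lborel\<close> integral.\<close>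

definition pull :: "(real^'n) set => (real^'n => 'm) => ('m => real) => real^'n => real" where
 "pull W psi f p = indicator W p*(weight (F o psi) p*f (psi p))"

lemma integral_chart:
 assumes c: "(W, psi) : A" and f: "f : borel_measurable borel" "!!x. x ~: psi ` W ==> f x = 0"
 shows "integrable mu f \<longleftrightarrow> integrable lborel (pull W psi f)" "(LINT x|mu. f x) = (LBINT p. pull W psi f p)"
  "pull W psi f : borel_measurable borel"
proof -
 interpret c: immersed_patch W "F o psi" by (rule patch[OF c])
 have r: "sets (restrict_space lborel W) = sets (restrict_space borel W)" by (simp add: sets_restrict_space)
 have m: "psi : borel_measurable (restrict_space lborel W)" "weight (F o psi) : borel_measurable (restrict_space lborel W)"
  using chart_measurable(2,4)[OF c] measurable_cong_sets[OF r refl] by blast+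
 note [measurable] = m f(1)
 have U[measurable]: "psi ` W : sets borel" using chart_image_open[OF c] by simp
 have i: "density mu (indicator (psi ` W)) = density mu (%x. ennreal (indicator (psi ` W) x))"
  by (intro arg_cong[where f="density mu"] ext) (simp add: indicator_def)
 have e: "(%x. indicator (psi ` W) x *R f x) = f" using f(2) by (intro ext) (auto simp: indicator_def)
 have W: "W \<inter> space lborel : sets lborel" using c.W by simp
 have AEw: "AE p in restrict_space lborel W. 0 <= weight (F o psi) p" by (rule AE_I2) (use c.weight_pos in "force simp: space_restrict_space")
 let ?R = "distr (density (restrict_space lborel W) (%p. ennreal (weight (F o psi) p))) borel psi"
 have p: "(%p. indicator W p *R (weight (F o psi) p *R f (psi p))) = pull W psi f" by (simp add: pull_def[abs_def])
 have "integrable mu f \<longleftrightarrow> integrable ?R f"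
  unfolding density_weighted_chart[OF c, symmetric] i by (subst integrable_density) (simp_all add: e[simplified])
 also have "... \<longleftrightarrow> integrable lborel (pull W psi f)" by (subst integrable_distr_eq, simp_all, subst integrable_density)
   (use W AEw in "auto simp: integrable_restrict_space[OF W] set_integrable_def p[simplified]")
 finally show "integrable mu f \<longleftrightarrow> integrable lborel (pull W psi f)" .
 have "(LINT x|mu. f x) = (\<integral>x. f x \<partial>?R)"
  unfolding density_weighted_chart[OF c, symmetric] i by (subst integral_density) (simp_all add: e[simplified])
 also have "... = (LBINT p. pull W psi f p)" by (subst integral_distr, simp_all, subst integral_density)
   (use W AEw in "auto simp: integral_restrict_space[OF W] set_lebesgue_integral_def p[simplified]")
 finally show "(LINT x|mu. f x) = (LBINT p. pull W psi f p)" .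
 have "(%p. weight (F o psi) p*f (psi p)) : borel_measurable (restrict_space lborel W)" by measurable
 thus "pull W psi f : borel_measurable borel"
  using borel_measurable_restrict_space_iff[OF W, of "%p. weight (F o psi) p*f (psi p)"] by (simp add: pull_def[abs_def])
qed

end

section \<open>Test functions on the manifold\<close>

lemma open_AE_outside_imp_empty:
 fixes N :: "(real^'n) set"
 assumes "open N" "AE x in lborel. x ~: N"
 shows "N = {}"
proof -
 have "N : null_sets lborel" using assms by (simp add: AE_iff_null_sets)
 hence "negligible N" using null_sets_completionI negligible_iff_null_sets by blast
 thus ?thesis using open_not_negligible[OF assms(1)] by blast
qed

text \<open>A nonnegative bump supported where \<open>D\<close> has the sign of \<open>D p\<close>
  would otherwise have a positive integral against that sign times \<open>D\<close>.\<close>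

lemma continuous_test_fun_zero:
 fixes D :: "real^'n => real"
 assumes S: "open S" and D: "continuous_on S D" and 0: "!!f. f : test_fun S ==> (LBINT x. D x*f x) = 0"
  and p: "p : S"
 shows "D p = 0"
proof (rule ccontr)
 assume "D p ~= 0"
 define s where "s = sgn (D p)"
 have s: "s*D p > 0" using \<open>D p ~= 0\<close> by (simp add: s_def sgn_mult_abs sgn_if)
 let ?P = "{x : S. s*D x : {0<..}}"
 have c: "continuous_on S (%x. s*D x)" by (intro continuous_intros D)
 have P: "open ?P" using continuous_open_preimage[OF c S open_greaterThan[of 0]] by (simp add: vimage_def Int_def)
 obtain f N where f: "f : test_fun ?P" "!!x. 0 <= f x" "open N" "{p} <= N" "N <= ?P" "!!x. x : N ==> f x = 1"
  by (rule cutoff_exists[of "{p}" ?P]) (use p s P in auto)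
 have fS: "f : test_fun S" using f(1) by (rule tf_mono) auto
 obtain K where K: "compact K" "K <= ?P" "!!x. x ~: K ==> f x = 0" using f(1) unfolding test_fun_def by blast
 have "integrable lborel (%x. indicator K x *R (s*D x*f x))" by (intro borel_integrable_compact K(1) continuous_intros continuous_on_subset[OF D]
   continuous_on_subset[OF smooth_continuous[OF tf_smooth[OF f(1)]]]) (use K(2) in auto)
 moreover have "(%x. indicator K x *R (s*D x*f x)) = (%x. s*D x*f x)" using K(3) by (intro ext) (auto simp: indicator_def)
 ultimately have i: "integrable lborel (%x. s*D x*f x)" by simp
 have nn: "0 <= s*D x*f x" for x using f(2)[of x] K(2,3) by (cases "x : K") (auto intro: mult_nonneg_nonneg less_imp_le)
 have "(LBINT x. s*D x*f x) = 0" using 0[OF fS] by (simp add: mult.assoc)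
 hence "AE x in lborel. s*D x*f x = 0" using integral_nonneg_eq_0_iff_AE[OF i] nn by simp
 hence "AE x in lborel. x ~: N" by (rule AE_mp) (use f(5,6) in "force intro!: AE_I2")
 thus False using open_AE_outside_imp_empty[OF f(3)] f(4) by simp
qed

lemma integral_pd_by_parts_local:
 assumes f: "f : test_fun U" and h: "smooth_on h U" and U: "open U"
 shows "(LBINT x. f x*pd i h x) = - (LBINT x. pd i f x*h x)"
proof -
 note t = tf_mult[OF f h U]
 have "pd i (%x. f x*h x) x = f x*pd i h x + pd i f x*h x" for x
 proof (cases "x : U")
  case True
  thus ?thesis by (intro pd_mult tf_diff[OF f] smooth_differentiable[OF h U])
 qed (simp add: tf_outside[OF tf_pd[OF t]] tf_outside[OF f] tf_outside[OF tf_pd[OF f]])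
 hence "0 = (LBINT x. f x*pd i h x + pd i f x*h x)" using integral_pd_tf[OF tf_UNIV[OF t], of i] by simp
 also have "... = (LBINT x. f x*pd i h x) + (LBINT x. pd i f x*h x)" by (intro LINT_add tf_integrable[where U=U] tf_mult f tf_pd smooth_pd h U)
 finally show ?thesis by simp
qed

context immersed_patch
begin

lemma weak_drift_coord:
 assumes f: "f : test_fun W" and g: "smooth_on g W"
 shows "(LBINT p. weight X p*drift_coord X g p*f p) = - (LBINT p. (SS i. pd i f p*(weight X p*flux X g i p)))"
proof -
 have s: "smooth_on (%p. weight X p*flux X g i p) W" for i by (intro smooth_mult W weight_smooth flux_smooth g)
 have "weight X p*drift_coord X g p*f p = (SS i. f p*pd i (%q. weight X q*flux X g i q) p)" for p
 proof (cases "p : W")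
  case True
  thus ?thesis using weight_pos[of p] by (simp add: drift_coord_def sum_distrib_left mult.commute)
 qed (simp add: tf_outside[OF f])
 hence "(LBINT p. weight X p*drift_coord X g p*f p) = (LBINT p. (SS i. f p*pd i (%q. weight X q*flux X g i q) p))" by simp
 also have "... = (SS i. \<integral>p. f p*pd i (%q. weight X q*flux X g i q) p \<partial>lborel)"
  by (intro LINT_sum tf_integrable[where U=W] tf_mult f smooth_pd' s W)
 also have "... = (SS i. - (LBINT p. pd i f p*(weight X p*flux X g i p)))" by (intro sum.cong refl integral_pd_by_parts_local[OF f s W])
 also have "... = - (LBINT p. (SS i. pd i f p*(weight X p*flux X g i p)))" unfolding sum_negf by (subst LINT_sum)
   (intro tf_integrable[where U=W] tf_mult tf_pd f s W, rule refl)
 finally show ?thesis .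
qed

end

context immersed_manifold
begin

lemma smooth_mapI: "(!!W psi. (W, psi) : A ==> smooth_on (%p. u (psi p)) W) ==> smooth_map A u" unfolding smooth_map_def by (auto simp: o_def)

lemma smooth_mapD': "smooth_map A u ==> (W, psi) : A ==> smooth_on (%p. u (psi p)) W" using smooth_mapD[of u W psi] by (simp add: o_def)

lemma smooth_map_const: "smooth_map A (%x. c)" by (rule smooth_mapI) (rule smooth_const[OF chart_open])

lemma smooth_map_add: "smooth_map A u ==> smooth_map A v ==> smooth_map A (%x. u x + v x)"
 by (rule smooth_mapI) (intro smooth_add smooth_mapD' chart_open)

lemma smooth_map_mult: "smooth_map A u ==> smooth_map A v ==> smooth_map A (%x. u x * v x :: real)"
 by (rule smooth_mapI) (intro smooth_mult smooth_mapD' chart_open)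

lemma smooth_map_compose:
 fixes u :: "'m => real" and s :: "real => real"
 shows "smooth_on s UNIV ==> smooth_map A u ==> smooth_map A (%x. s (u x))"
 by (rule smooth_mapI) (rule smooth_compose[OF chart_open open_UNIV smooth_mapD'], auto)

lemma smooth_map_continuous: "smooth_map A u ==> continuous_on UNIV u" by (rule continuous_on_charts) (rule smooth_continuous[OF smooth_mapD'])

lemma TF_iff: "phi : TF \<longleftrightarrow> smooth_map A phi & (EX K. compact K & (ALL x. x ~: K --> phi x = 0))"
proof -
 have "compact (closure {x. phi x ~= 0})" if K: "compact K" "ALL x. x ~: K --> phi x = 0" for K
 proof -
  have "closure {x. phi x ~= 0} <= K" using K by (intro closure_minimal compact_imp_closed) auto
  thus ?thesis using K(1) by (metis closed_closure compact_Int_closed inf.absorb_iff2)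
 qed
 moreover have "phi x = 0" if "x ~: closure {x. phi x ~= 0}" for x using that closure_subset[of "{x. phi x ~= 0}"] by blast
 ultimately show ?thesis unfolding test_functions_def by blast
qed

section \<open>Transfer of test functions between charts and the manifold\<close>

definition push :: "(real^'n) set => (real^'n => 'm) => (real^'n => real) => 'm => real" where
 "push W psi f x = (if x : psi ` W then f (inv_into W psi x) else 0)"

lemma push_chart: "(W, psi) : A ==> p : W ==> push W psi f (psi p) = f p" by (simp add: push_def chart_inv)

lemma push_support:
 assumes c: "(W, psi) : A" and f: "f : test_fun W"
 shows "EX K. compact K & K <= psi ` W & (ALL x. x ~: K --> push W psi f x = 0)"
proof -
 obtain K where K: "compact K" "K <= W" "!!x. x ~: K ==> f x = 0" using f unfolding test_fun_def by blast
 have "compact (psi ` K)" by (rule compact_continuous_image[OF continuous_on_subset[OF chart_continuous[OF c] K(2)] K(1)])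
 moreover have "psi ` K <= psi ` W" using K(2) by blast
 moreover have "push W psi f x = 0" if "x ~: psi ` K" for x
 proof (cases "x : psi ` W")
  case True
  then obtain p where "p : W" "x = psi p" by blast
  thus ?thesis using that K(3)[of p] push_chart[OF c, of p f] by auto
 qed (simp add: push_def)
 ultimately show ?thesis by (intro exI[of _ "psi ` K"]) auto
qed

text \<open>In another chart two open sets suffice: where the image of \<open>psi\<close> is met,
  the function is a composition with a transition map; off the compact support, which is closed by
  the Hausdorff property, it is 0.\<close>

lemma push_smooth:
 assumes c: "(W, psi) : A" and f: "f : test_fun W"
 shows "smooth_map A (push W psi f)"
proof (rule smooth_mapI)
 fix V eta assume d: "(V, eta) : A"
 obtain K where K: "compact K" "K <= psi ` W" "!!x. x ~: K ==> push W psi f x = 0" using push_support[OF c f] by blast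
 let ?O = "{p : V. eta p : psi ` W}" and ?C = "{p : V. eta p : - K}"
 have C: "open ?C" by (rule open_chart_preimage[OF d]) (use K(1) in "simp add: compact_imp_closed open_Compl")
 note t = transition[OF d c]
 show "smooth_on (%p. push W psi f (eta p)) V"
 proof (rule smooth_local[OF chart_open[OF d]])
  fix p assume p: "p : V"
  show "EX N. open N & p : N & smooth_on (%p. push W psi f (eta p)) N"
  proof (cases "eta p : K")
   case True
   have "smooth_on (%p. f ((inv_into W psi o eta) p)) ?O" by (rule smooth_compose[OF t(1) open_UNIV t(2) tf_smooth[OF f]]) simp
   hence "smooth_on (%p. push W psi f (eta p)) ?O" by (subst smooth_cong[OF t(1), of _ "%p. f ((inv_into W psi o eta) p)"]) (simp_all add: push_def)
   thus ?thesis using True K(2) p t(1) by (intro exI[of _ ?O]) auto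
  next
   case False
   have "smooth_on (%p. push W psi f (eta p)) ?C" by (subst smooth_cong[OF C, of _ "%p. 0"]) (use K(3) smooth_const[OF C] in auto)
   thus ?thesis using False p C by (intro exI[of _ ?C]) auto
  qed
 qed
qed

lemma push_test: "(W, psi) : A ==> f : test_fun W ==> push W psi f : TF" using push_smooth push_support unfolding TF_iff by metis

text \<open>The converse of \<open>push\<close>: a smooth function supported in a compact part of a
  chart is the push of its coordinate expression, whose support is compact because the inverse chart
  is continuous.\<close>

lemma push_supported:
 assumes d: "(V, eta) : A" and phi: "smooth_map A phi" and K: "compact K" "K <= eta ` V" "!!x. x ~: K ==> phi x = 0"
 defines "f \<equiv> %q. if q : V then phi (eta q) else 0"
 shows "f : test_fun V" "push V eta f = phi"
proof -
 let ?K = "inv_into V eta ` K"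
 have cK: "compact ?K" by (rule compact_continuous_image[OF continuous_on_subset[OF chart_inv_continuous[OF d] K(2)] K(1)])
 have KV: "?K <= V" using K(2) by (auto intro: inv_into_into)
 have out: "f q = 0" if "q ~: ?K" for q
 proof (cases "q : V")
  case True
  hence "eta q ~: K" using that chart_inv[OF d True] by force
  thus ?thesis using K(3) True by (simp add: f_def)
 qed (simp add: f_def)
 have o: "open (- ?K)" using cK by (simp add: compact_imp_closed open_Compl)
 have "smooth_on f UNIV"
 proof (rule smooth_local)
  fix q
  show "EX N. open N & q : N & smooth_on f N"
  proof (cases "q : V")
   case True
   have "smooth_on f V" by (subst smooth_cong[OF chart_open[OF d], of _ "%q. phi (eta q)"]) (simp_all add: f_def smooth_mapD'[OF phi d])
   thus ?thesis using True chart_open[OF d] by blast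
  next
   case False
   have "smooth_on f (- ?K)" by (subst smooth_cong[OF o, of _ "%_. 0"]) (use out smooth_const[OF o] in auto)
   thus ?thesis using False o KV by blast
  qed
 qed simp
 thus "f : test_fun V" unfolding test_fun_def using cK KV out by blast
 show "push V eta f = phi"
 proof
  fix x show "push V eta f x = phi x" using K(2) K(3)[of x] inv_into_into[of x eta V] f_inv_into_f[of x eta V] by (auto simp: push_def f_def)
 qed
qed

text \<open>The bump is kept in the form \<open>push W psi f\<close>, so that its chart and its
  coordinate expression stay available.\<close>

lemma bump_exists:
 assumes "open U" "x : U"
 obtains W psi f N where "(W, psi) : A" "f : test_fun W" "!!y. 0 <= push W psi f y" "!!y. push W psi f y <= 1"
  "open N" "x : N" "!!y. y : N ==> push W psi f y = 1" "!!y. y ~: U ==> push W psi f y = 0"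
proof -
 obtain W psi where c: "(W, psi) : A" "x : psi ` W" by (rule chart_at)
 then obtain p where p: "p : W" "psi p = x" by blast
 let ?S = "{p : W. psi p : U}"
 obtain f N where f: "f : test_fun ?S" "!!x. 0 <= f x" "!!x. f x <= 1" "open N" "{p} <= N" "N <= ?S" "!!x. x : N ==> f x = 1"
  by (rule cutoff_exists[of "{p}" ?S]) (use p assms open_chart_preimage[OF c(1) assms(1)] in auto)
 show ?thesis
 proof (rule that[OF c(1)])
  show "f : test_fun W" using f(1) by (rule tf_mono) auto
  show "open (psi ` N)" by (rule open_chart_image[OF c(1) f(4)]) (use f(6) in auto)
  show "x : psi ` N" using f(5) p by auto
  show "push W psi f y = 1" if "y : psi ` N" for y using that f(6,7) push_chart[OF c(1)] by auto
  show "push W psi f y = 0" if "y ~: U" for y using that tf_outside[OF f(1), of "inv_into W psi y"] by (auto simp: push_def f_inv_into_f)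
 qed (use f(2,3) in "auto simp: push_def")
qed

lemma TF_smooth: "phi : TF ==> smooth_map A phi" by (simp add: TF_iff)

lemma TF_mult:
 assumes "phi : TF" "smooth_map A u"
 shows "(%x. u x*phi x) : TF" using assms smooth_map_mult[of u phi] unfolding TF_iff by auto

lemma TF_lincomb:
 assumes "phi : TF" "xi : TF"
 shows "(%x. phi x + c * xi x) : TF"
proof -
 obtain K L where K: "compact K" "!!x. x ~: K ==> phi x = 0" and L: "compact L" "!!x. x ~: L ==> xi x = 0" using assms unfolding TF_iff by blast
 have "compact (K \<union> L)" "ALL x. x ~: K \<union> L --> phi x + c * xi x = 0" using K L by auto
 thus ?thesis using assms smooth_map_add[OF _ smooth_map_mult[OF smooth_map_const]] unfolding TF_iff by blast
qed

text \<open>A partition of unity as an induction rule. The support is covered by finitely many open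
  sets, each with a bump \<open>b\<close> that is 1 on it; in
  \<open>phi = phi * b + (1 - b) * phi\<close> the first part lives in one chart and the second
  vanishes on one more set of the cover.\<close>

lemma TF_induct[consumes 1, case_names chart add]:
 assumes phi: "phi : TF"
  and chart: "!!W psi f. (W, psi) : A ==> f : test_fun W ==> P (push W psi f)"
  and add: "!!f g. f : TF ==> g : TF ==> P f ==> P g ==> P (%x. f x + g x)"
 shows "P phi"
proof -
 obtain K where K: "compact K" "!!x. x ~: K ==> phi x = 0" using phi unfolding TF_iff by blast
 define good where "good N \<longleftrightarrow> open N & (EX W psi f. (W, psi) : A & f : test_fun W & (ALL y:N. push W psi f y = 1))" for N
 have cover: "EX N. good N & x : N" for x
 proof (rule bump_exists[OF open_UNIV UNIV_I, of x])
  fix W psi f N assume "(W, psi) : A" "f : test_fun W" "open N" "x : N" "!!y. y : N ==> push W psi f y = 1"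
  hence "good N & x : N" unfolding good_def by blast
  thus ?thesis by blast
 qed
 obtain \<N> where N: "finite \<N>" "\<N> <= Collect good" "K <= \<Union>\<N>"
  by (rule compactE[OF K(1), of "Collect good"]) (use cover in "auto simp: good_def")
 have "P phi" if "finite \<N>" "\<N> <= Collect good" "phi : TF" "!!x. x ~: \<Union>\<N> ==> phi x = 0" for \<N> phi using that
 proof (induction \<N> arbitrary: phi rule: finite_induct)
  case empty
  obtain W psi where c: "(W, psi) : A" by (rule chart_at)
  have "push W psi (%_. 0) = phi" using empty by (auto simp: push_def)
  thus ?case using chart[OF c tf_zero] by simp
 next
  case (insert N \<N>)
  have "good N" using insert.prems(1) by blast
  then obtain W psi f where c: "(W, psi) : A" "f : test_fun W" "!!y. y : N ==> push W psi f y = 1" unfolding good_def by blast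
  let ?b = "push W psi f"
  note b = push_test[OF c(1,2)]
  have s: "smooth_map A phi" using insert.prems(2) by (rule TF_smooth)
  obtain L where L: "compact L" "L <= psi ` W" "!!x. x ~: L ==> ?b x = 0" using push_support[OF c(1,2)] by blast
  have 1: "(%x. phi x*?b x) : TF" by (rule TF_mult[OF b s])
  have "P (%x. phi x*?b x)" using chart[OF c(1) push_supported(1)[OF c(1) TF_smooth[OF 1] L(1,2)]]
    push_supported(2)[OF c(1) TF_smooth[OF 1] L(1,2)] L(3) by simp
  moreover have 2: "(%x. (1 + - 1*?b x)*phi x) : TF"
   by (intro TF_mult insert.prems(2) smooth_map_add smooth_map_mult smooth_map_const TF_smooth[OF b])
  moreover have "P (%x. (1 + - 1*?b x)*phi x)" by (rule insert.IH[OF _ 2]) (use insert.prems c(3) in auto)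
  ultimately have "P (%x. phi x*?b x + (1 + - 1*?b x)*phi x)" using add[OF 1 2] by blast
  thus ?case by (simp add: algebra_simps)
 qed
 note this[OF N(1,2) phi]
 moreover have "phi x = 0" if "x ~: \<Union>\<N>" for x using K(2)[of x] N(3) that by auto
 ultimately show ?thesis by simp
qed

lemma integrable_push:
 assumes c: "(W, psi) : A" and f: "f : test_fun W"
 shows "integrable mu (push W psi f)"
proof -
 interpret c: immersed_patch W "F o psi" by (rule patch[OF c])
 have m: "push W psi f : borel_measurable borel" by (rule borel_measurable_continuous_onI[OF smooth_map_continuous[OF push_smooth[OF c f]]])
 have "pull W psi (push W psi f) = (%p. f p*weight (F o psi) p)" using tf_outside[OF f] by (auto simp: pull_def push_chart[OF c] indicator_def)
 hence "integrable lborel (pull W psi (push W psi f))" using tf_integrable[OF tf_mult[OF f c.weight_smooth c.W]] by simp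
 thus ?thesis by (subst integral_chart[OF c m]) (auto simp: push_def)
qed

text \<open>Every point has a neighbourhood of finite measure, because a bump equal to 1 there is
  integrable; hence compact sets have finite measure.\<close>

lemma integrable_compact_support:
 fixes g :: "'m => real"
 assumes g: "continuous_on UNIV g" and K: "compact K" "!!x. x ~: K ==> g x = 0"
 shows "integrable mu g"
proof -
 define good where "good N \<longleftrightarrow> open N & emeasure mu N < \<infinity>" for N
 have cover: "EX N. good N & x : N" for x
 proof -
  obtain W psi f N where b: "(W, psi) : A" "f : test_fun W" "!!y. 0 <= push W psi f y"
   "open N" "x : N" "!!y. y : N ==> push W psi f y = 1" by (rule bump_exists[OF open_UNIV UNIV_I, of x]) blast
  have "emeasure mu N = (\<integral>\<^sup>+y. indicator N y \<partial>mu)" using b(4) by simp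
  also have "... <= (\<integral>\<^sup>+y. ennreal (norm (push W psi f y)) \<partial>mu)"
   by (rule nn_integral_mono) (use b(3,6) in "auto simp: indicator_def")
  also have "... < \<infinity>" using integrable_push[OF b(1,2)] unfolding integrable_iff_bounded by blast
  finally show ?thesis using b(4,5) by (auto simp: good_def)
 qed
 obtain \<N> where N: "finite \<N>" "\<N> <= Collect good" "K <= \<Union>\<N>"
  by (rule compactE[OF K(1), of "Collect good"]) (use cover in "auto simp: good_def")
 have Kb: "K : sets borel" using K(1) by (simp add: borel_closed compact_imp_closed)
 have "emeasure mu K <= emeasure mu (\<Union>N\<in>\<N>. N)" using N(2,3) by (intro emeasure_mono) (auto simp: good_def intro!: borel_open open_Union)
 also have "... <= (\<Sum>N\<in>\<N>. emeasure mu N)" using N(1,2) by (intro emeasure_subadditive_finite) (auto simp: good_def)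
 also have "... < \<infinity>" using N(1,2) by (auto simp: good_def)
 finally have fin: "emeasure mu K < \<infinity>" .
 have "bounded (g ` K)" by (intro compact_imp_bounded compact_continuous_image K(1) continuous_on_subset[OF g]) auto
 then obtain B where B: "!!x. x : K ==> norm (g x) <= B" by (auto simp: bounded_iff)
 show ?thesis by (rule integrableI_bounded_set[of K _ _ B]) (use fin Kb K(2) B borel_measurable_continuous_onI[OF g] in auto)
qed

lemma grad_continuous:
 fixes u :: "'m => real"
 assumes u: "smooth_map A u" shows "continuous_on UNIV (grad A F u)"
proof (rule continuous_on_charts)
 fix W psi assume c: "(W, psi) : A"
 interpret c: immersed_patch W "F o psi" by (rule patch[OF c])
 have "continuous_on W (grad_coord (F o psi) (u o psi))" by (rule smooth_continuous[OF c.grad_coord_smooth[OF smooth_mapD[OF u c]]])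
 thus "continuous_on W (%p. grad A F u (psi p))" by (rule continuous_on_eq) (simp add: grad_chart[OF c _ u])
qed

lemma chart_coord_outside:
 assumes c: "(W, psi) : A" and K: "closed K" "!!x. x ~: K ==> u x = 0" and p: "p : W" "psi p ~: K"
 shows "pd i (u o psi) p = (0::real)"
proof -
 have "open {p : W. psi p : - K}" by (rule open_chart_preimage[OF c]) (use K(1) in auto)
 thus ?thesis using pd_cong_open[of "{p : W. psi p : - K}" p "u o psi" "%_. 0"] K(2) p by (simp add: pd_const)
qed

lemma grad_outside:
 fixes u :: "'m => real"
 assumes u: "smooth_map A u" and K: "closed K" "!!x. x ~: K ==> u x = 0" and x: "x ~: K"
 shows "grad A F u x = 0"
proof -
 obtain W psi where c: "(W, psi) : A" "x : psi ` W" by (rule chart_at)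
 then obtain p where p: "p : W" "x = psi p" by blast
 show ?thesis using chart_coord_outside[OF c(1) K p(1)] x by (simp add: p grad_chart[OF c(1) p(1) u] grad_coord_def)
qed

definition energy :: "('m => real) => ('m => real) => real" where
 "energy u v = (LINT x|mu. grad A F u x \<bullet> grad A F v x)"

lemma energy_chart:
 assumes c: "(W, psi) : A" and f: "f : test_fun W" and u: "smooth_map A u"
 shows "energy (push W psi f) u = (LBINT p. (SS i. pd i f p*(weight (F o psi) p*flux (F o psi) (u o psi) i p)))"
proof -
 interpret c: immersed_patch W "F o psi" by (rule patch[OF c])
 note s = push_smooth[OF c f]
 obtain K where K: "compact K" "K <= psi ` W" "!!x. x ~: K ==> push W psi f x = 0" using push_support[OF c f] by blast
 let ?g = "%x. grad A F (push W psi f) x \<bullet> grad A F u x"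
 have m: "?g : borel_measurable borel" by (intro borel_measurable_continuous_onI continuous_intros grad_continuous s u)
 have "pull W psi ?g p = (SS i. pd i f p*(weight (F o psi) p*flux (F o psi) (u o psi) i p))" for p
 proof (cases "p : W")
  case True
  have "pd i (push W psi f o psi) p = pd i f p" for i by (rule pd_cong_open[OF c.W True]) (simp add: push_chart[OF c])
  thus ?thesis using True
   by (simp add: pull_def grad_chart[OF c _ s] grad_chart[OF c _ u] c.grad_coord_inner_grad_coord[OF _ smooth_map_differentiable[OF s c]]
    sum_distrib_left mult_ac)
 qed (simp add: pull_def tf_outside[OF tf_pd[OF f]])
 moreover have "?g x = 0" if "x ~: psi ` W" for x
  using grad_outside[OF s compact_imp_closed[OF K(1)] K(3), of x] subsetD[OF K(2), of x] that by (metis inner_zero_left)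
 ultimately show ?thesis unfolding energy_def using integral_chart(2)[OF c m] by simp
qed

section \<open>Chart independence of the drifted Laplacian and integration by parts\<close>

text \<open>Tested with a function supported in the overlap, either side gives minus the energy, an
  integral of gradients already known not to depend on the chart. Continuity turns this weak
  equality into a pointwise one, and no second derivatives have to be transformed.\<close>

lemma drift_coord_transition:
 assumes c: "(W, psi) : A" and d: "(V, eta) : A" and p: "p : W" "psi p : eta ` V" and u: "smooth_map A u"
 shows "drift_coord (F o psi) (u o psi) p = drift_coord (F o eta) (u o eta) (inv_into V eta (psi p))"
proof -
 interpret c: immersed_patch W "F o psi" by (rule patch[OF c])
 interpret d: immersed_patch V "F o eta" by (rule patch[OF d])
 let ?S = "{p : W. psi p : eta ` V}" and ?t = "%p. inv_into V eta (psi p)"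
 note t = transition[OF c d]
 have ct: "continuous_on ?S ?t" using smooth_continuous[OF t(2)] by (simp add: o_def)
 have cd: "continuous_on ?S (%p. drift_coord (F o eta) (u o eta) (?t p))"
  by (rule continuous_on_compose2[OF smooth_continuous[OF d.drift_coord_smooth[OF smooth_mapD[OF u d]]] ct]) (use t(3) in auto)
 have cc: "continuous_on ?S (drift_coord (F o psi) (u o psi))" "continuous_on ?S (weight (F o psi))"
  by (rule continuous_on_subset[OF smooth_continuous[OF c.drift_coord_smooth[OF smooth_mapD[OF u c]]]]
    continuous_on_subset[OF smooth_continuous[OF c.weight_smooth]], auto)+
 let ?D = "%p. weight (F o psi) p*(drift_coord (F o psi) (u o psi) p - drift_coord (F o eta) (u o eta) (?t p))"
 have "?D p = 0"
 proof (rule continuous_test_fun_zero[OF t(1), where D = ?D and p = p])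
  show "continuous_on ?S ?D" by (intro continuous_intros cd cc)
  show "p : ?S" using p by simp
  fix f assume f: "f : test_fun ?S"
  hence fW: "f : test_fun W" by (rule tf_mono) auto
  let ?phi = "push W psi f"
  note s = push_smooth[OF c fW]
  obtain L where L: "compact L" "L <= ?S" "!!x. x ~: L ==> f x = 0" using f unfolding test_fun_def by blast
  have LW: "L <= W" using L(2) by auto
  have K: "compact (psi ` L)" "psi ` L <= eta ` V"
   using compact_continuous_image[OF continuous_on_subset[OF chart_continuous[OF c] LW] L(1)] L(2) by auto
  have K0: "?phi x = 0" if "x ~: psi ` L" for x
  proof (cases "x : psi ` W")
   case True
   then obtain p where "p : W" "x = psi p" by blast
   thus ?thesis using that L(3)[of p] push_chart[OF c, of p f] by auto
  qed (simp add: push_def)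
  let ?g = "%q. if q : V then ?phi (eta q) else 0"
  have g: "?g : test_fun V" "push V eta ?g = ?phi" by (rule push_supported[OF d s K], erule K0)+
  \<comment> \<open>The operator read in the chart \<open>eta\<close>, times the test function.
    Integrated through \<open>psi\<close> it is the integral in question; integrated through
    \<open>eta\<close> it is minus the energy.\<close>
  define h where "h x = ?phi x*(if x : eta ` V then drift_coord (F o eta) (u o eta) (inv_into V eta x) else 0)" for x
  have hg: "h = push V eta (%q. ?g q*drift_coord (F o eta) (u o eta) q)" by (rule ext) (auto simp: h_def push_def f_inv_into_f inv_into_into)
  have gt: "(%q. ?g q*drift_coord (F o eta) (u o eta) q) : test_fun V" by (rule tf_mult[OF g(1) d.drift_coord_smooth[OF smooth_mapD[OF u d]] d.W])
  have hm: "h : borel_measurable borel" unfolding hg by (rule borel_measurable_continuous_onI[OF smooth_map_continuous[OF push_smooth[OF d gt]]])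
  have h0: "h x = 0" if "x ~: psi ` W" for x using that by (simp add: h_def push_def)
  have h0': "h x = 0" if "x ~: eta ` V" for x using that by (simp add: h_def)
  have pc: "pull W psi h = (%p. weight (F o psi) p*drift_coord (F o eta) (u o eta) (?t p)*f p)"
   using tf_outside[OF f] by (intro ext) (auto simp: pull_def h_def push_chart[OF c] indicator_def)
  have pd: "pull V eta h = (%q. weight (F o eta) q*drift_coord (F o eta) (u o eta) q*?g q)"
   by (intro ext) (auto simp: pull_def h_def chart_inv[OF d] indicator_def)
  have "(LBINT p. weight (F o psi) p*drift_coord (F o eta) (u o eta) (?t p)*f p) = (LINT x|mu. h x)"
   using integral_chart(2)[OF c hm h0] by (simp add: pc)
  also have "... = (LBINT q. weight (F o eta) q*drift_coord (F o eta) (u o eta) q*?g q)" using integral_chart(2)[OF d hm h0', unfolded pd] .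
  also have "... = - energy ?phi u" using d.weak_drift_coord[OF g(1) smooth_mapD[OF u d]] energy_chart[OF d g(1) u, unfolded g(2)] by linarith
  also have "... = (LBINT p. weight (F o psi) p*drift_coord (F o psi) (u o psi) p*f p)"
   unfolding c.weak_drift_coord[OF fW smooth_mapD[OF u c]] energy_chart[OF c fW u, symmetric] ..
  finally have e: "(LBINT p. weight (F o psi) p*drift_coord (F o eta) (u o eta) (?t p)*f p)
   = (LBINT p. weight (F o psi) p*drift_coord (F o psi) (u o psi) p*f p)" .
  have cont: "integrable lborel (%p. k p*f p)" if k: "continuous_on ?S k" for k
  proof -
   have "integrable lborel (%x. indicator L x *R (k x*f x))"
    by (intro borel_integrable_compact L(1) continuous_intros continuous_on_subset[OF k L(2)]
     continuous_on_subset[OF smooth_continuous[OF tf_smooth[OF f]]]) auto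
   moreover have "(%x. indicator L x *R (k x*f x)) = (%x. k x*f x)" using L(3) by (intro ext) (auto simp: indicator_def)
   ultimately show ?thesis by simp
  qed
  have "(LBINT p. ?D p*f p) = (LBINT p. weight (F o psi) p*drift_coord (F o psi) (u o psi) p*f p
   - weight (F o psi) p*drift_coord (F o eta) (u o eta) (?t p)*f p)"
   by (intro arg_cong[where f="integral\<^sup>L lborel"] ext) (simp add: algebra_simps)
  also have "... = (LBINT p. weight (F o psi) p*drift_coord (F o psi) (u o psi) p*f p)
   - (LBINT p. weight (F o psi) p*drift_coord (F o eta) (u o eta) (?t p)*f p)" by (intro LINT_diff cont continuous_intros cc cd)
  finally show "(LBINT p. ?D p*f p) = 0" using e by simp
 qed
 thus ?thesis using c.weight_pos[OF p(1)] by simp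
qed

abbreviation "L \<equiv> drifted_laplacian A F"

text \<open>The operator is defined through the chart that \<open>param_at\<close> happens to
  select; from here on any chart may be used.\<close>

lemma drift_chart:
 assumes c: "(W, psi) : A" and p: "p : W" and u: "smooth_map A u"
 shows "L u (psi p) = drift_coord (F o psi) (u o psi) p"
proof -
 obtain V eta where d: "param_at A (psi p) = (V, eta)" "(V, eta) : A" "psi p : eta ` V" by (rule param_at)
 interpret d: immersed_patch V "F o eta" by (rule patch[OF d(2)])
 have q: "inv_into V eta (psi p) : V" by (rule inv_into_into[OF d(3)])
 show ?thesis using d.drift_coord_eq[OF q smooth_mapD[OF u d(2)]] drift_coord_transition[OF c d(2) p d(3) u] d(1,3)
  by (simp add: drifted_laplacian_def laplacian_def grad_def f_inv_into_f)
qed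

lemma L_smooth:
 assumes u: "smooth_map A u" shows "smooth_map A (L u)"
proof (rule smooth_mapI)
 fix W psi assume c: "(W, psi) : A"
 interpret c: immersed_patch W "F o psi" by (rule patch[OF c])
 show "smooth_on (%p. L u (psi p)) W"
  by (subst smooth_cong[OF c.W drift_chart[OF c _ u]]) (simp_all add: c.drift_coord_smooth[OF smooth_mapD[OF u c]])
qed

lemma grad_add: "smooth_map A u ==> smooth_map A v ==> grad A F (%x. u x + v x) x = grad A F u x + grad A F v x"
 and grad_mult: "smooth_map A u ==> smooth_map A v ==> grad A F (%x. u x * v x) x = u x *R grad A F v x + v x *R grad A F u x"
proof -
 assume u: "smooth_map A u" and v: "smooth_map A v"
 obtain W psi where c: "(W, psi) : A" "x : psi ` W" by (rule chart_at)
 then obtain p where p: "p : W" "x = psi p" by blast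
 note d = smooth_map_differentiable[OF u c(1) p(1)] smooth_map_differentiable[OF v c(1) p(1)]
 note e = grad_chart[OF c(1) p(1) u] grad_chart[OF c(1) p(1) v]
 have o: "(%x. u x + v x) o psi = (%p. (u o psi) p + (v o psi) p)" "(%x. u x * v x) o psi = (%p. (u o psi) p*(v o psi) p)" by auto
 show "grad A F (%x. u x + v x) x = grad A F u x + grad A F v x" unfolding p(2) e grad_chart[OF c(1) p(1) smooth_map_add[OF u v]] o
  by (simp only: grad_coord_def pd_add[OF d] distrib_left scaleR_left_distrib sum.distrib)
 show "grad A F (%x. u x * v x) x = u x *R grad A F v x + v x *R grad A F u x" unfolding p(2) e grad_chart[OF c(1) p(1) smooth_map_mult[OF u v]] o
  by (simp only: grad_coord_def pd_mult[OF d] distrib_left scaleR_left_distrib sum.distrib) (simp add: scaleR_sum_right mult_ac)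
qed

lemma grad_test_integrable:
 assumes phi: "phi : TF" and u: "smooth_map A u"
 shows "integrable mu (%x. grad A F phi x \<bullet> grad A F u x)"
proof -
 obtain K where K: "compact K" "!!x. x ~: K ==> phi x = 0" using phi unfolding TF_iff by blast
 show ?thesis using grad_outside[OF TF_smooth[OF phi] compact_imp_closed[OF K(1)] K(2)]
  by (intro integrable_compact_support[OF _ K(1)] continuous_intros grad_continuous TF_smooth[OF phi] u) auto
qed

lemma test_mult_integrable:
 assumes phi: "phi : TF" and u: "continuous_on UNIV u"
 shows "integrable mu (%x. phi x*u x)"
proof -
 obtain K where K: "compact K" "!!x. x ~: K ==> phi x = 0" using phi unfolding TF_iff by blast
 show ?thesis using K(2) by (intro integrable_compact_support[OF _ K(1)] continuous_intros u smooth_map_continuous TF_smooth[OF phi]) auto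
qed

lemma energy_sym: "energy u v = energy v u" by (simp add: energy_def inner_commute)

text \<open>Both sides are additive in \<open>phi\<close>, so \<open>TF_induct\<close> reduces the
  claim to one chart, where it is \<open>weak_drift_coord\<close>.\<close>

theorem integration_by_parts:
 assumes phi: "phi : TF" and u: "smooth_map A u"
 shows "(LINT x|mu. phi x*L u x) = - energy phi u" using phi
proof (induction rule: TF_induct)
 case (chart W psi f)
 note c = chart(1) and f = chart(2)
 interpret c: immersed_patch W "F o psi" by (rule patch[OF c])
 have m: "(%x. push W psi f x*L u x) : borel_measurable borel"
  by (intro borel_measurable_continuous_onI continuous_intros smooth_map_continuous L_smooth push_smooth[OF c f] u)
 have "pull W psi (%x. push W psi f x*L u x) = (%p. weight (F o psi) p*drift_coord (F o psi) (u o psi) p*f p)"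
  using tf_outside[OF f] by (intro ext) (auto simp: pull_def push_chart[OF c] drift_chart[OF c _ u] indicator_def)
 moreover have "push W psi f x*L u x = 0" if "x ~: psi ` W" for x using that by (simp add: push_def)
 ultimately show ?case using integral_chart(2)[OF c m] by (simp add: c.weak_drift_coord[OF f smooth_mapD[OF u c]] energy_chart[OF c f u])
next
 case (add f g)
 have "(LINT x|mu. (f x + g x)*L u x) = (LINT x|mu. f x*L u x) + (LINT x|mu. g x*L u x)"
  unfolding distrib_right by (intro LINT_add test_mult_integrable add smooth_map_continuous L_smooth u)
 moreover have "energy (%x. f x + g x) u = energy f u + energy g u"
  unfolding energy_def grad_add[OF TF_smooth[OF add(1)] TF_smooth[OF add(2)]] inner_add_left by (intro LINT_add grad_test_integrable add u)
 ultimately show ?case using add by simp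
qed

end

section \<open>The drifted Laplacian of the squared distance to the origin\<close>

text \<open>Jacobi's formula. A permutation other than the identity moves at least two indices, so
  after one factor is differentiated an off-diagonal entry of \<open>N p\<close>, which is 0,
  remains.\<close>

lemma pd_det_at_identity:
 fixes N :: "real^'n => real^'m::finite ^ 'm"
 assumes I: "N p = mat 1" and d: "!!i j. (%q. N q$i$j) differentiable (at p)"
 shows "pd k (%q. det (N q)) p = (SS i. pd k (%q. N q$i$i) p)"
proof -
 let ?S = "{\<pi>. \<pi> permutes (UNIV :: 'm set)}"
 have prod: "(\<Prod>j\<in>UNIV - {i}. N p$j$\<pi> j) = (if \<pi> = id then 1 else 0)" if \<pi>: "\<pi> : ?S" for \<pi> i
 proof (cases "\<pi> = id")
  case False
  have "EX j. j ~= i & \<pi> j ~= j"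
  proof (rule ccontr)
   assume "~ ?thesis"
   hence *: "!!j. j ~= i ==> \<pi> j = j" by blast
   have "\<pi> i = i" using*permutes_inj[of \<pi> UNIV] \<pi> by (metis injD mem_Collect_eq)
   thus False using*False by (metis eq_id_iff)
  qed
  then obtain j where j: "j : UNIV - {i}" "N p$j$\<pi> j = 0" by (auto simp: I mat_def)
  have "(\<Prod>j\<in>UNIV - {i}. N p$j$\<pi> j) = 0" by (rule prod_zero) (use j in auto)
  thus ?thesis using False by simp
 qed (simp add: I mat_def)
 have dprod: "((%q. \<Prod>i\<in>UNIV. N q$i$\<pi> i) has_derivative
   (%y. SS i. FD (%q. N q$i$\<pi> i) p y*(\<Prod>j\<in>UNIV - {i}. N p$j$\<pi> j))) (at p)" for \<pi>
  by (rule has_derivative_prod) (use d frechet_derivative_works in blast)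
 have dp: "(%q. \<Prod>i\<in>UNIV. N q$i$\<pi> i) differentiable (at p)" for \<pi> by (rule differentiableI[OF dprod])
 have pdp: "pd k (%q. \<Prod>i\<in>UNIV. N q$i$\<pi> i) p = (SS i. pd k (%q. N q$i$\<pi> i) p*(\<Prod>j\<in>UNIV - {i}. N p$j$\<pi> j))" for \<pi>
  unfolding pd_eq[OF dprod] by (simp add: pd_def)
 have "pd k (%q. det (N q)) p = (\<Sum>\<pi>\<in>?S. of_int (sign \<pi>)*pd k (%q. \<Prod>i\<in>UNIV. N q$i$\<pi> i) p)"
  unfolding det_def by (subst pd_sum) (auto intro!: differentiable_mult dp simp: pd_cmult[OF dp])
 also have "... = (\<Sum>\<pi>\<in>?S. if \<pi> = id then SS i. pd k (%q. N q$i$i) p else 0)"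
  unfolding pdp by (rule sum.cong[OF refl]) (auto simp: prod)
 also have "... = (SS i. pd k (%q. N q$i$i) p)" by (subst sum.delta) (auto simp: permutes_id finite_permutations)
 finally show ?thesis .
qed

context immersed_patch
begin

lemma pd_X_smooth: "smooth_on (%p. pd i X p) W" "smooth_on (%p. pd j (%p. pd i X p) p) W" by (intro smooth_pd' X)+

lemma differentiable_smooth: "smooth_on f W ==> p : W ==> f differentiable (at p)"
 for f :: "real^'n => 'b::real_normed_vector" by (rule smooth_differentiable[OF _ W])

lemma pd_inner_const: "f differentiable (at p) ==> pd i (%q. f q \<bullet> nu) p = pd i f p \<bullet> nu"
 for f :: "real^'n => 'b::euclidean_space" by (rule pd_bounded_linear[OF _ bounded_linear_inner_left])

lemma pd_pd_sym:
 assumes p: "p : W"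
 shows "pd i (%q. pd j X q) p = pd j (%q. pd i X q) p"
proof (rule euclidean_eqI)
 fix b :: 'e
 have s: "smooth_on (%q. X q \<bullet> b) W" by (intro smooth_inner W X smooth_const)
 have e: "pd l (pd k (%q. X q \<bullet> b)) p = pd l (%q. pd k X q) p \<bullet> b" for k l
  using pd_cong_open[OF W p, of "pd k (%q. X q \<bullet> b)" "%q. pd k X q \<bullet> b" l] pd_inner_const[OF X_differentiable]
   pd_inner_const[OF differentiable_smooth[OF pd_X_smooth(1) p]] by simp
 show "pd i (%q. pd j X q) p \<bullet> b = pd j (%q. pd i X q) p \<bullet> b" using pd_commute[OF s W p, of i j] by (simp only: e)
qed

text \<open>Jacobi's formula for the product of the inverse metric frozen at \<open>p\<close> with
  the metric at \<open>q\<close>, which is the identity at \<open>q = p\<close>. The derivative of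
  the metric contributes the sum twice, and this 2 is matched by differentiating the square of
  \<open>vol_density\<close>.\<close>

lemma pd_vol:
 assumes p: "p : W"
 shows "pd k (vol_density X) p = vol_density X p*(SS i j. ginv p$i$j*(pd j X p \<bullet> pd k (%q. pd i X q) p))"
proof -
 let ?g = "%q. metric X q" and ?N = "%q. ginv p ** metric X q"
 have gd: "(%q. ?g q$i$j) differentiable (at p)" for i j by (rule differentiable_smooth[OF metric_smooth p])
 have N: "?N q$i$j = (SS l. ginv p$i$l*?g q$l$j)" for q i j by (simp add: matrix_matrix_mult_def)
 have Nd: "(%q. ?N q$i$j) differentiable (at p)" for i j unfolding N by (rule differentiable_sum) (auto intro!: differentiable_mult gd)
 have pdN: "pd k (%q. ?N q$i$j) p = (SS l. ginv p$i$l*pd k (%q. ?g q$l$j) p)" for i j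
  unfolding N by (subst pd_sum) (auto intro!: differentiable_mult gd simp: pd_cmult[OF gd])
 have g: "pd k (%q. ?g q$l$i) p = pd l X p \<bullet> pd k (%q. pd i X q) p + pd k (%q. pd l X q) p \<bullet> pd i X p" for l i
  unfolding metric_def vec_lambda_beta by (intro pd_inner differentiable_smooth[OF pd_X_smooth(1) p])
 let ?s = "SS i j. ginv p$i$j*(pd j X p \<bullet> pd k (%q. pd i X q) p)"
 have tr: "(SS i l. ginv p$i$l*pd k (%q. ?g q$l$i) p) = 2*?s"
 proof -
  have "(SS i l. ginv p$i$l*(pd k (%q. pd l X q) p \<bullet> pd i X p)) = ?s" by (subst sum.swap) (simp add: ginv_sym[OF p] inner_commute)
  thus ?thesis by (simp add: g distrib_left sum.distrib)
 qed
 have detd: "(%q. det (?g q)) differentiable (at p)" by (rule differentiable_smooth[OF smooth_det[OF W metric_smooth] p])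
 have "2*?s = pd k (%q. det (?N q)) p" using pd_det_at_identity[of ?N p k, OF matrix_inv_mult(2)[OF det_nz[OF p]] Nd] by (simp only: pdN tr)
 also have "... = det (ginv p)*pd k (%q. det (?g q)) p" unfolding det_mul by (rule pd_cmult[OF detd])
 finally have 1: "det (?g p)*(2*?s) = pd k (%q. det (?g q)) p" using arg_cong[OF matrix_inv_mult(1)[OF det_nz[OF p]], of det] by (simp add: det_mul)
 have "pd k (%q. det (?g q)) p = pd k (%q. vol_density X q * vol_density X q) p"
  by (rule pd_cong_open[OF W p]) (use det_pos in "simp add: vol_density_def less_imp_le")
 also have "... = 2 * vol_density X p*pd k (vol_density X) p"
  using pd_mult[OF differentiable_smooth[OF vol_smooth p] differentiable_smooth[OF vol_smooth p], of k] by simp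
 finally have "det (?g p)*(2*?s) = 2 * vol_density X p*pd k (vol_density X) p" unfolding 1 .
 moreover have "det (?g p) = vol_density X p * vol_density X p" using det_pos[OF p] by (simp add: vol_density_def)
 ultimately have "2 * vol_density X p*(vol_density X p*?s) = 2 * vol_density X p*pd k (vol_density X) p" by (simp only: mult_ac)
 thus ?thesis using vol_pos[OF p] by simp
qed

text \<open>The gradients of the coordinate functions, a tangent frame dual to the frame of the
  \<open>pd k X\<close>.\<close>

definition dual_frame :: "'n => real^'n => 'e" where
 "dual_frame i p = (SS j. ginv p$i$j *R pd j X p)"

lemma dual_frame_smooth: "smooth_on (%p. dual_frame i p) W" unfolding dual_frame_def by (intro smooth_sum smooth_scaleR W ginv_smooth pd_X_smooth)

lemma dual_frame_inner: "p : W ==> dual_frame i p \<bullet> pd k X p = (if i = k then 1 else 0)"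
 using ginv_metric[of p i k] by (simp add: dual_frame_def inner_sum_left metric_def)

lemma tangential_inner:
 assumes p: "p : W"
 shows "(SS i. (v \<bullet> dual_frame i p) *R pd i X p) \<bullet> pd k X p = v \<bullet> pd k X p" (is "?T \<bullet> _ = _")
proof -
  have "?T \<bullet> pd k X p = v \<bullet> (SS i. metric X p$k$i *R dual_frame i p)"
   by (simp add: inner_sum_left inner_sum_right metric_def inner_commute mult_ac)
  also have "(SS i. metric X p$k$i *R dual_frame i p) = (SS j. (SS i. metric X p$k$i*ginv p$i$j) *R pd j X p)"
   unfolding dual_frame_def scaleR_sum_right scaleR_sum_left scaleR_scaleR by (rule sum.swap)
  also have "... = (SS j. (if k = j then 1 else 0) *R pd j X p)"
   using arg_cong[OF matrix_inv_mult(1)[OF det_nz[OF p]], of "%M. M$k$_"] by (simp add: matrix_matrix_mult_def mat_def)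
  also have "... = pd k X p" by (simp add: if_distrib[of "%x. x *R _"] cong: if_cong)
  finally show ?thesis .
qed

text \<open>The right side is orthogonal to the coordinate frame, and Pythagoras makes it the
  closest point.\<close>

lemma normal_part_eq:
 assumes p: "p : W"
 shows "normal_part X p v = v - (SS i. (v \<bullet> dual_frame i p) *R pd i X p)"
proof -
 let ?T = "SS i. (v \<bullet> dual_frame i p) *R pd i X p" and ?S = "range (FD X p)"
 have T: "?T = FD X p (\<chi> i. v \<bullet> dual_frame i p)" by (simp add: frechet_derivative_pd[OF X_differentiable[OF p]])
 have S: "y : ?S\<^sup>\<bottom> \<longleftrightarrow> (ALL i. y \<bullet> pd i X p = 0)" for y
 proof
  assume "y : ?S\<^sup>\<bottom>"
  thus "ALL i. y \<bullet> pd i X p = 0" unfolding pd_def orthogonal_comp_def orthogonal_def by (simp add: inner_commute)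
 qed (auto simp: orthogonal_comp_def orthogonal_def frechet_derivative_pd[OF X_differentiable[OF p]] inner_sum_right inner_commute[of _ y])
 note pdT = tangential_inner[OF p, of v]
 have "v - ?T = closest_point (?S\<^sup>\<bottom>) v"
 proof (rule closest_point_unique)
  show "convex (?S\<^sup>\<bottom>)" "closed (?S\<^sup>\<bottom>)" using subspace_orthogonal_comp subspace_imp_convex closed_subspace by blast+
  show "v - ?T : ?S\<^sup>\<bottom>" unfolding S by (simp add: inner_diff_left pdT)
  show "ALL z:?S\<^sup>\<bottom>. dist v (v - ?T) <= dist v z"
  proof
   fix z assume z: "z : ?S\<^sup>\<bottom>"
   have "(v - ?T - z) \<bullet> pd i X p = 0" for i using z unfolding S by (simp add: inner_diff_left pdT)
   hence "orthogonal ?T (v - ?T - z)" unfolding orthogonal_def inner_sum_left inner_scaleR_left by (simp add: inner_commute[of "pd _ X p"])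
   hence "(norm (?T + (v - ?T - z)))^2 = (norm ?T)^2 + (norm (v - ?T - z))^2" by (rule norm_add_Pythagorean)
   hence "(norm ?T)^2 <= (norm (v - z))^2" by simp
   thus "dist v (v - ?T) <= dist v z" by (simp add: dist_norm)
  qed
 qed
 thus ?thesis by (simp add: normal_part_def)
qed

text \<open>The Laplace--Beltrami operator in divergence form, applied to the immersion itself as a
  vector valued function.\<close>

definition laplace_X :: "real^'n => 'e" where
 "laplace_X p = (1 / vol_density X p) *R (SS i. pd i (%q. vol_density X q *R dual_frame i q) p)"

lemma vol_dual_smooth: "smooth_on (%q. vol_density X q *R dual_frame i q) W" by (rule smooth_scaleR[OF W vol_smooth dual_frame_smooth])

lemma pd_vol_dual_inner:
 assumes p: "p : W"
 shows "pd i (%q. vol_density X q *R dual_frame i q) p \<bullet> pd k X p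
  = (if i = k then pd k (vol_density X) p else 0) - vol_density X p*(dual_frame i p \<bullet> pd i (%q. pd k X q) p)"
proof -
 have "pd i (%q. (vol_density X q *R dual_frame i q) \<bullet> pd k X q) p
   = (vol_density X p *R dual_frame i p) \<bullet> pd i (%q. pd k X q) p + pd i (%q. vol_density X q *R dual_frame i q) p \<bullet> pd k X p"
  by (rule pd_inner[OF differentiable_smooth[OF vol_dual_smooth p] differentiable_smooth[OF pd_X_smooth(1) p]])
 moreover have "pd i (%q. (vol_density X q *R dual_frame i q) \<bullet> pd k X q) p = pd i (%q. if i = k then vol_density X q else 0) p"
  by (rule pd_cong_open[OF W p]) (simp add: dual_frame_inner)
 moreover have "... = (if i = k then pd k (vol_density X) p else 0)" by (simp add: pd_const)
 ultimately show ?thesis by simp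
qed

text \<open>Differentiating the relations between \<open>dual_frame\<close> and
  \<open>pd k X\<close> produces a derivative of \<open>vol_density\<close> and a term with second
  derivatives of \<open>X\<close>; these cancel by \<open>pd_vol\<close> and the symmetry of second
  derivatives.\<close>

lemma laplace_X_normal:
 assumes p: "p : W"
 shows "laplace_X p \<bullet> pd k X p = 0"
proof -
 have "(SS i. dual_frame i p \<bullet> pd i (%q. pd k X q) p) = (SS i j. ginv p$i$j*(pd j X p \<bullet> pd k (%q. pd i X q) p))"
  by (simp add: dual_frame_def inner_sum_left pd_pd_sym[OF p, of _ k])
 hence "vol_density X p*(SS i. dual_frame i p \<bullet> pd i (%q. pd k X q) p) = pd k (vol_density X) p" by (simp add: pd_vol[OF p])
 hence "(SS i. pd i (%q. vol_density X q *R dual_frame i q) p) \<bullet> pd k X p = 0"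
  unfolding inner_sum_left pd_vol_dual_inner[OF p] sum_subtractf by (simp add: sum_distrib_left)
 thus ?thesis by (simp add: laplace_X_def)
qed

text \<open>Against a normal vector only second derivatives of \<open>X\<close> survive, since
  derivatives of the coefficients come with tangent vectors.\<close>

lemma laplace_X_inner_normal:
 assumes p: "p : W" and nu: "!!k. pd k X p \<bullet> nu = 0"
 shows "laplace_X p \<bullet> nu = (SS i j. ginv p$i$j*(pd i (%q. pd j X q) p \<bullet> nu))"
proof -
 have "pd i (%q. vol_density X q *R dual_frame i q) p \<bullet> nu = vol_density X p*(SS j. ginv p$i$j*(pd i (%q. pd j X q) p \<bullet> nu))" for i
 proof -
  let ?c = "%j q. vol_density X q*ginv q$i$j"
  have s: "smooth_on (?c j) W" "smooth_on (%q. pd j X q \<bullet> nu) W" for j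
   by (intro smooth_mult smooth_inner W vol_smooth ginv_smooth pd_X_smooth smooth_const)+
  note d = differentiable_smooth[OF s(1) p] differentiable_smooth[OF s(2) p]
  have "pd i (%q. vol_density X q *R dual_frame i q) p \<bullet> nu = pd i (%q. (vol_density X q *R dual_frame i q) \<bullet> nu) p"
   by (rule pd_inner_const[OF differentiable_smooth[OF vol_dual_smooth p], symmetric])
  also have "(%q. (vol_density X q *R dual_frame i q) \<bullet> nu) = (%q. SS j. ?c j q*(pd j X q \<bullet> nu))"
   by (simp add: dual_frame_def inner_sum_left sum_distrib_left mult_ac)
  also have "pd i ... p = (SS j. pd i (%q. ?c j q*(pd j X q \<bullet> nu)) p)" by (rule pd_sum) (intro differentiable_mult d)
  also have "... = (SS j. ?c j p*(pd i (%q. pd j X q) p \<bullet> nu))"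
  proof (rule sum.cong[OF refl])
   fix j
   show "pd i (%q. ?c j q*(pd j X q \<bullet> nu)) p = ?c j p*(pd i (%q. pd j X q) p \<bullet> nu)"
    by (simp add: pd_mult[OF d] nu pd_inner_const[OF differentiable_smooth[OF pd_X_smooth(1) p]])
  qed
  finally show ?thesis by (simp add: sum_distrib_left mult_ac)
 qed
 thus ?thesis using vol_pos[OF p] by (simp add: laplace_X_def inner_sum_left sum_distrib_left[symmetric])
qed

text \<open>For the matrix M with rows \<open>e a p\<close>, orthonormality reads M g M^T = 1; hence
  M^T M is the inverse of the metric g.\<close>

lemma frame_matrix:
 assumes p: "p : V" "V <= W" and e: "orthonormal_frame X V e"
 shows "(SS a. e a p$i*e a p$j) = ginv p$i$j"
proof -
 have pW: "p : W" using p by blast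
 define M :: "real^'n ^ 'n" where "M = (\<chi> a. e a p)"
 have "M ** (metric X p ** transpose M) = mat 1"
 proof -
  have "(M ** (metric X p ** transpose M))$a$b = mat 1$a$b" for a b
  proof -
   have "(M ** (metric X p ** transpose M))$a$b = e a p \<bullet> (metric X p *v e b p)"
    by (simp add: M_def matrix_matrix_mult_def transpose_def inner_vec_def matrix_vector_mult_def)
   also have "... = (if a = b then 1 else 0)"
    unfolding metric_quadratic[OF X_differentiable[OF pW]] using e p(1) unfolding orthonormal_frame_def by blast
   finally show ?thesis by (simp add: mat_def)
  qed
  thus ?thesis by (simp add: vec_eq_iff)
 qed
 hence "metric X p ** (transpose M ** M) = mat 1" using matrix_left_right_inverse by (metis matrix_mul_assoc)
 hence "ginv p = transpose M ** M" using matrix_inv_mult(2)[OF det_nz[OF pW]] by (metis matrix_mul_assoc matrix_mul_lid matrix_mul_rid)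
 thus ?thesis by (simp add: M_def matrix_matrix_mult_def transpose_def)
qed

text \<open>The difference \<open>nu\<close> of the two vectors is normal. Paired with a normal
  vector, both reduce to second derivatives of \<open>X\<close> contracted with the inverse metric,
  in one case written as a sum over the frame. So \<open>nu\<close> is orthogonal to itself.\<close>

lemma mean_curvature_eq_laplace_X:
 assumes p: "p : W" and H: "is_mean_curvature X W p H"
 shows "laplace_X p = H"
proof -
 obtain V e where V: "open V" "p : V" "V <= W" and e: "orthonormal_frame X V e"
  and He: "H = (SS a. normal_part X p (FD (%q. FD X q (e a q)) p (e a p)))"
  using H unfolding is_mean_curvature_def by blast
 let ?D = "%a. FD (%q. FD X q (e a q)) p (e a p)"
 have N: "normal_part X p v \<bullet> pd k X p = 0" for v k by (simp add: normal_part_eq[OF p] inner_diff_left tangential_inner[OF p])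
 define nu where "nu = laplace_X p - H"
 have nu: "pd k X p \<bullet> nu = 0" for k
  using laplace_X_normal[OF p, of k] by (simp add: nu_def He inner_diff_right inner_sum_right N inner_commute[of "pd k X p"])
 have Dn: "?D a \<bullet> nu = (SS i j. e a p$i*e a p$j*(pd i (%q. pd j X q) p \<bullet> nu))" for a
 proof -
  have es: "smooth_on (%q. e a q$j) V" for j using e smooth_bounded_linear[OF bounded_linear_vec_nth V(1)] unfolding orthonormal_frame_def by blast
  have Xs: "smooth_on (%q. pd j X q) V" for j by (rule smooth_subset[OF pd_X_smooth(1) V(3) W V(1)])
  let ?f = "%q. SS j. e a q$j *R pd j X q"
  have fs: "smooth_on ?f V" by (intro smooth_sum smooth_scaleR V es Xs)
  have eq: "FD X q (e a q) = ?f q" if "q : V" for q using that V(3) by (intro frechet_derivative_pd X_differentiable) auto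
  have D: "((%q. FD X q (e a q)) has_derivative FD ?f p) (at p)"
   by (rule has_derivative_transform_within_open[OF smooth_has_derivative[OF fs V(1,2)] V(1,2)]) (simp add: eq)
  have fd: "?f differentiable (at p)" by (rule smooth_differentiable[OF fs V(1,2)])
  have "?D a = FD ?f p (e a p)" using frechet_derivative_at[OF D] by simp
  also have "... = (SS i. (e a p$i) *R pd i ?f p)" by (rule frechet_derivative_pd[OF fd])
  finally have "?D a \<bullet> nu = (SS i. e a p$i*(pd i ?f p \<bullet> nu))" by (simp add: inner_sum_left)
  moreover have "pd i ?f p \<bullet> nu = (SS j. e a p$j*(pd i (%q. pd j X q) p \<bullet> nu))" for i
  proof -
   note d = smooth_differentiable[OF es V(1,2)] smooth_differentiable[OF Xs V(1,2)]
   have "pd i ?f p = (SS j. pd i (%q. e a q$j *R pd j X q) p)" by (rule pd_sum) (intro smooth_differentiable[OF _ V(1,2)] smooth_scaleR V es Xs)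
   also have "... = (SS j. e a p$j *R pd i (%q. pd j X q) p + pd i (%q. e a q$j) p *R pd j X p)"
    by (intro sum.cong refl pd_bilinear[OF bounded_bilinear_scaleR] d)
   finally show ?thesis by (simp add: inner_sum_left inner_add_left nu)
  qed
  ultimately show ?thesis by (simp add: sum_distrib_left mult_ac)
 qed
 have nD: "normal_part X p v \<bullet> nu = v \<bullet> nu" for v by (simp add: normal_part_eq[OF p] inner_diff_left inner_sum_left nu)
 have "H \<bullet> nu = (SS a. ?D a \<bullet> nu)" unfolding He inner_sum_left nD ..
 also have "... = (SS a i j. e a p$i*e a p$j*(pd i (%q. pd j X q) p \<bullet> nu))" unfolding Dn ..
 also have "... = (SS i j a. e a p$i*e a p$j*(pd i (%q. pd j X q) p \<bullet> nu))"
  by (subst sum.swap, rule sum.cong[OF refl], subst sum.swap, rule refl)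
 also have "... = laplace_X p \<bullet> nu" unfolding laplace_X_inner_normal[OF p nu] sum_distrib_right[symmetric] frame_matrix[OF V(2,3) e] ..
 finally have "nu \<bullet> nu = 0" by (simp add: nu_def inner_diff_left)
 thus ?thesis by (simp add: nu_def)
qed

text \<open>The Laplacian contributes 2n and twice the inner product of \<open>X\<close> with
  \<open>laplace_X\<close>, which by the self-expander equation is the squared norm of the normal
  part of \<open>X\<close>; the drift contributes the squared norm of the tangential part.\<close>

theorem drift_coord_norm_sq:
 assumes p: "p : W" and H: "is_mean_curvature X W p ((1/2) *R normal_part X p (X p))"
 shows "drift_coord X (%q. (norm (X q))^2) p = 2*CARD('n) + (norm (X p))^2"
proof -
 let ?f = "%q. X q \<bullet> X q" and ?v = "vol_density X"
 have fs: "smooth_on ?f W" by (intro smooth_inner W X)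
 have pdf: "pd j ?f q = 2*(X q \<bullet> pd j X q)" if "q : W" for j q
  using pd_inner[OF X_differentiable[OF that] X_differentiable[OF that], of j] by (simp add: inner_commute)
 have fl: "flux X ?f i q = 2*(X q \<bullet> dual_frame i q)" if "q : W" for i q
  by (simp add: flux_def pdf[OF that] dual_frame_def inner_sum_right sum_distrib_left mult_ac)
 have "(SS i. pd i (%q. ?v q*flux X ?f i q) p) = (SS i. 2*(X p \<bullet> pd i (%q. ?v q *R dual_frame i q) p + ?v p))"
 proof (rule sum.cong[OF refl])
  fix i
  note d = X_differentiable[OF p] differentiable_smooth[OF vol_dual_smooth p]
  have "pd i (%q. ?v q*flux X ?f i q) p = pd i (%q. 2*(X q \<bullet> (?v q *R dual_frame i q))) p" by (rule pd_cong_open[OF W p]) (simp add: fl)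
  also have "... = 2*pd i (%q. X q \<bullet> (?v q *R dual_frame i q)) p"
   by (rule pd_cmult) (rule differentiable_smooth[OF smooth_inner[OF W X vol_dual_smooth] p])
  also have "pd i (%q. X q \<bullet> (?v q *R dual_frame i q)) p = X p \<bullet> pd i (%q. ?v q *R dual_frame i q) p + ?v p"
   using pd_inner[OF d, of i] dual_frame_inner[OF p, of i i] by (simp add: inner_commute)
  finally show "pd i (%q. ?v q*flux X ?f i q) p = 2*(X p \<bullet> pd i (%q. ?v q *R dual_frame i q) p + ?v p)" .
 qed
 hence "laplace_coord X ?f p = 1 / ?v p * (SS i. 2*(X p \<bullet> pd i (%q. ?v q *R dual_frame i q) p + ?v p))"
  by (simp add: laplace_coord_def flux_def[symmetric])
 also have "... = 2*(X p \<bullet> laplace_X p) + 2*CARD('n)"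
  using vol_pos[OF p] by (simp add: laplace_X_def inner_sum_right sum.distrib sum_distrib_left[symmetric] distrib_left)
 finally have lap: "laplace_coord X ?f p = 2*(X p \<bullet> laplace_X p) + 2*CARD('n)" .
 have gr: "X p \<bullet> grad_coord X ?f p = 2*(X p \<bullet> (SS i. (X p \<bullet> dual_frame i p) *R pd i X p))"
  by (simp add: grad_coord_flux fl[OF p] inner_sum_right sum_distrib_left mult_ac)
 have "drift_coord X ?f p = 2*CARD('n) + (norm (X p))^2"
  unfolding drift_coord_eq[OF p fs, symmetric] lap gr mean_curvature_eq_laplace_X[OF p H] normal_part_eq[OF p]
  by (simp add: inner_diff_right power2_norm_eq_inner field_simps)
 thus ?thesis by (simp add: power2_norm_eq_inner)
qed

end

section \<open>Compactness\<close>

text \<open>The error terms of the compactness inequality. The representation is required for every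
  function \<open>u\<close>, which makes sums and nonnegative multiples immediate.\<close>

definition finite_rank :: "'a measure => (('a => real) => real) => bool" where
 "finite_rank mu q \<longleftrightarrow> (EX (g :: nat => 'a => real) N. (ALL i<N. g i : L2 mu) & (ALL u. q u = (\<Sum>i<N. (L2_inner mu (g i) u)^2)))"

lemma finite_rank_single: "g : L2 mu ==> finite_rank mu (%u. (L2_inner mu g u)^2)"
 unfolding finite_rank_def by (intro exI[of _ "%_. g"] exI[of _ 1]) simp

lemma finite_rank_add:
 assumes "finite_rank mu p" "finite_rank mu q"
 shows "finite_rank mu (%u. p u + q u)"
proof -
 obtain g N where g: "!!i. i < (N :: nat) ==> g i : L2 mu" "!!u. p u = (\<Sum>i<N. (L2_inner mu (g i) u)^2)"
  using assms(1) unfolding finite_rank_def by blast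
 obtain h M where h: "!!i. i < (M :: nat) ==> h i : L2 mu" "!!u. q u = (\<Sum>i<M. (L2_inner mu (h i) u)^2)"
  using assms(2) unfolding finite_rank_def by blast
 let ?k = "%i. if i < N then g i else h (i - N)"
 have s: "(\<Sum>i<N + M. F i) = (\<Sum>i<N. F i) + (\<Sum>i<M. F (N + i))" for F :: "nat => real" by (induction M) (simp_all add: add.assoc)
 have A: "p u + q u = (\<Sum>i<N + M. (L2_inner mu (?k i) u)^2)" for u unfolding s g(2) h(2) by simp
 have B: "ALL i<N + M. ?k i : L2 mu" using g(1) h(1) by auto
 show ?thesis unfolding finite_rank_def by (intro exI[of _ ?k] exI[of _ "N + M"] conjI B allI A)
qed

lemma finite_rank_cmult:
 assumes "finite_rank mu q" "c >= 0"
 shows "finite_rank mu (%u. c*q u)"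
proof -
 obtain g N where g: "!!i. i < (N :: nat) ==> g i : L2 mu" "!!u. q u = (\<Sum>i<N. (L2_inner mu (g i) u)^2)"
  using assms(1) unfolding finite_rank_def by blast
 have "L2_inner mu (%x. sqrt c*g i x) u = sqrt c*L2_inner mu (g i) u" for i u by (simp add: L2_inner_def mult.assoc)
 hence A: "c*q u = (\<Sum>i<N. (L2_inner mu (%x. sqrt c*g i x) u)^2)" for u using assms(2) by (simp add: g(2) sum_distrib_left power_mult_distrib)
 have B: "ALL i<N. (%x. sqrt c*g i x) : L2 mu" using g(1) by (auto intro: L2_scale)
 show ?thesis unfolding finite_rank_def by (intro exI[of _ "%i x. sqrt c*g i x"] exI[of _ N] conjI B allI A)
qed

lemma finite_rank_sum: "finite I ==> (!!k. k : I ==> finite_rank mu (q k)) ==> finite_rank mu (%u. \<Sum>k\<in>I. q k u)"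
proof (induction I rule: finite_induct)
 case empty
 thus ?case unfolding finite_rank_def by (intro exI[of _ undefined] exI[of _ 0]) simp
qed (simp add: finite_rank_add)

lemma indicator_L2:
 assumes "A : sets mu" "emeasure mu A < \<infinity>"
 shows "indicator A : L2 mu"
proof -
 have "(%x. (indicator A x :: real)^2) = indicator A" by (auto simp: indicator_def)
 thus ?thesis using assms by (simp add: L2_def)
qed

text \<open>The difference is the integral of a directional derivative along the segment; its square
  is at most the integral of the square, and translation invariance removes the dependence on the
  point of the segment.\<close>

lemma translate_difference_bound:
 fixes f :: "real^'n => real"
 assumes f: "f : test_fun UNIV"
 shows "(NN x. ennreal ((f x - f (x + z))^2)) <= ennreal ((norm z)^2)*(NN x. ennreal (SS i. (pd i f x)^2))"
proof -
 let ?S = "%x. SS i. (pd i f x)^2"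
 have pm[measurable]: "pd i f : borel_measurable borel" for i by (rule tf_measurable[OF tf_pd[OF f]])
 have S0: "?S x >= 0" for x by (simp add: sum_nonneg)
 have pw: "ennreal ((f x - f (x + z))^2) <= (NN t. ennreal ((norm z)^2*?S (x + t *R z))*indicator {0..1} t)" for x
 proof -
  define g' where "g' t = (SS i. z$i*pd i f (x + t *R z))" for t
  have pc: "continuous_on UNIV (%t. pd i f (x + t *R z))" for i using smooth_continuous[OF tf_smooth[OF tf_pd[OF f, of i]]]
   by (rule continuous_on_compose2) (auto intro!: continuous_intros)
  have c: "continuous_on {0..1} g'" unfolding g'_def by (intro continuous_intros continuous_on_subset[OF pc]) auto
  have "((%t. f (x + t *R z)) has_vector_derivative g' t) (at t within {0..1})" for t
  proof -
   have 1: "((%t. x + t *R z) has_derivative (%t. t *R z)) (at t)" by (auto intro!: derivative_eq_intros)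
   have "((%t. f (x + t *R z)) has_derivative (%s. FD f (x + t *R z) (s *R z))) (at t)"
    by (rule has_derivative_compose[OF 1]) (use tf_diff[OF f] frechet_derivative_works in blast)
   moreover have "FD f (x + t *R z) (s *R z) = s *R g' t" for s
    by (simp add: frechet_derivative_pd[OF tf_diff[OF f]] g'_def sum_distrib_left mult_ac)
   ultimately show ?thesis by (simp add: has_vector_derivative_def has_derivative_at_withinI)
  qed
  hence I1: "(g' has_integral (f (x + z) - f x)) {0..1}" using fundamental_theorem_of_calculus[of 0 1 "%t. f (x + t *R z)" g'] by simp
  let ?c = "f (x + z) - f x"
  obtain I where I2: "((%t. (g' t)^2) has_integral I) {0..1}"
   using integrable_continuous_real[of 0 1 "%t. (g' t)^2"] c by (auto intro!: continuous_intros simp: integrable_on_def)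
  \<comment> \<open>Integrating the square of \<open>g' t - ?c\<close>, which is nonnegative, over
    the unit interval gives \<open>?c^2 <= I\<close>.\<close>
  have "((%t. (g' t)^2 - 2*?c*g' t + ?c^2) has_integral (I - 2*?c*?c + ?c^2)) {0..1}"
   using has_integral_const_real[of "?c^2" 0 1] by (intro has_integral_add has_integral_diff I2 has_integral_mult_right I1) simp
  moreover have "0 <= (g' t)^2 - 2*?c*g' t + ?c^2" for t using zero_le_power2[of "g' t - ?c"] by (simp add: power2_eq_square algebra_simps)
  ultimately have "0 <= I - 2*?c*?c + ?c^2" by (rule has_integral_nonneg)
  hence "(f x - f (x + z))^2 <= I" by (simp add: power2_eq_square algebra_simps)
  hence "ennreal ((f x - f (x + z))^2) <= ennreal I" by (rule ennreal_leI)
  also have "ennreal I = (NN t. ennreal ((g' t)^2)*indicator {0..1} t)" by (rule nn_integral_has_integral_lebesgue'[OF _ I2, symmetric]) simp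
  also have "... <= (NN t. ennreal ((norm z)^2*?S (x + t *R z))*indicator {0..1} t)"
  proof (rule nn_integral_mono, rule mult_right_mono, rule ennreal_leI)
   fix t
   have "(z \<bullet> (\<chi> i. pd i f (x + t *R z)))^2 <= (z \<bullet> z)*((\<chi> i. pd i f (x + t *R z)) \<bullet> (\<chi> i. pd i f (x + t *R z)))"
    by (rule Cauchy_Schwarz_ineq)
   thus "(g' t)^2 <= (norm z)^2*?S (x + t *R z)" unfolding power2_norm_eq_inner by (simp add: g'_def inner_vec_def power2_eq_square)
  qed simp
  finally show ?thesis .
 qed
 have "(NN x. ennreal ((f x - f (x + z))^2)) <= (NN x. (NN t. ennreal ((norm z)^2*?S (x + t *R z))*indicator {0..1} t))"
  by (rule nn_integral_mono[OF pw])
 also have "... = (NN t. (NN x. ennreal ((norm z)^2*?S (x + t *R z))*indicator {0..1::real} t))" by (rule lborel_pair.Fubini') measurable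
 also have "... = (NN t. ennreal ((norm z)^2)*(NN x. ennreal (?S x))*indicator {0..1::real} t)"
 proof (rule nn_integral_cong)
  fix t :: real
  have "(NN x. ennreal ((norm z)^2*?S (x + t *R z))) = ennreal ((norm z)^2)*(NN x. ennreal (?S (x - (- t *R z))))"
   by (simp add: ennreal_mult S0 nn_integral_cmult)
  also have "(NN x. ennreal (?S (x - (- t *R z)))) = (NN x. ennreal (?S x))" by (rule nn_integral_shift(2)) measurable
  finally show "(NN x. ennreal ((norm z)^2*?S (x + t *R z))*indicator {0..1::real} t)
   = ennreal ((norm z)^2)*(NN x. ennreal (?S x))*indicator {0..1::real} t" by (simp add: nn_integral_multc)
 qed
 also have "... = ennreal ((norm z)^2)*(NN x. ennreal (?S x))" by (simp add: nn_integral_cmult)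
 finally show ?thesis .
qed

section \<open>Rellich's theorem by averaging over cubes\<close>

text \<open>The half-open cubes of a grid of mesh \<open>h\<close>; for \<open>h > 0\<close> they
  partition the space.\<close>

definition cell :: "real => ('n => int) => (real^'n) set" where
 "cell h m = {x. ALL i. h * of_int (m i) <= x$i & x$i < h*(of_int (m i) + 1)}"

lemma cell_at: "h > 0 ==> x : cell h (%i. \<lfloor>x$i / h\<rfloor>)"
 unfolding cell_def using floor_divide_lower[of h] floor_divide_upper[of h] by (auto simp: mult.commute)

lemma cell_borel[measurable]: "cell h m : sets borel"
proof -
 have "cell h m = (\<Inter>i. {x. h * of_int (m i) <= x$i} \<inter> {x. x$i < h*(of_int (m i) + 1)})" by (auto simp: cell_def)
 also have "... : sets borel" by (intro sets.finite_INT sets.Int borel_closed borel_open closed_Collect_le open_Collect_less continuous_intros) auto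
 finally show ?thesis .
qed

lemma measure_cell:
 assumes h: "h > 0"
 shows "emeasure lborel (cell h m :: (real^'n) set) = ennreal (h^CARD('n))"
proof (rule antisym)
 define a :: "real^'n" where "a = (\<chi> i. h * of_int (m i))"
 have b: "(\<Prod>b\<in>Basis. (a + (\<chi> i. h) - a) \<bullet> b) = h^CARD('n)"
  by (simp add: Basis_vec_eq prod.reindex inj_on_def axis_eq_axis inner_axis)
 have le: "a \<bullet> b <= (a + (\<chi> i. h)) \<bullet> b" if "b : Basis" for b using that h by (auto simp: Basis_vec_eq inner_axis)
 have "emeasure lborel (cell h m) <= emeasure lborel (cbox a (a + (\<chi> i. h)))"
  by (rule emeasure_mono) (auto simp: cell_def mem_box_cart a_def algebra_simps less_imp_le)
 thus "emeasure lborel (cell h m :: (real^'n) set) <= ennreal (h^CARD('n))" using emeasure_lborel_cbox[of a, OF le] by (simp only: b)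
 have "emeasure lborel (box a (a + (\<chi> i. h))) <= emeasure lborel (cell h m)"
  by (rule emeasure_mono) (auto simp: cell_def mem_box_cart a_def algebra_simps less_imp_le)
 thus "ennreal (h^CARD('n)) <= emeasure lborel (cell h m :: (real^'n) set)" using emeasure_lborel_box[of a, OF le] by (simp only: b)
qed

text \<open>Up to the factor 2, the square of \<open>f x\<close> is bounded by the squared mean over
  the cube plus the mean of \<open>(f x - f y)^2\<close>. Writing \<open>y = x + z\<close> with
  \<open>z\<close> in a fixed box of side \<open>2h\<close> makes the second term independent of the
  cube.\<close>

lemma cell_pointwise_bound:
 fixes f :: "real^'n => real"
 assumes h: "h > 0" and f: "f : test_fun UNIV" and x: "x : cell h m"
 shows "ennreal ((f x)^2) <= ennreal (2 / (h^CARD('n))^2*(L2_inner lborel (indicator (cell h m)) f)^2)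
  + ennreal (2 / h^CARD('n))*(NN z. indicator (box (\<chi> i. - h) (\<chi> i. h)) z*ennreal ((f x - f (x + z))^2))"
proof -
 let ?Q = "cell h m" and ?Z = "box (\<chi> i. - h) (\<chi> i. h) :: (real^'n) set"
 define q where "q = h^CARD('n)"
 have q: "q > 0" "emeasure lborel ?Q = ennreal q" using h by (simp_all add: q_def measure_cell)
 have fm[measurable]: "f : borel_measurable borel" by (rule tf_measurable[OF f])
 obtain B where B: "!!y. abs (f y) <= B" using tf_bounded[OF f] by metis
 have dB: "abs (f x - f y) <= 2*B" for y using B[of x] B[of y] by linarith
 define J where "J = (LBINT y. indicator ?Q y*(f x - f y)^2)"
 have iQ: "(indicator ?Q :: real^'n => real) : L2 lborel" by (rule indicator_L2) (use q in auto)
 have i1: "integrable lborel (%y. (f x - f y)*indicator ?Q y)" by (rule integrable_mult_bounded[where B = "2*B"]) (use q dB in auto)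
 have i2: "integrable lborel (%y. (f x - f y)^2*indicator ?Q y)" by (rule integrable_mult_bounded[where B = "(2*B)^2"])
   (use q power_mono[OF dB abs_ge_zero, where n = 2] in auto)
 have L: "(%y. (f x - f y)*indicator ?Q y) : L2 lborel"
 proof -
  have "(%y. ((f x - f y)*indicator ?Q y)^2) = (%y. (f x - f y)^2*indicator ?Q y)" by (auto simp: indicator_def)
  thus ?thesis unfolding L2_def using i2 by auto
 qed
 let ?A = "L2_inner lborel (indicator ?Q) f"
 have fi: "integrable lborel (%y. indicator ?Q y*f y)" using L2_mult_integrable[OF iQ tf_L2[OF f]] .
 have "L2_inner lborel (%y. (f x - f y)*indicator ?Q y) (indicator ?Q) = (LBINT y. f x*indicator ?Q y - indicator ?Q y*f y)"
  unfolding L2_inner_def by (intro LINT_cong) (auto simp: indicator_def)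
 also have "... = f x*q - ?A" using fi q by (subst LINT_diff) (auto simp: L2_inner_def measure_def)
 finally have "abs (f x*q - ?A) <= L2_norm lborel (%y. (f x - f y)*indicator ?Q y)*L2_norm lborel (indicator ?Q :: real^'n => real)"
  using L2_Cauchy_Schwarz[OF L iQ] by simp
 hence "(f x*q - ?A)^2 <= (L2_norm lborel (%y. (f x - f y)*indicator ?Q y))^2*(L2_norm lborel (indicator ?Q :: real^'n => real))^2"
  unfolding power_mult_distrib[symmetric] by (rule abs_le_square_iff[THEN iffD1, OF order_trans]) simp
 also have "(L2_norm lborel (%y. (f x - f y)*indicator ?Q y))^2 = J"
  unfolding L2_norm_sq L2_inner_def J_def by (intro LINT_cong) (auto simp: indicator_def power2_eq_square)
 also have "(L2_norm lborel (indicator ?Q :: real^'n => real))^2 = q"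
  unfolding L2_norm_sq L2_inner_def using q by (simp add: measure_def indicator_inter_arith[symmetric])
 finally have "(f x*q - ?A)^2 / q^2 <= J / q" using q by (simp add: divide_simps power2_eq_square)
 moreover have "(f x)^2 <= 2*(?A^2 / q^2) + 2*((f x*q - ?A)^2 / q^2)"
 proof -
  have "f x = ?A / q + (f x*q - ?A) / q" using q by (simp add: field_simps)
  moreover have "(a + b)^2 <= 2*a^2 + 2*b^2" for a b :: real using zero_le_power2[of "a - b"] by (simp add: power2_eq_square algebra_simps)
  ultimately show ?thesis by (metis power_divide)
 qed
 ultimately have "(f x)^2 <= 2 / q^2*?A^2 + 2 / q*J" by simp
 moreover have J0: "J >= 0" unfolding J_def by (rule LINT_nonneg) simp
 ultimately have "ennreal ((f x)^2) <= ennreal (2 / q^2*?A^2) + ennreal (2 / q)*ennreal J"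
  using q by (simp add: ennreal_leI ennreal_mult[symmetric] ennreal_plus[symmetric] del: ennreal_plus)
 moreover have "ennreal J <= (NN z. indicator ?Z z*ennreal ((f x - f (x + z))^2))"
 proof -
  have "ennreal J = (NN y. ennreal (indicator ?Q y*(f x - f y)^2))"
   unfolding J_def using i2 by (intro nn_integral_eq_integral[symmetric]) (simp_all add: mult.commute)
  also have "... <= (NN y. indicator ?Z (y - x)*ennreal ((f x - f (x + (y - x)))^2))"
  proof (rule nn_integral_mono)
   fix y
   show "ennreal (indicator ?Q y*(f x - f y)^2) <= indicator ?Z (y - x)*ennreal ((f x - f (x + (y - x)))^2)"
   proof (cases "y : ?Q")
    case True
    have "y - x : ?Z" unfolding mem_box_cart
    proof (intro allI)
     fix i
     have "h * of_int (m i) <= x$i" "x$i < h * of_int (m i) + h" "h * of_int (m i) <= y$i" "y$i < h * of_int (m i) + h"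
      using True x by (auto simp: cell_def distrib_left)
     thus "(\<chi> i. - h)$i < (y - x)$i & (y - x)$i < (\<chi> i. h)$i" by simp
    qed
    thus ?thesis by (simp add: indicator_def)
   qed simp
  qed
  also have "... = (NN z. indicator ?Z z*ennreal ((f x - f (x + z))^2))"
   by (rule nn_integral_shift(2)[of "%z. indicator ?Z z*ennreal ((f x - f (x + z))^2)"]) measurable
  finally show ?thesis .
 qed
 ultimately show ?thesis unfolding q_def by (meson add_left_mono mult_left_mono order_trans zero_le)
qed

text \<open>Finitely many cubes cover the ball of radius \<open>R\<close>, and the inner products
  with their indicators form the finite rank part \<open>q\<close>; the rest consists of
  translations by \<open>z\<close> with \<open>|z|^2 <= n h^2\<close>.\<close>

lemma rellich:
 assumes d: "delta > 0"
 shows "EX q. finite_rank lborel q & (ALL f:test_fun (UNIV :: (real^'n) set). (ALL x. norm x > R --> f x = 0) -->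
  (LBINT x. (f x)^2) <= delta*(LBINT x. (SS i. (pd i f x)^2)) + q f)"
proof -
 let ?n = "CARD('n)"
 \<comment> \<open>The remainder is \<open>(2 / h^n) * (2h)^n * n h^2 = c * h^2\<close> times the
   integral of the squared gradient; the mesh is then fixed by
   \<open>c * h^2 = delta\<close>.\<close>
 define c where "c = 2*2 ^ ?n*real ?n"
 have c: "c > 0" by (simp add: c_def)
 define h where "h = sqrt (delta / c)"
 have h: "h > 0" "c*h^2 = delta" using c d by (simp_all add: h_def)
 define B where "B = \<lceil>(abs R) / h\<rceil> + 1"
 define M where "M = {m :: 'n => int. ALL i. m i : {-B..B}}"
 have fM: "finite M"
 proof -
  have "M = PiE UNIV (%_. {-B..B})" by (auto simp: M_def PiE_def)
  thus ?thesis by (simp add: finite_PiE)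
 qed
 define q where "q f = (\<Sum>m\<in>M. 2 / h ^ ?n * (L2_inner lborel (indicator (cell h m)) f)^2)" for f :: "real^'n => real"
 have iQ: "(indicator (cell h m) :: real^'n => real) : L2 lborel" for m by (rule indicator_L2) (use h in "auto simp: measure_cell")
 have "finite_rank lborel q" unfolding q_def by (intro finite_rank_sum fM finite_rank_cmult finite_rank_single iQ) (use h in auto)
 moreover have "(LBINT x. (f x)^2) <= delta*(LBINT x. (SS i. (pd i f x)^2)) + q f"
  if f: "f : test_fun UNIV" and R: "!!x. norm x > R ==> f x = 0" for f :: "real^'n => real"
 proof -
  have fm[measurable]: "f : borel_measurable borel" by (rule tf_measurable[OF f])
  let ?S = "%x. SS i. (pd i f x)^2" and ?Z = "box (\<chi> i. - h) (\<chi> i. h) :: (real^'n) set"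
  let ?A = "%m. (L2_inner lborel (indicator (cell h m)) f)^2" and ?q = "h ^ ?n"
  have S: "integrable lborel ?S" "!!x. 0 <= ?S x" using tf_L2[OF tf_pd[OF f]] by (auto simp: L2_def sum_nonneg)
  have Z: "emeasure lborel ?Z = ennreal ((2*h) ^ ?n)"
   by (subst emeasure_lborel_box) (use h in "auto simp: Basis_vec_eq prod.reindex inj_on_def axis_eq_axis inner_axis")
  have zn: "(norm z)^2 <= real ?n*h^2" if "z : ?Z" for z
  proof -
   have "(norm z)^2 = (SS i. (z$i)^2)" unfolding power2_norm_eq_inner by (simp add: inner_vec_def power2_eq_square)
   also have "... <= (\<Sum>i\<in>(UNIV :: 'n set). h^2)"
   proof (rule sum_mono)
    fix i show "(z$i)^2 <= h^2" using that by (intro abs_le_square_iff[THEN iffD1]) (auto simp: mem_box_cart abs_le_iff less_imp_le dest!: spec[of _ i])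
   qed
   finally show ?thesis by simp
  qed
  have pw: "ennreal ((f x)^2) <= (\<Sum>m\<in>M. ennreal (2 / ?q^2*?A m)*indicator (cell h m) x)
    + ennreal (2 / ?q)*(NN z. indicator ?Z z*ennreal ((f x - f (x + z))^2))" for x
  proof (cases "f x = 0")
   case False
   hence nx: "norm x <= R" using R[of x] by force
   let ?m = "%i. \<lfloor>x$i / h\<rfloor>"
   have "?m i : {-B..B}" for i
   proof -
    have "abs (x$i) / h <= abs R / h" using component_le_norm_cart[of x i] nx h by (intro divide_right_mono) auto
    hence "abs (x$i / h) <= abs R / h" using h by simp
    hence "x$i / h <= abs R / h" "- (abs R / h) <= x$i / h" unfolding abs_le_iff by linarith+
    hence "\<lfloor>x$i / h\<rfloor> <= \<lceil>(abs R) / h\<rceil> + 1" "- (\<lceil>(abs R) / h\<rceil> + 1) <= \<lfloor>x$i / h\<rfloor>" by linarith+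
    thus ?thesis unfolding B_def by simp
   qed
   hence m: "?m : M" by (simp add: M_def)
   have "ennreal ((f x)^2) <= ennreal (2 / ?q^2*?A ?m)
    + ennreal (2 / ?q)*(NN z. indicator ?Z z*ennreal ((f x - f (x + z))^2))" by (rule cell_pointwise_bound[OF h(1) f cell_at[OF h(1)]])
   also have "ennreal (2 / ?q^2*?A ?m) = ennreal (2 / ?q^2*?A ?m)*indicator (cell h ?m) x" using cell_at[OF h(1), of x] by simp
   also have "... <= (\<Sum>m\<in>M. ennreal (2 / ?q^2*?A m)*indicator (cell h m) x)" by (rule member_le_sum[OF m _ fM]) simp
   finally show ?thesis by simp
  qed simp
  have "(NN x. ennreal ((f x)^2)) <= (NN x. (\<Sum>m\<in>M. ennreal (2 / ?q^2*?A m)*indicator (cell h m) x)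
    + ennreal (2 / ?q)*(NN z. indicator ?Z z*ennreal ((f x - f (x + z))^2)))" by (rule nn_integral_mono[OF pw])
  also have "... = (\<Sum>m\<in>M. ennreal (2 / ?q^2*?A m)*ennreal ?q)
    + ennreal (2 / ?q)*(NN x. (NN z. indicator ?Z z*ennreal ((f x - f (x + z))^2)))"
   using h by (subst nn_integral_add) (auto simp: nn_integral_sum nn_integral_cmult measure_cell)
  also have "(\<Sum>m\<in>M. ennreal (2 / ?q^2*?A m)*ennreal ?q) = ennreal (q f)"
   using h by (simp add: q_def ennreal_mult[symmetric] sum_ennreal power2_eq_square)
  also have "(NN x. (NN z. indicator ?Z z*ennreal ((f x - f (x + z))^2)))
    = (NN z. (NN x. indicator ?Z z*ennreal ((f x - f (x + z))^2)))" by (rule lborel_pair.Fubini') measurable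
  also have "... <= (NN z. indicator ?Z z*(ennreal (real ?n*h^2)*(NN x. ennreal (?S x))))"
  proof (rule nn_integral_mono)
   fix z
   show "(NN x. indicator ?Z z*ennreal ((f x - f (x + z))^2)) <= indicator ?Z z*(ennreal (real ?n*h^2)*(NN x. ennreal (?S x)))"
   proof (cases "z : ?Z")
    case True
    have "(NN x. ennreal ((f x - f (x + z))^2)) <= ennreal ((norm z)^2)*(NN x. ennreal (?S x))" by (rule translate_difference_bound[OF f])
    also have "... <= ennreal (real ?n*h^2)*(NN x. ennreal (?S x))" by (intro mult_right_mono ennreal_leI zn True) simp
    finally show ?thesis using True by simp
   qed simp
  qed
  also have "... = ennreal ((2*h) ^ ?n)*(ennreal (real ?n*h^2)*(NN x. ennreal (?S x)))" by (simp add: nn_integral_multc Z)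
  also have "(NN x. ennreal (?S x)) = ennreal (LBINT x. ?S x)" by (rule nn_integral_eq_integral[OF S(1)]) (simp add: S)
  finally have "(NN x. ennreal ((f x)^2)) <= ennreal (q f) + ennreal (2 / ?q)*(ennreal ((2*h) ^ ?n)*(ennreal (real ?n*h^2)*ennreal (LBINT x. ?S x)))"
   by (simp add: mult_left_mono)
  also have "(NN x. ennreal ((f x)^2)) = ennreal (LBINT x. (f x)^2)" using tf_L2[OF f] by (intro nn_integral_eq_integral) (auto simp: L2_def)
  also have "ennreal (2 / ?q)*(ennreal ((2*h) ^ ?n)*(ennreal (real ?n*h^2)*ennreal (LBINT x. ?S x))) = ennreal (delta*(LBINT x. ?S x))"
  proof -
   have k: "2 / ?q*((2*h) ^ ?n*(real ?n*h^2*(LBINT x. ?S x))) = delta*(LBINT x. ?S x)"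
    unfolding h(2)[symmetric] c_def using h(1) by (simp add: power_mult_distrib)
   have m: "ennreal a*(ennreal b*(ennreal k*ennreal I)) = ennreal (a*(b*(k*I)))"
    if "0 <= a" "0 <= b" "0 <= k" "0 <= I" for a b k I :: real using that by (simp add: ennreal_mult)
   have p: "0 <= 2 / ?q" "0 <= (2*h) ^ ?n" "0 <= real ?n*h^2" "0 <= (LBINT x. ?S x)" using h(1) S by (simp_all add: LINT_nonneg)
   from m[OF p] show ?thesis unfolding k .
  qed
  finally show ?thesis using h(1) d S by (simp add: ennreal_plus[symmetric] q_def sum_nonneg LINT_nonneg add.commute del: ennreal_plus)
 qed
 ultimately show ?thesis by blast
qed

context immersed_manifold
begin

section \<open>The compactness inequality near a point of the manifold\<close>

lemma push_borel:
 assumes c: "(W, psi) : A" and k[measurable]: "k : borel_measurable borel"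
 shows "push W psi k : borel_measurable borel"
proof -
 define \<iota> where "\<iota> x = (if x : psi ` W then inv_into W psi x else 0)" for x
 have U[measurable]: "psi ` W : sets borel" using chart_image_open[OF c] by simp
 have i[measurable]: "\<iota> : borel_measurable borel" unfolding \<iota>_def
  by (rule borel_measurable_continuous_on_if[OF U chart_inv_continuous[OF c]]) simp
 have "push W psi k = (%x. indicator (psi ` W) x * k (\<iota> x))" by (auto simp: push_def \<iota>_def indicator_def)
 thus ?thesis by simp
qed

text \<open>An inner product in coordinates becomes one on the manifold after division by the
  density, and the test function \<open>t\<close> keeps the quotient bounded. This carries the
  finite rank part of \<open>rellich\<close> over to the manifold.\<close>

lemma inner_push:
 assumes c: "(W, psi) : A" and t: "t : test_fun W" and g: "g : L2 lborel"
 shows "EX g'. g' : L2 mu & (ALL u : borel_measurable borel. L2_inner lborel g (%p. t p*u (psi p)) = L2_inner mu g' u)"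
proof -
 interpret c: immersed_patch W "F o psi" by (rule patch[OF c])
 let ?w = "weight (F o psi)"
 have iw: "smooth_on (%p. 1 / ?w p) W" using c.weight_pos by (intro smooth_divide smooth_const c.weight_smooth c.W) force
 define s where "s p = t p*(1 / ?w p)" for p
 have s: "s : test_fun W" unfolding s_def[abs_def] by (rule tf_mult[OF t iw c.W])
 have sw: "?w p * s p = t p" for p using c.weight_pos[of p] tf_outside[OF t, of p] by (cases "p : W") (auto simp: s_def)
 have st: "(%p. t p * s p) : test_fun W" by (rule tf_mult[OF t smooth_subset[OF tf_smooth[OF s]] c.W]) (auto simp: c.W)
 have [measurable]: "g : borel_measurable borel" "s : borel_measurable borel" using L2_measurable[OF g] s by auto
 let ?g = "push W psi (%p. s p*g p)"
 have gm: "?g : borel_measurable borel" by (rule push_borel[OF c]) measurable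
 have out: "?g x = 0" if "x ~: psi ` W" for x using that by (simp add: push_def)
 obtain B where B: "!!p. abs (t p * s p) <= B" using tf_bounded[OF st] by metis
 have "pull W psi (%x. (?g x)^2) = (%p. (t p * s p)*(g p)^2)" using tf_outside[OF t]
  by (intro ext) (auto simp: pull_def push_chart[OF c] indicator_def power2_eq_square sw[symmetric])
 moreover have "integrable lborel (%p. (t p * s p)*(g p)^2)"
  by (rule integrable_mult_bounded[OF _ _ B]) (use g tf_measurable[OF st] in "auto simp: L2_def")
 ultimately have "integrable mu (%x. (?g x)^2)" using integral_chart(1)[OF c, of "%x. (?g x)^2"] gm out by simp
 hence "?g : L2 mu" using gm by (simp add: L2_def cong: measurable_cong_sets)
 moreover have "L2_inner lborel g (%p. t p*u (psi p)) = L2_inner mu ?g u" if u: "u : borel_measurable borel" for u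
 proof -
  have "pull W psi (%x. ?g x*u x) = (%p. g p*(t p*u (psi p)))"
   using tf_outside[OF t] by (intro ext) (auto simp: pull_def push_chart[OF c] indicator_def sw[symmetric])
  thus ?thesis unfolding L2_inner_def using integral_chart(2)[OF c, of "%x. ?g x*u x"] gm u out by simp
 qed
 ultimately show ?thesis by blast
qed

lemma TF_measurable: "phi : TF ==> phi : borel_measurable borel" by (rule borel_measurable_continuous_onI[OF smooth_map_continuous[OF TF_smooth]])

lemma test_square_integrable: "phi : TF ==> integrable mu (%x. (phi x)^2)"
 unfolding power2_eq_square by (intro test_mult_integrable smooth_map_continuous TF_smooth)

lemma TF_L2: "phi : TF ==> phi : L2 mu" using test_square_integrable TF_measurable by (simp add: L2_def cong: measurable_cong_sets)

text \<open>The product rule with \<open>|a + b|^2 <= 2 |a|^2 + 2 |b|^2\<close>; \<open>C\<close>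
  bounds the squared gradient of the cutoff.\<close>

lemma energy_cutoff:
 assumes b: "\<beta> : TF" "!!x. 0 <= \<beta> x" "!!x. \<beta> x <= 1"
 shows "EX C>=0. ALL phi:TF. energy (%x. phi x*\<beta> x) (%x. phi x*\<beta> x) <= 2*energy phi phi + 2*C*(LINT x|mu. (phi x)^2)"
proof -
 note bs = TF_smooth[OF b(1)]
 obtain K where K: "compact K" "!!x. x ~: K ==> \<beta> x = 0" using b(1) unfolding TF_iff by blast
 have "bounded (grad A F \<beta> ` K)"
  by (intro compact_imp_bounded compact_continuous_image K continuous_on_subset[OF grad_continuous[OF bs]]) auto
 then obtain B where B: "!!x. x : K ==> norm (grad A F \<beta> x) <= B" by (auto simp: bounded_iff)
 define C where "C = (abs B)^2"
 have C: "(norm (grad A F \<beta> x))^2 <= C" for x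
 proof (cases "x : K")
  case True
  thus ?thesis unfolding C_def using B[OF True] by (intro power_mono) auto
 qed (simp add: grad_outside[OF bs compact_imp_closed[OF K(1)] K(2)] C_def)
 have "energy (%x. phi x*\<beta> x) (%x. phi x*\<beta> x) <= 2*energy phi phi + 2*C*(LINT x|mu. (phi x)^2)" if phi: "phi : TF" for phi
 proof -
  note s = TF_smooth[OF phi]
  have t: "(%x. phi x*\<beta> x) : TF" by (rule TF_mult[OF b(1) s])
  have i: "integrable mu (%x. 2*(grad A F phi x \<bullet> grad A F phi x))" "integrable mu (%x. 2*C*(phi x)^2)"
   using grad_test_integrable[OF phi s] test_square_integrable[OF phi] by simp_all
  have "energy (%x. phi x*\<beta> x) (%x. phi x*\<beta> x) <= (LINT x|mu. 2*(grad A F phi x \<bullet> grad A F phi x) + 2*C*(phi x)^2)"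
   unfolding energy_def
  proof (rule integral_mono)
   show "integrable mu (%x. grad A F (%x. phi x*\<beta> x) x \<bullet> grad A F (%x. phi x*\<beta> x) x)"
    by (rule grad_test_integrable[OF t TF_smooth[OF t]])
   show "integrable mu (%x. 2*(grad A F phi x \<bullet> grad A F phi x) + 2*C*(phi x)^2)" using i by (rule Lint_add)
   fix x
   let ?a = "phi x *R grad A F \<beta> x" and ?b = "\<beta> x *R grad A F phi x"
   have "(?a + ?b) \<bullet> (?a + ?b) <= 2*(?a \<bullet> ?a) + 2*(?b \<bullet> ?b)"
    using inner_ge_zero[of "?a - ?b"] by (simp add: inner_diff_left inner_diff_right inner_add_left inner_add_right inner_commute)
   moreover have "?a \<bullet> ?a <= C*(phi x)^2"
    using mult_right_mono[OF C, of "(phi x)^2" x] by (simp add: dot_square_norm power2_eq_square mult_ac)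
   moreover have "?b \<bullet> ?b <= grad A F phi x \<bullet> grad A F phi x"
    using mult_right_mono[OF mult_le_one[OF b(3) b(2) b(3)], of "grad A F phi x \<bullet> grad A F phi x" x x] by (simp add: mult.assoc)
   ultimately show "grad A F (%x. phi x*\<beta> x) x \<bullet> grad A F (%x. phi x*\<beta> x) x <= 2*(grad A F phi x \<bullet> grad A F phi x) + 2*C*(phi x)^2"
    unfolding grad_mult[OF s bs] by linarith
  qed
  also have "... = 2*energy phi phi + 2*C*(LINT x|mu. (phi x)^2)" using i by (subst LINT_add) (simp_all add: energy_def)
  finally show ?thesis .
 qed
 thus ?thesis by (intro exI[of _ C]) (simp add: C_def)
qed

text \<open>On a compact part of a chart the energy form is uniformly elliptic and the weight is
  bounded: the comparisons that lead from the weighted norm to \<open>rellich\<close> and back to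
  the energy.\<close>

lemma chart_ellipticity:
 assumes c: "(W, psi) : A" and K: "compact K" "K <= W"
 shows "EX m>0. EX B>0. ALL f:test_fun W. (ALL p. p ~: K --> f p = 0) -->
  m*(LBINT p. (SS i. (pd i f p)^2)) <= energy (push W psi f) (push W psi f) &
  (LINT x|mu. (push W psi f x)^2) <= B*(LBINT p. (f p)^2)"
proof -
 interpret c: immersed_patch W "F o psi" by (rule patch[OF c])
 let ?w = "weight (F o psi)"
 define a where "a i j p = ?w p * c.ginv p$i$j" for i j p
 have ac: "continuous_on K (a i j)" for i j
  unfolding a_def[abs_def] by (rule continuous_on_subset[OF smooth_continuous[OF smooth_mult[OF c.W c.weight_smooth c.ginv_smooth]] K(2)])
 have apos: "0 < (SS i j. a i j p*(xi$i * xi$j))" if "p : K" "xi ~= 0" for p xi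
 proof -
  have "(SS i j. a i j p*(xi$i * xi$j)) = ?w p*(xi \<bullet> (c.ginv p *v xi))"
   by (simp add: a_def inner_vec_def matrix_vector_mult_def sum_distrib_left mult_ac)
  thus ?thesis using that K(2) c.weight_pos[of p] c.ginv_pos[of p xi] by auto
 qed
 obtain m where m: "m > 0" "!!p xi. p : K ==> m*(SS i. (xi i)^2) <= (SS i j. a i j p*(xi i * xi j))"
  using uniform_ellipticity_on_compact[of K a, OF K(1) ac apos] by blast
 have "bounded (?w ` K)" by (intro compact_imp_bounded compact_continuous_image K continuous_on_subset[OF smooth_continuous[OF c.weight_smooth]])
 then obtain B where "!!p. p : K ==> norm (?w p) <= B" by (auto simp: bounded_iff)
 hence B: "p : K ==> ?w p <= abs B + 1" for p by force
 have "m*(LBINT p. (SS i. (pd i f p)^2)) <= energy (push W psi f) (push W psi f)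
  & (LINT x|mu. (push W psi f x)^2) <= (abs B + 1)*(LBINT p. (f p)^2)"
  if f: "f : test_fun W" and out: "!!p. p ~: K ==> f p = 0" for f
 proof
  let ?R = "%p. SS i. pd i f p*(?w p*flux (F o psi) f i p)"
  have dz: "pd i f p = 0" if "p ~: K" for i p
   using pd_cong_open[of "- K" p f "%_. 0" i] that out K(1) by (simp add: pd_const compact_imp_closed open_Compl)
  have fW: "smooth_on f W" by (rule smooth_subset[OF tf_smooth[OF f]]) (auto simp: c.W)
  have R: "integrable lborel ?R" by (intro Lint_sum tf_integrable[where U=W] tf_mult tf_pd f smooth_mult c.W c.weight_smooth c.flux_smooth fW)
  have "m*(LBINT p. (SS i. (pd i f p)^2)) = (LBINT p. m*(SS i. (pd i f p)^2))" by simp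
  also have "... <= (LBINT p. ?R p)"
  proof (rule integral_mono[OF _ R])
   show "integrable lborel (%p. m*(SS i. (pd i f p)^2))" using tf_L2[OF tf_pd[OF f]] by (simp add: L2_def)
   fix p
   show "m*(SS i. (pd i f p)^2) <= ?R p"
   proof (cases "p : K")
    case True
    have "?R p = (SS i j. a i j p*(pd i f p*pd j f p))" by (simp add: flux_def a_def sum_distrib_left mult_ac)
    thus ?thesis using m(2)[OF True, of "%i. pd i f p"] by simp
   qed (simp add: dz)
  qed
  also have "... = energy (push W psi f) (push W psi f)"
  proof -
   have "flux (F o psi) (push W psi f o psi) i p = flux (F o psi) f i p" if "p : W" for i p
    unfolding flux_def using pd_cong_open[OF c.W that, of "push W psi f o psi" f] push_chart[OF c] by simp
   hence "pd i f p*(?w p*flux (F o psi) (push W psi f o psi) i p) = pd i f p*(?w p*flux (F o psi) f i p)" for i p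
    using dz[of p i] K(2) by (cases "p : W") auto
   thus ?thesis unfolding energy_chart[OF c f push_smooth[OF c f]] by (simp only:)
  qed
  finally show "m*(LBINT p. (SS i. (pd i f p)^2)) <= energy (push W psi f) (push W psi f)" .
  have pl: "pull W psi (%x. (push W psi f x)^2) = (%p. ?w p*(f p)^2)"
   using tf_outside[OF f] by (intro ext) (auto simp: pull_def push_chart[OF c] indicator_def)
  have ff: "(%p. f p*(?w p*f p)) : test_fun W" by (intro tf_mult f smooth_mult c.W c.weight_smooth fW)
  have m2: "(%x. (push W psi f x)^2) : borel_measurable borel" by (rule borel_measurable_power[OF TF_measurable[OF push_test[OF c f]]])
  have "(LINT x|mu. (push W psi f x)^2) = (LBINT p. ?w p*(f p)^2)" unfolding pl[symmetric] by (rule integral_chart(2)[OF c m2]) (simp add: push_def)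
  also have "... <= (LBINT p. (abs B + 1)*(f p)^2)"
  proof (rule integral_mono)
   show "integrable lborel (%p. ?w p*(f p)^2)" using tf_integrable[OF ff] by (simp add: power2_eq_square mult_ac)
   show "integrable lborel (%p. (abs B + 1)*(f p)^2)" using tf_L2[OF f] by (simp add: L2_def)
   show "?w p*(f p)^2 <= (abs B + 1)*(f p)^2" for p using B[of p] out[of p] by (cases "p : K") (auto intro: mult_right_mono)
  qed
  finally show "(LINT x|mu. (push W psi f x)^2) <= (abs B + 1)*(LBINT p. (f p)^2)" by simp
 qed
 thus ?thesis using m(1) by (intro exI[of _ m] exI[of _ "abs B + 1"] conjI) auto
qed

text \<open>\<open>C\<close> comes from the gradient of a cutoff and is fixed before
  \<open>e\<close>: the global argument chooses \<open>e\<close> depending on the sum of these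
  constants over a finite cover.\<close>

lemma local_compactness:
 "EX N C. open N & x : N & 0 <= C & (ALL e>0. EX q. finite_rank mu q & (ALL phi:TF.
  (LINT y|mu. indicator N y*(phi y)^2) <= e*(energy phi phi + C*(LINT y|mu. (phi y)^2)) + q phi))"
proof (rule bump_exists[OF open_UNIV UNIV_I, of x])
 fix W psi c N
 assume c: "(W, psi) : A" and t: "c : test_fun W" and b: "!!y. 0 <= push W psi c y" "!!y. push W psi c y <= 1"
  and N: "open N" "x : N" "!!y. y : N ==> push W psi c y = 1"
 let ?b = "push W psi c"
 note bt = push_test[OF c t]
 have W: "open W" by (rule chart_open[OF c])
 obtain K where K: "compact K" "K <= W" "!!p. p ~: K ==> c p = 0" using t unfolding test_fun_def by blast
 obtain R where R: "!!p. p : K ==> norm p <= R" using compact_imp_bounded[OF K(1)] by (auto simp: bounded_iff)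
 obtain m B where m: "m > 0" "B > 0" and mB: "!!f. f : test_fun W ==> (!!p. p ~: K ==> f p = 0) ==>
  m*(LBINT p. (SS i. (pd i f p)^2)) <= energy (push W psi f) (push W psi f) &
  (LINT x|mu. (push W psi f x)^2) <= B*(LBINT p. (f p)^2)" using chart_ellipticity[OF c K(1,2)] by auto
 obtain C where C: "C >= 0" "!!phi. phi : TF ==> energy (%x. phi x*?b x) (%x. phi x*?b x) <= 2*energy phi phi + 2*C*(LINT x|mu. (phi x)^2)"
  using energy_cutoff[OF bt b] by blast
 have "EX q. finite_rank mu q & (ALL phi:TF.
   (LINT y|mu. indicator N y*(phi y)^2) <= e*(energy phi phi + C*(LINT y|mu. (phi y)^2)) + q phi)" if e: "e > 0" for e
 proof -
  \<comment> \<open>Chosen so that \<open>B * delta * (2 / m) = e\<close>.\<close>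
  define delta where "delta = e*m / (2*B)"
  have delta: "delta > 0" using e m by (simp add: delta_def)
  obtain q0 where q0: "finite_rank lborel q0" "!!f. f : test_fun UNIV ==> (!!p. norm p > R ==> f p = 0) ==>
   (LBINT p. (f p)^2) <= delta*(LBINT p. (SS i. (pd i f p)^2)) + q0 (f :: real^'n => real)" using rellich[OF delta, of R] by blast
  obtain g M where g: "!!i. i < (M :: nat) ==> g i : L2 lborel" "!!u. q0 u = (\<Sum>i<M. (L2_inner lborel (g i) u)^2)"
   using q0(1) unfolding finite_rank_def by blast
  have "ALL i. EX g'. i < M --> g' : L2 mu & (ALL u : borel_measurable borel. L2_inner lborel (g i) (%p. c p*u (psi p)) = L2_inner mu g' u)"
   using inner_push[OF c t g(1)] by blast
  then obtain g' where g': "!!i. i < M ==> g' i : L2 mu"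
   "!!i u. i < M ==> u : borel_measurable borel ==> L2_inner lborel (g i) (%p. c p*u (psi p)) = L2_inner mu (g' i) u" unfolding choice_iff by blast
  define q where "q u = B*(\<Sum>i<M. (L2_inner mu (g' i) u)^2)" for u
  have "finite_rank mu q" unfolding q_def by (intro finite_rank_cmult finite_rank_sum finite_rank_single g'(1)) (use m in auto)
  moreover have "(LINT y|mu. indicator N y*(phi y)^2) <= e*(energy phi phi + C*(LINT y|mu. (phi y)^2)) + q phi"
   if phi: "phi : TF" for phi
  proof -
   let ?f = "%p. c p*phi (psi p)"
   have f: "?f : test_fun W" by (rule tf_mult[OF t smooth_mapD'[OF TF_smooth[OF phi] c] W])
   have pf: "push W psi ?f = (%x. phi x*?b x)" by (intro ext) (auto simp: push_def f_inv_into_f)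
   have t2: "(%x. phi x*?b x) : TF" by (rule TF_mult[OF bt TF_smooth[OF phi]])
   have f0: "?f p = 0" if "p ~: K" for p using K(3)[OF that] by simp
   have fR: "?f p = 0" if "norm p > R" for p using K(3)[of p] R[of p] that by force
   note E = mB[OF f f0, unfolded pf]
   have "integrable mu (%y. indicator N y *R (phi y)^2)" using N(1) test_square_integrable[OF phi] by (intro integrable_mult_indicator) auto
   hence "(LINT y|mu. indicator N y*(phi y)^2) <= (LINT y|mu. (phi y*?b y)^2)"
    using N(3) by (intro integral_mono test_square_integrable[OF t2]) (auto simp: indicator_def)
   also have "... <= B*(LBINT p. (?f p)^2)" using E by simp
   also have "... <= B*(delta*(LBINT p. (SS i. (pd i ?f p)^2)) + q0 ?f)" by (intro mult_left_mono q0(2)[OF tf_UNIV[OF f] fR]) (use m in auto)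
   also have "... <= B*(delta*((2*energy phi phi + 2*C*(LINT x|mu. (phi x)^2)) / m) + q0 ?f)"
   proof -
    have "(LBINT p. (SS i. (pd i ?f p)^2)) <= (2*energy phi phi + 2*C*(LINT x|mu. (phi x)^2)) / m"
     using E C(2)[OF phi] m(1) by (simp add: pos_le_divide_eq mult.commute)
    thus ?thesis using m(2) delta by (intro mult_left_mono add_right_mono) auto
   qed
   also have "... = e*(energy phi phi + C*(LINT y|mu. (phi y)^2)) + B*q0 ?f" using m by (simp add: delta_def field_simps)
   also have "B*q0 ?f = q phi" unfolding g(2) q_def using g'(2)[OF _ TF_measurable[OF phi]] by simp
   finally show ?thesis .
  qed
  ultimately show ?thesis by blast
 qed
 thus ?thesis using N(1,2) C(1) by (intro exI[of _ N] exI[of _ C]) blast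
qed

lemma L_outside:
 assumes u: "smooth_map A u" and K: "closed K" "!!x. x ~: K ==> u x = 0" and x: "x ~: K"
 shows "L u x = 0"
proof -
 obtain W psi where c: "(W, psi) : A" "x : psi ` W" by (rule chart_at)
 then obtain p where p: "p : W" "x = psi p" by blast
 let ?S = "{q : W. psi q : - K}"
 have S: "open ?S" "p : ?S" using open_chart_preimage[OF c(1), of "- K"] K(1) p x by auto
 have "weight (F o psi) q*flux (F o psi) (u o psi) i q = 0" if "q : ?S" for i q
  using chart_coord_outside[OF c(1) K, where p = q] that by (simp add: flux_def)
 hence "pd i (%q. weight (F o psi) q*flux (F o psi) (u o psi) i q) p = pd i (%q. 0) p" for i by (rule pd_cong_open[OF S])
 thus ?thesis by (simp add: p(2) drift_chart[OF c(1) p(1) u] drift_coord_def pd_const)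
qed

section \<open>Regularity of weak solutions on the manifold\<close>

lemma AE_chart:
 assumes c: "(W, psi) : A" and S: "S : sets borel" "S <= psi ` W" and ae: "AE p in lborel. p : W --> psi p ~: S"
 shows "AE x in mu. x ~: S"
proof -
 let ?g = "indicator S :: 'm => real"
 have g: "?g : borel_measurable borel" "!!x. x ~: psi ` W ==> ?g x = 0" using S by (auto simp: indicator_def)
 note i = integral_chart[OF c g]
 have z: "AE p in lborel. pull W psi ?g p = 0" using ae by eventually_elim (auto simp: pull_def indicator_def)
 have "integrable lborel (pull W psi ?g)" using integrable_cong_AE[of "pull W psi ?g" lborel "%_. 0 :: real"] z i(3) by simp
 hence "integrable mu ?g" using i(1) by simp
 moreover have "(LINT x|mu. ?g x) = 0" by (rule trans[OF i(2) integral_eq_zero_AE[OF z]])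
 ultimately have "AE x in mu. ?g x = 0" by (subst integral_nonneg_eq_0_iff_AE[symmetric]) auto
 thus ?thesis by eventually_elim (auto simp: indicator_def)
qed

lemma continuous_test_zero:
 assumes D: "continuous_on UNIV D" and 0: "!!phi. phi : TF ==> (LINT x|mu. D x*phi x) = 0"
 shows "D x = 0"
proof -
 obtain W psi where c: "(W, psi) : A" "x : psi ` W" by (rule chart_at)
 then obtain p where p: "p : W" "x = psi p" by blast
 interpret c: immersed_patch W "F o psi" by (rule patch[OF c(1)])
 have "weight (F o psi) p*D (psi p) = 0"
 proof (rule continuous_test_fun_zero[OF c.W, where D = "%p. weight (F o psi) p*D (psi p)" and p = p])
  show "continuous_on W (%p. weight (F o psi) p*D (psi p))"
   by (intro continuous_intros smooth_continuous c.weight_smooth continuous_on_compose2[OF D chart_continuous[OF c(1)]]) simp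
  fix f assume f: "f : test_fun W"
  have pl: "pull W psi (%x. D x*push W psi f x) = (%p. weight (F o psi) p*D (psi p)*f p)"
   using tf_outside[OF f] by (intro ext) (auto simp: pull_def push_chart[OF c(1)] indicator_def)
  have m: "(%x. D x*push W psi f x) : borel_measurable borel"
   by (intro borel_measurable_continuous_onI continuous_intros D smooth_map_continuous push_smooth c f)
  show "(LBINT p. weight (F o psi) p*D (psi p)*f p) = 0"
   using integral_chart(2)[OF c(1) m] 0[OF push_test[OF c(1) f]] unfolding pl by (simp add: push_def)
 qed (rule p)
 thus ?thesis using c.weight_pos[OF p(1)] p(2) by simp
qed

text \<open>A bump supported in \<open>U\<close> would vanish almost everywhere, hence be
  annihilated by all test functions and, being continuous, be 0.\<close>

lemma open_not_null:
 assumes U: "open U" and ae: "AE x in mu. x ~: U"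
 shows "U = {}"
proof (rule ccontr)
 assume "U ~= {}"
 then obtain x where x: "x : U" by blast
 show False
 proof (rule bump_exists[OF U x])
  fix W psi f N
  assume c: "(W, psi) : A" "f : test_fun W" and N: "x : N" "!!y. y : N ==> push W psi f y = 1" "!!y. y ~: U ==> push W psi f y = 0"
  have "(LINT y|mu. push W psi f y*phi y) = 0" for phi by (rule integral_eq_zero_AE) (use ae in "eventually_elim, simp add: N(3)")
  hence "push W psi f x = 0" by (rule continuous_test_zero[OF smooth_map_continuous[OF push_smooth[OF c]]])
  thus False using N(2)[OF N(1)] by simp
 qed
qed

text \<open>In coordinates the weight times the drifted Laplacian is a divergence form operator with
  coefficients \<open>a\<close>, the weight times the inverse metric; so \<open>h o psi\<close>, cut
  off outside \<open>W\<close>, satisfies \<open>local_equation\<close> with \<open>b\<close> equal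
  to \<open>k\<close> times the weight.\<close>

lemma weak_solution_local:
 assumes c: "(W, psi) : A" and p: "p : W" and h: "h : L2 mu"
  and weak: "!!phi. phi : TF ==> (LINT x|mu. h x*(L phi x - k*phi x)) = 0"
 shows "EX r>0. EX f. ball p r <= W & smooth_on f UNIV & (AE q in lborel. q : ball p r --> h (psi q) = f q)"
proof -
 interpret c: immersed_patch W "F o psi" by (rule patch[OF c])
 let ?w = "weight (F o psi)"
 define a where "a i j q = ?w q * c.ginv q$i$j" for i j q
 have as: "smooth_on (a i j) W" for i j unfolding a_def[abs_def] by (rule smooth_mult[OF c.W c.weight_smooth c.ginv_smooth])
 define u where "u q = indicator W q*h (psi q)" for q
 have hm[measurable]: "h : borel_measurable borel" using L2_measurable[OF h] by (simp cong: measurable_cong_sets)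
 have um: "u : borel_measurable borel"
 proof -
  have "(%q. h (psi q)) : borel_measurable (restrict_space borel W)" using measurable_compose[OF chart_measurable(2)[OF c] hm] .
  thus ?thesis using borel_measurable_restrict_space_iff[of W borel "%q. h (psi q)"] c.W by (simp add: u_def[abs_def])
 qed
 \<comment> \<open>The weight is bounded below on \<open>K\<close>, so square integrability passes
   from the weighted measure to Lebesgue measure.\<close>
 have uL2: "(%x. indicator K x*u x) : L2 lborel" if K: "compact K" "K <= W" for K
 proof -
  let ?K = "psi ` K"
  have cK: "compact ?K" by (rule compact_continuous_image[OF continuous_on_subset[OF chart_continuous[OF c] K(2)] K(1)])
  have iw: "continuous_on K (%q. 1 / ?w q)"
   using c.weight_pos K(2) by (intro continuous_intros continuous_on_subset[OF smooth_continuous[OF c.weight_smooth] K(2)]) force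
  have "bounded ((%q. 1 / ?w q) ` K)" by (intro compact_imp_bounded compact_continuous_image iw K)
  then obtain B where "!!q. q : K ==> norm (1 / ?w q) <= B" by (auto simp: bounded_iff)
  hence B: "1 <= B*?w q" if "q : K" for q using that K(2) c.weight_pos[of q] by (force simp: divide_le_eq)
  let ?g = "%x. indicator ?K x*(h x)^2"
  have Kb[measurable]: "?K : sets borel" "K : sets borel" using cK K by (simp_all add: borel_closed compact_imp_closed)
  have gi: "integrable mu ?g" using integrable_mult_indicator[of ?K mu "%x. (h x)^2"] h Kb by (simp add: L2_def)
  have "integrable lborel (pull W psi ?g)" using integral_chart(1)[OF c, of ?g] gi K(2) by (simp add: indicator_def image_iff) blast
  hence "integrable lborel (%q. B*pull W psi ?g q)" by simp
  hence "integrable lborel (%x. (indicator K x*u x)^2)"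
  proof (rule Lint_bound)
   show "(%x. (indicator K x*u x)^2) : borel_measurable lborel" using um by measurable
   show "AE x in lborel. norm ((indicator K x*u x)^2) <= norm (B*pull W psi ?g x)"
   proof (rule AE_I2)
    fix x
    show "norm ((indicator K x*u x)^2) <= norm (B*pull W psi ?g x)"
    proof (cases "x : K")
     case True
     have "(h (psi x))^2 <= B*?w x*(h (psi x))^2" using mult_right_mono[OF B[OF True], of "(h (psi x))^2"] by simp
     thus ?thesis using True K(2) by (auto simp: u_def pull_def mult_ac intro: order_trans)
    qed simp
   qed
  qed
  thus ?thesis using um by (simp add: L2_def)
 qed
 have ui: "integrable lborel (%q. u q*t q)" if t: "t : test_fun W" for t
 proof -
  obtain K where K: "compact K" "K <= W" "!!p. p ~: K ==> t p = 0" using t unfolding test_fun_def by blast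
  have "integrable lborel (%q. (indicator K q*u q)*t q)" by (rule L2_mult_integrable[OF uL2[OF K(1,2)] tf_L2[OF t]])
  moreover have "(%q. (indicator K q*u q)*t q) = (%q. u q*t q)" using K(3) by (intro ext) (auto simp: indicator_def)
  ultimately show ?thesis by simp
 qed
 have at: "(%q. a i j q*pd j phi q) : test_fun W" if "phi : test_fun W" for i j phi by (rule tf_mult'[OF tf_pd[OF that] as c.W])
 interpret e: local_equation W a "%q. k*?w q" u
 proof
  show "open W" by (rule c.W)
  show "smooth_on (a i j) W" for i j by (rule as)
  show "smooth_on (%q. k*?w q) W" by (intro smooth_mult smooth_const c.W c.weight_smooth)
  show "u : borel_measurable borel" by (rule um)
  show "(%x. indicator K x*u x) : L2 lborel" if "compact K" "K <= W" for K by (rule uL2[OF that])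
  show "0 < (SS i j. a i j x*(xi$i * xi$j))" if "x : W" "xi ~= 0" for x xi
  proof -
   have "(SS i j. a i j x*(xi$i * xi$j)) = ?w x*(xi \<bullet> (c.ginv x *v xi))"
    by (simp add: a_def inner_vec_def matrix_vector_mult_def sum_distrib_left mult_ac)
   thus ?thesis using that c.weight_pos[of x] c.ginv_pos[of x xi] by auto
  qed
  fix phi assume f: "phi : test_fun W"
  have fW: "smooth_on phi W" by (rule smooth_subset[OF tf_smooth[OF f]]) (auto simp: c.W)
  let ?P = "push W psi phi"
  have Lp: "?w q*L ?P (psi q) = (SS i j. pd i (%x. a i j x*pd j phi x) q)" if q: "q : W" for q
  proof -
   have fl: "?w x*flux (F o psi) (?P o psi) i x = (SS j. a i j x*pd j phi x)" if "x : W" for i x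
    unfolding flux_def using pd_cong_open[OF c.W that, of "?P o psi" phi] push_chart[OF c] by (simp add: a_def sum_distrib_left mult_ac)
   have "?w q*L ?P (psi q) = (SS i. pd i (%x. ?w x*flux (F o psi) (?P o psi) i x) q)"
    using c.weight_pos[OF q] by (simp add: drift_chart[OF c q push_smooth[OF c f]] drift_coord_def)
   also have "... = (SS i. pd i (%x. SS j. a i j x*pd j phi x) q)" by (intro sum.cong refl pd_cong_open[OF c.W q] fl)
   also have "... = (SS i j. pd i (%x. a i j x*pd j phi x) q)" by (intro sum.cong refl pd_sum tf_diff[OF at[OF f]])
   finally show ?thesis .
  qed
  have wt: "(%x. (k*?w x)*phi x) : test_fun W" by (rule tf_mult'[OF f _ c.W]) (intro smooth_mult smooth_const c.W c.weight_smooth)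
  have m: "(%x. h x*(L ?P x - k*?P x)) : borel_measurable borel"
   by (intro borel_measurable_times hm borel_measurable_continuous_onI continuous_intros smooth_map_continuous L_smooth push_smooth[OF c f])
  have out: "h x*(L ?P x - k*?P x) = 0" if "x ~: psi ` W" for x
  proof -
   obtain K where K: "compact K" "K <= psi ` W" "!!x. x ~: K ==> ?P x = 0" using push_support[OF c f] by blast
   have "L ?P x = 0" using L_outside[OF push_smooth[OF c f] compact_imp_closed[OF K(1)] K(3)] K(2) that by blast
   thus ?thesis using that by (simp add: push_def)
  qed
  have "pull W psi (%x. h x*(L ?P x - k*?P x)) q = (SS i j. u q*pd i (%x. a i j x*pd j phi x) q) - u q*((k*?w q)*phi q)" for q
  proof (cases "q : W")
   case True
   have "pull W psi (%x. h x*(L ?P x - k*?P x)) q = h (psi q)*(?w q*L ?P (psi q)) - h (psi q)*((k*?w q)*phi q)"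
    using True by (simp add: pull_def push_chart[OF c] algebra_simps)
   thus ?thesis using True by (simp add: Lp u_def sum_distrib_left)
  qed (simp add: pull_def u_def)
  hence "0 = (LBINT q. (SS i j. u q*pd i (%x. a i j x*pd j phi x) q) - u q*((k*?w q)*phi q))"
   using weak[OF push_test[OF c f]] integral_chart(2)[OF c m out] by simp
  also have "... = (SS i j. L2_inner lborel u (pd i (%x. a i j x*pd j phi x))) - L2_inner lborel u (%x. (k*?w x)*phi x)"
   unfolding L2_inner_def by (subst LINT_diff) (simp_all only: LINT_sum Lint_sum ui[OF tf_pd[OF at[OF f]]] ui[OF wt])
  finally show "(SS i j. L2_inner lborel u (pd i (%x. a i j x*pd j phi x))) = L2_inner lborel u (%x. (k*?w x)*phi x)" by simp
 qed
 obtain r f where r: "r > 0" "ball p r <= W" "smooth_on f UNIV" "AE q in lborel. q : ball p r --> u q = f q" using e.local_regularity[OF p] by blast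
 have "AE q in lborel. q : ball p r --> h (psi q) = f q" using r(4) by eventually_elim (use r(2) in "auto simp: u_def")
 thus ?thesis using r by blast
qed

text \<open>Local smooth representatives agree on overlaps, since they are continuous and almost
  everywhere equal to \<open>h\<close>, while nonempty open sets are not null. So the representative
  around \<open>y\<close>, evaluated at \<open>y\<close>, defines \<open>u\<close>; a countable
  subcover collects the exceptional sets into one null set.\<close>

theorem weak_solution_smooth:
 assumes h: "h : L2 mu" and weak: "!!phi. phi : TF ==> (LINT x|mu. h x*(L phi x - k*phi x)) = 0"
 shows "EX u. smooth_map A u & (AE x in mu. h x = u x)"
proof -
 define good where "good N v \<longleftrightarrow> open N & continuous_on N v & (AE y in mu. y : N --> h y = v y) &
  (ALL V eta. (V, eta) : A --> smooth_on (%q. v (eta q)) {q : V. eta q : N})" for N and v :: "'m => real"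
 have hm[measurable]: "h : borel_measurable borel" using L2_measurable[OF h] by (simp cong: measurable_cong_sets)
 have "EX N v. x : N & good N v" for x
 proof -
  obtain W psi where c: "(W, psi) : A" "x : psi ` W" by (rule chart_at)
  then obtain p where p: "p : W" "x = psi p" by blast
  obtain r f where r: "r > 0" "ball p r <= W" "smooth_on f UNIV" "AE q in lborel. q : ball p r --> h (psi q) = f q"
   using weak_solution_local[OF c(1) p(1) h weak] by blast
  let ?N = "psi ` ball p r" and ?v = "push W psi f"
  have N: "open ?N" "?N <= psi ` W" using open_chart_image[OF c(1) open_ball r(2)] r(2) by auto
  have fc: "continuous_on UNIV f" by (rule smooth_continuous[OF r(3)])
  have vm[measurable]: "?v : borel_measurable borel" by (rule push_borel[OF c(1) borel_measurable_continuous_onI[OF fc]])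
  have "continuous_on (psi ` W) (%y. f (inv_into W psi y))" by (rule continuous_on_compose2[OF fc chart_inv_continuous[OF c(1)]]) simp
  hence "continuous_on ?N (%y. f (inv_into W psi y))" by (rule continuous_on_subset[OF _ N(2)])
  hence 1: "continuous_on ?N ?v" by (rule continuous_on_eq) (use N(2) in "auto simp: push_def")
  let ?S = "?N \<inter> {y. h y ~= ?v y}"
  have S: "?S : sets borel"
  proof (rule sets.Int)
   show "?N : sets borel" using N(1) by simp
   show "{y. h y ~= ?v y} : sets borel" by measurable
  qed
  have "AE y in mu. y ~: ?S"
  proof (rule AE_chart[OF c(1) S])
   show "?S <= psi ` W" using N(2) by blast
   show "AE q in lborel. q : W --> psi q ~: ?S" using r(4)
   proof eventually_elim
    case (elim q)
    show ?case
    proof (intro impI notI)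
     assume q: "q : W" "psi q : ?S"
     hence "q : ball p r" using inj_onD[OF chart_inj[OF c(1)]] r(2) by blast
     thus False using elim q push_chart[OF c(1) q(1), of f] by auto
    qed
   qed
  qed
  hence 2: "AE y in mu. y : ?N --> h y = ?v y" by eventually_elim auto
  have 3: "smooth_on (%q. ?v (eta q)) {q : V. eta q : ?N}" if d: "(V, eta) : A" for V eta
  proof -
   note t = transition[OF d c(1)]
   have o: "open {q : V. eta q : ?N}" by (rule open_chart_preimage[OF d N(1)])
   have "smooth_on (%q. f ((inv_into W psi o eta) q)) {q : V. eta q : ?N}"
    by (rule smooth_compose[OF o open_UNIV smooth_subset[OF t(2) _ t(1) o] r(3)]) (use N(2) in auto)
   thus ?thesis by (subst smooth_cong[OF o, of _ "%q. f ((inv_into W psi o eta) q)"]) (use N(2) in "auto simp: push_def")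
  qed
  have "x : ?N" using p r(1) by auto
  moreover have "good ?N ?v" unfolding good_def using N(1) 1 2 3 by blast
  ultimately show ?thesis by blast
 qed
 then obtain N v where x: "!!x. x : N x" and good: "!!x. good (N x) (v x)" by metis
 have No: "open (N x)" and vc: "continuous_on (N x) (v x)" and vh: "AE y in mu. y : N x --> h y = v x y" for x
  using good[of x] unfolding good_def by blast+
 have eq: "v y y = v z y" if yz: "y : N z" for y z
 proof (rule ccontr)
  assume ne: "v y y ~= v z y"
  let ?I = "N y \<inter> N z"
  let ?U = "{w : ?I. v y w - v z w : - {0}}"
  have "continuous_on ?I (%w. v y w - v z w)" by (intro continuous_intros continuous_on_subset[OF vc]) auto
  hence "open (?I \<inter> (%w. v y w - v z w) -` (- {0}))" by (rule continuous_open_preimage) (auto intro: No)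
  moreover have "?I \<inter> (%w. v y w - v z w) -` (- {0}) = ?U" by auto
  ultimately have U: "open ?U" by simp
  have "AE w in mu. w ~: ?U" using vh[of y] vh[of z] by eventually_elim auto
  thus False using open_not_null[OF U] x[of y] yz ne by auto
 qed
 define u where "u y = v y y" for y
 have "smooth_map A u"
 proof (rule smooth_mapI)
  fix V eta assume d: "(V, eta) : A"
  show "smooth_on (%q. u (eta q)) V"
  proof (rule smooth_local[OF chart_open[OF d]])
   fix q assume q: "q : V"
   let ?O = "{p : V. eta p : N (eta q)}"
   have o: "open ?O" by (rule open_chart_preimage[OF d No])
   have "smooth_on (%p. v (eta q) (eta p)) ?O" using good[of "eta q"] d unfolding good_def by blast
   hence "smooth_on (%p. u (eta p)) ?O" by (subst smooth_cong[OF o, of _ "%p. v (eta q) (eta p)"]) (auto simp: u_def eq)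
   thus "EX M. open M & q : M & smooth_on (%q. u (eta q)) M" using o q x[of "eta q"] by blast
  qed
 qed
 moreover have "AE y in mu. h y = u y"
 proof -
  obtain \<N> where \<N>: "\<N> <= range N" "countable \<N>" "\<Union>\<N> = \<Union>(range N)" by (rule Lindelof[of "range N"]) (use No in auto)
  have "AE y in mu. ALL M:\<N>. y : M --> h y = u y"
  proof (subst AE_ball_countable[OF \<N>(2)], intro ballI)
   fix M assume "M : \<N>"
   then obtain z where z: "M = N z" using \<N>(1) by blast
   show "AE y in mu. y : M --> h y = u y" using vh[of z] by eventually_elim (auto simp: z u_def eq)
  qed
  thus ?thesis by eventually_elim (use \<N>(3) x in blast)
 qed
 ultimately show ?thesis by blast
qed

end

section \<open>Proper self-expanders\<close>

lemma smooth_step_derivative: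
 "EX s'. (ALL t. (smooth_step has_field_derivative s' t) (at t)) & continuous_on UNIV s' & (ALL t>1. s' t = 0)"
proof -
 define s' where "s' t = FD smooth_step t 1" for t
 have d: "(smooth_step has_field_derivative s' t) (at t)" for t
 proof -
  have D: "(smooth_step has_derivative FD smooth_step t) (at t)" by (rule smooth_has_derivative[OF smooth_smooth_step]) auto
  have "FD smooth_step t h = h * s' t" for h using linear_cmul[OF has_derivative_linear[OF D], of h 1] by (simp add: s'_def)
  hence "FD smooth_step t = (*) (s' t)" by (intro ext) (simp only: mult.commute)
  thus ?thesis using D by (simp add: has_field_derivative_def)
 qed
 moreover have "continuous_on UNIV s'" unfolding s'_def by (rule smooth_continuous[OF smooth_frechet_derivative[OF smooth_smooth_step]])
 moreover have "s' t = 0" if "t > 1" for t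
 proof -
  have "(smooth_step has_field_derivative 0) (at t)"
   by (rule has_field_derivative_transform_within_open[of "%_. 1" 0 t "{1<..}"]) (use that in "auto simp: smooth_step_1")
  thus ?thesis using DERIV_unique[OF d] by blast
 qed
 ultimately show ?thesis by blast
qed

context immersed_manifold
begin

lemma grad_compose:
 assumes u: "smooth_map A u" and s: "(s has_field_derivative d) (at (u x))" and su: "smooth_map A (%x. s (u x))"
 shows "grad A F (%x. s (u x)) x = d *R grad A F u x"
proof -
 obtain W psi where c: "(W, psi) : A" "x : psi ` W" by (rule chart_at)
 then obtain p where p: "p : W" "x = psi p" by blast
 have "((%q. s ((u o psi) q)) has_derivative (%h. FD (u o psi) p h*d)) (at p)"
  by (rule DERIV_compose_FDERIV[OF _ smooth_map_differentiable[OF u c(1) p(1), unfolded frechet_derivative_works]]) (use s p(2) in simp)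
 hence "pd i ((%x. s (u x)) o psi) p = d*pd i (u o psi) p" for i using pd_eq by (fastforce simp: o_def pd_def)
 thus ?thesis unfolding p(2) grad_chart[OF c(1) p(1) u] grad_chart[OF c(1) p(1) su] by (simp add: grad_coord_def scaleR_sum_right mult_ac)
qed

lemma grad_const: "grad A F (%x. c :: real) x = 0"
proof -
 obtain W psi where c: "(W, psi) : A" "x : psi ` W" by (rule chart_at)
 then obtain p where p: "p : W" "x = psi p" by blast
 show ?thesis unfolding p(2) grad_chart[OF c(1) p(1) smooth_map_const] by (simp add: grad_coord_def o_def pd_const)
qed

lemma F_sq_smooth: "smooth_map A (%x. (norm (F x))^2)"
proof (rule smooth_mapI)
 fix W psi assume c: "(W, psi) : A"
 interpret c: immersed_patch W "F o psi" by (rule patch[OF c])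
 show "smooth_on (%p. (norm (F (psi p)))^2) W" using smooth_inner[OF c.W c.X c.X] by (simp add: power2_norm_eq_inner o_def)
qed

text \<open>The gradient \<open>v\<close> of \<open>|F|^2\<close> is twice the tangential part of
  \<open>F\<close>; it satisfies \<open>|v|^2 = 2 (F, v)\<close>.\<close>

lemma norm_grad_F_sq: "norm (grad A F (%x. (norm (F x))^2) x) <= 2*norm (F x)"
proof -
 obtain W psi where c: "(W, psi) : A" "x : psi ` W" by (rule chart_at)
 then obtain p where p: "p : W" "x = psi p" by blast
 interpret c: immersed_patch W "F o psi" by (rule patch[OF c(1)])
 let ?X = "F o psi" and ?f = "(%x. (norm (F x))^2) o psi"
 let ?v = "grad_coord ?X ?f p"
 have fd: "?f differentiable (at p)" by (rule smooth_map_differentiable[OF F_sq_smooth c(1) p(1)])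
 have "((%q. ?X q \<bullet> ?X q) has_derivative (%h. ?X p \<bullet> FD ?X p h + FD ?X p h \<bullet> ?X p)) (at p)"
  by (intro has_derivative_inner) (use c.X_differentiable[OF p(1)] in "simp_all add: frechet_derivative_works o_def")
 hence "(?f has_derivative (%h. 2*(?X p \<bullet> FD ?X p h))) (at p)" by (simp add: o_def power2_norm_eq_inner inner_commute)
 from frechet_derivative_at[OF this]
 have D: "FD ?f p xi = 2*(?X p \<bullet> FD ?X p xi)" for xi by metis
 have "?v \<bullet> ?v = 2*(?X p \<bullet> ?v)" using c.grad_coord_inner[OF p(1) fd, of "\<chi> i. flux ?X ?f i p"] D[of "\<chi> i. flux ?X ?f i p"]
  unfolding c.grad_coord_derivative[OF p(1), of ?f, symmetric] by simp
 moreover have "?v \<bullet> ?v = norm ?v * norm ?v" by (simp only: dot_square_norm power2_eq_square)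
 ultimately have "norm ?v * norm ?v <= 2*norm (?X p)*norm ?v" using norm_cauchy_schwarz[of "?X p" ?v] unfolding mult.assoc by linarith
 hence "norm ?v <= 2*norm (?X p)" by (cases "norm ?v = 0") auto
 thus ?thesis unfolding p(2) grad_chart[OF c(1) p(1) F_sq_smooth] by simp
qed

end

locale proper_expander = immersed_manifold A F
 for A :: "('n::finite, 'm::{t2_space, second_countable_topology}) param set" and F :: "'m => 'e::euclidean_space" +
 assumes expander: "self_expander A F" and proper: "proper_map_into F"
begin

lemma L_F_sq: "L (%x. (norm (F x))^2) x = 2*CARD('n) + (norm (F x))^2"
proof -
 obtain W psi where c: "(W, psi) : A" "x : psi ` W" by (rule chart_at)
 then obtain p where p: "p : W" "x = psi p" by blast
 interpret c: immersed_patch W "F o psi" by (rule patch[OF c(1)])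
 have "is_mean_curvature (F o psi) W p ((1/2) *R normal_part (F o psi) p ((F o psi) p))"
  using expander c(1) p(1) unfolding self_expander_def by fastforce
 from c.drift_coord_norm_sq[OF p(1) this]
 show ?thesis unfolding p(2) drift_chart[OF c(1) p(1) F_sq_smooth] by (simp add: o_def)
qed

text \<open>Testing \<open>L |x|^2 = 2 n + |x|^2\<close> with \<open>phi^2\<close> shows that functions of bounded
 energy carry little mass at infinity.\<close>

lemma tail_estimate:
 assumes phi: "phi : TF"
 shows "(LINT x|mu. (norm (F x))^2*(phi x)^2) <= 16*energy phi phi"
proof -
 let ?F2 = "%x. (norm (F x))^2"
 note s = TF_smooth[OF phi]
 have t: "(%x. phi x*phi x) : TF" by (rule TF_mult[OF phi s])
 have iF: "integrable mu (%x. ?F2 x*(phi x)^2)"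
  using test_mult_integrable[OF t smooth_map_continuous[OF F_sq_smooth]] by (simp add: power2_eq_square mult_ac)
 have iE: "integrable mu (%x. grad A F phi x \<bullet> grad A F phi x)" by (rule grad_test_integrable[OF phi s])
 have "(LINT x|mu. ?F2 x*(phi x)^2) <= (LINT x|mu. (phi x*phi x)*L ?F2 x)"
 proof (rule integral_mono[OF iF])
  show "integrable mu (%x. (phi x*phi x)*L ?F2 x)" by (rule test_mult_integrable[OF t smooth_map_continuous[OF L_smooth[OF F_sq_smooth]]])
  show "?F2 x*(phi x)^2 <= (phi x*phi x)*L ?F2 x" for x
  proof -
   have "(phi x*phi x)*L ?F2 x = 2*CARD('n)*(phi x)^2 + ?F2 x*(phi x)^2" unfolding L_F_sq by (simp add: power2_eq_square algebra_simps)
   thus ?thesis by simp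
  qed
 qed
 also have "... = (LINT x|mu. - (grad A F (%x. phi x*phi x) x \<bullet> grad A F ?F2 x))"
  unfolding integration_by_parts[OF t F_sq_smooth] energy_def by simp
 also have "... <= (LINT x|mu. 1/2*(?F2 x*(phi x)^2) + 8*(grad A F phi x \<bullet> grad A F phi x))"
 proof (rule integral_mono)
  show "integrable mu (%x. - (grad A F (%x. phi x*phi x) x \<bullet> grad A F ?F2 x))" using grad_test_integrable[OF t F_sq_smooth] by simp
  show "integrable mu (%x. 1/2*(?F2 x*(phi x)^2) + 8*(grad A F phi x \<bullet> grad A F phi x))" using iF iE by (intro Lint_add) simp_all
  fix x
  let ?g = "norm (grad A F phi x)"
  have "- (grad A F (%x. phi x*phi x) x \<bullet> grad A F ?F2 x) = - (2*phi x*(grad A F phi x \<bullet> grad A F ?F2 x))"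
   by (simp add: grad_mult[OF s s] inner_add_left)
  also have "... <= abs (2*phi x)*(?g*norm (grad A F ?F2 x))"
  proof -
   have "- (2*phi x*(grad A F phi x \<bullet> grad A F ?F2 x)) <= abs (2*phi x)*abs (grad A F phi x \<bullet> grad A F ?F2 x)"
    unfolding abs_mult[symmetric] by (rule abs_ge_minus_self)
   also have "... <= abs (2*phi x)*(?g*norm (grad A F ?F2 x))" by (intro mult_left_mono Cauchy_Schwarz_ineq2) simp
   finally show ?thesis .
  qed
  also have "... <= abs (2*phi x)*(?g*(2*norm (F x)))" by (intro mult_left_mono norm_grad_F_sq) auto
  also have "... <= 1/2*(norm (F x)*abs (phi x))^2 + 8*?g^2"
   using zero_le_power2[of "norm (F x)*abs (phi x) - 4*?g"] by (simp add: power2_eq_square algebra_simps abs_mult)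
  also have "... = 1/2*(?F2 x*(phi x)^2) + 8*(grad A F phi x \<bullet> grad A F phi x)" by (simp add: power_mult_distrib power2_norm_eq_inner)
  finally show "- (grad A F (%x. phi x*phi x) x \<bullet> grad A F ?F2 x) <= 1/2*(?F2 x*(phi x)^2) + 8*(grad A F phi x \<bullet> grad A F phi x)" .
 qed
 also have "... = 1/2*(LINT x|mu. ?F2 x*(phi x)^2) + 8*energy phi phi" unfolding energy_def using iF iE by (subst LINT_add) simp_all
 finally show ?thesis by simp
qed

lemma energy_nonneg: "0 <= energy u u" unfolding energy_def by (intro LINT_nonneg) simp

lemma compactness_estimate:
 assumes e: "e > 0"
 shows "EX q. finite_rank mu q & (ALL phi:TF. (LINT x|mu. (phi x)^2) <= e*energy phi phi + q phi)"
proof -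
 \<comment> \<open>Outside the ball of this radius the mass is at most
   \<open>16 / R^2 = e / 4\<close> times the energy.\<close>
 define R where "R = 8 / sqrt e"
 have R: "R > 0" "16 / R^2 = e / 4" using e by (simp_all add: R_def power_divide)
 define K where "K = F -` cball 0 R"
 have K: "compact K" using proper unfolding proper_map_into_def K_def by simp
 define good where "good N C \<longleftrightarrow> open N & 0 <= C & (ALL e>0. EX q. finite_rank mu q & (ALL phi:TF.
  (LINT y|mu. indicator N y*(phi y)^2) <= e*(energy phi phi + C*(LINT y|mu. (phi y)^2)) + q phi))" for N and C :: real
 have "EX N C. x : N & good N C" for x using local_compactness[of x] unfolding good_def by blast
 hence cover: "EX N:{N. EX C. good N C}. x : N" for x by blast
 obtain \<N> where N: "finite \<N>" "\<N> <= {N. EX C. good N C}" "K <= \<Union>\<N>"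
  by (rule compactE[OF K, of "{N. EX C. good N C}"]) (use cover in "auto simp: good_def")
 hence "ALL N:\<N>. EX C. good N C" by blast
 then obtain C where C: "!!N. N : \<N> ==> good N (C N)" unfolding bchoice_iff by blast
 define S where "S = (\<Sum>N\<in>\<N>. C N)"
 have C0: "N : \<N> ==> C N >= 0" for N using C unfolding good_def by blast
 hence S: "S >= 0" unfolding S_def by (rule sum_nonneg)
 \<comment> \<open>Together the local estimates may cost \<open>e / 4\<close> of the energy and half
   of the mass. That half is absorbed on the left, which accounts for the factor 2 in front of the
   finite rank part.\<close>
 define d where "d = min (e / (4*(card \<N> + 1))) (1 / (2*(S + 1)))"
 have d: "d > 0" "d * card \<N> <= e / 4" "d*S <= 1/2"
 proof -
  show "d > 0" using e S by (simp add: d_def)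
  have "d * card \<N> <= e / (4*(card \<N> + 1)) * card \<N>" by (rule mult_right_mono) (simp_all add: d_def)
  also have "... <= e / 4" using e by (simp add: field_simps)
  finally show "d * card \<N> <= e / 4" .
  have "d*S <= 1 / (2*(S + 1))*S" using S by (intro mult_right_mono) (simp_all add: d_def)
  also have "... <= 1/2" using S by (simp add: field_simps)
  finally show "d*S <= 1/2" .
 qed
 have "ALL N:\<N>. EX q. finite_rank mu q & (ALL phi:TF.
  (LINT y|mu. indicator N y*(phi y)^2) <= d*(energy phi phi + C N*(LINT y|mu. (phi y)^2)) + q phi)" using C d(1) unfolding good_def by blast
 then obtain q where q: "!!N. N : \<N> ==> finite_rank mu (q N)"
  "!!N phi. N : \<N> ==> phi : TF ==>
   (LINT y|mu. indicator N y*(phi y)^2) <= d*(energy phi phi + C N*(LINT y|mu. (phi y)^2)) + q N phi" unfolding bchoice_iff by blast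
 have "(LINT x|mu. (phi x)^2) <= e*energy phi phi + 2*(\<Sum>N\<in>\<N>. q N phi)" if phi: "phi : TF" for phi
 proof -
  let ?I = "LINT x|mu. (phi x)^2" and ?E = "energy phi phi"
  note i = test_square_integrable[OF phi]
  have iF: "integrable mu (%x. (norm (F x))^2*(phi x)^2)"
   using test_mult_integrable[OF TF_mult[OF phi TF_smooth[OF phi]] smooth_map_continuous[OF F_sq_smooth]] by (simp add: power2_eq_square mult_ac)
  have iN: "integrable mu (%y. indicator N y*(phi y)^2)" if "N : \<N>" for N
   using integrable_mult_indicator[of N mu, OF _ i] C[OF that] by (simp add: good_def)
  have "?I <= (LINT x|mu. 1 / R^2*((norm (F x))^2*(phi x)^2) + (\<Sum>N\<in>\<N>. indicator N x*(phi x)^2))"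
  proof (rule integral_mono[OF i])
   show "integrable mu (%x. 1 / R^2*((norm (F x))^2*(phi x)^2) + (\<Sum>N\<in>\<N>. indicator N x*(phi x)^2))"
    using iF iN by (intro Lint_add Lint_sum integrable_mult_right) auto
   fix x
   show "(phi x)^2 <= 1 / R^2*((norm (F x))^2*(phi x)^2) + (\<Sum>N\<in>\<N>. indicator N x*(phi x)^2)"
   proof (cases "x : K")
    case True
    then obtain N0 where N0: "N0 : \<N>" "x : N0" using N(3) by blast
    have "(phi x)^2 = indicator N0 x*(phi x)^2" using N0 by simp
    also have "... <= (\<Sum>N\<in>\<N>. indicator N x*(phi x)^2)" by (rule member_le_sum[OF N0(1) _ N(1)]) simp
    finally have "(phi x)^2 <= (\<Sum>N\<in>\<N>. indicator N x*(phi x)^2)" .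
    moreover have "0 <= 1 / R^2*((norm (F x))^2*(phi x)^2)" by simp
    ultimately show ?thesis by linarith
   next
    case False
    hence "R^2 <= (norm (F x))^2" using R(1) by (intro power_mono) (auto simp: K_def)
    hence "1 <= (norm (F x))^2 / R^2" using R(1) by simp
    from mult_right_mono[OF this, of "(phi x)^2"] show ?thesis by (simp add: add_increasing2 sum_nonneg)
   qed
  qed
  also have "... = 1 / R^2*(LINT x|mu. (norm (F x))^2*(phi x)^2) + (\<Sum>N\<in>\<N>. \<integral>x. indicator N x*(phi x)^2 \<partial>mu)"
   using iF iN by (subst LINT_add) (simp_all add: LINT_sum)
  also have "... <= 1 / R^2*(16*?E) + (\<Sum>N\<in>\<N>. d*(?E + C N*?I) + q N phi)"
   by (intro add_mono mult_left_mono tail_estimate sum_mono q(2) phi) auto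
  also have "... = e / 4*?E + (d * card \<N>)*?E + (d*S)*?I + (\<Sum>N\<in>\<N>. q N phi)"
   unfolding R(2)[symmetric] by (simp add: sum.distrib S_def sum_distrib_left sum_distrib_right distrib_left mult_ac)
  also have "... <= e / 4*?E + e / 4 * ?E + 1/2 * ?I + (\<Sum>N\<in>\<N>. q N phi)"
   by (intro add_mono mult_right_mono d(2,3) energy_nonneg LINT_nonneg) auto
  finally show ?thesis by simp
 qed
 moreover have "finite_rank mu (%phi. 2*(\<Sum>N\<in>\<N>. q N phi))" by (intro finite_rank_cmult finite_rank_sum N(1) q(1)) auto
 ultimately show ?thesis by blast
qed

text \<open>Functions of \<open>|F|^2 / R^2\<close> that drop from 1 to 0 between
  \<open>|F| = R\<close> and \<open>|F| = sqrt 2 * R\<close>; the support is compact by properness.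
  The gradient is of order \<open>|F| / R^2\<close>, hence of order \<open>1 / R\<close>.\<close>

lemma cutoff_family:
 "EX C. ALL R>0. EX xi:TF. (ALL x. 0 <= xi x & xi x <= 1 & norm (grad A F xi x) <= C / R) &
  (ALL x. norm (F x) < R --> xi x = 1 & grad A F xi x = 0)"
proof -
 let ?F2 = "%x. (norm (F x))^2"
 obtain s' where s': "!!t. (smooth_step has_field_derivative s' t) (at t)" "continuous_on UNIV s'" "!!t. t > 1 ==> s' t = 0"
  using smooth_step_derivative by blast
 have "bounded (s' ` {-2..2})" by (intro compact_imp_bounded compact_continuous_image continuous_on_subset[OF s'(2)]) auto
 then obtain B where "ALL y:s' ` {-2..2}. norm y <= B" unfolding bounded_iff by blast
 hence B: "!!t. t : {-2..2} ==> abs (s' t) <= B" by auto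
 have B0: "B >= 0" using B[of 0] by force
 have "EX xi:TF. (ALL x. 0 <= xi x & xi x <= 1 & norm (grad A F xi x) <= (4*B) / R) &
  (ALL x. norm (F x) < R --> xi x = 1 & grad A F xi x = 0)" if R: "R > 0" for R
 proof -
  \<comment> \<open>Where \<open>|F| <= 2 R\<close> its values lie between -2 and 2, the interval on
    which \<open>s'\<close> is bounded by \<open>B\<close>.\<close>
  let ?u = "%x. 2 + - (1 / R^2)*?F2 x"
  define xi where "xi x = smooth_step (?u x)" for x
  have us: "smooth_map A ?u" by (intro smooth_map_add smooth_map_mult smooth_map_const F_sq_smooth)
  have xs: "smooth_map A xi" unfolding xi_def by (rule smooth_map_compose[OF smooth_smooth_step us])
  let ?K = "F -` cball 0 (2 * R)"
  have K: "compact ?K" using proper unfolding proper_map_into_def by simp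
  have out: "xi x = 0" if "x ~: ?K" for x
  proof -
   have "(2 * R)^2 <= ?F2 x" using that R by (intro power_mono) auto
   hence "4 * R^2 <= ?F2 x" by (simp add: power_mult_distrib)
   moreover have "0 < R^2" using R by simp
   ultimately have "2 * R^2 <= ?F2 x" by linarith
   hence "?u x <= 0" using R by (simp add: field_simps)
   thus ?thesis by (simp add: xi_def smooth_step_0)
  qed
  have g: "grad A F xi x = (s' (?u x) * - (1 / R^2)) *R grad A F ?F2 x" for x
  proof -
   have "grad A F ?u x = - (1 / R^2) *R grad A F ?F2 x"
    unfolding grad_add[OF smooth_map_const smooth_map_mult[OF smooth_map_const F_sq_smooth]] grad_mult[OF smooth_map_const F_sq_smooth] grad_const by simp
   thus ?thesis using grad_compose[OF us s'(1) xs[unfolded xi_def]] by (simp add: xi_def[abs_def])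
  qed
  have "norm (grad A F xi x) <= (4*B) / R" for x
  proof (cases "x : ?K")
   case True
   have F: "norm (F x) <= 2 * R" using True by simp
   have "?F2 x <= (2 * R)^2" using F by (intro power_mono) auto
   hence "?u x : {-2..2}" using R by (simp add: field_simps)
   hence "abs (s' (?u x)) <= B" by (rule B)
   hence "abs (s' (?u x))*(1 / R^2)*norm (grad A F ?F2 x) <= B*(1 / R^2)*(2*(2 * R))" using norm_grad_F_sq[of x] F B0 by (intro mult_mono) auto
   thus ?thesis using R unfolding g by (simp add: abs_mult power2_eq_square mult.commute[of B 4])
  next
   case False
   thus ?thesis using grad_outside[OF xs compact_imp_closed[OF K] out] B0 R by simp
  qed
  moreover have "xi x = 1 & grad A F xi x = 0" if "norm (F x) < R" for x
  proof -
   have "?F2 x < R^2" using that by (intro power_strict_mono) auto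
   hence "?u x > 1" using R by (simp add: field_simps)
   thus ?thesis unfolding g using s'(3) by (simp add: xi_def smooth_step_1)
  qed
  moreover have "xi : TF" unfolding TF_iff using xs K out by blast
  moreover have "0 <= xi x & xi x <= 1" for x by (simp add: xi_def smooth_step_nonneg smooth_step_le_1)
  ultimately show ?thesis by (intro bexI[of _ xi]) simp_all
 qed
 thus ?thesis by blast
qed

section \<open>Weak and classical solutions\<close>

text \<open>On the support of \<open>phi\<close> the function \<open>u\<close> may be multiplied by
  a cutoff that is 1 there with gradient 0; both factors are then test functions, and the energy is
  symmetric.\<close>

lemma integration_by_parts':
 assumes phi: "phi : TF" and u: "smooth_map A u"
 shows "(LINT x|mu. u x*L phi x) = (LINT x|mu. phi x*L u x)"
proof -
 note s = TF_smooth[OF phi]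
 obtain K where K: "compact K" "!!x. x ~: K ==> phi x = 0" using phi unfolding TF_iff by blast
 have "bounded (F ` K)" by (intro compact_imp_bounded compact_continuous_image K continuous_on_subset[OF F_continuous]) auto
 then obtain R0 where R0: "!!x. x : K ==> norm (F x) <= R0" by (auto simp: bounded_iff)
 define R where "R = abs R0 + 1"
 have R: "R > 0" "!!x. x : K ==> norm (F x) < R" using R0 unfolding R_def by force+
 obtain xi where xi: "xi : TF" "!!x. norm (F x) < R ==> xi x = 1 & grad A F xi x = 0" using cutoff_family R(1) by blast
 note xs = TF_smooth[OF xi(1)]
 have t: "(%x. u x * xi x) : TF" by (rule TF_mult[OF xi(1) u])
 note out = L_outside[OF s compact_imp_closed[OF K(1)] K(2)] grad_outside[OF s compact_imp_closed[OF K(1)] K(2)]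
 have "(LINT x|mu. u x*L phi x) = (LINT x|mu. (u x * xi x)*L phi x)"
 proof (rule LINT_cong[OF refl])
  fix x show "u x*L phi x = (u x * xi x)*L phi x" using out(1)[of x] xi(2)[OF R(2), of x] by (cases "x : K") auto
 qed
 also have "... = - energy (%x. u x * xi x) phi" by (rule integration_by_parts[OF t s])
 also have "energy (%x. u x * xi x) phi = energy u phi" unfolding energy_def
 proof (rule LINT_cong[OF refl])
  fix x show "grad A F (%x. u x * xi x) x \<bullet> grad A F phi x = grad A F u x \<bullet> grad A F phi x"
   using out(2)[of x] xi(2)[OF R(2), of x] unfolding grad_mult[OF u xs] by (cases "x : K") auto
 qed
 finally show ?thesis using integration_by_parts[OF phi u] by (simp add: energy_sym)
qed

text \<open>Integration by parts moves the operator from \<open>phi\<close> to \<open>u\<close>, and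
  a continuous function whose integrals against all test functions vanish is 0.\<close>

lemma weak_solution_classical:
 assumes u: "smooth_map A u" and weak: "!!phi. phi : TF ==> (LINT x|mu. u x*(L phi x - k*phi x)) = 0"
 shows "L u x = k*u x"
proof -
 have "L u x - k*u x = 0"
 proof (rule continuous_test_zero[where D = "%x. L u x - k*u x"])
  show "continuous_on UNIV (%x. L u x - k*u x)" by (intro continuous_intros smooth_map_continuous L_smooth u)
  fix phi assume phi: "phi : TF"
  have i: "integrable mu (%x. phi x*L u x)" "integrable mu (%x. phi x*(k*u x))"
   by (intro test_mult_integrable[OF phi] continuous_intros smooth_map_continuous L_smooth u)+
  have L: "L phi : TF" using L_smooth L_outside compact_imp_closed phi unfolding TF_iff by metis
  have i': "integrable mu (%x. u x*L phi x)" using test_mult_integrable[OF L smooth_map_continuous[OF u]] by (simp add: mult.commute)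
  have "(LINT x|mu. (L u x - k*u x)*phi x) = (LINT x|mu. phi x*L u x - phi x*(k*u x))" by (intro LINT_cong refl) (simp add: algebra_simps)
  also have "... = (LINT x|mu. u x*L phi x) - (LINT x|mu. phi x*(k*u x))" using i by (simp add: integration_by_parts'[OF phi u])
  also have "... = (LINT x|mu. u x*L phi x - phi x*(k*u x))" using i i' by simp
  also have "... = (LINT x|mu. u x*(L phi x - k*phi x))" by (intro LINT_cong refl) (simp add: algebra_simps)
  finally show "(LINT x|mu. (L u x - k*u x)*phi x) = 0" using weak[OF phi] by simp
 qed
 thus ?thesis by simp
qed

text \<open>Regularity changes \<open>h\<close> on a null set only, so the weak equation passes to
  the smooth representative, where it holds pointwise.\<close>

lemma smooth_weak_solution:
 assumes h: "h : L2 mu" and weak: "!!phi. phi : TF ==> (LINT x|mu. h x*(L phi x - k*phi x)) = 0"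
 shows "EX u. smooth_map A u & (AE x in mu. h x = u x) & u : L2 mu & (ALL x. L u x = k*u x)"
proof -
 obtain u where u: "smooth_map A u" "AE x in mu. h x = u x" using weak_solution_smooth[OF h weak] by blast
 have um: "u : borel_measurable mu" using borel_measurable_continuous_onI[OF smooth_map_continuous[OF u(1)]] by (simp cong: measurable_cong_sets)
 have uL: "u : L2 mu" by (rule L2_cong_AE[OF u(2) h um])
 have "(LINT x|mu. u x*(L phi x - k*phi x)) = 0" if phi: "phi : TF" for phi
 proof -
  have [measurable]: "(%x. L phi x - k*phi x) : borel_measurable mu" "u : borel_measurable mu" "h : borel_measurable mu"
  proof -
   have "(%x. L phi x - k*phi x) : borel_measurable borel"
    by (intro borel_measurable_continuous_onI continuous_intros smooth_map_continuous L_smooth TF_smooth[OF phi])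
   thus "(%x. L phi x - k*phi x) : borel_measurable mu" by (simp cong: measurable_cong_sets)
  qed (rule um, rule L2_measurable[OF h])
  have "(LINT x|mu. u x*(L phi x - k*phi x)) = (LINT x|mu. h x*(L phi x - k*phi x))" by (rule integral_cong_AE) (use u(2) in auto)
  thus ?thesis using weak[OF phi] by simp
 qed
 from weak_solution_classical[OF u(1) this] u uL show ?thesis by blast
qed

text \<open>Testing the equation with \<open>xi^2 * u\<close> and completing the square bounds the
  integral of \<open>xi^2 u^2\<close> by that of \<open>|grad xi|^2 u^2\<close>, which is at most
  \<open>(C / R)^2\<close> times the integral of \<open>u^2\<close> and tends to 0.\<close>

lemma solution_zero:
 assumes u: "smooth_map A u" "u : L2 mu" and Lu: "!!x. L u x = u x"
 shows "u x = 0"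
proof (rule ccontr)
 assume ne: "u x ~= 0"
 obtain C where C: "!!R. R > 0 ==> EX xi:TF. (ALL x. 0 <= xi x & xi x <= 1 & norm (grad A F xi x) <= C / R) &
  (ALL x. norm (F x) < R --> xi x = 1 & grad A F xi x = 0)" using cutoff_family by blast
 have ui: "integrable mu (%x. (u x)^2)" using u(2) by (simp add: L2_def)
 let ?I = "LINT x|mu. (u x)^2"
 define R0 where "R0 = norm (F x) + 1"
 let ?U = "{y. norm (F y) < R0 & u y ~= 0}"
 have U: "open ?U" by (intro open_Collect_conj open_Collect_less open_Collect_neq continuous_intros continuous_on_norm F_continuous smooth_map_continuous[OF u(1)])
 have iU: "integrable mu (%y. indicator ?U y*(u y)^2)" using integrable_mult_indicator[of ?U mu, OF _ ui] U by simp
 let ?J = "LINT y|mu. indicator ?U y*(u y)^2"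
 have est: "?J <= (C / R)^2*?I" if R: "R >= R0" for R
 proof -
  have R0: "R > 0" using R norm_ge_zero[of "F x"] unfolding R0_def by linarith
  obtain xi where xi: "xi : TF" "!!x. norm (grad A F xi x) <= C / R" "!!x. norm (F x) < R ==> xi x = 1" using C[OF R0] by blast
  note xs = TF_smooth[OF xi(1)]
  have v: "(%x. u x * xi x) : TF" by (rule TF_mult[OF xi(1) u(1)])
  note vs = TF_smooth[OF v]
  have t: "(%x. xi x*(u x * xi x)) : TF" by (rule TF_mult[OF v xs])
  have "?J <= (LINT y|mu. (u y * xi y)^2)" by (rule integral_mono[OF iU test_square_integrable[OF v]]) (use xi(3) R in "auto simp: indicator_def")
  also have "... = (LINT y|mu. (xi y*(u y * xi y))*L u y)" by (intro LINT_cong refl) (simp add: Lu power2_eq_square mult_ac)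
  also have "... = (LINT y|mu. - (grad A F (%x. xi x*(u x * xi x)) y \<bullet> grad A F u y))"
   unfolding integration_by_parts[OF t u(1)] energy_def by simp
  also have "... <= (LINT y|mu. (C / R)^2*(u y)^2)"
  proof (rule integral_mono)
   show "integrable mu (%y. - (grad A F (%x. xi x*(u x * xi x)) y \<bullet> grad A F u y))" using grad_test_integrable[OF t u(1)] by simp
   show "integrable mu (%y. (C / R)^2*(u y)^2)" using ui by simp
   fix y
   let ?a = "xi y *R grad A F u y" and ?b = "u y *R grad A F xi y"
   have "- (grad A F (%x. xi x*(u x * xi x)) y \<bullet> grad A F u y) = - (?a \<bullet> ?a) - 2*(?a \<bullet> ?b)"
    unfolding grad_mult[OF xs vs] grad_mult[OF u(1) xs] by (simp add: inner_add_left inner_add_right inner_commute algebra_simps)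
   \<comment> \<open>Nonnegativity of the squared norm of \<open>?a + ?b\<close>, solved for the
     terms containing \<open>?a\<close>.\<close>
   also have "... <= ?b \<bullet> ?b" using inner_ge_zero[of "?a + ?b"] inner_commute[of ?b ?a] unfolding inner_add_left inner_add_right by linarith
   also have "... = (norm (grad A F xi y))^2*(u y)^2" by (simp add: dot_square_norm power2_eq_square mult_ac)
   also have "... <= (C / R)^2*(u y)^2" by (intro mult_right_mono power_mono xi(2)) auto
   finally show "- (grad A F (%x. xi x*(u x * xi x)) y \<bullet> grad A F u y) <= (C / R)^2*(u y)^2" .
  qed
  finally show ?thesis by simp
 qed
 have "((%R. (C / R)^2*?I) \<longlongrightarrow> (0^2)*?I) at_top"
  by (intro tendsto_intros tendsto_divide_0[OF tendsto_const] filterlim_at_top_imp_at_infinity filterlim_ident)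
 hence "?J <= 0" using tendsto_lowerbound[of "%R. (C / R)^2*?I" 0 at_top ?J] est eventually_ge_at_top[of R0] by (simp add: eventually_mono)
 moreover have "?J >= 0" by (rule LINT_nonneg) simp
 ultimately have "?J = 0" by linarith
 hence "AE y in mu. indicator ?U y*(u y)^2 = 0" using integral_nonneg_eq_0_iff_AE[OF iU] by simp
 hence "AE y in mu. y ~: ?U" by eventually_elim (auto simp: indicator_def)
 hence "?U = {}" by (rule open_not_null[OF U])
 thus False using ne by (auto simp: R0_def)
qed

section \<open>The operator on test functions and its closure\<close>

lemma L_lincomb:
 assumes "smooth_map A u" "smooth_map A v"
 shows "L (%x. u x + c * v x) = (%x. L u x + c*L v x)"
proof
 fix x
 note uv = assms
 have s: "smooth_map A (%x. u x + c * v x)" by (intro smooth_map_add smooth_map_mult smooth_map_const uv)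
 obtain W psi where ch: "(W, psi) : A" "x : psi ` W" by (rule chart_at)
 then obtain p where p: "p : W" "x = psi p" by blast
 interpret c: immersed_patch W "F o psi" by (rule patch[OF ch(1)])
 let ?X = "F o psi"
 let ?f = "%u i q. weight ?X q*flux ?X (u o psi) i q"
 have fs: "smooth_on (?f w i) W" if "smooth_map A w" for w i by (intro smooth_mult c.W c.weight_smooth c.flux_smooth smooth_mapD[OF that ch(1)])
 have "flux ?X ((%x. u x + c * v x) o psi) i q = flux ?X (u o psi) i q + c*flux ?X (v o psi) i q" if q: "q : W" for i q
 proof -
  have "pd j ((%x. u x + c * v x) o psi) q = pd j (u o psi) q + c*pd j (v o psi) q" for j
  proof -
   note d = smooth_map_differentiable[OF uv(1) ch(1) q] smooth_map_differentiable[OF uv(2) ch(1) q]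
   show ?thesis using pd_add[OF d(1) differentiable_mult[OF differentiable_const d(2)]] pd_cmult[OF d(2)] by (simp add: o_def)
  qed
  thus ?thesis by (simp add: flux_def distrib_left sum.distrib sum_distrib_left mult_ac)
 qed
 hence "pd i (?f (%x. u x + c * v x) i) p = pd i (%q. ?f u i q + c*?f v i q) p" for i
  by (intro pd_cong_open[OF c.W p(1)]) (simp add: distrib_left mult_ac)
 moreover have "pd i (%q. ?f u i q + c*?f v i q) p = pd i (?f u i) p + c*pd i (?f v i) p" for i
  using smooth_differentiable[OF fs[OF uv(1)] c.W p(1), of i] smooth_differentiable[OF fs[OF uv(2)] c.W p(1), of i]
  by (subst pd_add) (auto simp: pd_cmult intro!: differentiable_mult)
 ultimately show "L (%x. u x + c * v x) x = L u x + c*L v x"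
  unfolding p(2) drift_chart[OF ch(1) p(1) s] drift_chart[OF ch(1) p(1) uv(1)] drift_chart[OF ch(1) p(1) uv(2)]
  by (simp add: drift_coord_def sum.distrib sum_distrib_left distrib_left mult_ac)
qed

abbreviation "T \<equiv> %u x. - L u x"

lemma T_inner: "phi : TF ==> v : TF ==> L2_inner mu (T phi) v = energy phi v" using integration_by_parts[of v phi] TF_smooth[of phi]
 by (simp add: L2_inner_def mult.commute energy_sym)

lemma L_test: "phi : TF ==> L phi : TF" using L_smooth L_outside compact_imp_closed unfolding TF_iff by metis

lemma T_test: "phi : TF ==> T phi : TF" using TF_mult[OF L_test smooth_map_const[of "-1"]] by simp

sublocale op: compact_symmetric_operator mu "TF" T
proof
 show "TF <= L2 mu" using TF_L2 by blast
 show "TF ~= {}"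
 proof -
  obtain W psi where "(W, psi) : A" by (rule chart_at)
  thus ?thesis using push_test[OF _ tf_zero] by blast
 qed
 show "(%x. u x + c * v x) : TF" if "u : TF" "v : TF" for u v c by (rule TF_lincomb[OF that])
 show "T u : L2 mu" if "u : TF" for u by (rule TF_L2[OF T_test[OF that]])
 show "T (%x. u x + c * v x) = (%x. T u x + c*T v x)" if "u : TF" "v : TF" for u v c by (simp add: L_lincomb[OF that[THEN TF_smooth]])
 show "L2_inner mu (T u) v = L2_inner mu u (T v)" if "u : TF" "v : TF" for u v
  using T_inner[OF that] T_inner[OF that(2,1)] by (simp add: L2_inner_commute[of mu u] energy_sym)
 show "0 <= L2_inner mu (T u) u" if "u : TF" for u unfolding T_inner[OF that that] by (rule energy_nonneg)
 show "EX (g :: nat => 'm => real) N. (ALL i<N. g i : L2 mu) &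
   (ALL u:TF. L2_inner mu u u <= e*L2_inner mu (T u) u + (\<Sum>i<N. (L2_inner mu (g i) u)^2))" if e: "e > 0" for e
 proof -
  obtain q where q: "finite_rank mu q" "!!phi. phi : TF ==> (LINT x|mu. (phi x)^2) <= e*energy phi phi + q phi"
   using compactness_estimate[OF e] by blast
  obtain g N where g: "ALL i<(N :: nat). g i : L2 mu" "!!u. q u = (\<Sum>i<N. (L2_inner mu (g i) u)^2)"
   using q(1) unfolding finite_rank_def by blast
  have "L2_inner mu u u <= e*L2_inner mu (T u) u + (\<Sum>i<N. (L2_inner mu (g i) u)^2)" if "u : TF" for u
   unfolding T_inner[OF that that] g(2)[symmetric] using q(2)[OF that] by (simp add: L2_inner_def power2_eq_square)
  with g(1) show ?thesis by blast
 qed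
 \<comment> \<open>Orthogonality to the range of \<open>T + 1\<close> says that \<open>h\<close> is
   a weak L^2 solution of \<open>L h = h\<close>.\<close>
 show "AE x in mu. h x = 0" if h: "h : L2 mu" and orth: "!!u. u : TF ==> L2_inner mu h (%x. T u x + u x) = 0" for h
 proof -
  have "(LINT x|mu. h x*(L phi x - 1*phi x)) = 0" if "phi : TF" for phi
  proof -
   have "(LINT x|mu. h x*(L phi x - 1*phi x)) = (LINT x|mu. - (h x*(T phi x + phi x)))" by (intro LINT_cong refl) (simp add: algebra_simps)
   thus ?thesis using orth[OF that] by (simp add: L2_inner_def)
  qed
  then obtain u where u: "smooth_map A u" "AE x in mu. h x = u x" "u : L2 mu" "!!x. L u x = 1*u x" using smooth_weak_solution[OF h, of 1] by blast
  have "u x = 0" for x by (rule solution_zero[OF u(1,3)]) (use u(4) in simp)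
  thus ?thesis using u(2) by simp
 qed
qed

section \<open>Discreteness and the first eigenvalue\<close>

text \<open>Since \<open>T\<close> is minus \<open>L\<close>, the eigenvalue enters
  \<open>smooth_weak_solution\<close> with the opposite sign. The smooth representative still has
  norm 1 and so is not identically 0.\<close>

lemma eigen_imp_eigenvalue:
 assumes "op.eigen kappa"
 shows "weighted_eigenvalue A F kappa"
proof -
 obtain h where h: "(h, %x. kappa*h x) : op.G" "L2_inner mu h h = 1" using assms unfolding op.eigen_def by blast
 note hL = op.G_L2(1)[OF h(1)]
 have "(LINT x|mu. h x*(L phi x - (- kappa)*phi x)) = 0" if phi: "phi : TF" for phi
 proof -
  note i = L2_mult_integrable[OF hL TF_L2[OF L_test[OF phi]]] L2_mult_integrable[OF hL TF_L2[OF phi]]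
  have "(LINT x|mu. h x*(L phi x - (- kappa)*phi x)) = (LINT x|mu. h x*L phi x + kappa*(h x*phi x))"
   by (intro LINT_cong refl) (simp add: algebra_simps)
  also have "... = (LINT x|mu. h x*L phi x) + kappa*(LINT x|mu. h x*phi x)" using i by simp
  finally show ?thesis using op.G_sym[OF h(1) op.G_D[OF phi]] by (simp add: L2_inner_def mult.assoc)
 qed
 then obtain u where u: "smooth_map A u" "AE x in mu. h x = u x" "u : L2 mu" "!!x. L u x = (- kappa)*u x"
  using smooth_weak_solution[OF hL, of "- kappa"] by blast
 have "L2_inner mu u u = 1" using L2_inner_cong_AE[OF u(2) u(2) hL hL u(3) u(3)] h(2) by simp
 have "EX x. u x ~= 0"
 proof (rule ccontr)
  assume "~ ?thesis"
  hence "!!x. u x = 0" by blast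
  thus False using \<open>L2_inner mu u u = 1\<close> by (simp add: L2_inner_def)
 qed
 moreover have "u : weighted_eigenspace A F kappa" using u by (simp add: weighted_eigenspace_def)
 ultimately show ?thesis unfolding weighted_eigenvalue_def by blast
qed

text \<open>A classical eigenfunction comes without approximating test functions; integration by
  parts makes it a weak solution, and \<open>weak_in_G\<close> then places it in the closure. This
  brings finite multiplicity and the lower bound by \<open>bottom\<close> within reach of the
  abstract theory.\<close>

lemma eigenspace_in_G:
 assumes "u : weighted_eigenspace A F kappa"
 shows "(u, %x. kappa*u x) : op.G"
proof (rule op.weak_in_G)
 have u: "smooth_map A u" "u : L2 mu" "!!x. L u x = - kappa*u x" using assms unfolding weighted_eigenspace_def by (auto simp: eq_neg_iff_add_eq_0)
 show "u : L2 mu" by (rule u)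
 fix phi assume phi: "phi : TF"
 note i = L2_mult_integrable[OF u(2) TF_L2[OF L_test[OF phi]]] L2_mult_integrable[OF u(2) TF_L2[OF phi]]
 have "L2_inner mu u (%x. T phi x - kappa*phi x) = (LINT x|mu. - (u x*L phi x) - kappa*(u x*phi x))"
  unfolding L2_inner_def by (intro LINT_cong refl) (simp add: algebra_simps)
 also have "... = - (LINT x|mu. u x*L phi x) - kappa*(LINT x|mu. u x*phi x)" using i by simp
 also have "(LINT x|mu. u x*L phi x) = (LINT x|mu. - kappa*(u x*phi x))"
  unfolding integration_by_parts'[OF phi u(1)] by (intro LINT_cong refl) (simp add: u(3))
 also have "... = - kappa*(LINT x|mu. u x*phi x)" by (rule integral_mult_right_zero)
 finally show "L2_inner mu u (%x. T phi x - kappa*phi x) = 0" by simp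
qed

lemma smooth_AE_zero:
 assumes u: "smooth_map A u" "AE x in mu. u x = 0"
 shows "u x = 0"
proof -
 have "open {x. u x ~= 0}" by (intro open_Collect_neq smooth_map_continuous[OF u(1)] continuous_intros)
 moreover have "AE x in mu. x ~: {x. u x ~= 0}" using u(2) by simp
 ultimately have "{x. u x ~= 0} = {}" by (rule open_not_null)
 thus ?thesis by blast
qed

lemma eigenspace_finite: "finite_dimensional (weighted_eigenspace A F kappa)"
proof (rule op.eigenspace_finite_dimensional[OF _ eigenspace_in_G])
 show "(%x. u x + c * v x) : weighted_eigenspace A F kappa" if u: "u : weighted_eigenspace A F kappa" "v : weighted_eigenspace A F kappa" for u v c
 proof -
  have s: "smooth_map A u" "smooth_map A v" "u : L2 mu" "v : L2 mu" "!!x. L u x = - kappa*u x" "!!x. L v x = - kappa * v x"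
   using u unfolding weighted_eigenspace_def by (auto simp: eq_neg_iff_add_eq_0)
  have "smooth_map A (%x. u x + c * v x)" by (intro smooth_map_add smooth_map_mult smooth_map_const s)
  thus ?thesis unfolding weighted_eigenspace_def using L2_lincomb[OF s(3,4), of c] by (simp add: L_lincomb[OF s(1,2)] s(5,6) algebra_simps)
 qed
 show "u x = 0" if "u : weighted_eigenspace A F kappa" "AE x in mu. u x = 0" for u x
  using smooth_AE_zero[of u] that unfolding weighted_eigenspace_def by blast
qed

lemma drifted_spectrum_eq: "drifted_spectrum A F = spectrum_of mu op.G" by (simp add: drifted_spectrum_def op.G_def)

lemma discrete: "has_discrete_spectrum A F" unfolding has_discrete_spectrum_def drifted_spectrum_eq
 using op.spectrum_isolated op.spectrum_imp_eigen eigen_imp_eigenvalue eigenspace_finite by blast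

text \<open>Integration by parts identifies the two families of Rayleigh quotients.\<close>

lemma spectrum_bottom_eq: "spectrum_bottom A F = op.bottom"
proof -
 have e: "L2_inner mu phi phi = (LINT x|mu. (phi x)^2)" for phi by (simp add: L2_inner_def power2_eq_square)
 have "L2_inner mu (T phi) phi = (LINT x|mu. (norm (grad A F phi x))^2)" if "phi : TF" for phi
  unfolding T_inner[OF that that] energy_def by (simp add: power2_norm_eq_inner)
 hence "{(LINT x|mu. (norm (grad A F phi x))^2) / (LINT x|mu. (phi x)^2) | phi. phi : TF & (LINT x|mu. (phi x)^2) ~= 0}
  = {L2_inner mu (T u) u / L2_inner mu u u | u. u : TF & L2_inner mu u u ~= 0}"
  unfolding e by (intro Collect_cong ex_cong1 iffI) (elim conjE, simp)+
 thus ?thesis unfolding spectrum_bottom_def op.bottom_def by simp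
qed

lemma smooth_norm_pos:
 assumes "smooth_map A u" "u : L2 mu" "u x ~= 0"
 shows "L2_inner mu u u > 0"
proof -
 have "L2_inner mu u u ~= 0"
 proof
  assume "L2_inner mu u u = 0"
  hence "L2_norm mu u = 0" by (metis L2_norm_sq power2_eq_square mult_eq_0_iff)
  thus False using smooth_AE_zero[OF assms(1) L2_norm_zero_AE[OF assms(2)]] assms(3) by blast
 qed
 thus ?thesis using L2_inner_self_nonneg[of mu u] by simp
qed

lemma bottom_eigenvalue: "weighted_eigenvalue A F (spectrum_bottom A F)"
proof -
 \<comment> \<open>A type is inhabited, so the manifold has a point, and a bump there is a test
   function of positive norm; the infimum runs over a nonempty set.\<close>
 fix x :: 'm
 have "EX u:TF. u x ~= 0"
 proof (rule bump_exists[OF open_UNIV UNIV_I, of x])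
  fix W psi f N assume "(W, psi) : A" "f : test_fun W" "x : N" "!!y. y : N ==> push W psi f y = 1"
  thus ?thesis by (intro bexI[of _ "push W psi f"] push_test) auto
 qed
 then obtain u where u: "u : TF" "u x ~= 0" by blast
 have "L2_inner mu u u ~= 0" using smooth_norm_pos[OF TF_smooth[OF u(1)] TF_L2[OF u(1)] u(2)] by simp
 thus ?thesis unfolding spectrum_bottom_eq by (intro eigen_imp_eigenvalue op.eigen_bottom[OF u(1)])
qed

lemma bottom_le_eigenvalue:
 assumes "weighted_eigenvalue A F kappa"
 shows "spectrum_bottom A F <= kappa"
proof -
 obtain u x where u: "u : weighted_eigenspace A F kappa" "u x ~= 0" using assms unfolding weighted_eigenvalue_def by blast
 have "L2_inner mu u u > 0" using smooth_norm_pos[of u x] u unfolding weighted_eigenspace_def by blast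
 moreover have "op.bottom*L2_inner mu u u <= kappa*L2_inner mu u u"
  using op.bottom_le[OF eigenspace_in_G[OF u(1)]] by (simp add: L2_inner_def mult.assoc)
 ultimately show ?thesis unfolding spectrum_bottom_eq by simp
qed

end

theorem theorem1p1:
  fixes A :: "('n::finite, 'm::{t2_space, second_countable_topology}) param set"
    and F :: "'m \<Rightarrow> real ^ ('n + 'k::finite)"
  assumes "self_expander A F"
    and "complete_induced F"
    and "proper_map_into F"
  shows "has_discrete_spectrum A F \<and>
    weighted_eigenvalue A F (spectrum_bottom A F) \<and>
    (\<forall>\<kappa>. weighted_eigenvalue A F \<kappa> \<longrightarrow> spectrum_bottom A F \<le> \<kappa>)"
proof -
 interpret proper_expander A F by unfold_locales (use assms in "auto simp: self_expander_def")
 show ?thesis using discrete bottom_eigenvalue bottom_le_eigenvalue by blast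
qed

end
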